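(* Let $(R,\mathfrak{m})$ be a commutative Noetherian complete local ring, let $I$ be an ideal of $R$, and let $M$ be a non-zero $I$-cofinite $R$-module. Then $$\dim R/(I+\operatorname{Ann}_R M)=\dim M.$$
   Context: All rings are commutative with identity. "Complete" means complete with respect to the $\mathfrak{m}$-adic topology, where $\mathfrak{m}$ is the maximal ideal of $R$. For an ideal $I$ of $R$, $V(I)$ denotes the set of prime ideals of $R$ containing $I$. An $R$-module $M$ (not necessarily finitely generated) is called $I$-cofinite if $\operatorname{Supp} M\subseteq V(I)$ and $\operatorname{Ext}^i_R(R/I,M)$ is a finitely generated $R$-module for all $i\ge 0$. $\operatorname{Ann}_R M$ is the annihilator of $M$ in $R$. $\dim R/J$ is the Krull dimension of the ring $R/J$, and for an arbitrary non-zero $R$-module $M$, $\dim M$ is the Krull dimension of its support, i.e. $\dim M=\sup\{\dim R/\mathfrak{p} : \mathfrak{p}\in\operatorname{Supp} M\}$. *)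

theory Defs
  imports "HOL-Algebra.Module" "HOL-Algebra.Ideal_Product" "HOL-Algebra.QuotRing"
    "HOL-Algebra.Ring_Divisibility" "HOL-Library.Extended_Real"
begin

section \<open>Complete local rings\<close>

definition local_ring :: "('a, 'r) ring_scheme \<Rightarrow> 'a set \<Rightarrow> bool"
  where "local_ring R \<mm> \<longleftrightarrow> cring R \<and> maximalideal \<mm> R \<and> (\<forall>J. maximalideal J R \<longrightarrow> J = \<mm>)"

primrec ideal_power :: "('a, 'r) ring_scheme \<Rightarrow> 'a set \<Rightarrow> nat \<Rightarrow> 'a set"
  where
    "ideal_power R I 0 = carrier R"
  | "ideal_power R I (Suc n) = ideal_prod R I (ideal_power R I n)"

text \<open>Completeness includes separatedness: limits of Cauchy sequences exist and are unique.\<close>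

definition adic_Cauchy :: "('a, 'r) ring_scheme \<Rightarrow> 'a set \<Rightarrow> (nat \<Rightarrow> 'a) \<Rightarrow> bool"
  where "adic_Cauchy R I x \<longleftrightarrow>
    (\<forall>k. \<exists>N. \<forall>i\<ge>N. \<forall>j\<ge>N. x i \<ominus>\<^bsub>R\<^esub> x j \<in> ideal_power R I k)"

definition adic_limit :: "('a, 'r) ring_scheme \<Rightarrow> 'a set \<Rightarrow> (nat \<Rightarrow> 'a) \<Rightarrow> 'a \<Rightarrow> bool"
  where "adic_limit R I x l \<longleftrightarrow> (\<forall>k. \<exists>N. \<forall>i\<ge>N. x i \<ominus>\<^bsub>R\<^esub> l \<in> ideal_power R I k)"

definition adic_complete :: "('a, 'r) ring_scheme \<Rightarrow> 'a set \<Rightarrow> bool"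
  where "adic_complete R I \<longleftrightarrow>
    (\<forall>x. range x \<subseteq> carrier R \<and> adic_Cauchy R I x \<longrightarrow>
      (\<exists>!l. l \<in> carrier R \<and> adic_limit R I x l))"


section \<open>Spectrum, support and dimension\<close>

definition zero_locus :: "('a, 'r) ring_scheme \<Rightarrow> 'a set \<Rightarrow> 'a set set"
  where "zero_locus R I = {\<pp>. primeideal \<pp> R \<and> I \<subseteq> \<pp>}"

definition annihilator :: "('a, 'r) ring_scheme \<Rightarrow> ('a, 'b, 'm) module_scheme \<Rightarrow> 'a set"
  where "annihilator R M = {a \<in> carrier R. \<forall>x\<in>carrier M. a \<odot>\<^bsub>M\<^esub> x = \<zero>\<^bsub>M\<^esub>}"

text \<open>The underlying set of the localization of M at a prime; the pair (x, s) stands for the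
  fraction x/s.\<close>

definition loc_rel ::
    "('a, 'r) ring_scheme \<Rightarrow> ('a, 'b, 'm) module_scheme \<Rightarrow> 'a set \<Rightarrow> (('b \<times> 'a) \<times> ('b \<times> 'a)) set"
  where "loc_rel R M \<pp> = {((x, s), (y, t)) | x s y t.
    x \<in> carrier M \<and> y \<in> carrier M \<and> s \<in> carrier R - \<pp> \<and> t \<in> carrier R - \<pp> \<and>
    (\<exists>u \<in> carrier R - \<pp>. u \<odot>\<^bsub>M\<^esub> (t \<odot>\<^bsub>M\<^esub> x) = u \<odot>\<^bsub>M\<^esub> (s \<odot>\<^bsub>M\<^esub> y))}"

definition localization ::
    "('a, 'r) ring_scheme \<Rightarrow> ('a, 'b, 'm) module_scheme \<Rightarrow> 'a set \<Rightarrow> ('b \<times> 'a) set set"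
  where "localization R M \<pp> = (carrier M \<times> (carrier R - \<pp>)) // loc_rel R M \<pp>"

definition Supp :: "('a, 'r) ring_scheme \<Rightarrow> ('a, 'b, 'm) module_scheme \<Rightarrow> 'a set set"
  where "Supp R M = {\<pp>. primeideal \<pp> R \<and>
    localization R M \<pp> \<noteq> {loc_rel R M \<pp> `` {(\<zero>\<^bsub>M\<^esub>, \<one>\<^bsub>R\<^esub>)}}}"

text \<open>With values in the extended reals, the zero ring and the zero module get dimension
  \<open>-\<infinity>\<close> (supremum of the empty set).\<close>

definition krull_dim :: "('a, 'r) ring_scheme \<Rightarrow> ereal"
  where "krull_dim A = Sup {ereal (real n) | n. \<exists>P :: nat \<Rightarrow> 'a set.
    (\<forall>i\<le>n. primeideal (P i) A) \<and> (\<forall>i<n. P i \<subset> P (Suc i))}"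

definition module_dim :: "('a, 'r) ring_scheme \<Rightarrow> ('a, 'b, 'm) module_scheme \<Rightarrow> ereal"
  where "module_dim R M = (SUP \<pp>\<in>Supp R M. krull_dim (R Quot \<pp>))"


section \<open>Modules\<close>

text \<open>The ring multiplication and unit of a \<^type>\<open>module\<close> record play no role in
  \<^locale>\<open>module\<close> and are left unspecified below.\<close>

definition fin_gen_module :: "('a, 'r) ring_scheme \<Rightarrow> ('a, 'b, 'm) module_scheme \<Rightarrow> bool"
  where "fin_gen_module R M \<longleftrightarrow>
    (\<exists>S \<subseteq> carrier M. finite S \<and> (\<forall>H. submodule H R M \<and> S \<subseteq> H \<longrightarrow> H = carrier M))"

definition regular_module :: "('a, 'r) ring_scheme \<Rightarrow> ('a, 'a) module"
  where "regular_module R =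
    \<lparr>carrier = carrier R, monoid.mult = undefined, one = undefined,
     ring.zero = \<zero>\<^bsub>R\<^esub>, add = (\<oplus>\<^bsub>R\<^esub>), smult = (\<otimes>\<^bsub>R\<^esub>)\<rparr>"

definition quot_module :: "('a, 'b, 'm) module_scheme \<Rightarrow> 'b set \<Rightarrow> ('a, 'b set) module"
  where "quot_module M H =
    \<lparr>carrier = a_rcosets\<^bsub>M\<^esub> H, monoid.mult = undefined, one = undefined,
     ring.zero = H, add = set_add M, smult = (\<lambda>r X. \<Union>x\<in>X. H +>\<^bsub>M\<^esub> (r \<odot>\<^bsub>M\<^esub> x))\<rparr>"

definition module_hom ::
    "('a, 'r) ring_scheme \<Rightarrow> ('a, 'b, 'n) module_scheme \<Rightarrow> ('a, 'c, 'm) module_scheme \<Rightarrow> ('b \<Rightarrow> 'c) set"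
  where "module_hom R N M = {f \<in> carrier N \<rightarrow>\<^sub>E carrier M.
    (\<forall>x\<in>carrier N. \<forall>y\<in>carrier N. f (x \<oplus>\<^bsub>N\<^esub> y) = f x \<oplus>\<^bsub>M\<^esub> f y) \<and>
    (\<forall>r\<in>carrier R. \<forall>x\<in>carrier N. f (r \<odot>\<^bsub>N\<^esub> x) = r \<odot>\<^bsub>M\<^esub> f x)}"

definition hom_module ::
    "('a, 'r) ring_scheme \<Rightarrow> ('a, 'b, 'n) module_scheme \<Rightarrow> ('a, 'c, 'm) module_scheme \<Rightarrow> ('a, 'b \<Rightarrow> 'c) module"
  where "hom_module R N M =
    \<lparr>carrier = module_hom R N M, monoid.mult = undefined, one = undefined,
     ring.zero = (\<lambda>x\<in>carrier N. \<zero>\<^bsub>M\<^esub>),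
     add = (\<lambda>f g. \<lambda>x\<in>carrier N. f x \<oplus>\<^bsub>M\<^esub> g x),
     smult = (\<lambda>r f. \<lambda>x\<in>carrier N. r \<odot>\<^bsub>M\<^esub> f x)\<rparr>"

text \<open>The free module on X: finitely supported functions vanishing outside X.\<close>

definition free_module :: "('a, 'r) ring_scheme \<Rightarrow> 's set \<Rightarrow> ('a, 's \<Rightarrow> 'a) module"
  where "free_module R X =
    \<lparr>carrier = {f. range f \<subseteq> carrier R \<and> finite {s. f s \<noteq> \<zero>\<^bsub>R\<^esub>} \<and> {s. f s \<noteq> \<zero>\<^bsub>R\<^esub>} \<subseteq> X},
     monoid.mult = undefined, one = undefined,
     ring.zero = (\<lambda>_. \<zero>\<^bsub>R\<^esub>),
     add = (\<lambda>f g s. f s \<oplus>\<^bsub>R\<^esub> g s),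
     smult = (\<lambda>r f s. r \<otimes>\<^bsub>R\<^esub> f s)\<rparr>"

definition lin_ext ::
    "('a, 'r) ring_scheme \<Rightarrow> ('a, 'b, 'm) module_scheme \<Rightarrow> ('s \<Rightarrow> 'b) \<Rightarrow> ('s \<Rightarrow> 'a) \<Rightarrow> 'b"
  where "lin_ext R N v f = (\<Oplus>\<^bsub>N\<^esub>s\<in>{s. f s \<noteq> \<zero>\<^bsub>R\<^esub>}. f s \<odot>\<^bsub>N\<^esub> v s)"


section \<open>Ext\<close>

text \<open>
  Ext(N, M) is computed from a free resolution of N. To have one for every N inside a single type,
  and without choices, we use the resolution F whose basis in degree 0 is the carrier of N, and
  whose basis in degree n + 1 consists of one symbol \<open>Syz xs\<close> for each formal linear combination xs
  of basis elements of degree n that represents a cycle; the differential sends \<open>Syz xs\<close> to the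
  element represented by xs. That this is a free resolution is \<open>std_resolution\<close> below.
\<close>

datatype ('a, 'b) syz = Gen (gen_of: 'b) | Syz (rel_of: "(('a, 'b) syz \<times> 'a) list")

primrec lin_comb :: "('a, 'r) ring_scheme \<Rightarrow> ('s \<times> 'a) list \<Rightarrow> 's \<Rightarrow> 'a"
  where
    "lin_comb R [] = (\<lambda>_. \<zero>\<^bsub>R\<^esub>)"
  | "lin_comb R (p # xs) = (lin_comb R xs)(fst p := snd p \<oplus>\<^bsub>R\<^esub> lin_comb R xs (fst p))"

definition std_aug ::
    "('a, 'r) ring_scheme \<Rightarrow> ('a, 'b, 'n) module_scheme \<Rightarrow> (('a, 'b) syz \<Rightarrow> 'a) \<Rightarrow> 'b"
  where "std_aug R N = lin_ext R N gen_of"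

definition std_diff ::
    "('a, 'r) ring_scheme \<Rightarrow> (('a, 'b) syz \<Rightarrow> 'a) \<Rightarrow> (('a, 'b) syz \<Rightarrow> 'a)"
  where "std_diff R = lin_ext R (free_module R UNIV) (\<lambda>s. lin_comb R (rel_of s))"

fun std_basis ::
    "('a, 'r) ring_scheme \<Rightarrow> ('a, 'b, 'n) module_scheme \<Rightarrow> nat \<Rightarrow> ('a, 'b) syz set"
  where
    "std_basis R N 0 = Gen ` carrier N"
  | "std_basis R N (Suc 0) = Syz ` {xs. set xs \<subseteq> std_basis R N 0 \<times> carrier R \<and>
       std_aug R N (lin_comb R xs) = \<zero>\<^bsub>N\<^esub>}"
  | "std_basis R N (Suc (Suc n)) = Syz ` {xs. set xs \<subseteq> std_basis R N (Suc n) \<times> carrier R \<and>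
       std_diff R (lin_comb R xs) = (\<lambda>_. \<zero>\<^bsub>R\<^esub>)}"

definition std_free ::
    "('a, 'r) ring_scheme \<Rightarrow> ('a, 'b, 'n) module_scheme \<Rightarrow> nat \<Rightarrow> ('a, ('a, 'b) syz \<Rightarrow> 'a) module"
  where "std_free R N n = free_module R (std_basis R N n)"

subsection \<open>The resolution is a free resolution\<close>

lemma free_module_simps:
  "f \<in> carrier (free_module R X) \<longleftrightarrow>
     range f \<subseteq> carrier R \<and> finite {s. f s \<noteq> \<zero>\<^bsub>R\<^esub>} \<and> {s. f s \<noteq> \<zero>\<^bsub>R\<^esub>} \<subseteq> X"
  "\<zero>\<^bsub>free_module R X\<^esub> = (\<lambda>_. \<zero>\<^bsub>R\<^esub>)"
  "f \<oplus>\<^bsub>free_module R X\<^esub> g = (\<lambda>s. f s \<oplus>\<^bsub>R\<^esub> g s)"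
  "r \<odot>\<^bsub>free_module R X\<^esub> f = (\<lambda>s. r \<otimes>\<^bsub>R\<^esub> f s)"
  by (simp_all add: free_module_def)

lemma free_module_val: "f \<in> carrier (free_module R X) \<Longrightarrow> f s \<in> carrier R"
  by (auto simp: free_module_simps)

lemma module_free_module:
  assumes "cring R" shows "module R (free_module R X)"
proof -
  interpret cring R by fact
  have fin: "finite {s. h s \<noteq> \<zero>\<^bsub>R\<^esub>}" "{s. h s \<noteq> \<zero>\<^bsub>R\<^esub>} \<subseteq> X"
    if f: "f \<in> carrier (free_module R X)" and g: "g \<in> carrier (free_module R X)"
      and h: "\<And>s. f s = \<zero>\<^bsub>R\<^esub> \<Longrightarrow> g s = \<zero>\<^bsub>R\<^esub> \<Longrightarrow> h s = \<zero>\<^bsub>R\<^esub>" for f g h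
  proof -
    have sub: "{s. h s \<noteq> \<zero>\<^bsub>R\<^esub>} \<subseteq> {s. f s \<noteq> \<zero>\<^bsub>R\<^esub>} \<union> {s. g s \<noteq> \<zero>\<^bsub>R\<^esub>}"
      using h by auto
    have "finite {s. f s \<noteq> \<zero>\<^bsub>R\<^esub>}" "finite {s. g s \<noteq> \<zero>\<^bsub>R\<^esub>}"
      using f g by (simp_all add: free_module_simps)
    then show "finite {s. h s \<noteq> \<zero>\<^bsub>R\<^esub>}"
      using finite_subset[OF sub] by blast
    show "{s. h s \<noteq> \<zero>\<^bsub>R\<^esub>} \<subseteq> X"
      using sub f g unfolding free_module_simps(1) by blast
  qed
  have mem: "h \<in> carrier (free_module R X)"
    if "f \<in> carrier (free_module R X)" "g \<in> carrier (free_module R X)"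
      "\<And>s. f s = \<zero>\<^bsub>R\<^esub> \<Longrightarrow> g s = \<zero>\<^bsub>R\<^esub> \<Longrightarrow> h s = \<zero>\<^bsub>R\<^esub>" "\<And>s. h s \<in> carrier R" for f g h
    unfolding free_module_simps(1) using fin[of f g h, OF that(1-3)] that(4) by blast
  have add: "(\<lambda>s. f s \<oplus>\<^bsub>R\<^esub> g s) \<in> carrier (free_module R X)"
    if "f \<in> carrier (free_module R X)" "g \<in> carrier (free_module R X)" for f g
    by (rule mem[OF that]) (simp_all add: free_module_val[OF that(1)] free_module_val[OF that(2)])
  have smult: "(\<lambda>s. r \<otimes>\<^bsub>R\<^esub> f s) \<in> carrier (free_module R X)"
    if "f \<in> carrier (free_module R X)" "r \<in> carrier R" for f r
    by (rule mem[OF that(1,1)]) (simp_all add: free_module_val[OF that(1)] that(2))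
  have neg: "(\<lambda>s. \<ominus>\<^bsub>R\<^esub> f s) \<in> carrier (free_module R X)"
    if "f \<in> carrier (free_module R X)" for f
    by (rule mem[OF that that]) (simp_all add: free_module_val[OF that])
  have grp: "abelian_group (free_module R X)"
  proof (rule abelian_groupI)
    fix f assume f: "f \<in> carrier (free_module R X)"
    show "\<exists>g\<in>carrier (free_module R X). g \<oplus>\<^bsub>free_module R X\<^esub> f = \<zero>\<^bsub>free_module R X\<^esub>"
      using neg[OF f] free_module_val[OF f]
      by (intro bexI[of _ "\<lambda>s. \<ominus>\<^bsub>R\<^esub> f s"]) (simp_all add: free_module_simps(2-) l_neg)
  next
    show "\<zero>\<^bsub>free_module R X\<^esub> \<in> carrier (free_module R X)"
      by (auto simp: free_module_simps)
  qed (simp_all add: free_module_simps(2-) free_module_val[where X = X] add a_ac)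
  show ?thesis
    by (rule moduleI[OF assms grp])
      (simp_all add: free_module_simps(2-) free_module_val[where X = X] smult l_distr r_distr m_assoc)
qed

lemma lin_ext_superset:
  assumes N: "module R N" and A: "finite A" "{s. f s \<noteq> \<zero>\<^bsub>R\<^esub>} \<subseteq> A" "range f \<subseteq> carrier R"
    and v: "v \<in> A \<rightarrow> carrier N"
  shows "lin_ext R N v f = (\<Oplus>\<^bsub>N\<^esub>s\<in>A. f s \<odot>\<^bsub>N\<^esub> v s)"
proof -
  interpret module R N by fact
  show ?thesis
    unfolding lin_ext_def
    using A v by (intro M.add.finprod_mono_neutral_cong_left) (auto simp: Pi_iff image_subset_iff)
qed

context
  fixes R :: "('a, 'r) ring_scheme" and N :: "('a, 'b, 'n) module_scheme"
    and v :: "'s \<Rightarrow> 'b" and X :: "'s set"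
  assumes N: "module R N" and v: "v \<in> X \<rightarrow> carrier N"
begin

interpretation N: module R N by (fact N)

lemma lin_ext_closed:
  assumes "f \<in> carrier (free_module R X)" shows "lin_ext R N v f \<in> carrier N"
  using assms v unfolding lin_ext_def
  by (intro N.M.finsum_closed) (auto simp: free_module_simps Pi_iff image_subset_iff)

lemma lin_ext_add:
  assumes f: "f \<in> carrier (free_module R X)" and g: "g \<in> carrier (free_module R X)"
  shows "lin_ext R N v (\<lambda>s. f s \<oplus>\<^bsub>R\<^esub> g s) = lin_ext R N v f \<oplus>\<^bsub>N\<^esub> lin_ext R N v g"
proof -
  define A where "A = {s. f s \<noteq> \<zero>\<^bsub>R\<^esub>} \<union> {s. g s \<noteq> \<zero>\<^bsub>R\<^esub>}"
  have A: "finite A" "A \<subseteq> X"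
    using f g by (auto simp: A_def free_module_simps)
  have vA: "v \<in> A \<rightarrow> carrier N"
    using v A by auto
  have fg: "f s \<in> carrier R" "g s \<in> carrier R" for s
    using f g by (auto dest: free_module_val)
  have "lin_ext R N v (\<lambda>s. f s \<oplus>\<^bsub>R\<^esub> g s) = (\<Oplus>\<^bsub>N\<^esub>s\<in>A. (f s \<oplus>\<^bsub>R\<^esub> g s) \<odot>\<^bsub>N\<^esub> v s)"
    using A vA fg by (intro lin_ext_superset[OF N]) (auto simp: A_def)
  also have "\<dots> = (\<Oplus>\<^bsub>N\<^esub>s\<in>A. (f s \<odot>\<^bsub>N\<^esub> v s) \<oplus>\<^bsub>N\<^esub> (g s \<odot>\<^bsub>N\<^esub> v s))"
    using vA fg by (intro N.M.finsum_cong') (auto simp: N.smult_l_distr Pi_iff)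
  also have "\<dots> = (\<Oplus>\<^bsub>N\<^esub>s\<in>A. f s \<odot>\<^bsub>N\<^esub> v s) \<oplus>\<^bsub>N\<^esub> (\<Oplus>\<^bsub>N\<^esub>s\<in>A. g s \<odot>\<^bsub>N\<^esub> v s)"
    using vA fg by (intro N.M.finsum_addf) (auto simp: Pi_iff)
  also have "(\<Oplus>\<^bsub>N\<^esub>s\<in>A. f s \<odot>\<^bsub>N\<^esub> v s) = lin_ext R N v f"
    using A vA fg by (intro lin_ext_superset[OF N, symmetric]) (auto simp: A_def)
  also have "(\<Oplus>\<^bsub>N\<^esub>s\<in>A. g s \<odot>\<^bsub>N\<^esub> v s) = lin_ext R N v g"
    using A vA fg by (intro lin_ext_superset[OF N, symmetric]) (auto simp: A_def)
  finally show ?thesis .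
qed

lemma lin_ext_smult:
  assumes f: "f \<in> carrier (free_module R X)" and r: "r \<in> carrier R"
  shows "lin_ext R N v (\<lambda>s. r \<otimes>\<^bsub>R\<^esub> f s) = r \<odot>\<^bsub>N\<^esub> lin_ext R N v f"
proof -
  define A where "A = {s. f s \<noteq> \<zero>\<^bsub>R\<^esub>}"
  have A: "finite A" "A \<subseteq> X"
    using f by (auto simp: A_def free_module_simps)
  have vA: "v \<in> A \<rightarrow> carrier N"
    using v A by auto
  have fc: "f s \<in> carrier R" for s
    using f by (auto dest: free_module_val)
  have "lin_ext R N v (\<lambda>s. r \<otimes>\<^bsub>R\<^esub> f s) = (\<Oplus>\<^bsub>N\<^esub>s\<in>A. (r \<otimes>\<^bsub>R\<^esub> f s) \<odot>\<^bsub>N\<^esub> v s)"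
    using A vA fc r by (intro lin_ext_superset[OF N]) (auto simp: A_def)
  also have "\<dots> = (\<Oplus>\<^bsub>N\<^esub>s\<in>A. r \<odot>\<^bsub>N\<^esub> (f s \<odot>\<^bsub>N\<^esub> v s))"
    using vA fc r by (intro N.M.finsum_cong') (auto simp: N.smult_assoc1 Pi_iff)
  also have "\<dots> = r \<odot>\<^bsub>N\<^esub> lin_ext R N v f"
    unfolding lin_ext_def A_def[symmetric]
    using A vA fc r by (intro N.finsum_smult_ldistr[symmetric]) (auto simp: Pi_iff)
  finally show ?thesis .
qed

lemma lin_ext_zero: "lin_ext R N v (\<lambda>_. \<zero>\<^bsub>R\<^esub>) = \<zero>\<^bsub>N\<^esub>"
  by (simp add: lin_ext_def)

lemma lin_ext_unit:
  assumes "s \<in> X"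
  shows "lin_ext R N v (\<lambda>t. if t = s then \<one>\<^bsub>R\<^esub> else \<zero>\<^bsub>R\<^esub>) = v s"
proof -
  have "lin_ext R N v (\<lambda>t. if t = s then \<one>\<^bsub>R\<^esub> else \<zero>\<^bsub>R\<^esub>) =
      (\<Oplus>\<^bsub>N\<^esub>t\<in>{s}. (if t = s then \<one>\<^bsub>R\<^esub> else \<zero>\<^bsub>R\<^esub>) \<odot>\<^bsub>N\<^esub> v t)"
    using assms v by (intro lin_ext_superset[OF N]) (auto split: if_splits)
  also have "\<dots> = v s"
    using assms v by (auto simp: Pi_iff)
  finally show ?thesis .
qed

end

lemma unit_in_free_module:
  assumes "cring R" "s \<in> X"
  shows "(\<lambda>t. if t = s then \<one>\<^bsub>R\<^esub> else \<zero>\<^bsub>R\<^esub>) \<in> carrier (free_module R X)"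
proof -
  interpret cring R by fact
  have "{t. (if t = s then \<one>\<^bsub>R\<^esub> else \<zero>\<^bsub>R\<^esub>) \<noteq> \<zero>\<^bsub>R\<^esub>} \<subseteq> {s}"
    by auto
  with assms(2) show ?thesis
    by (auto simp: free_module_simps intro: finite_subset)
qed

lemma lin_comb_closed:
  assumes "cring R" "set xs \<subseteq> X \<times> carrier R"
  shows "lin_comb R xs \<in> carrier (free_module R X)"
  using assms(2)
proof (induction xs)
  interpret cring R by fact
  case Nil
  show ?case by (auto simp: free_module_simps)
next
  interpret cring R by fact
  case (Cons p xs)
  then have IH: "lin_comb R xs \<in> carrier (free_module R X)" and p: "fst p \<in> X" "snd p \<in> carrier R"
    by auto
  have sub: "{s. lin_comb R (p # xs) s \<noteq> \<zero>\<^bsub>R\<^esub>} \<subseteq> insert (fst p) {s. lin_comb R xs s \<noteq> \<zero>\<^bsub>R\<^esub>}"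
    by auto
  have "finite {s. lin_comb R (p # xs) s \<noteq> \<zero>\<^bsub>R\<^esub>}"
    using IH by (intro finite_subset[OF sub]) (simp add: free_module_simps)
  moreover have "{s. lin_comb R (p # xs) s \<noteq> \<zero>\<^bsub>R\<^esub>} \<subseteq> X"
    using sub IH p by (force simp: free_module_simps)
  moreover have "range (lin_comb R (p # xs)) \<subseteq> carrier R"
    using IH p by (auto dest: free_module_val)
  ultimately show ?case
    by (simp only: free_module_simps)
qed

lemma lin_comb_exists:
  assumes "cring R" "f \<in> carrier (free_module R X)"
  shows "\<exists>xs. set xs \<subseteq> X \<times> carrier R \<and> lin_comb R xs = f"
proof -
  interpret cring R by fact
  have "\<exists>xs. set xs \<subseteq> X \<times> carrier R \<and> lin_comb R xs = f"
    if "finite A" "A \<subseteq> X" "{s. f s \<noteq> \<zero>\<^bsub>R\<^esub>} \<subseteq> A" "range f \<subseteq> carrier R" for A f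
    using that
  proof (induction A arbitrary: f rule: finite_induct)
    case empty
    then have "lin_comb R [] = f"
      by auto
    then show ?case
      by (intro exI[of _ "[]"]) simp
  next
    case (insert a A)
    let ?g = "f(a := \<zero>\<^bsub>R\<^esub>)"
    have "{s. ?g s \<noteq> \<zero>\<^bsub>R\<^esub>} \<subseteq> A" "range ?g \<subseteq> carrier R" "A \<subseteq> X"
      using insert.prems by auto
    then obtain xs where xs: "set xs \<subseteq> X \<times> carrier R" "lin_comb R xs = ?g"
      using insert.IH by blast
    have fa: "f a \<in> carrier R"
      using insert.prems by auto
    then have "lin_comb R ((a, f a) # xs) = f"
      using xs by (simp add: fun_eq_iff)
    then show ?case
      using xs fa insert.prems by (intro exI[of _ "(a, f a) # xs"]) simp
  qed
  from this[of "{s. f s \<noteq> \<zero>\<^bsub>R\<^esub>}" f] assms(2) show ?thesis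
    by (auto simp: free_module_simps)
qed

lemma rel_closed:
  assumes "cring R" "Y \<subseteq> Syz ` {xs. set xs \<subseteq> X \<times> carrier R}"
  shows "(\<lambda>s. lin_comb R (rel_of s)) \<in> Y \<rightarrow> carrier (free_module R X)"
proof
  fix s assume "s \<in> Y"
  then obtain xs where "set xs \<subseteq> X \<times> carrier R" "s = Syz xs"
    using assms(2) by blast
  then show "lin_comb R (rel_of s) \<in> carrier (free_module R X)"
    using lin_comb_closed[OF assms(1)] by simp
qed

lemma std_diff_exact:
  fixes R :: "('a, 'r) ring_scheme" and X Y :: "('a, 'c) syz set"
  assumes N: "module R N" and v: "v \<in> X \<rightarrow> carrier N"
    and Y: "Y = Syz ` {xs. set xs \<subseteq> X \<times> carrier R \<and> lin_ext R N v (lin_comb R xs) = \<zero>\<^bsub>N\<^esub>}"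
  shows "std_diff R ` carrier (free_module R Y) =
    {f \<in> carrier (free_module R X). lin_ext R N v f = \<zero>\<^bsub>N\<^esub>}" (is "_ = ?Z")
proof (intro equalityI subsetI)
  interpret N: module R N by fact
  interpret F: module R "free_module R X" by (rule module_free_module[OF N.R.is_cring])
  interpret U: module R "free_module R (UNIV :: ('a, 'c) syz set)"
    by (rule module_free_module[OF N.R.is_cring])
  have sub: "?Z \<subseteq> carrier (free_module R UNIV)"
    by (auto simp: free_module_simps)
  have fs: "finsum (free_module R UNIV) w A \<in> ?Z" if "finite A" "w \<in> A \<rightarrow> ?Z" for A w
    using that
  proof (induction A rule: finite_induct)
    case empty
    show ?case
      using F.zero_closed lin_ext_zero[OF N v] by (simp add: free_module_simps(2))
  next
    case (insert a A)
    then have w: "w a \<in> ?Z" "finsum (free_module R UNIV) w A \<in> ?Z"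
      by auto
    have "finsum (free_module R UNIV) w (insert a A) =
        (\<lambda>s. w a s \<oplus>\<^bsub>R\<^esub> finsum (free_module R UNIV) w A s)"
      using insert sub by (subst U.finsum_insert) (auto simp: free_module_simps(3) Pi_iff)
    moreover have "(\<lambda>s. w a s \<oplus>\<^bsub>R\<^esub> finsum (free_module R UNIV) w A s) \<in> ?Z"
      using w F.a_closed[of "w a" "finsum (free_module R UNIV) w A"]
      by (simp add: lin_ext_add[OF N v] free_module_simps(3))
    ultimately show ?case by simp
  qed
  {
    fix h assume "h \<in> std_diff R ` carrier (free_module R Y)"
    then obtain f where f: "f \<in> carrier (free_module R Y)" "h = std_diff R f"
      by auto
    have "f s \<odot>\<^bsub>free_module R UNIV\<^esub> lin_comb R (rel_of s) \<in> ?Z" if "f s \<noteq> \<zero>\<^bsub>R\<^esub>" for s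
    proof -
      have s: "s \<in> Y" "f s \<in> carrier R"
        using that f by (auto simp: free_module_simps)
      then have "lin_comb R (rel_of s) \<in> ?Z"
        using Y lin_comb_closed[OF N.R.is_cring] by auto
      then show ?thesis
        using F.smult_closed[of "f s" "lin_comb R (rel_of s)"] s
        by (simp add: lin_ext_smult[OF N v] free_module_simps(4))
    qed
    then show "h \<in> ?Z"
      using f unfolding std_diff_def lin_ext_def[of R "free_module R UNIV"]
      by (simp only:, intro fs) (auto simp: free_module_simps(1))
  next
    fix f assume f: "f \<in> ?Z"
    then obtain xs where xs: "set xs \<subseteq> X \<times> carrier R" "lin_comb R xs = f"
      using lin_comb_exists[OF N.R.is_cring] by auto
    then have s: "Syz xs \<in> Y"
      using f Y by auto
    have "std_diff R (\<lambda>t. if t = Syz xs then \<one>\<^bsub>R\<^esub> else \<zero>\<^bsub>R\<^esub>) = f"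
      unfolding std_diff_def using xs f sub
      by (subst lin_ext_unit[OF U.module_axioms, where X = "{Syz xs}"]) auto
    then show "f \<in> std_diff R ` carrier (free_module R Y)"
      using unit_in_free_module[OF N.R.is_cring s] by (metis image_eqI)
  }
qed

lemma std_basis_rel:
  assumes "cring R"
  shows "(\<lambda>s. lin_comb R (rel_of s)) \<in> std_basis R N (Suc n) \<rightarrow>
    carrier (free_module R (std_basis R N n))"
  by (rule rel_closed[OF assms]) (cases n; auto)

theorem std_resolution:
  fixes R :: "('a, 'r) ring_scheme" and N :: "('a, 'c, 'n) module_scheme"
  assumes N: "module R N"
  shows "module R (std_free R N n)"
    and "restrict (std_aug R N) (carrier (std_free R N 0)) \<in> module_hom R (std_free R N 0) N"
    and "restrict (std_diff R) (carrier (std_free R N (Suc n)))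
          \<in> module_hom R (std_free R N (Suc n)) (std_free R N n)"
    and "std_aug R N ` carrier (std_free R N 0) = carrier N"
    and "std_diff R ` carrier (std_free R N 1) =
          {f \<in> carrier (std_free R N 0). std_aug R N f = \<zero>\<^bsub>N\<^esub>}"
    and "std_diff R ` carrier (std_free R N (Suc (Suc n))) =
          {f \<in> carrier (std_free R N (Suc n)). std_diff R f = \<zero>\<^bsub>std_free R N n\<^esub>}"
proof -
  interpret N: module R N by fact
  note R = N.R.is_cring
  have F: "module R (free_module R X)" for X :: "('a, 'c) syz set"
    by (rule module_free_module[OF R])
  show "module R (std_free R N n)"
    unfolding std_free_def by (rule F)
  have gen: "gen_of \<in> std_basis R N 0 \<rightarrow> carrier N"
    by auto
  have rel: "(\<lambda>s. lin_comb R (rel_of s)) \<in> std_basis R N (Suc n) \<rightarrow> carrier (free_module R UNIV)" for n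
    using std_basis_rel[OF R, of N n] by (auto simp: free_module_simps Pi_iff)
  have add: "(\<lambda>s. f s \<oplus>\<^bsub>R\<^esub> g s) \<in> carrier (free_module R X)"
    if "f \<in> carrier (free_module R X)" "g \<in> carrier (free_module R X)"
    for f g and X :: "('a, 'c) syz set"
    using abelian_monoid.a_closed[OF abelian_group.axioms(1)[OF module.axioms(2)[OF F]] that]
    by (simp only: free_module_simps(3))
  have smult: "(\<lambda>s. r \<otimes>\<^bsub>R\<^esub> f s) \<in> carrier (free_module R X)"
    if "f \<in> carrier (free_module R X)" "r \<in> carrier R" for f r and X :: "('a, 'c) syz set"
    using module.smult_closed[OF F that(2,1)] by (simp only: free_module_simps(4))
  show "restrict (std_aug R N) (carrier (std_free R N 0)) \<in> module_hom R (std_free R N 0) N"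
    using lin_ext_closed[OF N gen] lin_ext_add[OF N gen] lin_ext_smult[OF N gen]
    by (auto simp: module_hom_def std_aug_def std_free_def free_module_simps(2-) add smult
        simp del: std_basis.simps)
  show exact0: "std_diff R ` carrier (std_free R N 1) =
      {f \<in> carrier (std_free R N 0). std_aug R N f = \<zero>\<^bsub>N\<^esub>}"
    unfolding std_free_def std_aug_def
    by (rule std_diff_exact[OF N gen]) (simp add: std_aug_def)
  show exact: "std_diff R ` carrier (std_free R N (Suc (Suc n))) =
      {f \<in> carrier (std_free R N (Suc n)). std_diff R f = \<zero>\<^bsub>std_free R N n\<^esub>}" for n
    using std_diff_exact[OF F rel[of n] refl]
    by (simp add: std_free_def std_diff_def free_module_simps(2))
  have "std_diff R f \<in> carrier (std_free R N n)" if "f \<in> carrier (std_free R N (Suc n))" for f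
  proof -
    have "std_diff R f \<in> std_diff R ` carrier (std_free R N (Suc n))"
      using that by (rule imageI)
    then show ?thesis
    proof (cases n)
      case 0
      then show ?thesis
        using \<open>std_diff R f \<in> _\<close> exact0 by simp
    next
      case (Suc m)
      have "std_diff R f \<in> {f \<in> carrier (std_free R N (Suc m)). std_diff R f = \<zero>\<^bsub>std_free R N m\<^esub>}"
        using \<open>std_diff R f \<in> _\<close> unfolding Suc exact .
      then show ?thesis
        using Suc by simp
    qed
  qed
  then show "restrict (std_diff R) (carrier (std_free R N (Suc n)))
      \<in> module_hom R (std_free R N (Suc n)) (std_free R N n)"
    using lin_ext_add[OF F rel[of n], folded std_diff_def]
      lin_ext_smult[OF F rel[of n], folded std_diff_def]
    unfolding module_hom_def std_free_def
    by (intro CollectI conjI ballI restrict_PiE_iff[THEN iffD2])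
      (simp_all del: std_basis.simps add: free_module_simps(2-) add smult)
  show "std_aug R N ` carrier (std_free R N 0) = carrier N"
  proof
    show "std_aug R N ` carrier (std_free R N 0) \<subseteq> carrier N"
      using lin_ext_closed[OF N gen] by (auto simp: std_aug_def std_free_def)
    show "carrier N \<subseteq> std_aug R N ` carrier (std_free R N 0)"
    proof
      fix x assume "x \<in> carrier N"
      then have g: "Gen x \<in> std_basis R N 0"
        by simp
      show "x \<in> std_aug R N ` carrier (std_free R N 0)"
        using lin_ext_unit[OF N gen g] unit_in_free_module[OF R g]
        unfolding std_aug_def std_free_def by (metis image_eqI syz.sel(1))
    qed
  qed
qed

subsection \<open>Cohomology\<close>

text \<open>The complex Hom(F, M), with differential given by precomposition with
  \<^const>\<open>std_diff\<close>.\<close>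

definition ext_diff ::
    "('a, 'r) ring_scheme \<Rightarrow> ('a, 'b, 'n) module_scheme \<Rightarrow> nat \<Rightarrow>
      ((('a, 'b) syz \<Rightarrow> 'a) \<Rightarrow> 'c) \<Rightarrow> ((('a, 'b) syz \<Rightarrow> 'a) \<Rightarrow> 'c)"
  where "ext_diff R N i f = compose (carrier (std_free R N (Suc i))) f (std_diff R)"

definition ext_cocycles ::
    "('a, 'r) ring_scheme \<Rightarrow> ('a, 'b, 'n) module_scheme \<Rightarrow> ('a, 'c, 'm) module_scheme \<Rightarrow> nat \<Rightarrow>
      ((('a, 'b) syz \<Rightarrow> 'a) \<Rightarrow> 'c) set"
  where "ext_cocycles R N M i = {f \<in> module_hom R (std_free R N i) M.
    ext_diff R N i f = \<zero>\<^bsub>hom_module R (std_free R N (Suc i)) M\<^esub>}"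

primrec ext_coboundaries ::
    "('a, 'r) ring_scheme \<Rightarrow> ('a, 'b, 'n) module_scheme \<Rightarrow> ('a, 'c, 'm) module_scheme \<Rightarrow> nat \<Rightarrow>
      ((('a, 'b) syz \<Rightarrow> 'a) \<Rightarrow> 'c) set"
  where
    "ext_coboundaries R N M 0 = {\<zero>\<^bsub>hom_module R (std_free R N 0) M\<^esub>}"
  | "ext_coboundaries R N M (Suc i) = ext_diff R N i ` module_hom R (std_free R N i) M"

definition Ext ::
    "('a, 'r) ring_scheme \<Rightarrow> nat \<Rightarrow> ('a, 'b, 'n) module_scheme \<Rightarrow> ('a, 'c, 'm) module_scheme \<Rightarrow>
      ('a, ((('a, 'b) syz \<Rightarrow> 'a) \<Rightarrow> 'c) set) module"
  where "Ext R i N M =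
    quot_module ((hom_module R (std_free R N i) M)\<lparr>carrier := ext_cocycles R N M i\<rparr>)
      (ext_coboundaries R N M i)"

definition cofinite_module ::
    "('a, 'r) ring_scheme \<Rightarrow> 'a set \<Rightarrow> ('a, 'b, 'm) module_scheme \<Rightarrow> bool"
  where "cofinite_module R I M \<longleftrightarrow>
    Supp R M \<subseteq> zero_locus R I \<and>
    (\<forall>i. fin_gen_module R (Ext R i (quot_module (regular_module R) I) M))"

end

theory Submission
  imports Defs "HOL-Library.Nat_Bijection"
begin

text \<open>
  The dimension formula follows from the equality \<open>Supp M = V(I + Ann M)\<close> (\<open>Supp_cofinite\<close>), because
  the dimension of \<open>R / J\<close> is the supremum of the dimensions of \<open>R / \<pp>\<close> over the primes
  \<open>\<pp> \<supseteq> J\<close>. One inclusion is immediate. For the other, let \<open>\<pp> \<supseteq> I + Ann M\<close> be a prime with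
  \<open>M\<^sub>\<pp> = 0\<close>; it suffices to find \<open>s \<notin> \<pp>\<close> and \<open>a \<in> I\<close> such that some \<open>s\<^sup>n + a\<close> kills \<open>M\<close>,
  since then \<open>s\<^sup>n \<in> \<pp>\<close>.

  In the language of derived categories this is seen as follows. Let \<open>X\<close> be the derived completion of
  \<open>M\<close> along suitable \<open>x\<^sub>1, \<dots>, x\<^sub>n \<in> I\<close>. The Koszul complexes of \<open>M\<close> and of \<open>X\<close> have
  the same homology, which is finitely generated as \<open>M\<close> is cofinite. Since \<open>R\<close> is complete, the
  homology of \<open>X\<close> itself is finitely generated. The Koszul homology vanishes at \<open>\<pp>\<close>, so it is killed
  by some \<open>s \<notin> \<pp>\<close>, and Nakayama's lemma turns this into an element \<open>s\<^sup>n + a\<close> that kills the homology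
  of \<open>X\<close>. Finally \<open>M\<close>, being \<open>I\<close>-torsion, is recovered from \<open>X\<close>, so a power of this element kills
  \<open>M\<close>.

  The proof below uses no derived categories. It works with modules with an endomorphism of square zero,
  without a grading, and completes in one variable at a time: \<open>E\<close> is replaced by the cone of \<open>x - u\<close> on
  \<open>E[[u]]\<close>, whose reduction modulo \<open>u\<close> is the Koszul construction on \<open>x\<close>. The three steps above are
  \<open>fg_homology_completion\<close>, \<open>kills_homology_completion\<close> and \<open>kills_koszul_power\<close>;
  \<open>kills_koszul_powers\<close> combines them into a single element \<open>s\<^sup>n + a\<close> that kills the Koszul
  homology of \<open>M\<close> for \<open>x\<^sub>1\<^sup>k, \<dots>, x\<^sub>n\<^sup>k\<close> for all \<open>k \<ge> 1\<close> at once. The bottom of that homology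
  consists of the elements of \<open>M\<close> killed by \<open>x\<^sub>1\<^sup>k, \<dots>, x\<^sub>n\<^sup>k\<close>, and these exhaust \<open>M\<close>.

  It remains to see that the Koszul homology of \<open>M\<close> is finitely generated (\<open>fg_homology_koszul\<close>). The
  modules \<open>Ext\<^sup>j(R / I, M)\<close> may be computed from a subcomplex of the standard resolution with
  finite bases (\<open>fg_cohomology_if_Ext\<close>). With such a resolution all finitely generated modules have
  finitely generated cohomology, so that boundaries, homology and cycles of the Koszul complex can be
  handled alternately with the long exact sequence, starting in the lowest degree
  (\<open>fg_homology_of_complex\<close>).
\<close>

section \<open>Relatively finitely generated submodules\<close>

definition gen_submodule ::
    "('a, 'r) ring_scheme \<Rightarrow> ('a, 'b, 'm) module_scheme \<Rightarrow> 'b set \<Rightarrow> 'b set"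
  where "gen_submodule R M S = \<Inter>{H. submodule H R M \<and> S \<subseteq> H}"

text \<open>For submodules \<open>B \<subseteq> Z\<close> this says that \<open>Z / B\<close> is finitely generated. Quotients of
  submodules, in particular homology modules, are only ever handled in this form.\<close>

definition fg_over ::
    "('a, 'r) ring_scheme \<Rightarrow> ('a, 'b, 'm) module_scheme \<Rightarrow> 'b set \<Rightarrow> 'b set \<Rightarrow> bool"
  where "fg_over R M B Z \<longleftrightarrow> (\<exists>S. finite S \<and> S \<subseteq> Z \<and> Z \<subseteq> gen_submodule R M (S \<union> B))"

definition linear_on ::
    "('a, 'r) ring_scheme \<Rightarrow> ('a, 'b, 'm) module_scheme \<Rightarrow> 'b set \<Rightarrow> ('a, 'c, 'n) module_scheme \<Rightarrow>
      ('b \<Rightarrow> 'c) \<Rightarrow> bool"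
  where "linear_on R M E N \<phi> \<longleftrightarrow> (\<forall>x\<in>E. \<phi> x \<in> carrier N) \<and>
    (\<forall>x\<in>E. \<forall>y\<in>E. \<phi> (x \<oplus>\<^bsub>M\<^esub> y) = \<phi> x \<oplus>\<^bsub>N\<^esub> \<phi> y) \<and>
    (\<forall>r\<in>carrier R. \<forall>x\<in>E. \<phi> (r \<odot>\<^bsub>M\<^esub> x) = r \<odot>\<^bsub>N\<^esub> \<phi> x)"

lemma linear_onI:
  assumes "\<And>x. x \<in> E \<Longrightarrow> \<phi> x \<in> carrier N"
    and "\<And>x y. x \<in> E \<Longrightarrow> y \<in> E \<Longrightarrow> \<phi> (x \<oplus>\<^bsub>M\<^esub> y) = \<phi> x \<oplus>\<^bsub>N\<^esub> \<phi> y"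
    and "\<And>r x. r \<in> carrier R \<Longrightarrow> x \<in> E \<Longrightarrow> \<phi> (r \<odot>\<^bsub>M\<^esub> x) = r \<odot>\<^bsub>N\<^esub> \<phi> x"
  shows "linear_on R M E N \<phi>"
  using assms unfolding linear_on_def by blast

lemma linear_onD:
  assumes "linear_on R M E N \<phi>"
  shows "\<And>x. x \<in> E \<Longrightarrow> \<phi> x \<in> carrier N"
    and "\<And>x y. x \<in> E \<Longrightarrow> y \<in> E \<Longrightarrow> \<phi> (x \<oplus>\<^bsub>M\<^esub> y) = \<phi> x \<oplus>\<^bsub>N\<^esub> \<phi> y"
    and "\<And>r x. r \<in> carrier R \<Longrightarrow> x \<in> E \<Longrightarrow> \<phi> (r \<odot>\<^bsub>M\<^esub> x) = r \<odot>\<^bsub>N\<^esub> \<phi> x"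
  using assms unfolding linear_on_def by blast+

lemma linear_on_subset: "linear_on R M E N \<phi> \<Longrightarrow> E' \<subseteq> E \<Longrightarrow> linear_on R M E' N \<phi>"
  unfolding linear_on_def by blast

context module
begin

lemma minus_zero_module: "\<ominus>\<^bsub>M\<^esub> \<zero>\<^bsub>M\<^esub> = \<zero>\<^bsub>M\<^esub>"
  using M.l_neg[OF M.zero_closed] by simp

lemma smult_lcomm:
  "r \<in> carrier R \<Longrightarrow> s \<in> carrier R \<Longrightarrow> x \<in> carrier M \<Longrightarrow> r \<odot>\<^bsub>M\<^esub> (s \<odot>\<^bsub>M\<^esub> x) = s \<odot>\<^bsub>M\<^esub> (r \<odot>\<^bsub>M\<^esub> x)"
  by (metis R.m_comm smult_assoc1)

text \<open>With these rules the method \<open>algebra\<close> decides identities between linear combinations.\<close>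

lemmas module_simprules [algebra abelian_group "zero M" "add M" "a_inv M" "a_minus M" "smult M"] =
  M.a_closed M.zero_closed M.a_inv_closed M.minus_closed smult_closed
  M.a_assoc M.l_zero M.l_neg M.a_comm M.minus_eq M.r_zero M.r_neg M.r_neg2 M.r_neg1 M.minus_add
  M.minus_minus minus_zero_module M.a_lcomm smult_r_distr smult_l_distr smult_l_minus smult_r_minus
  smult_assoc1 smult_lcomm smult_one smult_l_null smult_r_null R.a_inv_closed R.one_closed
  R.a_closed R.m_closed R.zero_closed

lemma minus_eq_smult: "x \<in> carrier M \<Longrightarrow> \<ominus>\<^bsub>M\<^esub> x = (\<ominus> \<one>) \<odot>\<^bsub>M\<^esub> x"
  by (simp add: smult_l_minus)

lemma submodule_intro:
  assumes "H \<subseteq> carrier M" "\<zero>\<^bsub>M\<^esub> \<in> H"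
    and "\<And>x y. x \<in> H \<Longrightarrow> y \<in> H \<Longrightarrow> x \<oplus>\<^bsub>M\<^esub> y \<in> H"
    and smult: "\<And>r x. r \<in> carrier R \<Longrightarrow> x \<in> H \<Longrightarrow> r \<odot>\<^bsub>M\<^esub> x \<in> H"
  shows "submodule H R M"
proof (rule submoduleI)
  fix x assume "x \<in> H"
  then have "\<ominus>\<^bsub>M\<^esub> x = (\<ominus> \<one>) \<odot>\<^bsub>M\<^esub> x" "(\<ominus> \<one>) \<odot>\<^bsub>M\<^esub> x \<in> H"
    using assms(1) smult[of "\<ominus> \<one>" x] by (auto intro: minus_eq_smult)
  then show "\<ominus>\<^bsub>M\<^esub> x \<in> H" by simp
qed (use assms in auto)

lemma submoduleD:
  assumes "submodule H R M"
  shows "H \<subseteq> carrier M" "\<And>x. x \<in> H \<Longrightarrow> x \<in> carrier M" "\<zero>\<^bsub>M\<^esub> \<in> H"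
    and "\<And>x y. x \<in> H \<Longrightarrow> y \<in> H \<Longrightarrow> x \<oplus>\<^bsub>M\<^esub> y \<in> H"
    and "\<And>r x. r \<in> carrier R \<Longrightarrow> x \<in> H \<Longrightarrow> r \<odot>\<^bsub>M\<^esub> x \<in> H"
    and "\<And>x. x \<in> H \<Longrightarrow> \<ominus>\<^bsub>M\<^esub> x \<in> H"
    and "\<And>x y. x \<in> H \<Longrightarrow> y \<in> H \<Longrightarrow> x \<ominus>\<^bsub>M\<^esub> y \<in> H"
proof -
  interpret H: submodule H R M by fact
  show *: "H \<subseteq> carrier M" using submoduleE(1)[OF assms] .
  show "\<And>x. x \<in> H \<Longrightarrow> x \<in> carrier M" using * by blast
  obtain x where x: "x \<in> H" using submoduleE(2)[OF assms] by blast
  then have "\<zero> \<odot>\<^bsub>M\<^esub> x = \<zero>\<^bsub>M\<^esub>" using * by auto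
  then show "\<zero>\<^bsub>M\<^esub> \<in> H" using submoduleE(4)[OF assms _ x, of \<zero>] by simp
qed (use submoduleE[OF assms] in \<open>auto simp: M.minus_eq\<close>)

lemma submodule_Int: "submodule A R M \<Longrightarrow> submodule B R M \<Longrightarrow> submodule (A \<inter> B) R M"
  by (rule submodule_intro) (auto dest: submoduleD)

lemma submodule_zero: "submodule {\<zero>\<^bsub>M\<^esub>} R M"
  by (rule submodule_intro) auto

definition plus_set :: "'c set \<Rightarrow> 'c set \<Rightarrow> 'c set"
  where "plus_set A B = {a \<oplus>\<^bsub>M\<^esub> b | a b. a \<in> A \<and> b \<in> B}"

lemma submodule_plus:
  assumes A: "submodule A R M" and B: "submodule B R M"
  shows "submodule (plus_set A B) R M" "A \<subseteq> plus_set A B" "B \<subseteq> plus_set A B"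
proof -
  note AD = submoduleD[OF A] and BD = submoduleD[OF B]
  show "submodule (plus_set A B) R M"
  proof (rule submodule_intro)
    show "plus_set A B \<subseteq> carrier M" unfolding plus_set_def using AD(2) BD(2) by blast
    show "\<zero>\<^bsub>M\<^esub> \<in> plus_set A B" unfolding plus_set_def using AD(3) BD(3) by force
  next
    fix x y assume "x \<in> plus_set A B" "y \<in> plus_set A B"
    then obtain a b a' b' where "x = a \<oplus>\<^bsub>M\<^esub> b" "y = a' \<oplus>\<^bsub>M\<^esub> b'" and
      m: "a \<in> A" "b \<in> B" "a' \<in> A" "b' \<in> B"
      unfolding plus_set_def by blast
    then have "x \<oplus>\<^bsub>M\<^esub> y = (a \<oplus>\<^bsub>M\<^esub> a') \<oplus>\<^bsub>M\<^esub> (b \<oplus>\<^bsub>M\<^esub> b')"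
      using AD(2) BD(2) by (simp add: M.a_ac)
    then show "x \<oplus>\<^bsub>M\<^esub> y \<in> plus_set A B"
      unfolding plus_set_def using AD(4) BD(4) m by blast
  next
    fix r x assume r: "r \<in> carrier R" and "x \<in> plus_set A B"
    then obtain a b where "x = a \<oplus>\<^bsub>M\<^esub> b" and m: "a \<in> A" "b \<in> B"
      unfolding plus_set_def by blast
    then have "r \<odot>\<^bsub>M\<^esub> x = r \<odot>\<^bsub>M\<^esub> a \<oplus>\<^bsub>M\<^esub> r \<odot>\<^bsub>M\<^esub> b"
      using AD(2) BD(2) r by (simp add: smult_r_distr)
    then show "r \<odot>\<^bsub>M\<^esub> x \<in> plus_set A B"
      unfolding plus_set_def using AD(5) BD(5) m r by blast
  qed
  show "A \<subseteq> plus_set A B"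
  proof
    fix a assume "a \<in> A"
    then have "a = a \<oplus>\<^bsub>M\<^esub> \<zero>\<^bsub>M\<^esub>" using AD(2) by simp
    then show "a \<in> plus_set A B" unfolding plus_set_def using BD(3) \<open>a \<in> A\<close> by blast
  qed
  show "B \<subseteq> plus_set A B"
  proof
    fix b assume "b \<in> B"
    then have "b = \<zero>\<^bsub>M\<^esub> \<oplus>\<^bsub>M\<^esub> b" using BD(2) by simp
    then show "b \<in> plus_set A B" unfolding plus_set_def using AD(3) \<open>b \<in> B\<close> by blast
  qed
qed

lemma gen_subset: "S \<subseteq> gen_submodule R M S"
  unfolding gen_submodule_def by blast

lemma gen_least: "submodule H R M \<Longrightarrow> S \<subseteq> H \<Longrightarrow> gen_submodule R M S \<subseteq> H"
  unfolding gen_submodule_def by blast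

lemma gen_mono: "S \<subseteq> T \<Longrightarrow> gen_submodule R M S \<subseteq> gen_submodule R M T"
  unfolding gen_submodule_def by blast

lemma gen_eqI: "submodule H R M \<Longrightarrow> gen_submodule R M H = H"
  unfolding gen_submodule_def by blast

lemma gen_submodule:
  assumes "S \<subseteq> carrier M" shows "submodule (gen_submodule R M S) R M"
proof (rule submodule_intro)
  show "gen_submodule R M S \<subseteq> carrier M"
    using gen_least[OF carrier_is_submodule assms] .
qed (unfold gen_submodule_def, auto dest: submoduleD)

lemma gen_insertE:
  assumes v: "v \<in> carrier M" and S: "S \<subseteq> carrier M" and x: "x \<in> gen_submodule R M (insert v S)"
  obtains r h where "r \<in> carrier R" "h \<in> gen_submodule R M S" "x = r \<odot>\<^bsub>M\<^esub> v \<oplus>\<^bsub>M\<^esub> h"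
proof -
  let ?A = "{r \<odot>\<^bsub>M\<^esub> v | r. r \<in> carrier R}"
  have A: "submodule ?A R M"
  proof (rule submodule_intro)
    show "\<zero>\<^bsub>M\<^esub> \<in> ?A" using v by (auto intro!: exI[of _ \<zero>])
    show "\<And>x y. x \<in> ?A \<Longrightarrow> y \<in> ?A \<Longrightarrow> x \<oplus>\<^bsub>M\<^esub> y \<in> ?A"
      using v smult_l_distr[of _ _ v, symmetric] by auto
    show "\<And>r x. r \<in> carrier R \<Longrightarrow> x \<in> ?A \<Longrightarrow> r \<odot>\<^bsub>M\<^esub> x \<in> ?A"
      using v smult_assoc1[of _ _ v, symmetric] by auto
  qed (use v in auto)
  note P = submodule_plus[OF A gen_submodule[OF S]]
  have "v = \<one> \<odot>\<^bsub>M\<^esub> v" using v by simp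
  then have "v \<in> ?A" by blast
  then have "insert v S \<subseteq> plus_set ?A (gen_submodule R M S)"
    using P(2,3) gen_subset[of S] by blast
  then have "x \<in> plus_set ?A (gen_submodule R M S)"
    using x gen_least[OF P(1)] by blast
  then show ?thesis using that unfolding plus_set_def by blast
qed

lemma fg_overI:
  assumes "finite S" "S \<subseteq> Z" "\<And>H. submodule H R M \<Longrightarrow> S \<subseteq> H \<Longrightarrow> B \<subseteq> H \<Longrightarrow> Z \<subseteq> H"
  shows "fg_over R M B Z"
proof -
  have "Z \<subseteq> gen_submodule R M (S \<union> B)"
  proof (unfold gen_submodule_def, rule Inter_greatest)
    fix H assume "H \<in> {H. submodule H R M \<and> S \<union> B \<subseteq> H}"
    then show "Z \<subseteq> H" using assms(3)[of H] by simp
  qed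
  then show ?thesis using assms(1,2) unfolding fg_over_def by blast
qed

lemma fg_overE:
  assumes "fg_over R M B Z"
  obtains S where "finite S" "S \<subseteq> Z" "\<And>H. submodule H R M \<Longrightarrow> S \<subseteq> H \<Longrightarrow> B \<subseteq> H \<Longrightarrow> Z \<subseteq> H"
proof -
  obtain S where S: "finite S" "S \<subseteq> Z" "Z \<subseteq> gen_submodule R M (S \<union> B)"
    using assms unfolding fg_over_def by blast
  show ?thesis
  proof (rule that[OF S(1,2)])
    fix H assume "submodule H R M" "S \<subseteq> H" "B \<subseteq> H"
    then show "Z \<subseteq> H" using S(3) gen_least[of H "S \<union> B"] by blast
  qed
qed

lemma fg_over_mono: "fg_over R M B Z \<Longrightarrow> B \<subseteq> B' \<Longrightarrow> fg_over R M B' Z"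
proof (erule fg_overE)
  fix S assume B: "B \<subseteq> B'" and S: "finite S" "S \<subseteq> Z"
    and gen: "\<And>H. submodule H R M \<Longrightarrow> S \<subseteq> H \<Longrightarrow> B \<subseteq> H \<Longrightarrow> Z \<subseteq> H"
  show ?thesis
    by (rule fg_overI[OF S], rule gen) (use B in auto)
qed

lemma fg_over_self: "Z \<subseteq> B \<Longrightarrow> fg_over R M B Z"
  by (rule fg_overI[of "{}"]) auto

text \<open>The coefficients that the elements of \<open>Z'\<close> can have at one generator form an ideal; lifting
  finitely many generators of this ideal to \<open>Z'\<close> leaves a submodule that needs one generator less.\<close>

lemma fg_over_submodule:
  assumes noeth: "noetherian_ring R"
    and fg: "fg_over R M B Z" and B: "B \<subseteq> carrier M" and Zc: "Z \<subseteq> carrier M"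
    and Z': "submodule Z' R M" "B \<subseteq> Z'" "Z' \<subseteq> Z"
  shows "fg_over R M B Z'"
proof -
  interpret noetherian_ring R by fact
  have step: "fg_over R M B Y"
    if "finite S" "S \<subseteq> carrier M" "submodule Y R M" "B \<subseteq> Y" "Y \<subseteq> gen_submodule R M (S \<union> B)" for S Y
    using that
  proof (induction S arbitrary: Y rule: finite_induct)
    case empty
    show ?case
    proof (rule fg_overI[of "{}"])
      fix H assume "submodule H R M" "B \<subseteq> H"
      then show "Y \<subseteq> H" using empty(4) gen_least[of H B] by auto
    qed auto
  next
    case (insert v S)
    define G where "G = gen_submodule R M (S \<union> B)"
    have v: "v \<in> carrier M" and SB: "S \<union> B \<subseteq> carrier M" using insert.prems B by auto
    have G: "submodule G R M" "B \<subseteq> G" "S \<subseteq> G"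
      using gen_submodule[OF SB] gen_subset[of "S \<union> B"] unfolding G_def by auto
    note GD = submoduleD[OF G(1)] and YD = submoduleD[OF insert.prems(2)]
    have coeff_ideal: "ideal {r \<in> carrier R. \<exists>h\<in>G. r \<odot>\<^bsub>M\<^esub> v \<oplus>\<^bsub>M\<^esub> h \<in> X} R" if "submodule X R M" for X
    proof (rule idealI[OF R.ring_axioms])
      note XD = submoduleD[OF that]
      let ?J = "{r \<in> carrier R. \<exists>h\<in>G. r \<odot>\<^bsub>M\<^esub> v \<oplus>\<^bsub>M\<^esub> h \<in> X}"
      have add: "r \<oplus> r' \<in> ?J" if "r \<in> ?J" "r' \<in> ?J" for r r'
      proof -
        obtain h h' where h: "h \<in> G" "h' \<in> G" "r \<odot>\<^bsub>M\<^esub> v \<oplus>\<^bsub>M\<^esub> h \<in> X" "r' \<odot>\<^bsub>M\<^esub> v \<oplus>\<^bsub>M\<^esub> h' \<in> X"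
          and r: "r \<in> carrier R" "r' \<in> carrier R"
          using \<open>r \<in> ?J\<close> \<open>r' \<in> ?J\<close> by blast
        have "h \<in> carrier M" "h' \<in> carrier M" using h GD(2) by auto
        then have "(r \<odot>\<^bsub>M\<^esub> v \<oplus>\<^bsub>M\<^esub> h) \<oplus>\<^bsub>M\<^esub> (r' \<odot>\<^bsub>M\<^esub> v \<oplus>\<^bsub>M\<^esub> h') = (r \<oplus> r') \<odot>\<^bsub>M\<^esub> v \<oplus>\<^bsub>M\<^esub> (h \<oplus>\<^bsub>M\<^esub> h')"
          using r v by algebra
        then have "(r \<oplus> r') \<odot>\<^bsub>M\<^esub> v \<oplus>\<^bsub>M\<^esub> (h \<oplus>\<^bsub>M\<^esub> h') \<in> X" using XD(4)[OF h(3,4)] by simp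
        then show ?thesis using r GD(4)[OF h(1,2)] by blast
      qed
      have mult: "a \<otimes> r \<in> ?J" if "r \<in> ?J" "a \<in> carrier R" for r a
      proof -
        obtain h where h: "h \<in> G" "r \<odot>\<^bsub>M\<^esub> v \<oplus>\<^bsub>M\<^esub> h \<in> X" and r: "r \<in> carrier R"
          using \<open>r \<in> ?J\<close> by blast
        have "h \<in> carrier M" using h GD(2) by auto
        then have "a \<odot>\<^bsub>M\<^esub> (r \<odot>\<^bsub>M\<^esub> v \<oplus>\<^bsub>M\<^esub> h) = (a \<otimes> r) \<odot>\<^bsub>M\<^esub> v \<oplus>\<^bsub>M\<^esub> a \<odot>\<^bsub>M\<^esub> h"
          using r v that(2) by algebra
        then have "(a \<otimes> r) \<odot>\<^bsub>M\<^esub> v \<oplus>\<^bsub>M\<^esub> a \<odot>\<^bsub>M\<^esub> h \<in> X" using XD(5)[OF that(2) h(2)] by simp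
        then show ?thesis using r that GD(5)[OF that(2) h(1)] by blast
      qed
      show "a \<otimes> r \<in> ?J" "r \<otimes> a \<in> ?J" if "r \<in> ?J" "a \<in> carrier R" for r a
        using mult[OF that] that by (simp_all add: R.m_comm)
      have zero: "\<zero> \<in> ?J" using v GD(3) XD(3) by (auto intro!: bexI[of _ "\<zero>\<^bsub>M\<^esub>"])
      have neg: "\<ominus> r \<in> ?J" if "r \<in> ?J" for r
        using mult[OF that, of "\<ominus> \<one>"] that by (simp add: R.l_minus)
      show "subgroup ?J (add_monoid R)"
      proof (rule group.subgroupI)
        show "group (add_monoid R)" using R.add.is_group .
        show "?J \<noteq> {}" using zero by blast
      qed (use add neg in \<open>auto simp: a_inv_def[symmetric]\<close>)
    qed
    define J where "J = {r \<in> carrier R. \<exists>h\<in>G. r \<odot>\<^bsub>M\<^esub> v \<oplus>\<^bsub>M\<^esub> h \<in> Y}"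
    obtain A where A: "A \<subseteq> carrier R" "finite A" "J = Idl A"
      using finetely_gen[OF coeff_ideal[OF insert.prems(2)]] unfolding J_def by blast
    have "\<forall>a\<in>A. \<exists>h. h \<in> G \<and> a \<odot>\<^bsub>M\<^esub> v \<oplus>\<^bsub>M\<^esub> h \<in> Y"
      using genideal_self[OF A(1)] A(3) unfolding J_def by blast
    then obtain h where h: "\<And>a. a \<in> A \<Longrightarrow> h a \<in> G" "\<And>a. a \<in> A \<Longrightarrow> a \<odot>\<^bsub>M\<^esub> v \<oplus>\<^bsub>M\<^esub> h a \<in> Y"
      by metis
    have "fg_over R M B (Y \<inter> G)"
      using insert.prems G by (intro insert.IH submodule_Int) (auto simp: G_def[symmetric])
    then obtain S' where S': "finite S'" "S' \<subseteq> Y \<inter> G"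
      "\<And>H. submodule H R M \<Longrightarrow> S' \<subseteq> H \<Longrightarrow> B \<subseteq> H \<Longrightarrow> Y \<inter> G \<subseteq> H"
      by (rule fg_overE) blast
    show ?case
    proof (rule fg_overI[of "(\<lambda>a. a \<odot>\<^bsub>M\<^esub> v \<oplus>\<^bsub>M\<^esub> h a) ` A \<union> S'"])
      show "finite ((\<lambda>a. a \<odot>\<^bsub>M\<^esub> v \<oplus>\<^bsub>M\<^esub> h a) ` A \<union> S')" using A S' by simp
      show "(\<lambda>a. a \<odot>\<^bsub>M\<^esub> v \<oplus>\<^bsub>M\<^esub> h a) ` A \<union> S' \<subseteq> Y" using h S' by blast
      fix H assume H: "submodule H R M" "(\<lambda>a. a \<odot>\<^bsub>M\<^esub> v \<oplus>\<^bsub>M\<^esub> h a) ` A \<union> S' \<subseteq> H" "B \<subseteq> H"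
      note HY = submodule_Int[OF H(1) insert.prems(2)]
      have "A \<subseteq> {r \<in> carrier R. \<exists>h\<in>G. r \<odot>\<^bsub>M\<^esub> v \<oplus>\<^bsub>M\<^esub> h \<in> H \<inter> Y}"
        using A h H(2) by blast
      then have J: "J \<subseteq> {r \<in> carrier R. \<exists>h\<in>G. r \<odot>\<^bsub>M\<^esub> v \<oplus>\<^bsub>M\<^esub> h \<in> H \<inter> Y}"
        unfolding A(3) by (intro genideal_minimal coeff_ideal[OF HY])
      show "Y \<subseteq> H"
      proof
        fix y assume y: "y \<in> Y"
        then have "y \<in> gen_submodule R M (insert v (S \<union> B))" using insert.prems(4) by auto
        then obtain r g where r: "r \<in> carrier R" "g \<in> G" "y = r \<odot>\<^bsub>M\<^esub> v \<oplus>\<^bsub>M\<^esub> g"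
          unfolding G_def using gen_insertE[OF v SB] by metis
        then have "r \<in> J" using y unfolding J_def by blast
        then obtain g' where g': "g' \<in> G" "r \<odot>\<^bsub>M\<^esub> v \<oplus>\<^bsub>M\<^esub> g' \<in> H" "r \<odot>\<^bsub>M\<^esub> v \<oplus>\<^bsub>M\<^esub> g' \<in> Y"
          using J by blast
        have rv: "r \<odot>\<^bsub>M\<^esub> v \<in> carrier M" "g \<in> carrier M" "g' \<in> carrier M" using r v g' GD(2) by auto
        have "y \<ominus>\<^bsub>M\<^esub> (r \<odot>\<^bsub>M\<^esub> v \<oplus>\<^bsub>M\<^esub> g') = g \<ominus>\<^bsub>M\<^esub> g'"
          using rv unfolding r(3) by algebra
        then have "y \<ominus>\<^bsub>M\<^esub> (r \<odot>\<^bsub>M\<^esub> v \<oplus>\<^bsub>M\<^esub> g') \<in> Y \<inter> G"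
          using GD(7)[OF r(2) g'(1)] YD(7)[OF y g'(3)] by simp
        then have "y \<ominus>\<^bsub>M\<^esub> (r \<odot>\<^bsub>M\<^esub> v \<oplus>\<^bsub>M\<^esub> g') \<in> H" using S'(3)[OF H(1)] H by blast
        then have "(y \<ominus>\<^bsub>M\<^esub> (r \<odot>\<^bsub>M\<^esub> v \<oplus>\<^bsub>M\<^esub> g')) \<oplus>\<^bsub>M\<^esub> (r \<odot>\<^bsub>M\<^esub> v \<oplus>\<^bsub>M\<^esub> g') \<in> H"
          using submoduleD(4)[OF H(1)] g'(2) by blast
        moreover have "(y \<ominus>\<^bsub>M\<^esub> (r \<odot>\<^bsub>M\<^esub> v \<oplus>\<^bsub>M\<^esub> g')) \<oplus>\<^bsub>M\<^esub> (r \<odot>\<^bsub>M\<^esub> v \<oplus>\<^bsub>M\<^esub> g') = y"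
          using rv YD(2)[OF y] by algebra
        ultimately show "y \<in> H" by simp
      qed
    qed
  qed
  obtain S where S: "finite S" "S \<subseteq> Z" "Z \<subseteq> gen_submodule R M (S \<union> B)"
    using fg unfolding fg_over_def by blast
  show ?thesis
    by (rule step[OF S(1) _ Z'(1,2)]) (use S Zc Z'(3) in auto)
qed

end

lemma linear_on_basics:
  assumes M: "module R M" and N: "module R N" and E: "submodule E R M" and \<phi>: "linear_on R M E N \<phi>"
  shows "\<phi> \<zero>\<^bsub>M\<^esub> = \<zero>\<^bsub>N\<^esub>"
    and "\<And>x. x \<in> E \<Longrightarrow> \<phi> (\<ominus>\<^bsub>M\<^esub> x) = \<ominus>\<^bsub>N\<^esub> \<phi> x"
    and "\<And>x y. x \<in> E \<Longrightarrow> y \<in> E \<Longrightarrow> \<phi> (x \<ominus>\<^bsub>M\<^esub> y) = \<phi> x \<ominus>\<^bsub>N\<^esub> \<phi> y"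
proof -
  interpret M: module R M by fact
  interpret N: module R N by fact
  note ED = M.submoduleD[OF E] and L = linear_onD[OF \<phi>]
  have "\<phi> (\<zero>\<^bsub>R\<^esub> \<odot>\<^bsub>M\<^esub> \<zero>\<^bsub>M\<^esub>) = \<zero>\<^bsub>R\<^esub> \<odot>\<^bsub>N\<^esub> \<phi> \<zero>\<^bsub>M\<^esub>"
    using L(3) ED(3) by blast
  then show "\<phi> \<zero>\<^bsub>M\<^esub> = \<zero>\<^bsub>N\<^esub>" using L(1)[OF ED(3)] by simp
  show neg: "\<phi> (\<ominus>\<^bsub>M\<^esub> x) = \<ominus>\<^bsub>N\<^esub> \<phi> x" if "x \<in> E" for x
    using L(3)[of "\<ominus>\<^bsub>R\<^esub> \<one>\<^bsub>R\<^esub>" x] L(1)[OF that] that ED(2)[OF that]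
    by (simp add: M.minus_eq_smult N.minus_eq_smult)
  show "\<phi> (x \<ominus>\<^bsub>M\<^esub> y) = \<phi> x \<ominus>\<^bsub>N\<^esub> \<phi> y" if "x \<in> E" "y \<in> E" for x y
    using L(2)[OF that(1) ED(6)[OF that(2)]] neg[OF that(2)]
    by (simp add: M.M.minus_eq N.M.minus_eq)
qed

lemma submodule_image:
  assumes M: "module R M" and N: "module R N" and E: "submodule E R M" and \<phi>: "linear_on R M E N \<phi>"
  shows "submodule (\<phi> ` E) R N"
proof -
  interpret M: module R M by fact
  interpret N: module R N by fact
  note ED = M.submoduleD[OF E] and L = linear_onD[OF \<phi>]
  show ?thesis
  proof (rule N.submodule_intro)
    show "\<zero>\<^bsub>N\<^esub> \<in> \<phi> ` E"
      using ED(3) linear_on_basics(1)[OF assms, symmetric] by (rule rev_image_eqI)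
  next
    fix u v assume "u \<in> \<phi> ` E" "v \<in> \<phi> ` E"
    then obtain x y where "u = \<phi> x" "v = \<phi> y" "x \<in> E" "y \<in> E" by blast
    then show "u \<oplus>\<^bsub>N\<^esub> v \<in> \<phi> ` E" using L(2) ED(4) by (metis imageI)
  next
    fix r u assume r: "r \<in> carrier R" and "u \<in> \<phi> ` E"
    then obtain x where "u = \<phi> x" "x \<in> E" by blast
    then show "r \<odot>\<^bsub>N\<^esub> u \<in> \<phi> ` E" using L(3) ED(5) r by (metis imageI)
  qed (use L(1) in auto)
qed

lemma submodule_vimage:
  assumes M: "module R M" and N: "module R N" and E: "submodule E R M" and \<phi>: "linear_on R M E N \<phi>"
    and C: "submodule C R N"
  shows "submodule {x \<in> E. \<phi> x \<in> C} R M"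
proof -
  interpret M: module R M by fact
  interpret N: module R N by fact
  note ED = M.submoduleD[OF E] and CD = N.submoduleD[OF C] and L = linear_onD[OF \<phi>]
  show ?thesis
    by (rule M.submodule_intro)
      (use ED CD L linear_on_basics(1)[OF M N E \<phi>] in auto)
qed

lemma fg_over_image:
  assumes M: "module R M" and N: "module R N" and E: "submodule E R M" and \<phi>: "linear_on R M E N \<phi>"
    and B: "B \<subseteq> E" and fg: "fg_over R M B E"
  shows "fg_over R N (\<phi> ` B) (\<phi> ` E)"
proof -
  interpret M: module R M by fact
  interpret N: module R N by fact
  obtain S where S: "finite S" "S \<subseteq> E" "\<And>H. submodule H R M \<Longrightarrow> S \<subseteq> H \<Longrightarrow> B \<subseteq> H \<Longrightarrow> E \<subseteq> H"
    using fg by (rule M.fg_overE) blast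
  show ?thesis
  proof (rule N.fg_overI[of "\<phi> ` S"])
    fix H assume H: "submodule H R N" "\<phi> ` S \<subseteq> H" "\<phi> ` B \<subseteq> H"
    have "E \<subseteq> {x \<in> E. \<phi> x \<in> H}"
      by (rule S(3)[OF submodule_vimage[OF M N E \<phi> H(1)]]) (use S(2) B H in auto)
    then show "\<phi> ` E \<subseteq> H" by blast
  qed (use S in auto)
qed

text \<open>Finite generation passes to extensions: the image of \<open>E\<close> modulo \<open>C\<close> is a submodule of
  \<open>W\<close> modulo \<open>C\<close>, and the kernel of \<open>E \<rightarrow> W / C\<close> is assumed to be finitely generated over
  \<open>B\<close>.\<close>

lemma fg_over_extension:
  assumes noeth: "noetherian_ring R" and M: "module R M" and N: "module R N"
    and E: "submodule E R M" and \<phi>: "linear_on R M E N \<phi>"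
    and W: "submodule W R N" and C: "submodule C R N" and "C \<subseteq> W" and \<phi>W: "\<And>x. x \<in> E \<Longrightarrow> \<phi> x \<in> W"
    and fgW: "fg_over R N C W" and fgB: "fg_over R M B {x \<in> E. \<phi> x \<in> C}"
  shows "fg_over R M B E"
proof -
  interpret M: module R M by fact
  interpret N: module R N by fact
  note ED = M.submoduleD[OF E] and CD = N.submoduleD[OF C] and L = linear_onD[OF \<phi>]
  define W' where "W' = N.plus_set (\<phi> ` E) C"
  note im = submodule_image[OF M N E \<phi>]
  have W': "submodule W' R N" "\<phi> ` E \<subseteq> W'" "C \<subseteq> W'"
    using N.submodule_plus[OF im C] unfolding W'_def by auto
  have "W' \<subseteq> W"
    using \<phi>W \<open>C \<subseteq> W\<close> N.submoduleD(4)[OF W] unfolding W'_def N.plus_set_def by blast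
  then have "fg_over R N C W'"
    using N.fg_over_submodule[OF noeth fgW] N.submoduleD(1)[OF C] N.submoduleD(1)[OF W] W' by blast
  then obtain S where S: "finite S" "S \<subseteq> W'"
    "\<And>H. submodule H R N \<Longrightarrow> S \<subseteq> H \<Longrightarrow> C \<subseteq> H \<Longrightarrow> W' \<subseteq> H"
    by (rule N.fg_overE) blast
  have "\<forall>w\<in>S. \<exists>e. e \<in> E \<and> (\<exists>c\<in>C. w = \<phi> e \<oplus>\<^bsub>N\<^esub> c)"
    using S(2) unfolding W'_def N.plus_set_def by blast
  then obtain e where e: "\<And>w. w \<in> S \<Longrightarrow> e w \<in> E" "\<And>w. w \<in> S \<Longrightarrow> \<exists>c\<in>C. w = \<phi> (e w) \<oplus>\<^bsub>N\<^esub> c"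
    by metis
  obtain S2 where S2: "finite S2" "S2 \<subseteq> {x \<in> E. \<phi> x \<in> C}"
    "\<And>H. submodule H R M \<Longrightarrow> S2 \<subseteq> H \<Longrightarrow> B \<subseteq> H \<Longrightarrow> {x \<in> E. \<phi> x \<in> C} \<subseteq> H"
    using fgB by (rule M.fg_overE) blast
  show ?thesis
  proof (rule M.fg_overI[of "e ` S \<union> S2"])
    show "finite (e ` S \<union> S2)" using S S2 by simp
    show "e ` S \<union> S2 \<subseteq> E" using e S2 by auto
    fix H assume H: "submodule H R M" "e ` S \<union> S2 \<subseteq> H" "B \<subseteq> H"
    note HD = M.submoduleD[OF H(1)]
    have HE: "submodule (H \<inter> E) R M" by (rule M.submodule_Int[OF H(1) E])
    have imHE: "submodule (\<phi> ` (H \<inter> E)) R N"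
      by (rule submodule_image[OF M N HE linear_on_subset[OF \<phi>]]) auto
    note P = N.submodule_plus[OF imHE C]
    have "S \<subseteq> N.plus_set (\<phi> ` (H \<inter> E)) C"
      using e H(2) unfolding N.plus_set_def by blast
    then have sub: "W' \<subseteq> N.plus_set (\<phi> ` (H \<inter> E)) C" using S(3)[OF P(1)] P(3) by blast
    have S2H: "{x \<in> E. \<phi> x \<in> C} \<subseteq> H" using S2(3)[OF H(1)] H by blast
    show "E \<subseteq> H"
    proof
      fix z assume z: "z \<in> E"
      then have "\<phi> z \<in> N.plus_set (\<phi> ` (H \<inter> E)) C" using W' sub by blast
      then obtain h c where h: "h \<in> H" "h \<in> E" "c \<in> C" "\<phi> z = \<phi> h \<oplus>\<^bsub>N\<^esub> c"
        unfolding N.plus_set_def by blast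
      have "\<phi> h \<in> carrier N" "c \<in> carrier N" using L(1) CD(2) h by auto
      then have "\<phi> (z \<ominus>\<^bsub>M\<^esub> h) = c"
        unfolding linear_on_basics(3)[OF M N E \<phi> z h(2)] h(4) by algebra
      then have "z \<ominus>\<^bsub>M\<^esub> h \<in> H" using h ED(7)[OF z h(2)] S2H by blast
      then have "(z \<ominus>\<^bsub>M\<^esub> h) \<oplus>\<^bsub>M\<^esub> h \<in> H" using HD(4) h(1) by blast
      moreover have "(z \<ominus>\<^bsub>M\<^esub> h) \<oplus>\<^bsub>M\<^esub> h = z"
        using ED(2)[OF z] ED(2)[OF h(2)] by algebra
      ultimately show "z \<in> H" by simp
    qed
  qed
qed

context module
begin

lemma linear_on_id: "E \<subseteq> carrier M \<Longrightarrow> linear_on R M E M (\<lambda>x. x)"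
  by (auto simp: linear_on_def)

text \<open>The Cayley-Hamilton argument behind Nakayama's lemma. Induction on the number of generators
  makes determinants unnecessary: if \<open>f = s\<^sup>n + b x\<close> maps \<open>Z\<close> into \<open>R v + B\<close> and \<open>f v = r v\<close> modulo
  \<open>B\<close>, then \<open>(s f - x r) f\<close> maps \<open>Z\<close> into \<open>B\<close>.\<close>

lemma power_plus_multiple_annihilates:
  assumes fg: "fg_over R M B Z" and B: "submodule B R M" and Z: "submodule Z R M" and "B \<subseteq> Z"
    and s: "s \<in> carrier R" and x: "x \<in> carrier R"
    and sx: "\<And>z. z \<in> Z \<Longrightarrow> \<exists>y\<in>Z. \<exists>b\<in>B. s \<odot>\<^bsub>M\<^esub> z = x \<odot>\<^bsub>M\<^esub> y \<oplus>\<^bsub>M\<^esub> b"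
  shows "\<exists>(n::nat). \<exists>b\<in>carrier R. \<forall>z\<in>Z. (s [^] n \<oplus> b \<otimes> x) \<odot>\<^bsub>M\<^esub> z \<in> B"
proof -
  note ZD = submoduleD[OF Z]
  have step: "\<exists>(n::nat). \<exists>b\<in>carrier R. \<forall>z\<in>Z. (s [^] n \<oplus> b \<otimes> x) \<odot>\<^bsub>M\<^esub> z \<in> B"
    if "finite S" "S \<subseteq> Z" "submodule B R M" "B \<subseteq> Z" "Z \<subseteq> gen_submodule R M (S \<union> B)"
      "\<And>z. z \<in> Z \<Longrightarrow> \<exists>y\<in>Z. \<exists>b\<in>B. s \<odot>\<^bsub>M\<^esub> z = x \<odot>\<^bsub>M\<^esub> y \<oplus>\<^bsub>M\<^esub> b" for S B
    using that
  proof (induction S arbitrary: B rule: finite_induct)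
    case empty
    then have "Z \<subseteq> B" using gen_least[of B B] by auto
    then have "(s [^] (0::nat) \<oplus> \<zero> \<otimes> x) \<odot>\<^bsub>M\<^esub> z \<in> B" if "z \<in> Z" for z
      using that x ZD(2) by auto
    then show ?case by blast
  next
    case (insert v S)
    note BD = submoduleD[OF insert.prems(2)]
    have v: "v \<in> Z" "v \<in> carrier M" using insert.prems ZD by auto
    define B1 where "B1 = gen_submodule R M (insert v B)"
    have vB: "insert v B \<subseteq> carrier M" using v BD(1) by simp
    have B1: "submodule B1 R M" "B \<subseteq> B1" "v \<in> B1"
      using gen_submodule[OF vB] gen_subset[of "insert v B"] unfolding B1_def by auto
    have B1E: "\<exists>r\<in>carrier R. \<exists>h\<in>B. w = r \<odot>\<^bsub>M\<^esub> v \<oplus>\<^bsub>M\<^esub> h" if "w \<in> B1" for w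
      using gen_insertE[OF v(2) BD(1), of w] that unfolding B1_def gen_eqI[OF insert.prems(2)]
      by metis
    have B1Z: "B1 \<subseteq> Z"
      unfolding B1_def using v insert.prems by (intro gen_least[OF Z]) auto
    have S1: "S \<union> B1 \<subseteq> carrier M" using insert.prems B1Z ZD(1) by auto
    have "Z \<subseteq> gen_submodule R M (S \<union> B1)"
      using insert.prems(4) gen_mono[of "insert v S \<union> B" "S \<union> B1"] B1 by auto
    moreover have "\<exists>y\<in>Z. \<exists>b\<in>B1. s \<odot>\<^bsub>M\<^esub> z = x \<odot>\<^bsub>M\<^esub> y \<oplus>\<^bsub>M\<^esub> b" if "z \<in> Z" for z
      using insert.prems(5)[OF that] B1(2) by blast
    ultimately have "\<exists>(n::nat). \<exists>b\<in>carrier R. \<forall>z\<in>Z. (s [^] n \<oplus> b \<otimes> x) \<odot>\<^bsub>M\<^esub> z \<in> B1"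
      using insert.IH[OF _ B1(1) B1Z] insert.prems(1) by simp
    then obtain n :: nat and b where b: "b \<in> carrier R"
      and f1: "\<And>z. z \<in> Z \<Longrightarrow> (s [^] n \<oplus> b \<otimes> x) \<odot>\<^bsub>M\<^esub> z \<in> B1" by blast
    define f where "f = s [^] n \<oplus> b \<otimes> x"
    have f: "f \<in> carrier R" using s b x by (simp add: f_def)
    note f1 = f1[folded f_def]
    obtain y b0 where y: "y \<in> Z" "b0 \<in> B" "s \<odot>\<^bsub>M\<^esub> v = x \<odot>\<^bsub>M\<^esub> y \<oplus>\<^bsub>M\<^esub> b0"
      using insert.prems(5)[OF v(1)] by blast
    obtain r h where r: "r \<in> carrier R" "h \<in> B" "f \<odot>\<^bsub>M\<^esub> y = r \<odot>\<^bsub>M\<^esub> v \<oplus>\<^bsub>M\<^esub> h"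
      using B1E[OF f1[OF y(1)]] by blast
    (* g v lies in B because s (f v) = f (s v) = f (x y + b0) = x (r v) modulo B. *)
    define g where "g = s \<otimes> f \<ominus> x \<otimes> r"
    have g: "g \<in> carrier R" using s f x r by (simp add: g_def)
    have car: "y \<in> carrier M" "b0 \<in> carrier M" "h \<in> carrier M" using y r ZD BD by auto
    have "s \<odot>\<^bsub>M\<^esub> (f \<odot>\<^bsub>M\<^esub> v) = f \<odot>\<^bsub>M\<^esub> (x \<odot>\<^bsub>M\<^esub> y \<oplus>\<^bsub>M\<^esub> b0)"
      using s f v y(3) smult_lcomm by metis
    also have "\<dots> = x \<odot>\<^bsub>M\<^esub> (f \<odot>\<^bsub>M\<^esub> y) \<oplus>\<^bsub>M\<^esub> f \<odot>\<^bsub>M\<^esub> b0" using f x car by algebra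
    also have "\<dots> = x \<odot>\<^bsub>M\<^esub> (r \<odot>\<^bsub>M\<^esub> v) \<oplus>\<^bsub>M\<^esub> (x \<odot>\<^bsub>M\<^esub> h \<oplus>\<^bsub>M\<^esub> f \<odot>\<^bsub>M\<^esub> b0)"
      unfolding r(3) using f x r car v by algebra
    finally have sfv: "s \<odot>\<^bsub>M\<^esub> (f \<odot>\<^bsub>M\<^esub> v) = x \<odot>\<^bsub>M\<^esub> (r \<odot>\<^bsub>M\<^esub> v) \<oplus>\<^bsub>M\<^esub> (x \<odot>\<^bsub>M\<^esub> h \<oplus>\<^bsub>M\<^esub> f \<odot>\<^bsub>M\<^esub> b0)" .
    have "g \<odot>\<^bsub>M\<^esub> v = s \<odot>\<^bsub>M\<^esub> (f \<odot>\<^bsub>M\<^esub> v) \<ominus>\<^bsub>M\<^esub> x \<odot>\<^bsub>M\<^esub> (r \<odot>\<^bsub>M\<^esub> v)"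
      unfolding g_def R.minus_eq using s f x r v by algebra
    also have "\<dots> = x \<odot>\<^bsub>M\<^esub> h \<oplus>\<^bsub>M\<^esub> f \<odot>\<^bsub>M\<^esub> b0" unfolding sfv using s f x r v car by algebra
    finally have gv: "g \<odot>\<^bsub>M\<^esub> v \<in> B" using BD(4,5) x f r y by auto
    have gf: "(g \<otimes> f) \<odot>\<^bsub>M\<^esub> z \<in> B" if z: "z \<in> Z" for z
    proof -
      obtain r' h' where r': "r' \<in> carrier R" "h' \<in> B" "f \<odot>\<^bsub>M\<^esub> z = r' \<odot>\<^bsub>M\<^esub> v \<oplus>\<^bsub>M\<^esub> h'"
        using B1E[OF f1[OF z]] by blast
      have "(g \<otimes> f) \<odot>\<^bsub>M\<^esub> z = g \<odot>\<^bsub>M\<^esub> (r' \<odot>\<^bsub>M\<^esub> v \<oplus>\<^bsub>M\<^esub> h')"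
        using g f ZD(2)[OF z] r'(3) by (simp add: smult_assoc1)
      also have "\<dots> = r' \<odot>\<^bsub>M\<^esub> (g \<odot>\<^bsub>M\<^esub> v) \<oplus>\<^bsub>M\<^esub> g \<odot>\<^bsub>M\<^esub> h'"
        using g r'(1) v BD(2)[OF r'(2)] by algebra
      finally show ?thesis using BD(4,5) gv g r' by auto
    qed
    define c where "c = s \<otimes> (s [^] n \<otimes> b \<oplus> s [^] n \<otimes> b \<oplus> b \<otimes> b \<otimes> x) \<ominus> r \<otimes> f"
    have c: "c \<in> carrier R" using s b x r f by (simp add: c_def)
    have pow: "s [^] (Suc (n + n)) = s [^] n \<otimes> s [^] n \<otimes> s" using s by (simp add: R.nat_pow_mult)
    define p where "p = s [^] n"
    have p: "p \<in> carrier R" using s by (simp add: p_def)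
    have "g \<otimes> f = s [^] (Suc (n + n)) \<oplus> c \<otimes> x"
      unfolding g_def c_def pow f_def p_def[symmetric] using s b x r(1) p by algebra
    then show ?case using gf c by metis
  qed
  obtain S where S: "finite S" "S \<subseteq> Z" "Z \<subseteq> gen_submodule R M (S \<union> B)"
    using fg unfolding fg_over_def by blast
  show ?thesis
    by (rule step[OF S(1,2) B \<open>B \<subseteq> Z\<close> S(3) sx])
qed

end

section \<open>Differential modules and completion in one variable\<close>

text \<open>Pairs of elements are encoded as elements of the same module. Thus the constructions below
  do not change the type and can be iterated along a list.\<close>

locale pairing_module = module R M for R (structure) and M (structure) +
  fixes join :: "'c \<Rightarrow> 'c \<Rightarrow> 'c" and lo hi :: "'c \<Rightarrow> 'c"
  assumes join_closed: "\<And>a b. a \<in> carrier M \<Longrightarrow> b \<in> carrier M \<Longrightarrow> join a b \<in> carrier M"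
    and lo_linear: "linear_on R M (carrier M) M lo"
    and hi_linear: "linear_on R M (carrier M) M hi"
    and lo_join [simp]: "\<And>a b. lo (join a b) = a"
    and hi_join [simp]: "\<And>a b. hi (join a b) = b"
    and join_lo_hi [simp]: "\<And>w. join (lo w) (hi w) = w"
begin

lemmas lo = linear_onD[OF lo_linear] and hi = linear_onD[OF hi_linear]

lemma lo_hi_zero [simp]: "lo \<zero>\<^bsub>M\<^esub> = \<zero>\<^bsub>M\<^esub>" "hi \<zero>\<^bsub>M\<^esub> = \<zero>\<^bsub>M\<^esub>"
  using linear_on_basics(1)[OF module_axioms module_axioms carrier_is_submodule] lo_linear hi_linear
  by auto

lemma lo_hi_minus:
  "w \<in> carrier M \<Longrightarrow> lo (\<ominus>\<^bsub>M\<^esub> w) = \<ominus>\<^bsub>M\<^esub> lo w" "w \<in> carrier M \<Longrightarrow> hi (\<ominus>\<^bsub>M\<^esub> w) = \<ominus>\<^bsub>M\<^esub> hi w"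
  using linear_on_basics(2)[OF module_axioms module_axioms carrier_is_submodule] lo_linear hi_linear
  by auto

lemma pair_eqI: "lo v = lo w \<Longrightarrow> hi v = hi w \<Longrightarrow> v = w"
  by (metis join_lo_hi)

lemma join_zero [simp]: "join \<zero>\<^bsub>M\<^esub> \<zero>\<^bsub>M\<^esub> = \<zero>\<^bsub>M\<^esub>"
  by (rule pair_eqI) simp_all

text \<open>Complexes enter as differential modules without a grading, so that no degrees have to be
  carried along and all degrees are treated at once.\<close>

definition dmod :: "'c set \<Rightarrow> ('c \<Rightarrow> 'c) \<Rightarrow> bool"
  where "dmod E d \<longleftrightarrow> submodule E R M \<and> linear_on R M E M d \<and>
    (\<forall>v\<in>E. d v \<in> E \<and> d (d v) = \<zero>\<^bsub>M\<^esub>)"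

definition cycles :: "'c set \<Rightarrow> ('c \<Rightarrow> 'c) \<Rightarrow> 'c set"
  where "cycles E d = {v \<in> E. d v = \<zero>\<^bsub>M\<^esub>}"

definition fg_homology :: "'c set \<Rightarrow> ('c \<Rightarrow> 'c) \<Rightarrow> bool"
  where "fg_homology E d \<longleftrightarrow> fg_over R M (d ` E) (cycles E d)"

definition kills_homology :: "'a \<Rightarrow> 'c set \<Rightarrow> ('c \<Rightarrow> 'c) \<Rightarrow> bool"
  where "kills_homology f E d \<longleftrightarrow> (\<forall>z\<in>cycles E d. f \<odot>\<^bsub>M\<^esub> z \<in> d ` E)"

lemma dmodD:
  assumes "dmod E d"
  shows "submodule E R M" "linear_on R M E M d"
    "\<And>v. v \<in> E \<Longrightarrow> v \<in> carrier M" "\<And>v. v \<in> E \<Longrightarrow> d v \<in> E" "\<And>v. v \<in> E \<Longrightarrow> d (d v) = \<zero>\<^bsub>M\<^esub>"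
    "\<And>v. v \<in> E \<Longrightarrow> d v \<in> carrier M"
    "\<And>v w. v \<in> E \<Longrightarrow> w \<in> E \<Longrightarrow> d (v \<oplus>\<^bsub>M\<^esub> w) = d v \<oplus>\<^bsub>M\<^esub> d w"
    "\<And>v w. v \<in> E \<Longrightarrow> w \<in> E \<Longrightarrow> d (v \<ominus>\<^bsub>M\<^esub> w) = d v \<ominus>\<^bsub>M\<^esub> d w"
    "\<And>v. v \<in> E \<Longrightarrow> d (\<ominus>\<^bsub>M\<^esub> v) = \<ominus>\<^bsub>M\<^esub> d v"
    "\<And>r v. r \<in> carrier R \<Longrightarrow> v \<in> E \<Longrightarrow> d (r \<odot>\<^bsub>M\<^esub> v) = r \<odot>\<^bsub>M\<^esub> d v"
    "d \<zero>\<^bsub>M\<^esub> = \<zero>\<^bsub>M\<^esub>"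
proof -
  show 1: "submodule E R M" and 2: "linear_on R M E M d"
    and 3: "\<And>v. v \<in> E \<Longrightarrow> d v \<in> E" "\<And>v. v \<in> E \<Longrightarrow> d (d v) = \<zero>\<^bsub>M\<^esub>"
    using assms unfolding dmod_def by auto
  show 4: "\<And>v. v \<in> E \<Longrightarrow> v \<in> carrier M" using submoduleD(2)[OF 1] .
  then show "\<And>v. v \<in> E \<Longrightarrow> d v \<in> carrier M" using 3 by blast
  show "\<And>v w. v \<in> E \<Longrightarrow> w \<in> E \<Longrightarrow> d (v \<oplus>\<^bsub>M\<^esub> w) = d v \<oplus>\<^bsub>M\<^esub> d w"
    "\<And>r v. r \<in> carrier R \<Longrightarrow> v \<in> E \<Longrightarrow> d (r \<odot>\<^bsub>M\<^esub> v) = r \<odot>\<^bsub>M\<^esub> d v"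
    using linear_onD[OF 2] by blast+
  show "\<And>v w. v \<in> E \<Longrightarrow> w \<in> E \<Longrightarrow> d (v \<ominus>\<^bsub>M\<^esub> w) = d v \<ominus>\<^bsub>M\<^esub> d w"
    "\<And>v. v \<in> E \<Longrightarrow> d (\<ominus>\<^bsub>M\<^esub> v) = \<ominus>\<^bsub>M\<^esub> d v" "d \<zero>\<^bsub>M\<^esub> = \<zero>\<^bsub>M\<^esub>"
    using linear_on_basics[OF module_axioms module_axioms 1 2] by blast+
qed

lemma dmodI:
  assumes "submodule E R M" "linear_on R M E M d" "\<And>v. v \<in> E \<Longrightarrow> d v \<in> E"
    "\<And>v. v \<in> E \<Longrightarrow> d (d v) = \<zero>\<^bsub>M\<^esub>"
  shows "dmod E d"
  using assms unfolding dmod_def by blast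

lemma submodule_cycles:
  assumes "dmod E d" shows "submodule (cycles E d) R M"
proof -
  have "submodule {v \<in> E. d v \<in> {\<zero>\<^bsub>M\<^esub>}} R M"
    using submodule_vimage[OF module_axioms module_axioms _ _ submodule_zero] dmodD(1,2)[OF assms] .
  then show ?thesis by (simp add: cycles_def)
qed

lemma submodule_boundaries: "dmod E d \<Longrightarrow> submodule (d ` E) R M"
  using submodule_image[OF module_axioms module_axioms] dmodD(1,2) by blast

lemma boundaries_sub_cycles: "dmod E d \<Longrightarrow> d ` E \<subseteq> cycles E d"
  by (auto simp: cycles_def dmodD)

text \<open>The cone of the multiplication by \<open>x\<close>.\<close>

definition koszul :: "'c set \<Rightarrow> 'c set"
  where "koszul E = {w \<in> carrier M. lo w \<in> E \<and> hi w \<in> E}"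

definition koszul_diff :: "'a \<Rightarrow> ('c \<Rightarrow> 'c) \<Rightarrow> 'c \<Rightarrow> 'c"
  where "koszul_diff x d w = join (d (lo w) \<oplus>\<^bsub>M\<^esub> x \<odot>\<^bsub>M\<^esub> hi w) (\<ominus>\<^bsub>M\<^esub> d (hi w))"

lemma koszul_diff_simps [simp]:
  "lo (koszul_diff x d w) = d (lo w) \<oplus>\<^bsub>M\<^esub> x \<odot>\<^bsub>M\<^esub> hi w"
  "hi (koszul_diff x d w) = \<ominus>\<^bsub>M\<^esub> d (hi w)"
  by (simp_all add: koszul_diff_def)

lemma join_in_koszul: "dmod E d \<Longrightarrow> a \<in> E \<Longrightarrow> b \<in> E \<Longrightarrow> join a b \<in> koszul E"
  by (simp add: koszul_def join_closed dmodD)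

lemma submodule_koszul:
  assumes "submodule E R M" shows "submodule (koszul E) R M"
proof (rule submodule_intro)
  note ED = submoduleD[OF assms]
  show "koszul E \<subseteq> carrier M" by (auto simp: koszul_def)
  show "\<zero>\<^bsub>M\<^esub> \<in> koszul E" using ED(3) by (simp add: koszul_def)
  show "\<And>v w. v \<in> koszul E \<Longrightarrow> w \<in> koszul E \<Longrightarrow> v \<oplus>\<^bsub>M\<^esub> w \<in> koszul E"
    using ED(4) lo(2) hi(2) by (simp add: koszul_def)
  show "\<And>r v. r \<in> carrier R \<Longrightarrow> v \<in> koszul E \<Longrightarrow> r \<odot>\<^bsub>M\<^esub> v \<in> koszul E"
    using ED(5) lo(3) hi(3) by (simp add: koszul_def)
qed

lemma dmod_koszul:
  assumes E: "dmod E d" and x: "x \<in> carrier R"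
  shows "dmod (koszul E) (koszul_diff x d)"
proof (rule dmodI)
  note D = dmodD[OF E] and ED = submoduleD[OF dmodD(1)[OF E]]
  show "submodule (koszul E) R M" by (rule submodule_koszul[OF D(1)])
  show "koszul_diff x d v \<in> koszul E" if "v \<in> koszul E" for v
    using that D(4) ED(4,5,6) x unfolding koszul_diff_def
    by (intro join_in_koszul[OF E]) (auto simp: koszul_def)
  show "koszul_diff x d (koszul_diff x d v) = \<zero>\<^bsub>M\<^esub>" if "v \<in> koszul E" for v
  proof (rule pair_eqI)
    have v: "lo v \<in> E" "hi v \<in> E" using that by (auto simp: koszul_def)
    have c: "d (hi v) \<in> carrier M" using D(6) v by blast
    have "d (d (lo v) \<oplus>\<^bsub>M\<^esub> x \<odot>\<^bsub>M\<^esub> hi v) = x \<odot>\<^bsub>M\<^esub> d (hi v)"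
      using v x D(4,5,7,10) ED(5) c by simp
    then show "lo (koszul_diff x d (koszul_diff x d v)) = lo \<zero>\<^bsub>M\<^esub>"
      using c x by simp algebra
    show "hi (koszul_diff x d (koszul_diff x d v)) = hi \<zero>\<^bsub>M\<^esub>"
      using D(4,5,9) v by (simp add: minus_zero_module)
  qed
  show "linear_on R M (koszul E) M (koszul_diff x d)"
  proof (rule linear_onI)
    fix v assume "v \<in> koszul E"
    then show "koszul_diff x d v \<in> carrier M"
      unfolding koszul_diff_def using D(3,6) x by (intro join_closed) (auto simp: koszul_def)
  next
    fix v w assume vw: "v \<in> koszul E" "w \<in> koszul E"
    then have m: "v \<in> carrier M" "w \<in> carrier M" "lo v \<in> E" "hi v \<in> E" "lo w \<in> E" "hi w \<in> E"
      by (auto simp: koszul_def)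
    have c: "d (lo v) \<in> carrier M" "d (lo w) \<in> carrier M" "d (hi v) \<in> carrier M" "d (hi w) \<in> carrier M"
      "hi v \<in> carrier M" "hi w \<in> carrier M"
      using D(3,6) m by auto
    have k: "koszul_diff x d v \<in> carrier M" "koszul_diff x d w \<in> carrier M"
      unfolding koszul_diff_def using c x by (auto intro!: join_closed)
    show "koszul_diff x d (v \<oplus>\<^bsub>M\<^esub> w) = koszul_diff x d v \<oplus>\<^bsub>M\<^esub> koszul_diff x d w"
      by (rule pair_eqI) (use c x in \<open>(simp add: lo(2) hi(2) m k D(7), algebra)+\<close>)
  next
    fix r v assume r: "r \<in> carrier R" and v: "v \<in> koszul E"
    then have m: "v \<in> carrier M" "lo v \<in> E" "hi v \<in> E"
      by (auto simp: koszul_def)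
    have c: "d (lo v) \<in> carrier M" "d (hi v) \<in> carrier M" "hi v \<in> carrier M"
      using D(3,6) m by auto
    have k: "koszul_diff x d v \<in> carrier M"
      unfolding koszul_diff_def using c x by (auto intro!: join_closed)
    show "koszul_diff x d (r \<odot>\<^bsub>M\<^esub> v) = r \<odot>\<^bsub>M\<^esub> koszul_diff x d v"
      by (rule pair_eqI) (use c x r in \<open>(simp add: lo(3) hi(3) m k D(10), algebra)+\<close>)
  qed
qed

end

text \<open>\<open>E'\<close> consists of pairs \<open>(p, q)\<close> of power series in \<open>u\<close> over \<open>E\<close>, with coefficients \<open>P k\<close> and
  \<open>Q k\<close>, and its differential is \<open>(p, q) \<mapsto> (d p + (x - u) q, - d q)\<close>. This is the derived
  completion of \<open>E\<close> at \<open>x\<close>: the coefficients at \<open>u\<^sup>0\<close> form the Koszul construction on \<open>x\<close>, while \<open>u\<close>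
  and \<open>x\<close> induce the same map on homology. The coefficients are axiomatized, instead of taking
  sequences, so that \<open>E'\<close> lives in the same ambient module as \<open>E\<close> and the construction can be
  repeated.\<close>

locale completion = pairing_module +
  fixes x E d E' d' and P Q :: "nat \<Rightarrow> 'c \<Rightarrow> 'c"
  assumes x: "x \<in> carrier R" and E: "dmod E d" and E': "dmod E' d'"
    and P_linear: "\<And>k. linear_on R M E' M (P k)" and Q_linear: "\<And>k. linear_on R M E' M (Q k)"
    and P_closed: "\<And>k w. w \<in> E' \<Longrightarrow> P k w \<in> E" and Q_closed: "\<And>k w. w \<in> E' \<Longrightarrow> Q k w \<in> E"
    and coeff_inj: "\<And>v w. v \<in> E' \<Longrightarrow> w \<in> E' \<Longrightarrow> (\<And>k. P k v = P k w) \<Longrightarrow> (\<And>k. Q k v = Q k w) \<Longrightarrow> v = w"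
    and coeff_surj: "\<And>p q. (\<And>k. p k \<in> E) \<Longrightarrow> (\<And>k. q k \<in> E) \<Longrightarrow>
        \<exists>w\<in>E'. (\<forall>k. P k w = p k) \<and> (\<forall>k. Q k w = q k)"
    and P_diff_0: "\<And>w. w \<in> E' \<Longrightarrow> P 0 (d' w) = d (P 0 w) \<oplus>\<^bsub>M\<^esub> x \<odot>\<^bsub>M\<^esub> Q 0 w"
    and P_diff_Suc: "\<And>k w. w \<in> E' \<Longrightarrow>
        P (Suc k) (d' w) = d (P (Suc k) w) \<oplus>\<^bsub>M\<^esub> x \<odot>\<^bsub>M\<^esub> Q (Suc k) w \<ominus>\<^bsub>M\<^esub> Q k w"
    and Q_diff: "\<And>k w. w \<in> E' \<Longrightarrow> Q k (d' w) = \<ominus>\<^bsub>M\<^esub> d (Q k w)"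
begin

lemmas DE = dmodD[OF E] and DE' = dmodD[OF E']
lemmas SE = submoduleD[OF DE(1)] and SE' = submoduleD[OF DE'(1)]

lemma coeff_simps:
  "\<And>v w. v \<in> E' \<Longrightarrow> w \<in> E' \<Longrightarrow> P k (v \<oplus>\<^bsub>M\<^esub> w) = P k v \<oplus>\<^bsub>M\<^esub> P k w"
  "\<And>v w. v \<in> E' \<Longrightarrow> w \<in> E' \<Longrightarrow> Q k (v \<oplus>\<^bsub>M\<^esub> w) = Q k v \<oplus>\<^bsub>M\<^esub> Q k w"
  "\<And>v w. v \<in> E' \<Longrightarrow> w \<in> E' \<Longrightarrow> P k (v \<ominus>\<^bsub>M\<^esub> w) = P k v \<ominus>\<^bsub>M\<^esub> P k w"
  "\<And>v w. v \<in> E' \<Longrightarrow> w \<in> E' \<Longrightarrow> Q k (v \<ominus>\<^bsub>M\<^esub> w) = Q k v \<ominus>\<^bsub>M\<^esub> Q k w"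
  "\<And>r v. r \<in> carrier R \<Longrightarrow> v \<in> E' \<Longrightarrow> P k (r \<odot>\<^bsub>M\<^esub> v) = r \<odot>\<^bsub>M\<^esub> P k v"
  "\<And>r v. r \<in> carrier R \<Longrightarrow> v \<in> E' \<Longrightarrow> Q k (r \<odot>\<^bsub>M\<^esub> v) = r \<odot>\<^bsub>M\<^esub> Q k v"
  "P k \<zero>\<^bsub>M\<^esub> = \<zero>\<^bsub>M\<^esub>" "Q k \<zero>\<^bsub>M\<^esub> = \<zero>\<^bsub>M\<^esub>"
  using linear_onD(2,3)[OF P_linear[of k]] linear_onD(2,3)[OF Q_linear[of k]]
    linear_on_basics(1,3)[OF module_axioms module_axioms DE'(1) P_linear[of k]]
    linear_on_basics(1,3)[OF module_axioms module_axioms DE'(1) Q_linear[of k]]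
  by auto

definition mk :: "(nat \<Rightarrow> 'c) \<Rightarrow> (nat \<Rightarrow> 'c) \<Rightarrow> 'c"
  where "mk p q = (SOME w. w \<in> E' \<and> (\<forall>k. P k w = p k) \<and> (\<forall>k. Q k w = q k))"

lemma mk:
  assumes "\<And>k. p k \<in> E" "\<And>k. q k \<in> E"
  shows "mk p q \<in> E'" "P k (mk p q) = p k" "Q k (mk p q) = q k"
proof -
  have "\<exists>w. w \<in> E' \<and> (\<forall>k. P k w = p k) \<and> (\<forall>k. Q k w = q k)"
    using coeff_surj[of p q] assms by blast
  from someI_ex[OF this, folded mk_def]
  show "mk p q \<in> E'" "P k (mk p q) = p k" "Q k (mk p q) = q k" by blast+
qed

definition shift :: "'c \<Rightarrow> 'c"
  where "shift w = mk (case_nat \<zero>\<^bsub>M\<^esub> (\<lambda>k. P k w)) (case_nat \<zero>\<^bsub>M\<^esub> (\<lambda>k. Q k w))"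

lemma shift:
  assumes "w \<in> E'"
  shows "shift w \<in> E'" "P 0 (shift w) = \<zero>\<^bsub>M\<^esub>" "Q 0 (shift w) = \<zero>\<^bsub>M\<^esub>"
    "P (Suc k) (shift w) = P k w" "Q (Suc k) (shift w) = Q k w"
proof -
  have "case_nat \<zero>\<^bsub>M\<^esub> (\<lambda>k. P k w) k \<in> E" "case_nat \<zero>\<^bsub>M\<^esub> (\<lambda>k. Q k w) k \<in> E" for k
    using assms P_closed Q_closed SE(3) by (auto split: nat.split)
  note m = mk[of "case_nat \<zero>\<^bsub>M\<^esub> (\<lambda>k. P k w)" "case_nat \<zero>\<^bsub>M\<^esub> (\<lambda>k. Q k w)", OF this, folded shift_def]
  show "shift w \<in> E'" "P 0 (shift w) = \<zero>\<^bsub>M\<^esub>" "Q 0 (shift w) = \<zero>\<^bsub>M\<^esub>"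
    "P (Suc k) (shift w) = P k w" "Q (Suc k) (shift w) = Q k w"
    using m(1) m(2)[of 0] m(3)[of 0] m(2)[of "Suc k"] m(3)[of "Suc k"] by simp_all
qed

lemma coeff_eqI:
  assumes "v \<in> E'" "w \<in> E'" "P 0 v = P 0 w" "Q 0 v = Q 0 w"
    "\<And>k. P (Suc k) v = P (Suc k) w" "\<And>k. Q (Suc k) v = Q (Suc k) w"
  shows "v = w"
  by (rule coeff_inj[OF assms(1,2)]) (metis assms(3-6) not0_implies_Suc)+

lemma shift_linear: "linear_on R M E' M shift"
  by (rule linear_onI; (rule coeff_eqI)?) (auto simp: coeff_simps shift SE' DE'(3))

lemma shift_diff: "w \<in> E' \<Longrightarrow> d' (shift w) = shift (d' w)"
proof (rule coeff_eqI)
  fix k assume w: "w \<in> E'"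
  then have c: "d (P 0 w) \<in> carrier M" "Q 0 w \<in> carrier M"
    using P_closed Q_closed DE(3,6) by blast+
  show "P (Suc k) (d' (shift w)) = P (Suc k) (shift (d' w))"
  proof (cases k)
    case 0
    have "d (P 0 w) \<oplus>\<^bsub>M\<^esub> x \<odot>\<^bsub>M\<^esub> Q 0 w \<ominus>\<^bsub>M\<^esub> \<zero>\<^bsub>M\<^esub> = d (P 0 w) \<oplus>\<^bsub>M\<^esub> x \<odot>\<^bsub>M\<^esub> Q 0 w"
      using c x by algebra
    then show ?thesis using 0 w DE'(4) by (simp add: P_diff_0 P_diff_Suc shift)
  qed (use w DE'(4) in \<open>simp add: P_diff_Suc shift\<close>)
qed (use x in \<open>auto simp: shift DE' DE P_diff_0 Q_diff minus_zero_module\<close>)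

lemma shift_inj:
  assumes "w \<in> E'" "shift w = \<zero>\<^bsub>M\<^esub>" shows "w = \<zero>\<^bsub>M\<^esub>"
proof (rule coeff_inj[OF assms(1) SE'(3)])
  show "P k w = P k \<zero>\<^bsub>M\<^esub>" "Q k w = Q k \<zero>\<^bsub>M\<^esub>" for k
    using shift(4,5)[OF assms(1), of k] unfolding assms(2) coeff_simps by simp_all
qed

lemma shift_surj:
  assumes w: "w \<in> E'" and "P 0 w = \<zero>\<^bsub>M\<^esub>" "Q 0 w = \<zero>\<^bsub>M\<^esub>"
  obtains v where "v \<in> E'" "w = shift v"
proof -
  define v where "v = mk (\<lambda>k. P (Suc k) w) (\<lambda>k. Q (Suc k) w)"
  have v: "v \<in> E'" "\<And>k. P k v = P (Suc k) w" "\<And>k. Q k v = Q (Suc k) w"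
    using mk[of "\<lambda>k. P (Suc k) w" "\<lambda>k. Q (Suc k) w", folded v_def] w P_closed Q_closed by auto
  have "w = shift v"
    by (rule coeff_eqI) (use assms v in \<open>simp_all add: shift\<close>)
  with v show ?thesis using that by blast
qed

text \<open>Multiplication by \<open>x - u\<close> is null-homotopic: the homotopy is \<open>(p, q) \<mapsto> (0, p)\<close>.\<close>

lemma shift_homotopic:
  assumes v: "v \<in> cycles E' d'"
  shows "x \<odot>\<^bsub>M\<^esub> v \<ominus>\<^bsub>M\<^esub> shift v \<in> d' ` E'"
proof -
  have vE: "v \<in> E'" and dv: "d' v = \<zero>\<^bsub>M\<^esub>" using v by (auto simp: cycles_def)
  define h where "h = mk (\<lambda>_. \<zero>\<^bsub>M\<^esub>) (\<lambda>k. P k v)"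
  have h: "h \<in> E'" "\<And>k. P k h = \<zero>\<^bsub>M\<^esub>" "\<And>k. Q k h = P k v"
    using mk[of "\<lambda>_. \<zero>\<^bsub>M\<^esub>" "\<lambda>k. P k v", folded h_def] vE P_closed SE(3) by auto
  have c: "P k v \<in> carrier M" "Q k v \<in> carrier M" "d (P k v) \<in> carrier M" for k
    using vE P_closed Q_closed DE(3,6) by blast+
  have d0: "\<ominus>\<^bsub>M\<^esub> d (P 0 v) = x \<odot>\<^bsub>M\<^esub> Q 0 v"
    using P_diff_0[OF vE] c[of 0] x unfolding dv coeff_simps by (metis M.minus_equality M.a_comm M.minus_minus smult_closed)
  have dS: "\<ominus>\<^bsub>M\<^esub> d (P (Suc k) v) = x \<odot>\<^bsub>M\<^esub> Q (Suc k) v \<ominus>\<^bsub>M\<^esub> Q k v" for k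
  proof -
    have "\<ominus>\<^bsub>M\<^esub> d (P (Suc k) v) = \<ominus>\<^bsub>M\<^esub> d (P (Suc k) v) \<oplus>\<^bsub>M\<^esub> P (Suc k) (d' v)"
      unfolding dv coeff_simps using c by simp
    also have "\<dots> = x \<odot>\<^bsub>M\<^esub> Q (Suc k) v \<ominus>\<^bsub>M\<^esub> Q k v"
      unfolding P_diff_Suc[OF vE] using c[of k] c[of "Suc k"] x by algebra
    finally show ?thesis .
  qed
  have "x \<odot>\<^bsub>M\<^esub> v \<ominus>\<^bsub>M\<^esub> shift v = d' h"
  proof (rule coeff_eqI)
    show "x \<odot>\<^bsub>M\<^esub> v \<ominus>\<^bsub>M\<^esub> shift v \<in> E'" "d' h \<in> E'"
      using SE'(5,7) x vE shift(1) h DE'(4) by auto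
    show "P 0 (x \<odot>\<^bsub>M\<^esub> v \<ominus>\<^bsub>M\<^esub> shift v) = P 0 (d' h)"
      using SE'(5) x vE shift h c[of 0] DE(11)
      by (simp add: coeff_simps P_diff_0) algebra
    show "Q 0 (x \<odot>\<^bsub>M\<^esub> v \<ominus>\<^bsub>M\<^esub> shift v) = Q 0 (d' h)"
      using SE'(5) x vE shift h c[of 0] by (simp add: coeff_simps Q_diff d0) algebra
    fix k
    show "P (Suc k) (x \<odot>\<^bsub>M\<^esub> v \<ominus>\<^bsub>M\<^esub> shift v) = P (Suc k) (d' h)"
      using SE'(5) x vE shift h c[of k] c[of "Suc k"] DE(11)
      by (simp add: coeff_simps P_diff_Suc)
    show "Q (Suc k) (x \<odot>\<^bsub>M\<^esub> v \<ominus>\<^bsub>M\<^esub> shift v) = Q (Suc k) (d' h)"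
      using SE'(5) x vE shift h by (simp add: coeff_simps Q_diff dS)
  qed
  then show ?thesis using h by blast
qed

text \<open>Reduction modulo \<open>u\<close>, with kernel \<open>u E'\<close> and values in the Koszul construction.\<close>

definition ev0 :: "'c \<Rightarrow> 'c" where "ev0 w = join (P 0 w) (Q 0 w)"

lemma ev0_linear: "linear_on R M E' M ev0"
proof (rule linear_onI)
  have c: "w \<in> E' \<Longrightarrow> P 0 w \<in> carrier M" "w \<in> E' \<Longrightarrow> Q 0 w \<in> carrier M" for w
    using P_closed Q_closed DE(3) by blast+
  show ev: "ev0 w \<in> carrier M" if "w \<in> E'" for w
    unfolding ev0_def using c[OF that] by (rule join_closed)
  show "ev0 (v \<oplus>\<^bsub>M\<^esub> w) = ev0 v \<oplus>\<^bsub>M\<^esub> ev0 w" if "v \<in> E'" "w \<in> E'" for v w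
    using ev[OF that(1)] ev[OF that(2)] that
    by - (rule pair_eqI, simp_all add: lo(2) hi(2), simp_all add: ev0_def coeff_simps)
  show "ev0 (r \<odot>\<^bsub>M\<^esub> v) = r \<odot>\<^bsub>M\<^esub> ev0 v" if "r \<in> carrier R" "v \<in> E'" for r v
    using ev[OF that(2)] that
    by - (rule pair_eqI, simp_all add: lo(3) hi(3), simp_all add: ev0_def coeff_simps)
qed

lemma ev0_closed: "w \<in> E' \<Longrightarrow> ev0 w \<in> koszul E"
  unfolding ev0_def using P_closed Q_closed by (intro join_in_koszul[OF E]) auto

lemma ev0_diff: "w \<in> E' \<Longrightarrow> ev0 (d' w) = koszul_diff x d (ev0 w)"
  by (rule pair_eqI) (simp_all add: ev0_def P_diff_0 Q_diff)

lemma ev0_zero [simp]: "ev0 \<zero>\<^bsub>M\<^esub> = \<zero>\<^bsub>M\<^esub>"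
  by (simp add: ev0_def coeff_simps)

lemma ev0_surj:
  assumes "b \<in> koszul E" obtains w where "w \<in> E'" "ev0 w = b"
proof -
  have b: "lo b \<in> E" "hi b \<in> E" using assms by (auto simp: koszul_def)
  note m = mk[of "\<lambda>_. lo b" "\<lambda>_. hi b", OF b]
  show ?thesis
    by (rule that[OF m(1)]) (simp add: ev0_def m)
qed

lemma ev0_cycle: "z \<in> cycles E' d' \<Longrightarrow> ev0 z \<in> cycles (koszul E) (koszul_diff x d)"
  by (auto simp: cycles_def ev0_closed simp flip: ev0_diff)

lemma shift_cycle: "z \<in> cycles E' d' \<Longrightarrow> shift z \<in> cycles E' d'"
  using linear_on_basics(1)[OF module_axioms module_axioms DE'(1) shift_linear]
  by (auto simp: cycles_def shift shift_diff)

text \<open>Exactness at the middle of \<open>H(E') \<rightarrow> H(E') \<rightarrow> H(koszul E)\<close>, where the first map is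
  multiplication by \<open>u\<close>: a boundary lifts, and a cycle in \<open>u E'\<close> is \<open>u\<close> times a cycle.\<close>

lemma cycle_with_boundary_constant_term:
  assumes z: "z \<in> cycles E' d'" and ev: "ev0 z \<in> koszul_diff x d ` koszul E"
  obtains b y where "b \<in> E'" "y \<in> cycles E' d'" "z = d' b \<oplus>\<^bsub>M\<^esub> shift y"
proof -
  have zE: "z \<in> E'" "d' z = \<zero>\<^bsub>M\<^esub>" using z by (auto simp: cycles_def)
  obtain k where k: "k \<in> koszul E" "ev0 z = koszul_diff x d k" using ev by blast
  obtain b where b: "b \<in> E'" "ev0 b = k" using ev0_surj[OF k(1)] .
  define w where "w = z \<ominus>\<^bsub>M\<^esub> d' b"
  have w: "w \<in> E'" using SE'(7) zE b DE'(4) by (auto simp: w_def)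
  have "ev0 z \<in> carrier M" using linear_onD(1)[OF ev0_linear zE(1)] .
  then have "ev0 w = \<zero>\<^bsub>M\<^esub>"
    using linear_on_basics(3)[OF module_axioms module_axioms DE'(1) ev0_linear zE(1) DE'(4)[OF b(1)]]
      ev0_diff[OF b(1)] b(2) k(2) by (simp add: w_def M.r_neg M.minus_eq)
  then have "P 0 w = \<zero>\<^bsub>M\<^esub>" "Q 0 w = \<zero>\<^bsub>M\<^esub>" unfolding ev0_def using lo_join hi_join lo_hi_zero by metis+
  then obtain y where y: "y \<in> E'" "w = shift y" using shift_surj[OF w] by blast
  have "shift (d' y) = d' w" using y shift_diff by simp
  also have "\<dots> = \<zero>\<^bsub>M\<^esub>"
    unfolding w_def using DE'(8)[OF zE(1) DE'(4)[OF b(1)]] DE'(5)[OF b(1)] zE by (simp add: M.minus_eq minus_zero_module)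
  finally have "d' y = \<zero>\<^bsub>M\<^esub>" using shift_inj DE'(4) y by blast
  moreover have "z = d' b \<oplus>\<^bsub>M\<^esub> w"
    unfolding w_def using DE'(3)[OF zE(1)] DE'(6)[OF b(1)] by algebra
  ultimately show ?thesis using that b y by (auto simp: cycles_def)
qed

end

text \<open>What completeness of \<open>R\<close> is used for: \<open>t 0\<close> is the sum of the series \<open>\<Sum>k. r k x\<^sup>k\<close>, and
  \<open>t (k + 1)\<close> are the coefficients of the quotient of \<open>\<Sum>k. r k u\<^sup>k - t 0\<close> by \<open>u - x\<close>.\<close>

definition power_series_summable :: "('a, 'r) ring_scheme \<Rightarrow> 'a \<Rightarrow> bool"
  where "power_series_summable R x \<longleftrightarrow> (\<forall>r. range r \<subseteq> carrier R \<longrightarrow>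
    (\<exists>t. range t \<subseteq> carrier R \<and> (\<forall>k::nat. t k = r k \<oplus>\<^bsub>R\<^esub> x \<otimes>\<^bsub>R\<^esub> t (Suc k))))"

context completion
begin

text \<open>The homology of \<open>E'\<close> modulo \<open>u\<close> embeds into that of the Koszul construction.\<close>

lemma cycles_fg_over_boundaries_plus_shift:
  assumes noeth: "noetherian_ring R" and fg: "fg_homology (koszul E) (koszul_diff x d)"
  shows "fg_over R M {z \<in> cycles E' d'. ev0 z \<in> koszul_diff x d ` koszul E} (cycles E' d')"
proof (rule fg_over_extension[OF noeth module_axioms module_axioms])
  have K: "dmod (koszul E) (koszul_diff x d)" by (rule dmod_koszul[OF E x])
  show "submodule (cycles E' d') R M" by (rule submodule_cycles[OF E'])
  show "linear_on R M (cycles E' d') M ev0"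
    by (rule linear_on_subset[OF ev0_linear]) (auto simp: cycles_def)
  show "submodule (cycles (koszul E) (koszul_diff x d)) R M" by (rule submodule_cycles[OF K])
  show "submodule (koszul_diff x d ` koszul E) R M" by (rule submodule_boundaries[OF K])
  show "koszul_diff x d ` koszul E \<subseteq> cycles (koszul E) (koszul_diff x d)"
    by (rule boundaries_sub_cycles[OF K])
  show "fg_over R M (koszul_diff x d ` koszul E) (cycles (koszul E) (koszul_diff x d))"
    using fg by (simp add: fg_homology_def)
qed (auto intro: ev0_cycle fg_over_self)

text \<open>\<open>C\<close> contains every sum of a series \<open>\<Sum>j. u\<^sup>j (c j)\<close> with terms from \<open>C\<close>. Such a sum is expressed
  through the tails \<open>y j\<close> of the series.\<close>

definition series_closed :: "'c set \<Rightarrow> bool"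
  where "series_closed C \<longleftrightarrow> (\<forall>c y. (\<forall>j. c j \<in> C) \<and> (\<forall>j. y j \<in> E') \<and>
    (\<forall>j::nat. y j = c j \<oplus>\<^bsub>M\<^esub> shift (y (Suc j))) \<longrightarrow> y 0 \<in> C)"

lemma series_closedD:
  assumes "series_closed C" "\<And>j. c j \<in> C" "\<And>j. y j \<in> E'"
    "\<And>j::nat. y j = c j \<oplus>\<^bsub>M\<^esub> shift (y (Suc j))"
  shows "y 0 \<in> C"
  using assms unfolding series_closed_def by blast

lemma zero_if_infinitely_shifted:
  assumes w: "\<And>j. w j \<in> E'" and eq: "\<And>j::nat. w j = shift (w (Suc j))"
  shows "w j = \<zero>\<^bsub>M\<^esub>"
proof (rule coeff_inj[OF w SE'(3)])
  show "P k (w j) = P k \<zero>\<^bsub>M\<^esub>" "Q k (w j) = Q k \<zero>\<^bsub>M\<^esub>" for k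
  proof (induction k arbitrary: j)
    case 0
    { case 1 show ?case using shift(2)[OF w[of "Suc j"]] eq[of j] by (simp add: coeff_simps) }
    { case 2 show ?case using shift(3)[OF w[of "Suc j"]] eq[of j] by (simp add: coeff_simps) }
  next
    case (Suc k)
    { case 1 show ?case
        using shift(4)[OF w[of "Suc j"], of k] eq[of j] Suc(1)[of "Suc j"] by (simp add: coeff_simps) }
    { case 2 show ?case
        using shift(5)[OF w[of "Suc j"], of k] eq[of j] Suc(2)[of "Suc j"] by (simp add: coeff_simps) }
  qed
qed

text \<open>The tails of a series are computed coefficient by coefficient: the \<open>(n + 1)\<close>-st coefficient
  of one tail needs the \<open>n\<close>-th coefficient of the next.\<close>

lemma series_sum_exists:
  assumes b: "\<And>j. b j \<in> E'"
  obtains \<beta> where "\<And>j. \<beta> j \<in> E'" "\<And>j::nat. \<beta> j = b j \<oplus>\<^bsub>M\<^esub> shift (\<beta> (Suc j))"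
proof -
  define p where "p = rec_nat (\<lambda>j. P 0 (b j)) (\<lambda>n f j. P (Suc n) (b j) \<oplus>\<^bsub>M\<^esub> f (Suc j))"
  define q where "q = rec_nat (\<lambda>j. Q 0 (b j)) (\<lambda>n f j. Q (Suc n) (b j) \<oplus>\<^bsub>M\<^esub> f (Suc j))"
  have pE: "p n j \<in> E" and qE: "q n j \<in> E" for n j
    by (induction n arbitrary: j)
      (simp_all add: p_def q_def P_closed Q_closed b SE(4))
  define \<beta> where "\<beta> j = mk (\<lambda>n. p n j) (\<lambda>n. q n j)" for j
  have \<beta>: "\<beta> j \<in> E'" "P n (\<beta> j) = p n j" "Q n (\<beta> j) = q n j" for n j
    unfolding \<beta>_def using mk[of "\<lambda>n. p n j" "\<lambda>n. q n j"] pE qE by auto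
  have c: "P n (b j) \<in> carrier M" "Q n (b j) \<in> carrier M" for n j
    using P_closed[OF b] Q_closed[OF b] DE(3) by auto
  have "\<beta> j = b j \<oplus>\<^bsub>M\<^esub> shift (\<beta> (Suc j))" for j
    by (rule coeff_eqI) (use c in \<open>auto simp: coeff_simps \<beta> b shift SE'(4) p_def q_def\<close>)
  with \<beta>(1) that show ?thesis by blast
qed

lemma series_closed_boundaries: "series_closed (d' ` E')"
  unfolding series_closed_def
proof (intro allI impI, elim conjE)
  fix c y assume c: "\<forall>j. c j \<in> d' ` E'" and y: "\<forall>j. y j \<in> E'"
    and eq: "\<forall>j::nat. y j = c j \<oplus>\<^bsub>M\<^esub> shift (y (Suc j))"
  have "\<forall>j. \<exists>b. b \<in> E' \<and> c j = d' b" using c by blast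
  then obtain b where b: "\<And>j. b j \<in> E'" "\<And>j. c j = d' (b j)" by metis
  obtain \<beta> where \<beta>: "\<And>j. \<beta> j \<in> E'" "\<And>j::nat. \<beta> j = b j \<oplus>\<^bsub>M\<^esub> shift (\<beta> (Suc j))"
    using series_sum_exists[of b] b(1) by blast
  define w where "w j = y j \<ominus>\<^bsub>M\<^esub> d' (\<beta> j)" for j
  have w: "w j \<in> E'" for j using y \<beta>(1) DE'(4) SE'(7) by (simp add: w_def)
  have "w j = shift (w (Suc j))" for j
  proof -
    have s: "shift (y (Suc j)) \<in> E'" "shift (\<beta> (Suc j)) \<in> E'" using shift(1) y \<beta>(1) by auto
    have "d' (\<beta> j) = d' (b j) \<oplus>\<^bsub>M\<^esub> shift (d' (\<beta> (Suc j)))"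
      using \<beta>(2)[of j] DE'(7)[OF b(1)[of j] s(2)] shift_diff[OF \<beta>(1)] by simp
    moreover have "shift (w (Suc j)) = shift (y (Suc j)) \<ominus>\<^bsub>M\<^esub> shift (d' (\<beta> (Suc j)))"
      unfolding w_def using y \<beta>(1) DE'(4)
      by (intro linear_on_basics(3)[OF module_axioms module_axioms DE'(1) shift_linear]) auto
    moreover have "y j = d' (b j) \<oplus>\<^bsub>M\<^esub> shift (y (Suc j))" using eq b(2) by metis
    moreover have "d' (b j) \<in> carrier M" "shift (y (Suc j)) \<in> carrier M"
        "shift (d' (\<beta> (Suc j))) \<in> carrier M"
      using b(1) s DE'(3,6) shift(1)[OF DE'(4)[OF \<beta>(1)]] by auto
    ultimately show ?thesis unfolding w_def by simp algebra
  qed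
  then have "w 0 = \<zero>\<^bsub>M\<^esub>" using zero_if_infinitely_shifted w by blast
  then have "y 0 = d' (\<beta> 0)"
    using y \<beta>(1) DE'(3,6) unfolding w_def by (metis M.add.inv_solve_right' M.l_zero M.minus_eq M.zero_closed)
  then show "y 0 \<in> d' ` E'" using \<beta>(1) by blast
qed

text \<open>In a series \<open>\<Sum>j. u\<^sup>j (c j + r j v)\<close> the part \<open>(\<Sum>j. r j u\<^sup>j) v\<close> may be replaced by \<open>t 0 v\<close>, where
  \<open>t 0 = \<Sum>j. r j x\<^sup>j\<close>: the difference is a multiple of \<open>(u - x) v\<close>, a boundary.\<close>

lemma series_closed_insert:
  assumes xs: "power_series_summable R x" and C: "submodule C R M" "series_closed C" "d' ` E' \<subseteq> C"
    and v: "v \<in> cycles E' d'"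
  shows "series_closed (gen_submodule R M (insert v C))"
  unfolding series_closed_def
proof (intro allI impI, elim conjE)
  note CD = submoduleD[OF C(1)]
  let ?C = "gen_submodule R M (insert v C)"
  have vE: "v \<in> E'" "v \<in> carrier M" using v DE'(3) by (auto simp: cycles_def)
  have vC: "insert v C \<subseteq> carrier M" using vE CD by auto
  have G: "submodule ?C R M" "C \<subseteq> ?C" "v \<in> ?C"
    using gen_submodule[OF vC] gen_subset[of "insert v C"] by auto
  fix c y assume c: "\<forall>j. c j \<in> ?C" and y: "\<forall>j. y j \<in> E'"
    and eq: "\<forall>j::nat. y j = c j \<oplus>\<^bsub>M\<^esub> shift (y (Suc j))"
  have "\<forall>j. \<exists>r h. r \<in> carrier R \<and> h \<in> C \<and> c j = r \<odot>\<^bsub>M\<^esub> v \<oplus>\<^bsub>M\<^esub> h"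
    using gen_insertE[OF vE(2) CD(1)] c unfolding gen_eqI[OF C(1)] by metis
  then obtain r h where r: "\<And>j. r j \<in> carrier R" and h: "\<And>j. h j \<in> C"
    and c_eq: "\<And>j. c j = r j \<odot>\<^bsub>M\<^esub> v \<oplus>\<^bsub>M\<^esub> h j" by metis
  have "range r \<subseteq> carrier R" using r by blast
  then obtain t where "range t \<subseteq> carrier R" and t_eq: "\<And>j. t j = r j \<oplus> x \<otimes> t (Suc j)"
    using xs unfolding power_series_summable_def by blast
  then have t: "t j \<in> carrier R" for j by blast
  define k where "k j = h j \<ominus>\<^bsub>M\<^esub> t (Suc j) \<odot>\<^bsub>M\<^esub> (x \<odot>\<^bsub>M\<^esub> v \<ominus>\<^bsub>M\<^esub> shift v)" for j
  define z where "z j = y j \<ominus>\<^bsub>M\<^esub> t j \<odot>\<^bsub>M\<^esub> v" for j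
  have "k j \<in> C" for j
    using h t CD(5,7) shift_homotopic[OF v] C(3) unfolding k_def by blast
  moreover have "z j \<in> E'" for j
    using y t vE SE'(5,7) unfolding z_def by blast
  moreover have "z j = k j \<oplus>\<^bsub>M\<^esub> shift (z (Suc j))" for j
  proof -
    have "shift (z (Suc j)) = shift (y (Suc j)) \<ominus>\<^bsub>M\<^esub> t (Suc j) \<odot>\<^bsub>M\<^esub> shift v"
      unfolding z_def
      using linear_on_basics(3)[OF module_axioms module_axioms DE'(1) shift_linear]
        linear_onD(3)[OF shift_linear] y t vE SE'(5) by simp
    moreover have "y j = (r j \<odot>\<^bsub>M\<^esub> v \<oplus>\<^bsub>M\<^esub> h j) \<oplus>\<^bsub>M\<^esub> shift (y (Suc j))"
      using eq c_eq by metis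
    moreover have "t j \<odot>\<^bsub>M\<^esub> v = r j \<odot>\<^bsub>M\<^esub> v \<oplus>\<^bsub>M\<^esub> x \<odot>\<^bsub>M\<^esub> (t (Suc j) \<odot>\<^bsub>M\<^esub> v)"
      using t_eq[of j] r t x vE by (metis R.m_closed smult_assoc1 smult_l_distr)
    moreover have "shift (y (Suc j)) \<in> carrier M" "shift v \<in> carrier M" "h j \<in> carrier M"
      using shift(1) y vE DE'(3) h CD(2) by auto
    ultimately show ?thesis
      unfolding k_def z_def using r[of j] t[of "Suc j"] x vE(2) by simp algebra
  qed
  ultimately have "z 0 \<in> C" using series_closedD[OF C(2)] by blast
  then have "z 0 \<oplus>\<^bsub>M\<^esub> t 0 \<odot>\<^bsub>M\<^esub> v \<in> ?C" using submoduleD(4,5)[OF G(1)] G(2,3) t by blast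
  moreover have "z 0 \<oplus>\<^bsub>M\<^esub> t 0 \<odot>\<^bsub>M\<^esub> v = y 0"
  proof -
    have "y 0 \<in> carrier M" using y DE'(3) by blast
    then show ?thesis unfolding z_def using t[of 0] vE by algebra
  qed
  ultimately show "y 0 \<in> ?C" by simp
qed

text \<open>Finitely many cycles that generate modulo boundaries and \<open>u\<close> generate modulo boundaries:
  expanding the error terms repeatedly writes every cycle as a series.\<close>

theorem fg_homology_completion:
  assumes noeth: "noetherian_ring R" and xs: "power_series_summable R x"
    and fg: "fg_homology (koszul E) (koszul_diff x d)"
  shows "fg_homology E' d'"
proof -
  define Z where "Z = cycles E' d'"
  define Y where "Y = {z \<in> Z. ev0 z \<in> koszul_diff x d ` koszul E}"
  note Z = submodule_cycles[OF E', folded Z_def] and B = submodule_boundaries[OF E']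
    and BZ = boundaries_sub_cycles[OF E', folded Z_def]
  note ZD = submoduleD[OF Z]
  obtain S where S: "finite S" "S \<subseteq> Z"
    "\<And>H. submodule H R M \<Longrightarrow> S \<subseteq> H \<Longrightarrow> Y \<subseteq> H \<Longrightarrow> Z \<subseteq> H"
    using cycles_fg_over_boundaries_plus_shift[OF noeth fg, folded Z_def, folded Y_def]
    by (rule fg_overE) blast
  have "\<exists>C. submodule C R M \<and> series_closed C \<and> d' ` E' \<subseteq> C \<and> T \<subseteq> C \<and> C \<subseteq> gen_submodule R M (T \<union> d' ` E')"
    if "finite T" "T \<subseteq> Z" for T
    using that
  proof (induction T rule: finite_induct)
    case empty
    show ?case
      using B series_closed_boundaries gen_subset[of "d' ` E'"] by auto
  next
    case (insert v T)
    then obtain C where C: "submodule C R M" "series_closed C" "d' ` E' \<subseteq> C" "T \<subseteq> C"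
      "C \<subseteq> gen_submodule R M (T \<union> d' ` E')" by auto
    have v: "v \<in> Z" using insert.prems by simp
    have vC: "insert v C \<subseteq> carrier M" using ZD(2)[OF v] submoduleD(1)[OF C(1)] by simp
    have TZ: "insert v T \<union> d' ` E' \<subseteq> carrier M"
      using insert.prems BZ ZD(1) by blast
    have "insert v C \<subseteq> gen_submodule R M (insert v T \<union> d' ` E')"
      using C(5) gen_mono[of "T \<union> d' ` E'" "insert v T \<union> d' ` E'"] gen_subset[of "insert v T \<union> d' ` E'"]
      by blast
    then have "gen_submodule R M (insert v C) \<subseteq> gen_submodule R M (insert v T \<union> d' ` E')"
      by (rule gen_least[OF gen_submodule[OF TZ]])
    then show ?case
      using gen_submodule[OF vC] series_closed_insert[OF xs C(1-3) v[unfolded Z_def]]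
        gen_subset[of "insert v C"] C(3,4) by (intro exI[of _ "gen_submodule R M (insert v C)"]) auto
  qed
  from this[OF S(1,2)] obtain C where C: "submodule C R M" "series_closed C" "d' ` E' \<subseteq> C" "S \<subseteq> C"
    "C \<subseteq> gen_submodule R M (S \<union> d' ` E')" by blast
  have shZ: "submodule (shift ` Z) R M"
    by (rule submodule_image[OF module_axioms module_axioms Z linear_on_subset[OF shift_linear]])
      (auto simp: Z_def cycles_def)
  note PL = submodule_plus[OF C(1) shZ]
  have "Y \<subseteq> plus_set C (shift ` Z)"
  proof
    fix z assume "z \<in> Y"
    then obtain b y where "b \<in> E'" "y \<in> Z" "z = d' b \<oplus>\<^bsub>M\<^esub> shift y"
      unfolding Y_def Z_def using cycle_with_boundary_constant_term[of z] by blast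
    then show "z \<in> plus_set C (shift ` Z)" unfolding plus_set_def using C(3) by blast
  qed
  then have "Z \<subseteq> plus_set C (shift ` Z)" using S(3)[OF PL(1)] PL(2) C(4) by blast
  then have step: "\<forall>z\<in>Z. \<exists>y. y \<in> Z \<and> (\<exists>c\<in>C. z = c \<oplus>\<^bsub>M\<^esub> shift y)" unfolding plus_set_def by blast
  have "Z \<subseteq> C"
  proof
    fix z assume z: "z \<in> Z"
    obtain g where g: "\<And>z. z \<in> Z \<Longrightarrow> g z \<in> Z" "\<And>z. z \<in> Z \<Longrightarrow> \<exists>c\<in>C. z = c \<oplus>\<^bsub>M\<^esub> shift (g z)"
      using step by metis
    define y where "y j = (g ^^ j) z" for j
    have y: "y j \<in> Z" for j by (induction j) (use z g(1) in \<open>auto simp: y_def\<close>)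
    have "\<forall>j. \<exists>c. c \<in> C \<and> y j = c \<oplus>\<^bsub>M\<^esub> shift (y (Suc j))"
      using g(2)[OF y] by (auto simp: y_def)
    then obtain c where c: "\<And>j. c j \<in> C" "\<And>j. y j = c j \<oplus>\<^bsub>M\<^esub> shift (y (Suc j))" by metis
    have "y j \<in> E'" for j using y[of j] by (simp add: Z_def cycles_def)
    then have "y 0 \<in> C" using series_closedD[of C c y] C(2) c by blast
    then show "z \<in> C" by (simp add: y_def)
  qed
  then have "Z \<subseteq> gen_submodule R M (S \<union> d' ` E')" using C(5) by blast
  then show ?thesis
    using S(1,2) unfolding fg_homology_def fg_over_def Z_def by blast
qed

text \<open>If \<open>s\<close> kills the Koszul homology, then \<open>s H \<subseteq> u H = x H\<close> for the homology \<open>H\<close> of \<open>E'\<close>,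
  and the Cayley-Hamilton argument applies because \<open>H\<close> is finitely generated.\<close>

theorem kills_homology_completion:
  assumes noeth: "noetherian_ring R" and xs: "power_series_summable R x"
    and fg: "fg_homology (koszul E) (koszul_diff x d)"
    and s: "s \<in> carrier R" "kills_homology s (koszul E) (koszul_diff x d)"
  shows "\<exists>(n::nat). \<exists>b\<in>carrier R. kills_homology (s [^] n \<oplus> b \<otimes> x) E' d'"
  unfolding kills_homology_def
proof (rule power_plus_multiple_annihilates)
  show "fg_over R M (d' ` E') (cycles E' d')"
    using fg_homology_completion[OF noeth xs fg] by (simp add: fg_homology_def)
  show Z: "submodule (cycles E' d') R M" and B: "submodule (d' ` E') R M"
    by (rule submodule_cycles[OF E'] submodule_boundaries[OF E'])+
  show "d' ` E' \<subseteq> cycles E' d'" by (rule boundaries_sub_cycles[OF E'])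
  note ZD = submoduleD[OF Z] and BD = submoduleD[OF B]
  fix z assume z: "z \<in> cycles E' d'"
  then have "z \<in> E'" by (simp add: cycles_def)
  then have "ev0 (s \<odot>\<^bsub>M\<^esub> z) \<in> koszul_diff x d ` koszul E"
    using s ev0_cycle[OF z] linear_onD(3)[OF ev0_linear] by (simp add: kills_homology_def)
  then obtain b y where b: "b \<in> E'" "y \<in> cycles E' d'" "s \<odot>\<^bsub>M\<^esub> z = d' b \<oplus>\<^bsub>M\<^esub> shift y"
    using cycle_with_boundary_constant_term[OF ZD(5)[OF s(1) z]] by blast
  define h where "h = x \<odot>\<^bsub>M\<^esub> y \<ominus>\<^bsub>M\<^esub> shift y"
  have h: "h \<in> d' ` E'" using shift_homotopic[OF b(2)] by (simp add: h_def)
  have "y \<in> carrier M" "shift y \<in> carrier M" "d' b \<in> carrier M"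
    using b ZD(2) shift_cycle[OF b(2)] DE'(6) by auto
  then have "s \<odot>\<^bsub>M\<^esub> z = x \<odot>\<^bsub>M\<^esub> y \<oplus>\<^bsub>M\<^esub> (d' b \<ominus>\<^bsub>M\<^esub> h)"
    unfolding b(3) h_def using x by algebra
  moreover have "d' b \<ominus>\<^bsub>M\<^esub> h \<in> d' ` E'" using b(1) h BD(7) by blast
  ultimately show "\<exists>y\<in>cycles E' d'. \<exists>b\<in>d' ` E'. s \<odot>\<^bsub>M\<^esub> z = x \<odot>\<^bsub>M\<^esub> y \<oplus>\<^bsub>M\<^esub> b"
    using b(2) by blast
qed (use s x in auto)

end

lemma (in module) eq_if_minus_zero:
  assumes "v \<in> carrier M" "w \<in> carrier M" "v \<ominus>\<^bsub>M\<^esub> w = \<zero>\<^bsub>M\<^esub>" shows "v = w"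
proof -
  have "v = (v \<ominus>\<^bsub>M\<^esub> w) \<oplus>\<^bsub>M\<^esub> w" using assms(1,2) by algebra
  then show ?thesis using assms by simp
qed

context completion
begin

lemma shift_power:
  assumes "w \<in> E'"
  shows "(shift ^^ n) w \<in> E'" "P j ((shift ^^ n) w) = (if j < n then \<zero>\<^bsub>M\<^esub> else P (j - n) w)"
    "Q j ((shift ^^ n) w) = (if j < n then \<zero>\<^bsub>M\<^esub> else Q (j - n) w)"
proof (induction n arbitrary: j)
  case 0
  { case 1 show ?case using assms by simp }
  { case 2 show ?case by simp }
  { case 3 show ?case by simp }
next
  case (Suc n)
  { case 1 show ?case using Suc(1) shift(1) by simp }
  { case 2 show ?case using shift(2,4)[OF Suc(1)] Suc(2) by (cases j) simp_all }
  { case 3 show ?case using shift(3,5)[OF Suc(1)] Suc(3) by (cases j) simp_all }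
qed

lemma shift_power_linear: "linear_on R M E' M (shift ^^ n)"
proof (rule linear_onI)
  show "(shift ^^ n) v \<in> carrier M" if "v \<in> E'" for v using shift_power(1)[OF that] DE'(3) by blast
  show "(shift ^^ n) (v \<oplus>\<^bsub>M\<^esub> w) = (shift ^^ n) v \<oplus>\<^bsub>M\<^esub> (shift ^^ n) w" if "v \<in> E'" "w \<in> E'" for v w
    using linear_onD(2)[OF shift_linear] shift_power(1) that by (induction n) auto
  show "(shift ^^ n) (r \<odot>\<^bsub>M\<^esub> v) = r \<odot>\<^bsub>M\<^esub> (shift ^^ n) v" if "r \<in> carrier R" "v \<in> E'" for r v
    using linear_onD(3)[OF shift_linear] shift_power(1) that by (induction n) auto
qed

lemma shift_power_diff: "w \<in> E' \<Longrightarrow> d' ((shift ^^ n) w) = (shift ^^ n) (d' w)"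
  by (induction n) (simp_all add: shift_diff shift_power)

text \<open>A cycle \<open>(a, b)\<close> for \<open>x\<^sup>n\<close> extends to the chain \<open>w = (a, \<Sum>j<n. x\<^bsup>n-1-j\<^esup> u\<^sup>j b)\<close>, whose
  differential is \<open>- u\<^sup>n (b, 0)\<close>. Two applications of \<open>f\<close>, one to the cycle \<open>(b, 0)\<close> and one to the
  cycle made out of \<open>w\<close>, turn \<open>w\<close> into a boundary modulo \<open>u\<^sup>n\<close>.\<close>

theorem kills_koszul_power:
  assumes f: "f \<in> carrier R" and kills: "kills_homology f E' d'"
  shows "kills_homology (f \<otimes> f) (koszul E) (koszul_diff (x [^] Suc k) d)"
  unfolding kills_homology_def
proof
  fix z assume "z \<in> cycles (koszul E) (koszul_diff (x [^] Suc k) d)"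
  then have zK: "z \<in> koszul E" and dz: "koszul_diff (x [^] Suc k) d z = \<zero>\<^bsub>M\<^esub>"
    by (auto simp: cycles_def)
  define a where "a = lo z"
  define b where "b = hi z"
  have ab: "a \<in> E" "b \<in> E" "z \<in> carrier M" using zK by (auto simp: a_def b_def koszul_def)
  then have abc: "a \<in> carrier M" "b \<in> carrier M" "d b \<in> carrier M" using DE(3,6) by auto
  have xp: "x [^] (n::nat) \<in> carrier R" for n using x by simp
  have da: "d a \<oplus>\<^bsub>M\<^esub> x [^] Suc k \<odot>\<^bsub>M\<^esub> b = \<zero>\<^bsub>M\<^esub>"
    using arg_cong[OF dz, of lo] by (simp add: a_def b_def del: R.nat_pow_Suc)
  have "\<ominus>\<^bsub>M\<^esub> d b = \<zero>\<^bsub>M\<^esub>" using arg_cong[OF dz, of hi] by (simp add: b_def)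
  then have db: "d b = \<zero>\<^bsub>M\<^esub>" using abc(3) M.minus_minus minus_zero_module by metis
  define w where "w = mk (\<lambda>j. if j = 0 then a else \<zero>\<^bsub>M\<^esub>) (\<lambda>j. if j \<le> k then x [^] (k - j) \<odot>\<^bsub>M\<^esub> b else \<zero>\<^bsub>M\<^esub>)"
  have "(if j = 0 then a else \<zero>\<^bsub>M\<^esub>) \<in> E" "(if j \<le> k then x [^] (k - j) \<odot>\<^bsub>M\<^esub> b else \<zero>\<^bsub>M\<^esub>) \<in> E" for j :: nat
    using ab SE xp by auto
  from mk[of "\<lambda>j. if j = 0 then a else \<zero>\<^bsub>M\<^esub>" "\<lambda>j. if j \<le> k then x [^] (k - j) \<odot>\<^bsub>M\<^esub> b else \<zero>\<^bsub>M\<^esub>",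
      OF this, folded w_def]
  have w: "w \<in> E'" "\<And>j. P j w = (if j = 0 then a else \<zero>\<^bsub>M\<^esub>)"
    "\<And>j. Q j w = (if j \<le> k then x [^] (k - j) \<odot>\<^bsub>M\<^esub> b else \<zero>\<^bsub>M\<^esub>)" by auto
  define e where "e = mk (\<lambda>j. if j = 0 then b else \<zero>\<^bsub>M\<^esub>) (\<lambda>_. \<zero>\<^bsub>M\<^esub>)"
  have e: "e \<in> E'" "\<And>j. P j e = (if j = 0 then b else \<zero>\<^bsub>M\<^esub>)" "\<And>j. Q j e = \<zero>\<^bsub>M\<^esub>"
    using mk[of "\<lambda>j. if j = 0 then b else \<zero>\<^bsub>M\<^esub>" "\<lambda>_. \<zero>\<^bsub>M\<^esub>", folded e_def] ab SE(3) by auto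
  have "d' e = \<zero>\<^bsub>M\<^esub>"
    by (rule coeff_eqI)
      (use e x db in \<open>auto simp: DE' SE' P_diff_0 P_diff_Suc Q_diff coeff_simps DE(11)
        minus_zero_module M.minus_eq\<close>)
  then have "e \<in> cycles E' d'" using e by (simp add: cycles_def)
  then obtain w1 where w1: "w1 \<in> E'" "f \<odot>\<^bsub>M\<^esub> e = d' w1"
    using kills by (auto simp: kills_homology_def)
  let ?u = "shift ^^ Suc k"
  have u: "?u v \<in> E'" "?u v \<in> carrier M" if "v \<in> E'" for v
    using shift_power(1)[OF that, of "Suc k"] DE'(3) by auto
  have Qw: "d (Q j w) = \<zero>\<^bsub>M\<^esub>" for j
    using ab DE(10,11) xp db by (simp add: w)
  (* All coefficients of d' w cancel in pairs, except the one at k + 1. *)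
  have dw: "d' w = \<ominus>\<^bsub>M\<^esub> ?u e"
  proof -
    have "d' w \<oplus>\<^bsub>M\<^esub> ?u e = \<zero>\<^bsub>M\<^esub>"
    proof (rule coeff_eqI)
      show "d' w \<oplus>\<^bsub>M\<^esub> ?u e \<in> E'" "\<zero>\<^bsub>M\<^esub> \<in> E'" using w e u DE'(4) SE' by auto
      have P0: "P 0 (d' w) = \<zero>\<^bsub>M\<^esub>"
        using da x xp abc unfolding P_diff_0[OF w(1)] w by (simp add: smult_assoc1 smult_lcomm[OF x xp])
      show "P 0 (d' w \<oplus>\<^bsub>M\<^esub> ?u e) = P 0 \<zero>\<^bsub>M\<^esub>"
        using w e u DE'(4) P0 shift_power(2)[OF e(1), of 0 "Suc k"] by (simp add: coeff_simps)
      show "Q 0 (d' w \<oplus>\<^bsub>M\<^esub> ?u e) = Q 0 \<zero>\<^bsub>M\<^esub>"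
        using w(1) e u DE'(4) shift_power(3)[OF e(1), of 0 "Suc k"]
        by (simp add: coeff_simps Q_diff Qw minus_zero_module)
      fix j
      show "Q (Suc j) (d' w \<oplus>\<^bsub>M\<^esub> ?u e) = Q (Suc j) \<zero>\<^bsub>M\<^esub>"
        using w(1) e u DE'(4) shift_power(3)[OF e(1), of "Suc j" "Suc k"]
        by (simp add: coeff_simps Q_diff Qw minus_zero_module)
      have xx: "x \<odot>\<^bsub>M\<^esub> (x [^] (k - Suc j) \<odot>\<^bsub>M\<^esub> b) = x [^] (k - j) \<odot>\<^bsub>M\<^esub> b" if "j < k"
        using that x abc(2) by (metis R.nat_pow_Suc2 Suc_diff_Suc smult_assoc1 xp)
      have "P (Suc j) (d' w) = (if j = k then \<ominus>\<^bsub>M\<^esub> b else \<zero>\<^bsub>M\<^esub>)"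
        unfolding P_diff_Suc[OF w(1)] using w xx x xp abc DE(11)
        by (auto simp: M.minus_eq M.r_neg minus_zero_module not_le)
      then show "P (Suc j) (d' w \<oplus>\<^bsub>M\<^esub> ?u e) = P (Suc j) \<zero>\<^bsub>M\<^esub>"
        using w(1) e u DE'(4) shift_power(2)[OF e(1), of "Suc j" "Suc k"] abc
        by (auto simp: coeff_simps M.l_neg)
    qed
    then show ?thesis using u[OF e(1)] DE'(6)[OF w(1)] by (metis M.minus_equality)
  qed
  define v where "v = f \<odot>\<^bsub>M\<^esub> w \<oplus>\<^bsub>M\<^esub> ?u w1"
  have "?u (d' w1) = f \<odot>\<^bsub>M\<^esub> ?u e"
    using linear_onD(3)[OF shift_power_linear f e(1)] w1(2) by metis
  moreover have "d' v = f \<odot>\<^bsub>M\<^esub> d' w \<oplus>\<^bsub>M\<^esub> ?u (d' w1)"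
    unfolding v_def using f w u[OF w1(1)] SE'(5) DE'(7,10) shift_power_diff[OF w1(1), of "Suc k"] by simp
  ultimately have "d' v = \<zero>\<^bsub>M\<^esub>"
    unfolding dw using u[OF e(1)] f by (simp add: smult_r_minus M.l_neg del: funpow.simps)
  moreover have vE: "v \<in> E'" unfolding v_def using f w u[OF w1(1)] SE'(4,5) by blast
  ultimately obtain g where g: "g \<in> E'" "f \<odot>\<^bsub>M\<^esub> v = d' g"
    using kills by (auto simp: kills_homology_def cycles_def)
  have c: "P j g \<in> carrier M" "Q j g \<in> carrier M" "d (P j g) \<in> carrier M" "P j g \<in> E" "Q j g \<in> E" for j
    using P_closed Q_closed g DE(3,6) by blast+
  have Pg: "P j (d' g) = (f \<otimes> f) \<odot>\<^bsub>M\<^esub> P j w" and Qg: "Q j (d' g) = (f \<otimes> f) \<odot>\<^bsub>M\<^esub> Q j w" if "j \<le> k" for j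
  proof -
    have m: "P j w \<in> carrier M" "Q j w \<in> carrier M" "f \<odot>\<^bsub>M\<^esub> w \<in> E'"
      using DE(3)[OF P_closed[OF w(1)]] DE(3)[OF Q_closed[OF w(1)]] SE'(5)[OF f w(1)] by auto
    have "P j v = f \<odot>\<^bsub>M\<^esub> P j w" "Q j v = f \<odot>\<^bsub>M\<^esub> Q j w"
      using coeff_simps(1,2)[OF m(3) u(1)[OF w1(1)], of j, folded v_def] coeff_simps(5,6)[OF f w(1), of j]
        shift_power(2,3)[OF w1(1), of j "Suc k"] that f m by auto
    then show "P j (d' g) = (f \<otimes> f) \<odot>\<^bsub>M\<^esub> P j w" "Q j (d' g) = (f \<otimes> f) \<odot>\<^bsub>M\<^esub> Q j w"
      using coeff_simps(5,6)[OF f vE, of j] g(2) f m by (simp_all add: smult_assoc1)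
  qed
  have ff: "f \<otimes> f \<in> carrier R" using f by simp
  (* The relations for the coefficients 1, ..., i of d' g eliminate Q 0 g in favour of Q i g. *)
  have "\<exists>\<alpha>\<in>E. (f \<otimes> f) \<odot>\<^bsub>M\<^esub> a = d \<alpha> \<oplus>\<^bsub>M\<^esub> x [^] Suc i \<odot>\<^bsub>M\<^esub> Q i g" if "i \<le> k" for i
    using that
  proof (induction i)
    case 0
    have "(f \<otimes> f) \<odot>\<^bsub>M\<^esub> a = d (P 0 g) \<oplus>\<^bsub>M\<^esub> x \<odot>\<^bsub>M\<^esub> Q 0 g"
      using Pg[of 0] P_diff_0[OF g(1)] w by simp
    then show ?case using c(4)[of 0] x by auto
  next
    case (Suc i)
    then obtain \<alpha> where \<alpha>: "\<alpha> \<in> E" "(f \<otimes> f) \<odot>\<^bsub>M\<^esub> a = d \<alpha> \<oplus>\<^bsub>M\<^esub> x [^] Suc i \<odot>\<^bsub>M\<^esub> Q i g" by auto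
    have "d (P (Suc i) g) \<oplus>\<^bsub>M\<^esub> x \<odot>\<^bsub>M\<^esub> Q (Suc i) g \<ominus>\<^bsub>M\<^esub> Q i g = \<zero>\<^bsub>M\<^esub>"
      using Pg[OF Suc.prems] P_diff_Suc[OF g(1), of i] w ff by simp
    then have Qi: "Q i g = d (P (Suc i) g) \<oplus>\<^bsub>M\<^esub> x \<odot>\<^bsub>M\<^esub> Q (Suc i) g"
      by - (rule eq_if_minus_zero[symmetric], use c x in auto)
    define y where "y = x [^] Suc i"
    have y: "y \<in> carrier R" "x [^] Suc (Suc i) = y \<otimes> x" using x by (auto simp: y_def)
    have "d (\<alpha> \<oplus>\<^bsub>M\<^esub> y \<odot>\<^bsub>M\<^esub> P (Suc i) g) = d \<alpha> \<oplus>\<^bsub>M\<^esub> y \<odot>\<^bsub>M\<^esub> d (P (Suc i) g)"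
      using \<alpha> c(4) y SE(5) DE(7,10) by simp
    then have "(f \<otimes> f) \<odot>\<^bsub>M\<^esub> a = d (\<alpha> \<oplus>\<^bsub>M\<^esub> y \<odot>\<^bsub>M\<^esub> P (Suc i) g) \<oplus>\<^bsub>M\<^esub> (y \<otimes> x) \<odot>\<^bsub>M\<^esub> Q (Suc i) g"
      unfolding \<alpha>(2) Qi y_def[symmetric] using y(1) x c[of "Suc i"] DE(6)[OF \<alpha>(1)] by simp algebra
    then show ?case unfolding y(2) using \<alpha>(1) c(4) y SE(4,5) by blast
  qed
  then obtain \<alpha> where \<alpha>: "\<alpha> \<in> E" "(f \<otimes> f) \<odot>\<^bsub>M\<^esub> a = d \<alpha> \<oplus>\<^bsub>M\<^esub> x [^] Suc k \<odot>\<^bsub>M\<^esub> Q k g" by blast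
  have "(f \<otimes> f) \<odot>\<^bsub>M\<^esub> b = \<ominus>\<^bsub>M\<^esub> d (Q k g)"
    using Qg[of k] Q_diff[OF g(1), of k] w abc by simp
  then have "(f \<otimes> f) \<odot>\<^bsub>M\<^esub> z = koszul_diff (x [^] Suc k) d (join \<alpha> (Q k g))"
    using ab(3) ff \<alpha>(2)
    by - (rule pair_eqI, simp_all add: lo(3) hi(3) a_def b_def del: R.nat_pow_Suc)
  then show "(f \<otimes> f) \<odot>\<^bsub>M\<^esub> z \<in> koszul_diff (x [^] Suc k) d ` koszul E"
    using join_in_koszul[OF E \<alpha>(1) c(5)] by blast
qed

end

section \<open>Iterated Koszul constructions\<close>

text \<open>Completion at \<open>x\<close> commutes with the Koszul construction on \<open>y\<close>, up to a sign.\<close>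

lemma (in completion) completion_koszul:
  assumes y: "y \<in> carrier R"
  shows "completion R M join lo hi x (koszul E) (koszul_diff y d) (koszul E') (koszul_diff y d')
    (\<lambda>k w. join (P k (lo w)) (P k (hi w))) (\<lambda>k w. join (Q k (lo w)) (\<ominus>\<^bsub>M\<^esub> Q k (hi w)))"
proof (unfold_locales)
  have PE: "P k w \<in> E" "P k w \<in> carrier M" "d (P k w) \<in> carrier M" if "w \<in> E'" for k w
    using P_closed[OF that] DE(3,6) by auto
  have QE: "Q k w \<in> E" "Q k w \<in> carrier M" "d (Q k w) \<in> carrier M" if "w \<in> E'" for k w
    using Q_closed[OF that] DE(3,6) by auto
  have KE: "w \<in> carrier M" "lo w \<in> E'" "hi w \<in> E'" if "w \<in> koszul E'" for w
    using that by (auto simp: koszul_def)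
  show "x \<in> carrier R" by (rule x)
  show "dmod (koszul E) (koszul_diff y d)" "dmod (koszul E') (koszul_diff y d')"
    by (intro dmod_koszul E E' y)+
  show closed: "join (P k (lo w)) (P k (hi w)) \<in> koszul E"
    "join (Q k (lo w)) (\<ominus>\<^bsub>M\<^esub> Q k (hi w)) \<in> koszul E" if "w \<in> koszul E'" for k w
    using PE(1) QE(1) SE(6) KE[OF that] by (intro join_in_koszul[OF E]; blast)+
  have closedM: "join (P k (lo w)) (P k (hi w)) \<in> carrier M"
    "join (Q k (lo w)) (\<ominus>\<^bsub>M\<^esub> Q k (hi w)) \<in> carrier M" if "w \<in> koszul E'" for k w
    using closed[OF that] by (auto simp: koszul_def)
  show "linear_on R M (koszul E') M (\<lambda>w. join (P k (lo w)) (P k (hi w)))" for k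
  proof (rule linear_onI, goal_cases)
    case (1 w) then show ?case by (rule closedM)
  next
    case (2 v w)
    then show ?case
      using KE[OF 2(1)] KE[OF 2(2)] closedM(1)[OF 2(1)] closedM(1)[OF 2(2)]
      by - (rule pair_eqI, simp_all add: lo(2) hi(2) coeff_simps)
  next
    case (3 r w)
    then show ?case
      using KE[OF 3(2)] closedM(1)[OF 3(2)]
      by - (rule pair_eqI, simp_all add: lo(3) hi(3) coeff_simps)
  qed
  show "linear_on R M (koszul E') M (\<lambda>w. join (Q k (lo w)) (\<ominus>\<^bsub>M\<^esub> Q k (hi w)))" for k
  proof (rule linear_onI, goal_cases)
    case (1 w) then show ?case by (rule closedM)
  next
    case (2 v w)
    then show ?case
      using KE[OF 2(1)] KE[OF 2(2)] closedM(2)[OF 2(1)] closedM(2)[OF 2(2)] QE(2)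
      by - (rule pair_eqI, simp_all add: lo(2) hi(2) coeff_simps M.minus_add)
  next
    case (3 r w)
    then show ?case
      using KE[OF 3(2)] closedM(2)[OF 3(2)] QE(2)
      by - (rule pair_eqI, simp_all add: lo(3) hi(3) coeff_simps smult_r_minus)
  qed
  show "v = w" if v: "v \<in> koszul E'" and w: "w \<in> koszul E'"
    and eqP: "\<And>k. join (P k (lo v)) (P k (hi v)) = join (P k (lo w)) (P k (hi w))"
    and eqQ: "\<And>k. join (Q k (lo v)) (\<ominus>\<^bsub>M\<^esub> Q k (hi v)) = join (Q k (lo w)) (\<ominus>\<^bsub>M\<^esub> Q k (hi w))" for v w
  proof (rule pair_eqI)
    have P: "P k (lo v) = P k (lo w)" "P k (hi v) = P k (hi w)" for k
      using arg_cong[OF eqP[of k], of lo] arg_cong[OF eqP[of k], of hi] by simp_all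
    have Q: "Q k (lo v) = Q k (lo w)" "\<ominus>\<^bsub>M\<^esub> Q k (hi v) = \<ominus>\<^bsub>M\<^esub> Q k (hi w)" for k
      using arg_cong[OF eqQ[of k], of lo] arg_cong[OF eqQ[of k], of hi] by simp_all
    have "Q k (hi v) = Q k (hi w)" for k
      using Q(2)[of k] QE(2)[OF KE(3)[OF v], of k] QE(2)[OF KE(3)[OF w], of k] by (metis M.minus_minus)
    then show "hi v = hi w" by (rule coeff_inj[OF KE(3)[OF v] KE(3)[OF w] P(2)])
    show "lo v = lo w" by (rule coeff_inj[OF KE(2)[OF v] KE(2)[OF w] P(1) Q(1)])
  qed
  show "\<exists>w\<in>koszul E'. (\<forall>k. join (P k (lo w)) (P k (hi w)) = p k) \<and>
      (\<forall>k. join (Q k (lo w)) (\<ominus>\<^bsub>M\<^esub> Q k (hi w)) = q k)"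
    if p: "\<And>k. p k \<in> koszul E" and q: "\<And>k. q k \<in> koszul E" for p q
  proof -
    have pq: "lo (p k) \<in> E" "hi (p k) \<in> E" "lo (q k) \<in> E" "hi (q k) \<in> E" "\<ominus>\<^bsub>M\<^esub> hi (q k) \<in> E"
      "hi (q k) \<in> carrier M" for k
      using p[of k] q[of k] SE(2,6) by (auto simp: koszul_def)
    define a where "a = mk (\<lambda>k. lo (p k)) (\<lambda>k. lo (q k))"
    define b where "b = mk (\<lambda>k. hi (p k)) (\<lambda>k. \<ominus>\<^bsub>M\<^esub> hi (q k))"
    have a: "a \<in> E'" "P k a = lo (p k)" "Q k a = lo (q k)" for k
      unfolding a_def using mk[of "\<lambda>k. lo (p k)" "\<lambda>k. lo (q k)"] pq by auto
    have b: "b \<in> E'" "P k b = hi (p k)" "Q k b = \<ominus>\<^bsub>M\<^esub> hi (q k)" for k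
      unfolding b_def using mk[of "\<lambda>k. hi (p k)" "\<lambda>k. \<ominus>\<^bsub>M\<^esub> hi (q k)"] pq by auto
    show ?thesis
      by (rule bexI[of _ "join a b"]) (use a b pq join_in_koszul[OF E'] in auto)
  qed
  fix w assume w: "w \<in> koszul E'"
  note k = KE[OF w]
  have dk: "koszul_diff y d' w \<in> koszul E'"
    using dmodD(4)[OF dmod_koszul[OF E' y] w] .
  have t: "y \<odot>\<^bsub>M\<^esub> hi w \<in> E'" "d' (lo w) \<in> E'" "d' (hi w) \<in> E'" using k SE'(5) y DE'(4) by auto
  have m: "P 0 (\<ominus>\<^bsub>M\<^esub> d' (hi w)) = \<ominus>\<^bsub>M\<^esub> P 0 (d' (hi w))"
    "P (Suc j) (\<ominus>\<^bsub>M\<^esub> d' (hi w)) = \<ominus>\<^bsub>M\<^esub> P (Suc j) (d' (hi w))"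
    "Q j (\<ominus>\<^bsub>M\<^esub> d' (hi w)) = \<ominus>\<^bsub>M\<^esub> Q j (d' (hi w))" for j
    using linear_on_basics(2)[OF module_axioms module_axioms DE'(1) P_linear t(3)]
      linear_on_basics(2)[OF module_axioms module_axioms DE'(1) Q_linear t(3)] by auto
  have dQ: "d (\<ominus>\<^bsub>M\<^esub> Q j (hi w)) = \<ominus>\<^bsub>M\<^esub> d (Q j (hi w))" for j
    using DE(9) QE(1) k by blast
  note S = coeff_simps t m P_diff_0 P_diff_Suc Q_diff k y x dQ
  note c = PE[OF k(2)] PE[OF k(3)] QE[OF k(2)] QE[OF k(3)]
  have cl: "koszul_diff y d (join (P j (lo w)) (P j (hi w))) \<in> carrier M"
    "koszul_diff y d (join (Q j (lo w)) (\<ominus>\<^bsub>M\<^esub> Q j (hi w))) \<in> carrier M"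
    "x \<odot>\<^bsub>M\<^esub> join (Q j (lo w)) (\<ominus>\<^bsub>M\<^esub> Q j (hi w)) \<in> carrier M"
    "join (Q j (lo w)) (\<ominus>\<^bsub>M\<^esub> Q j (hi w)) \<in> carrier M" for j
    using dmodD(6)[OF dmod_koszul[OF E y]] closed[OF w] closedM[OF w] x by auto
  note L = lo(2,3) hi(2,3) lo_hi_minus M.minus_eq M.a_closed M.a_inv_closed
  show "join (P 0 (lo (koszul_diff y d' w))) (P 0 (hi (koszul_diff y d' w))) =
      koszul_diff y d (join (P 0 (lo w)) (P 0 (hi w))) \<oplus>\<^bsub>M\<^esub> x \<odot>\<^bsub>M\<^esub> join (Q 0 (lo w)) (\<ominus>\<^bsub>M\<^esub> Q 0 (hi w))"
    by (rule pair_eqI; simp add: S L cl closedM[OF w]; use c[of 0] x y in algebra)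
  show "join (P (Suc j) (lo (koszul_diff y d' w))) (P (Suc j) (hi (koszul_diff y d' w))) =
      koszul_diff y d (join (P (Suc j) (lo w)) (P (Suc j) (hi w))) \<oplus>\<^bsub>M\<^esub>
        x \<odot>\<^bsub>M\<^esub> join (Q (Suc j) (lo w)) (\<ominus>\<^bsub>M\<^esub> Q (Suc j) (hi w)) \<ominus>\<^bsub>M\<^esub> join (Q j (lo w)) (\<ominus>\<^bsub>M\<^esub> Q j (hi w))" for j
    by (rule pair_eqI; simp add: S L cl closedM[OF w]; use c[of j] c[of "Suc j"] x y in algebra)
  show "join (Q j (lo (koszul_diff y d' w))) (\<ominus>\<^bsub>M\<^esub> Q j (hi (koszul_diff y d' w))) =
      \<ominus>\<^bsub>M\<^esub> koszul_diff y d (join (Q j (lo w)) (\<ominus>\<^bsub>M\<^esub> Q j (hi w)))" for j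
    by (rule pair_eqI; simp add: S L cl closedM[OF w]; use c[of j] x y in algebra)
qed

text \<open>Besides pairs, sequences of elements are encoded as elements; this provides the modules of
  pairs of power series.\<close>

locale sequence_module = pairing_module +
  fixes seq :: "(nat \<Rightarrow> 'c) \<Rightarrow> 'c" and coeff :: "nat \<Rightarrow> 'c \<Rightarrow> 'c"
  assumes seq_closed: "\<And>p. (\<And>k. p k \<in> carrier M) \<Longrightarrow> seq p \<in> carrier M"
    and coeff_linear: "\<And>k. linear_on R M (carrier M) M (coeff k)"
    and coeff_seq [simp]: "\<And>k p. coeff k (seq p) = p k"
    and seq_coeff: "\<And>v w. (\<And>k. coeff k v = coeff k w) \<Longrightarrow> v = w"
begin

lemma completion_exists:
  assumes E: "dmod E d" and x: "x \<in> carrier R"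
  shows "\<exists>E' d' P Q. completion R M join lo hi x E d E' d' P Q"
proof -
  note DE = dmodD[OF E] and SE = submoduleD[OF dmodD(1)[OF E]]
  define P where "P k w = coeff k (lo w)" for k w
  define Q where "Q k w = coeff k (hi w)" for k w
  define E' where "E' = {w \<in> carrier M. \<forall>k. P k w \<in> E \<and> Q k w \<in> E}"
  define d' where "d' w = join (seq (\<lambda>k. d (P k w) \<oplus>\<^bsub>M\<^esub> x \<odot>\<^bsub>M\<^esub> Q k w \<ominus>\<^bsub>M\<^esub> (case k of 0 \<Rightarrow> \<zero>\<^bsub>M\<^esub> | Suc j \<Rightarrow> Q j w)))
    (seq (\<lambda>k. \<ominus>\<^bsub>M\<^esub> d (Q k w)))" for w
  have Pd: "P k (d' w) = d (P k w) \<oplus>\<^bsub>M\<^esub> x \<odot>\<^bsub>M\<^esub> Q k w \<ominus>\<^bsub>M\<^esub> (case k of 0 \<Rightarrow> \<zero>\<^bsub>M\<^esub> | Suc j \<Rightarrow> Q j w)"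
    and Qd: "Q k (d' w) = \<ominus>\<^bsub>M\<^esub> d (Q k w)" for k w
    by (simp_all add: P_def Q_def d'_def)
  note co = linear_onD[OF coeff_linear]
  have lin: "P k (v \<oplus>\<^bsub>M\<^esub> w) = P k v \<oplus>\<^bsub>M\<^esub> P k w" "Q k (v \<oplus>\<^bsub>M\<^esub> w) = Q k v \<oplus>\<^bsub>M\<^esub> Q k w"
    if "v \<in> carrier M" "w \<in> carrier M" for k v w
    using that co lo hi by (simp_all add: P_def Q_def)
  have lins: "P k (r \<odot>\<^bsub>M\<^esub> w) = r \<odot>\<^bsub>M\<^esub> P k w" "Q k (r \<odot>\<^bsub>M\<^esub> w) = r \<odot>\<^bsub>M\<^esub> Q k w"
    if "r \<in> carrier R" "w \<in> carrier M" for k r w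
    using that co lo hi by (simp_all add: P_def Q_def)
  have lin0: "P k \<zero>\<^bsub>M\<^esub> = \<zero>\<^bsub>M\<^esub>" "Q k \<zero>\<^bsub>M\<^esub> = \<zero>\<^bsub>M\<^esub>" for k
    using linear_on_basics(1)[OF module_axioms module_axioms carrier_is_submodule coeff_linear]
    by (simp_all add: P_def Q_def)
  have eqI: "v = w" if "\<And>k. P k v = P k w" "\<And>k. Q k v = Q k w" for v w
    using that unfolding P_def Q_def by (metis seq_coeff pair_eqI)
  have m0: "w \<in> carrier M" if "w \<in> E'" for w using that by (auto simp: E'_def)
  have m: "P k w \<in> E" "Q k w \<in> E" "P k w \<in> carrier M" "Q k w \<in> carrier M"
    "d (P k w) \<in> carrier M" "d (Q k w) \<in> carrier M" "d (P k w) \<in> E" "d (Q k w) \<in> E" if "w \<in> E'" for k w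
    using that DE(3,4,6) by (auto simp: E'_def)
  have Pd0: "P 0 (d' w) = d (P 0 w) \<oplus>\<^bsub>M\<^esub> x \<odot>\<^bsub>M\<^esub> Q 0 w" if "w \<in> E'" for w
    using m[OF that, of 0] x by (simp add: Pd M.minus_eq minus_zero_module)
  have S: "submodule E' R M"
    by (rule submodule_intro) (use SE in \<open>auto simp: E'_def lin lins lin0\<close>)
  note SE' = submoduleD[OF S]
  have d'E: "d' w \<in> E'" if "w \<in> E'" for w
  proof -
    have "P k (d' w) \<in> E" for k
    proof -
      have "(case k of 0 \<Rightarrow> \<zero>\<^bsub>M\<^esub> | Suc j \<Rightarrow> Q j w) \<in> E" using m[OF that] SE(3) by (cases k) auto
      then show ?thesis
        unfolding Pd by (intro SE(4,5,7)) (use m[OF that] x in auto)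
    qed
    moreover have "Q k (d' w) \<in> E" for k unfolding Qd using m[OF that] SE(6) by blast
    moreover have "d' w \<in> carrier M"
      unfolding d'_def
    proof (intro join_closed seq_closed)
      show "d (P k w) \<oplus>\<^bsub>M\<^esub> x \<odot>\<^bsub>M\<^esub> Q k w \<ominus>\<^bsub>M\<^esub> (case k of 0 \<Rightarrow> \<zero>\<^bsub>M\<^esub> | Suc j \<Rightarrow> Q j w) \<in> carrier M" for k
        using m[OF that] x by (cases k) auto
    qed (use m[OF that] in auto)
    ultimately show ?thesis by (simp add: E'_def)
  qed
  have dm: "dmod E' d'"
  proof (rule dmodI[OF S])
    show "d' w \<in> E'" if "w \<in> E'" for w by (rule d'E[OF that])
    show "d' (d' w) = \<zero>\<^bsub>M\<^esub>" if w: "w \<in> E'" for w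
    proof (rule eqI)
      fix k
      have dPd: "d (P k (d' w)) = x \<odot>\<^bsub>M\<^esub> d (Q k w) \<ominus>\<^bsub>M\<^esub> (case k of 0 \<Rightarrow> \<zero>\<^bsub>M\<^esub> | Suc j \<Rightarrow> d (Q j w))" for k
        using m[OF w] SE(3,4,5) x DE(5,7,8,10,11)
        by (cases k) (auto simp: Pd minus_zero_module)
      have dQ: "d (\<ominus>\<^bsub>M\<^esub> d (Q k w)) = \<ominus>\<^bsub>M\<^esub> \<zero>\<^bsub>M\<^esub>" for k using DE(5,9) m[OF w] by simp
      show "P k (d' (d' w)) = P k \<zero>\<^bsub>M\<^esub>"
      proof (cases k)
        case 0
        show ?thesis
          unfolding 0 Pd0[OF d'E[OF w]] dPd Qd lin0 using m[OF w, of 0] x by simp algebra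
      next
        case (Suc j)
        then show ?thesis
          using m[OF w, of k] m[OF w, of j] x unfolding Pd[of k "d' w"] dPd Qd lin0 by simp algebra
      qed
      show "Q k (d' (d' w)) = Q k \<zero>\<^bsub>M\<^esub>"
        unfolding Qd lin0 dQ by (simp add: minus_zero_module)
    qed
    show "linear_on R M E' M d'"
    proof (rule linear_onI)
      show "d' w \<in> carrier M" if "w \<in> E'" for w using d'E[OF that] by (simp add: E'_def)
      show "d' (v \<oplus>\<^bsub>M\<^esub> w) = d' v \<oplus>\<^bsub>M\<^esub> d' w" if v: "v \<in> E'" and w: "w \<in> E'" for v w
      proof (rule eqI)
        fix k
        have dd: "d' v \<in> carrier M" "d' w \<in> carrier M" using d'E v w by (auto simp: E'_def)
        have ad: "d (P k v \<oplus>\<^bsub>M\<^esub> P k w) = d (P k v) \<oplus>\<^bsub>M\<^esub> d (P k w)"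
          "d (Q k v \<oplus>\<^bsub>M\<^esub> Q k w) = d (Q k v) \<oplus>\<^bsub>M\<^esub> d (Q k w)"
          using DE(7) m[OF v] m[OF w] by auto
        note l = lin[OF m0[OF v] m0[OF w]] lin[OF dd]
        show "P k (d' (v \<oplus>\<^bsub>M\<^esub> w)) = P k (d' v \<oplus>\<^bsub>M\<^esub> d' w)"
        proof (cases k)
          case 0
          then show ?thesis using m[OF v, of k] m[OF w, of k] x unfolding l Pd ad by simp algebra
        next
          case (Suc j)
          then show ?thesis
            using m[OF v, of k] m[OF w, of k] m[OF v, of j] m[OF w, of j] x
            unfolding l Pd ad by (simp add: l) algebra
        qed
        show "Q k (d' (v \<oplus>\<^bsub>M\<^esub> w)) = Q k (d' v \<oplus>\<^bsub>M\<^esub> d' w)"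
          using m[OF v, of k] m[OF w, of k] unfolding l Qd ad by algebra
      qed
      show "d' (r \<odot>\<^bsub>M\<^esub> w) = r \<odot>\<^bsub>M\<^esub> d' w" if r: "r \<in> carrier R" and w: "w \<in> E'" for r w
      proof (rule eqI)
        fix k
        have dd: "d' w \<in> carrier M" using d'E w by (auto simp: E'_def)
        have ad: "d (r \<odot>\<^bsub>M\<^esub> P k w) = r \<odot>\<^bsub>M\<^esub> d (P k w)" "d (r \<odot>\<^bsub>M\<^esub> Q k w) = r \<odot>\<^bsub>M\<^esub> d (Q k w)"
          using DE(10) r m[OF w] by auto
        note l = lins[OF r m0[OF w]] lins[OF r dd]
        show "P k (d' (r \<odot>\<^bsub>M\<^esub> w)) = P k (r \<odot>\<^bsub>M\<^esub> d' w)"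
        proof (cases k)
          case 0
          then show ?thesis using m[OF w, of k] x r unfolding l Pd ad by simp algebra
        next
          case (Suc j)
          then show ?thesis
            using m[OF w, of k] m[OF w, of j] x r unfolding l Pd ad by (simp add: l) algebra
        qed
        show "Q k (d' (r \<odot>\<^bsub>M\<^esub> w)) = Q k (r \<odot>\<^bsub>M\<^esub> d' w)"
          using m[OF w, of k] r unfolding l Qd ad by algebra
      qed
    qed
  qed
  have "completion R M join lo hi x E d E' d' P Q"
  proof (unfold_locales)
    show "linear_on R M E' M (P k)" "linear_on R M E' M (Q k)" for k
      by (rule linear_onI; use m m0 lin lins in auto)+
    show "\<exists>w\<in>E'. (\<forall>k. P k w = p k) \<and> (\<forall>k. Q k w = q k)"
      if "\<And>k. p k \<in> E" "\<And>k. q k \<in> E" for p q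
    proof (rule bexI[of _ "join (seq p) (seq q)"])
      show "join (seq p) (seq q) \<in> E'"
        using that DE(3) by (auto simp: E'_def P_def Q_def intro!: join_closed seq_closed)
    qed (simp add: P_def Q_def)
    show "P (Suc k) (d' w) = d (P (Suc k) w) \<oplus>\<^bsub>M\<^esub> x \<odot>\<^bsub>M\<^esub> Q (Suc k) w \<ominus>\<^bsub>M\<^esub> Q k w" if "w \<in> E'" for k w
      by (simp add: Pd)
  qed (use x E dm m m0 Pd0 Qd in \<open>auto intro: eqI\<close>)
  then show ?thesis by blast
qed

end

lemma (in cring) power_plus_ideal_closed:
  assumes I: "ideal I R" and s: "s \<in> carrier R"
  defines "C \<equiv> {f. \<exists>(n::nat). \<exists>a\<in>I. f = s [^] n \<oplus> a}"
  shows "f \<in> C \<Longrightarrow> g \<in> C \<Longrightarrow> f \<otimes> g \<in> C" "f \<in> C \<Longrightarrow> f [^] (n::nat) \<in> C" "f \<in> C \<Longrightarrow> a \<in> I \<Longrightarrow> f \<oplus> a \<in> C"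
proof -
  interpret ideal I R by fact
  show mult: "f \<otimes> g \<in> C" if "f \<in> C" "g \<in> C" for f g
  proof -
    obtain n m :: nat and a b where f: "a \<in> I" "f = s [^] n \<oplus> a" and g: "b \<in> I" "g = s [^] m \<oplus> b"
      using \<open>f \<in> C\<close> \<open>g \<in> C\<close> unfolding C_def by blast
    define p where "p = s [^] n"
    define q where "q = s [^] m"
    have c: "p \<in> carrier R" "q \<in> carrier R" "a \<in> carrier R" "b \<in> carrier R"
      using s f g a_subset by (auto simp: p_def q_def)
    have "f \<otimes> g = p \<otimes> q \<oplus> (p \<otimes> b \<oplus> a \<otimes> (q \<oplus> b))"
      unfolding f(2) g(2) p_def[symmetric] q_def[symmetric] using c by algebra
    then have "f \<otimes> g = s [^] (n + m) \<oplus> (p \<otimes> b \<oplus> a \<otimes> (q \<oplus> b))"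
      using s by (simp add: p_def q_def nat_pow_mult)
    moreover have "p \<otimes> b \<oplus> a \<otimes> (q \<oplus> b) \<in> I" 
      by (intro additive_subgroup.a_closed[OF ideal.axioms(1)[OF I]] I_l_closed I_r_closed f g)
        (use c in auto)
    ultimately show ?thesis unfolding C_def by blast
  qed
  show "f [^] (n::nat) \<in> C" if "f \<in> C"
  proof (induction n)
    case 0
    have "f [^] (0::nat) = s [^] (0::nat) \<oplus> \<zero>" by simp
    then show ?case unfolding C_def using zero_closed by blast
  next
    case (Suc n)
    then show ?case using mult that by simp
  qed
  show "f \<oplus> a \<in> C" if "f \<in> C" "a \<in> I"
  proof -
    obtain n :: nat and b where f: "b \<in> I" "f = s [^] n \<oplus> b" using \<open>f \<in> C\<close> unfolding C_def by blast
    then have "f \<oplus> a = s [^] n \<oplus> (b \<oplus> a)" "b \<oplus> a \<in> I"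
      using s that a_subset additive_subgroup.a_closed[OF ideal.axioms(1)[OF I]]
      by (auto simp: a_assoc subset_iff)
    then show ?thesis unfolding C_def by blast
  qed
qed

context pairing_module
begin

definition koszul_diffs :: "'a list \<Rightarrow> ('c \<Rightarrow> 'c) \<Rightarrow> ('c \<Rightarrow> 'c)"
  where "koszul_diffs xs d = foldr koszul_diff xs d"

lemma koszul_diffs_simps [simp]:
  "koszul_diffs [] d = d" "koszul_diffs (x # xs) d = koszul_diff x (koszul_diffs xs d)"
  by (simp_all add: koszul_diffs_def)

lemma dmod_koszul_diffs:
  "dmod E d \<Longrightarrow> set xs \<subseteq> carrier R \<Longrightarrow> dmod ((koszul ^^ length xs) E) (koszul_diffs xs d)"
  by (induction xs) (auto intro: dmod_koszul)

lemma completion_koszul_diffs: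
  assumes "completion R M join lo hi x E d E' d' P Q" "set xs \<subseteq> carrier R"
  shows "\<exists>P Q. completion R M join lo hi x ((koszul ^^ length xs) E) (koszul_diffs xs d)
    ((koszul ^^ length xs) E') (koszul_diffs xs d') P Q"
  using assms(2)
proof (induction xs)
  case Nil
  then show ?case using assms(1) by auto
next
  case (Cons y ys)
  then obtain P Q where "completion R M join lo hi x ((koszul ^^ length ys) E) (koszul_diffs ys d)
      ((koszul ^^ length ys) E') (koszul_diffs ys d') P Q" by auto
  from completion.completion_koszul[OF this, of y] show ?case using Cons.prems by auto
qed

end

text \<open>One variable at a time, the Koszul construction on \<open>x\<close> is replaced by the completion at \<open>x\<close>,
  which keeps homology finitely generated and turns the annihilator \<open>s\<close> into some \<open>s\<^sup>n + b x\<close>; on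
  the way back the completion is replaced by the Koszul construction on \<open>x\<^bsup>k+1\<^esup>\<close>. The point is that
  the exponent and the element of \<open>I\<close> do not depend on \<open>k\<close>. Each variable costs a squaring of the
  annihilator, which is harmless since the elements \<open>s\<^sup>n + a\<close> are closed under products.\<close>

theorem (in sequence_module) kills_koszul_powers:
  assumes noeth: "noetherian_ring R" and I: "ideal I R"
    and xs: "set xs \<subseteq> I" "\<And>x. x \<in> set xs \<Longrightarrow> power_series_summable R x"
    and E: "dmod E d" and fg: "fg_homology ((koszul ^^ length xs) E) (koszul_diffs xs d)"
    and s: "s \<in> carrier R" "kills_homology s ((koszul ^^ length xs) E) (koszul_diffs xs d)"
  shows "\<exists>(n::nat). \<exists>a\<in>I. \<forall>k. kills_homology (s [^] n \<oplus> a) ((koszul ^^ length xs) E)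
    (koszul_diffs (map (\<lambda>x. x [^] Suc k) xs) d)"
  using xs E fg s
proof (induction xs arbitrary: E d s)
  interpret ideal I R by fact
  case Nil
  have "s [^] (1::nat) \<oplus> \<zero> = s" using Nil by simp
  then have "\<forall>k. kills_homology (s [^] (1::nat) \<oplus> \<zero>) ((koszul ^^ length []) E)
      (koszul_diffs (map (\<lambda>x. x [^] Suc k) []) d)"
    using Nil by simp
  then show ?case using zero_closed by blast
next
  interpret ideal I R by fact
  case (Cons x xs)
  have x: "x \<in> I" "x \<in> carrier R" "power_series_summable R x" and xsR: "set xs \<subseteq> carrier R"
    using Cons.prems a_subset by auto
  have powR: "set (map (\<lambda>x. x [^] Suc k) xs) \<subseteq> carrier R" for k using xsR by auto
  let ?D = "(koszul ^^ length xs) E"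
  obtain E' d' P Q where C: "completion R M join lo hi x E d E' d' P Q"
    using completion_exists[OF Cons.prems(3) x(2)] by blast
  then have E': "dmod E' d'" by (rule completion.E')
  let ?D' = "(koszul ^^ length xs) E'"
  obtain P1 Q1 where C1: "completion R M join lo hi x ?D (koszul_diffs xs d) ?D' (koszul_diffs xs d') P1 Q1"
    using completion_koszul_diffs[OF C xsR] by blast
  have fg1: "fg_homology (koszul ?D) (koszul_diff x (koszul_diffs xs d))"
    and kills1: "kills_homology s (koszul ?D) (koszul_diff x (koszul_diffs xs d))"
    using Cons.prems by simp_all
  have fg': "fg_homology ?D' (koszul_diffs xs d')"
    by (rule completion.fg_homology_completion[OF C1 noeth x(3) fg1])
  obtain n :: nat and b where b: "b \<in> carrier R"
    and kills': "kills_homology (s [^] n \<oplus> b \<otimes> x) ?D' (koszul_diffs xs d')"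
    using completion.kills_homology_completion[OF C1 noeth x(3) fg1 Cons.prems(5) kills1] by blast
  define s1 where "s1 = s [^] n \<oplus> b \<otimes> x"
  have s1: "s1 \<in> carrier R" using b x Cons.prems(5) by (simp add: s1_def)
  obtain m :: nat and a where a: "a \<in> I"
    and killsk: "\<And>k. kills_homology (s1 [^] m \<oplus> a) ?D' (koszul_diffs (map (\<lambda>x. x [^] Suc k) xs) d')"
    using Cons.IH[OF _ _ E' fg' s1 kills'[folded s1_def]] Cons.prems(1,2) by auto
  define f where "f = s1 [^] m \<oplus> a"
  have f: "f \<in> carrier R" using s1 a by (simp add: f_def)
  note cl = power_plus_ideal_closed[OF I Cons.prems(5)]
  have "s1 \<in> {f. \<exists>(n::nat). \<exists>a\<in>I. f = s [^] n \<oplus> a}"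
    unfolding s1_def using I_l_closed[OF x(1) b] by blast
  then have "f \<otimes> f \<in> {f. \<exists>(n::nat). \<exists>a\<in>I. f = s [^] n \<oplus> a}"
    unfolding f_def by (intro cl) (use a in auto)
  then obtain N :: nat and c where c: "c \<in> I" "f \<otimes> f = s [^] N \<oplus> c" by blast
  have "kills_homology (f \<otimes> f) (koszul ?D)
      (koszul_diff (x [^] Suc k) (koszul_diffs (map (\<lambda>x. x [^] Suc k) xs) d))" for k
  proof -
    obtain P2 Q2 where C2: "completion R M join lo hi x ?D (koszul_diffs (map (\<lambda>x. x [^] Suc k) xs) d)
        ?D' (koszul_diffs (map (\<lambda>x. x [^] Suc k) xs) d') P2 Q2"
      using completion_koszul_diffs[OF C powR[of k]] by auto
    show ?thesis by (rule completion.kills_koszul_power[OF C2 f]) (use killsk in \<open>simp add: f_def\<close>)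
  qed
  then have "\<forall>k. kills_homology (s [^] N \<oplus> c) ((koszul ^^ length (x # xs)) E)
      (koszul_diffs (map (\<lambda>x. x [^] Suc k) (x # xs)) d)"
    unfolding c(2) by simp
  with c(1) show ?case by blast
qed

section \<open>Modules of functions\<close>

definition fun_module :: "('a, 'b, 'm) module_scheme \<Rightarrow> ('a, 'i \<Rightarrow> 'b) module"
  where "fun_module M =
    \<lparr>carrier = {f. \<forall>i. f i \<in> carrier M}, monoid.mult = undefined, one = undefined,
     ring.zero = (\<lambda>_. \<zero>\<^bsub>M\<^esub>),
     add = (\<lambda>f g i. f i \<oplus>\<^bsub>M\<^esub> g i),
     smult = (\<lambda>r f i. r \<odot>\<^bsub>M\<^esub> f i)\<rparr>"

lemma fun_module_simps:
  "f \<in> carrier (fun_module M) \<longleftrightarrow> (\<forall>i. f i \<in> carrier M)"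
  "\<zero>\<^bsub>fun_module M\<^esub> = (\<lambda>_. \<zero>\<^bsub>M\<^esub>)"
  "f \<oplus>\<^bsub>fun_module M\<^esub> g = (\<lambda>i. f i \<oplus>\<^bsub>M\<^esub> g i)"
  "r \<odot>\<^bsub>fun_module M\<^esub> f = (\<lambda>i. r \<odot>\<^bsub>M\<^esub> f i)"
  by (simp_all add: fun_module_def)

lemma module_fun_module:
  assumes "module R M" shows "module R (fun_module M :: ('a, 'i \<Rightarrow> 'b) module)"
proof -
  interpret module R M by fact
  show ?thesis
  proof (rule moduleI[OF R.is_cring])
    show "abelian_group (fun_module M)"
    proof (rule abelian_groupI)
      fix f assume "f \<in> carrier (fun_module M)"
      then show "\<exists>g\<in>carrier (fun_module M). g \<oplus>\<^bsub>fun_module M\<^esub> f = \<zero>\<^bsub>fun_module M\<^esub>"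
        by (intro bexI[of _ "\<lambda>i. \<ominus>\<^bsub>M\<^esub> f i"]) (auto simp: fun_module_simps M.l_neg)
    qed (auto simp: fun_module_simps M.a_ac)
  qed (auto simp: fun_module_simps smult_l_distr smult_r_distr smult_assoc1)
qed

text \<open>Functions on the natural numbers contain pairs and sequences of such functions, by splitting
  the arguments into even and odd ones, or by a pairing function.\<close>

definition even_part :: "(nat \<Rightarrow> 'b) \<Rightarrow> nat \<Rightarrow> 'b" where "even_part w i = w (2 * i)"
definition odd_part :: "(nat \<Rightarrow> 'b) \<Rightarrow> nat \<Rightarrow> 'b" where "odd_part w i = w (Suc (2 * i))"
definition interleave :: "(nat \<Rightarrow> 'b) \<Rightarrow> (nat \<Rightarrow> 'b) \<Rightarrow> nat \<Rightarrow> 'b"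
  where "interleave v w i = (if even i then v (i div 2) else w (i div 2))"
definition uncurry_seq :: "(nat \<Rightarrow> nat \<Rightarrow> 'b) \<Rightarrow> nat \<Rightarrow> 'b"
  where "uncurry_seq p i = (case prod_decode i of (k, j) \<Rightarrow> p k j)"
definition curry_seq :: "nat \<Rightarrow> (nat \<Rightarrow> 'b) \<Rightarrow> nat \<Rightarrow> 'b"
  where "curry_seq k w j = w (prod_encode (k, j))"

lemma sequence_module_fun_module:
  assumes "module R M"
  shows "sequence_module R (fun_module M :: ('a, nat \<Rightarrow> 'b) module) interleave even_part odd_part uncurry_seq curry_seq"
proof -
  interpret F: module R "fun_module M :: ('a, nat \<Rightarrow> 'b) module" by (rule module_fun_module[OF assms])
  show ?thesis
  proof (unfold_locales)
    show "interleave (even_part w) (odd_part w) = w" for w :: "nat \<Rightarrow> 'b"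
      by (rule ext) (auto simp: interleave_def even_part_def odd_part_def)
    show "v = w" if "\<And>k. curry_seq k v = curry_seq k w" for v w :: "nat \<Rightarrow> 'b"
    proof
      fix i
      obtain k j where "prod_decode i = (k, j)" by fastforce
      then have "i = prod_encode (k, j)" by (metis prod_decode_inverse)
      then show "v i = w i" using fun_cong[OF that[of k], of j] by (simp add: curry_seq_def)
    qed
  qed (auto simp: fun_module_simps interleave_def even_part_def odd_part_def linear_on_def
      uncurry_seq_def curry_seq_def fun_eq_iff split: prod.split)
qed

section \<open>Cohomology with respect to a complex of finite free modules\<close>

lemma (in module) submodule_finsum:
  assumes "submodule H R M" "finite A" "\<And>i. i \<in> A \<Longrightarrow> f i \<in> H"
  shows "finsum M f A \<in> H"
proof -
  note HD = submoduleD[OF assms(1)]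
  show ?thesis
    using assms(2,3) HD by (induction A rule: finite_induct) (auto simp: Pi_iff)
qed

lemma linear_on_finsum:
  assumes M: "module R M" and N: "module R N" and E: "submodule E R M" and \<phi>: "linear_on R M E N \<phi>"
    and A: "finite A" "\<And>i. i \<in> A \<Longrightarrow> f i \<in> E"
  shows "\<phi> (finsum M f A) = finsum N (\<lambda>i. \<phi> (f i)) A"
proof -
  interpret M: module R M by fact
  interpret N: module R N by fact
  note ED = M.submoduleD[OF E] and L = linear_onD[OF \<phi>]
  show ?thesis
    using A
  proof (induction A rule: finite_induct)
    case empty
    show ?case using linear_on_basics(1)[OF M N E \<phi>] by simp
  next
    case (insert a A)
    have "finsum M f A \<in> E" using M.submodule_finsum[OF E] insert by auto
    then show ?case
      using insert ED L by (simp add: Pi_iff)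
  qed
qed

lemma lin_ext_linear_map:
  assumes M: "module R M" and N: "module R N" and E: "submodule E R M" and \<phi>: "linear_on R M E N \<phi>"
    and f: "f \<in> carrier (free_module R X)" and v: "\<And>s. s \<in> X \<Longrightarrow> v s \<in> E"
  shows "\<phi> (lin_ext R M v f) = lin_ext R N (\<lambda>s. \<phi> (v s)) f"
proof -
  interpret M: module R M by fact
  interpret N: module R N by fact
  note ED = M.submoduleD[OF E] and L = linear_onD[OF \<phi>]
  let ?A = "{s. f s \<noteq> \<zero>\<^bsub>R\<^esub>}"
  have A: "finite ?A" "?A \<subseteq> X" "\<And>s. f s \<in> carrier R" using f by (auto simp: free_module_simps)
  have "\<phi> (lin_ext R M v f) = (\<Oplus>\<^bsub>N\<^esub>s\<in>?A. \<phi> (f s \<odot>\<^bsub>M\<^esub> v s))"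
    unfolding lin_ext_def
    by (rule linear_on_finsum[OF M N E \<phi> A(1)]) (use A v ED(5) in blast)
  also have "\<dots> = lin_ext R N (\<lambda>s. \<phi> (v s)) f"
    unfolding lin_ext_def
    by (rule N.M.finsum_cong') (use A v L in \<open>auto simp: subset_iff\<close>)
  finally show ?thesis .
qed

lemma (in module) lin_ext_in_submodule:
  assumes "submodule H R M" "f \<in> carrier (free_module R X)" "\<And>s. s \<in> X \<Longrightarrow> v s \<in> H"
  shows "lin_ext R M v f \<in> H"
  unfolding lin_ext_def using assms submoduleD(5)[OF assms(1)]
  by (intro submodule_finsum) (auto simp: free_module_simps subset_iff)

lemma (in module) lin_ext_cong:
  assumes "f \<in> carrier (free_module R X)" "\<And>s. s \<in> X \<Longrightarrow> v s = w s" "\<And>s. s \<in> X \<Longrightarrow> w s \<in> carrier M"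
  shows "lin_ext R M v f = lin_ext R M w f"
  unfolding lin_ext_def
  by (rule M.finsum_cong') (use assms in \<open>auto simp: free_module_simps subset_iff\<close>)

lemma (in module) lin_ext_linear_in_values:
  fixes f :: "'i \<Rightarrow> 'a"
  assumes f: "f \<in> carrier (free_module R X)"
  shows "linear_on R (fun_module M) {g. \<forall>s. g s \<in> carrier M} M (\<lambda>g. lin_ext R M g f)"
proof (rule linear_onI)
  let ?A = "{s. f s \<noteq> \<zero>}"
  have A: "finite ?A" "\<And>s. f s \<in> carrier R" using f by (auto simp: free_module_simps)
  fix g :: "'i \<Rightarrow> 'c" assume g: "g \<in> {g. \<forall>s. g s \<in> carrier M}"
  then show "lin_ext R M g f \<in> carrier M"
    using lin_ext_in_submodule[OF carrier_is_submodule f] by auto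
  {
    fix h :: "'i \<Rightarrow> 'c" assume "h \<in> {g. \<forall>s. g s \<in> carrier M}"
    then show "lin_ext R M (g \<oplus>\<^bsub>fun_module M\<^esub> h) f = lin_ext R M g f \<oplus>\<^bsub>M\<^esub> lin_ext R M h f"
      using A g unfolding lin_ext_def
      by (subst M.finsum_addf[symmetric]) (auto simp: fun_module_simps smult_r_distr intro!: M.finsum_cong')
  next
    fix r assume r: "r \<in> carrier R"
    then show "lin_ext R M (r \<odot>\<^bsub>fun_module M\<^esub> g) f = r \<odot>\<^bsub>M\<^esub> lin_ext R M g f"
      using A g unfolding lin_ext_def
      by (subst finsum_smult_ldistr) (auto simp: fun_module_simps smult_lcomm intro!: M.finsum_cong')
  }
qed

text \<open>A complex of free modules on finite sets \<open>S j\<close>, given by the boundaries of the basis elements.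
  A cochain with values in \<open>N\<close> is given by its values on the basis.\<close>

locale free_complex = cring R for R (structure) +
  fixes S :: "nat \<Rightarrow> 'i set" and bnd :: "'i \<Rightarrow> 'i \<Rightarrow> 'a"
  assumes finite_basis: "\<And>j. finite (S j)"
    and bnd_closed: "\<And>j t. t \<in> S (Suc j) \<Longrightarrow> bnd t \<in> carrier (free_module R (S j))"
    and bnd_bnd: "\<And>j t. t \<in> S (Suc (Suc j)) \<Longrightarrow> lin_ext R (free_module R UNIV) bnd (bnd t) = (\<lambda>_. \<zero>)"
begin

definition cochains :: "('a, 'c, 'm) module_scheme \<Rightarrow> nat \<Rightarrow> 'c set \<Rightarrow> ('i \<Rightarrow> 'c) set"
  where "cochains M j N = {g. (\<forall>t\<in>S j. g t \<in> N) \<and> (\<forall>t. t \<notin> S j \<longrightarrow> g t = \<zero>\<^bsub>M\<^esub>)}"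

definition coboundary :: "('a, 'c, 'm) module_scheme \<Rightarrow> nat \<Rightarrow> ('i \<Rightarrow> 'c) \<Rightarrow> 'i \<Rightarrow> 'c"
  where "coboundary M j g t = (if t \<in> S (Suc j) then lin_ext R M g (bnd t) else \<zero>\<^bsub>M\<^esub>)"

definition cocycles :: "('a, 'c, 'm) module_scheme \<Rightarrow> nat \<Rightarrow> 'c set \<Rightarrow> ('i \<Rightarrow> 'c) set"
  where "cocycles M j N = {g \<in> cochains M j N. coboundary M j g = (\<lambda>_. \<zero>\<^bsub>M\<^esub>)}"

primrec coboundaries :: "('a, 'c, 'm) module_scheme \<Rightarrow> nat \<Rightarrow> 'c set \<Rightarrow> ('i \<Rightarrow> 'c) set"
  where
    "coboundaries M 0 N = {\<lambda>_. \<zero>\<^bsub>M\<^esub>}"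
  | "coboundaries M (Suc j) N = coboundary M j ` cochains M j N"

text \<open>For a resolution of \<open>R / I\<close>, this is the finite generation of all \<open>Ext\<^sup>j(R / I, N)\<close>.\<close>

definition fg_cohomology :: "('a, 'c, 'm) module_scheme \<Rightarrow> 'c set \<Rightarrow> bool"
  where "fg_cohomology M N \<longleftrightarrow>
    (\<forall>j. fg_over R (fun_module M) (coboundaries M j N) (cocycles M j N))"

context
  fixes M :: "('a, 'c, 'm) module_scheme"
  assumes M: "module R M"
begin

interpretation M: module R M by (rule M)
interpretation F: module R "fun_module M :: ('a, 'i \<Rightarrow> 'c) module" by (rule module_fun_module[OF M])

lemma cochains_val: "submodule N R M \<Longrightarrow> g \<in> cochains M j N \<Longrightarrow> g t \<in> N"
  by (cases "t \<in> S j") (auto simp: cochains_def M.submoduleD(3))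

lemma submodule_cochains:
  assumes "submodule N R M" shows "submodule (cochains M j N) R (fun_module M)"
  by (rule F.submodule_intro)
    (use M.submoduleD[OF assms] in \<open>auto simp: cochains_def fun_module_simps, metis+\<close>)

lemma cochains_carrier:
  "submodule N R M \<Longrightarrow> cochains M j N \<subseteq> {g. \<forall>s. g s \<in> carrier M}"
  using cochains_val M.submoduleD(1) by blast

lemma coboundary_linear:
  assumes N: "submodule N R M"
  shows "linear_on R (fun_module M) (cochains M j N) (fun_module M) (coboundary M j)"
proof (rule linear_onI)
  have L: "linear_on R (fun_module M) (cochains M j N) M (\<lambda>g. lin_ext R M g (bnd t))"
    if "t \<in> S (Suc j)" for t
    using linear_on_subset[OF M.lin_ext_linear_in_values[OF bnd_closed[OF that]] cochains_carrier[OF N]] .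
  fix g assume g: "g \<in> cochains M j N"
  show "coboundary M j g \<in> carrier (fun_module M)"
    using linear_onD(1)[OF L] g by (auto simp: coboundary_def fun_module_simps)
  show "coboundary M j (g \<oplus>\<^bsub>fun_module M\<^esub> h) = coboundary M j g \<oplus>\<^bsub>fun_module M\<^esub> coboundary M j h"
    if "h \<in> cochains M j N" for h
    using linear_onD(2)[OF L] g that unfolding fun_eq_iff
    by (auto simp: coboundary_def fun_module_simps)
  show "coboundary M j (r \<odot>\<^bsub>fun_module M\<^esub> g) = r \<odot>\<^bsub>fun_module M\<^esub> coboundary M j g"
    if "r \<in> carrier R" for r
    using linear_onD(3)[OF L] g that unfolding fun_eq_iff
    by (auto simp: coboundary_def fun_module_simps)
qed

lemma coboundary_closed:
  assumes N: "submodule N R M" and g: "g \<in> cochains M j N"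
  shows "coboundary M j g \<in> cochains M (Suc j) N"
  using M.lin_ext_in_submodule[OF N bnd_closed] cochains_val[OF N g]
  by (auto simp: cochains_def coboundary_def)

lemma coboundary_coboundary:
  assumes g: "g \<in> cochains M j (carrier M)"
  shows "coboundary M (Suc j) (coboundary M j g) = (\<lambda>_. \<zero>\<^bsub>M\<^esub>)"
proof
  fix t
  have gc: "g s \<in> carrier M" for s using cochains_val[OF M.carrier_is_submodule g] .
  show "coboundary M (Suc j) (coboundary M j g) t = \<zero>\<^bsub>M\<^esub>"
  proof (cases "t \<in> S (Suc (Suc j))")
    case True
    interpret U: module R "free_module R (UNIV :: 'i set)" by (rule module_free_module[OF is_cring])
    have lin: "linear_on R (free_module R UNIV) (carrier (free_module R UNIV)) M (lin_ext R M g)"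
      using lin_ext_closed[OF M, of g UNIV] lin_ext_add[OF M, of g UNIV] lin_ext_smult[OF M, of g UNIV] gc
      by (auto intro!: linear_onI simp: free_module_simps(3,4))
    have bU: "bnd s \<in> carrier (free_module R UNIV)" if "s \<in> S (Suc j)" for s
      using bnd_closed[OF that] by (auto simp: free_module_simps)
    have "lin_ext R M (coboundary M j g) (bnd t) = lin_ext R M (\<lambda>s. lin_ext R M g (bnd s)) (bnd t)"
      by (rule M.lin_ext_cong[OF bnd_closed[OF True]])
        (use bU linear_onD(1)[OF lin] in \<open>auto simp: coboundary_def\<close>)
    also have "\<dots> = lin_ext R M g (lin_ext R (free_module R UNIV) bnd (bnd t))"
      by (rule lin_ext_linear_map[OF U.module_axioms M U.carrier_is_submodule lin bnd_closed[OF True], symmetric])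
        (rule bU)
    also have "\<dots> = \<zero>\<^bsub>M\<^esub>"
      unfolding bnd_bnd[OF True] using lin_ext_zero[OF M, of g UNIV] gc by simp
    finally show ?thesis using True by (simp add: coboundary_def)
  qed (simp add: coboundary_def)
qed

lemma submodule_cocycles:
  assumes "submodule N R M" shows "submodule (cocycles M j N) R (fun_module M)"
proof -
  have "submodule {g \<in> cochains M j N. coboundary M j g \<in> {\<zero>\<^bsub>fun_module M\<^esub>}} R (fun_module M)"
    by (rule submodule_vimage[OF F.module_axioms F.module_axioms submodule_cochains[OF assms]
          coboundary_linear[OF assms] F.submodule_zero])
  then show ?thesis by (simp add: cocycles_def fun_module_simps)
qed

lemma submodule_coboundaries:
  assumes "submodule N R M" shows "submodule (coboundaries M j N) R (fun_module M)"
proof (cases j)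
  case 0
  then show ?thesis using F.submodule_zero by (simp add: fun_module_simps)
next
  case (Suc i)
  then show ?thesis
    using submodule_image[OF F.module_axioms F.module_axioms submodule_cochains[OF assms]
          coboundary_linear[OF assms]] by simp
qed

lemma coboundaries_sub_cocycles:
  assumes N: "submodule N R M" shows "coboundaries M j N \<subseteq> cocycles M j N"
proof (cases j)
  case 0
  then show ?thesis
    using F.submoduleD(3)[OF submodule_cocycles[OF N, of 0]] by (simp add: fun_module_simps)
next
  case (Suc i)
  have "cochains M i N \<subseteq> cochains M i (carrier M)"
    using M.submoduleD(1)[OF N] by (auto simp: cochains_def)
  then show ?thesis
    using Suc coboundary_closed[OF N] coboundary_coboundary by (auto simp: cocycles_def)
qed

lemma cochains_mono: "N \<subseteq> N' \<Longrightarrow> cochains M j N \<subseteq> cochains M j N'"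
  by (auto simp: cochains_def)

lemma coboundaries_mono: "N \<subseteq> N' \<Longrightarrow> coboundaries M j N \<subseteq> coboundaries M j N'"
  by (cases j) (simp_all add: cochains_mono image_mono)

lemma single_cochain:
  fixes t :: 'i
  shows "linear_on R M (carrier M) (fun_module M) (\<lambda>v s. if s = t then v else \<zero>\<^bsub>M\<^esub>)"
  by (rule linear_onI) (auto simp: fun_module_simps fun_eq_iff)

lemma fg_over_cochains:
  assumes B: "submodule B R M" and N: "submodule N R M" and "B \<subseteq> N" and fg: "fg_over R M B N"
  shows "fg_over R (fun_module M) (cochains M j B) (cochains M j N)"
proof -
  note ND = M.submoduleD[OF N] and BD = M.submoduleD[OF B]
  obtain T where T: "finite T" "T \<subseteq> N" "\<And>H. submodule H R M \<Longrightarrow> T \<subseteq> H \<Longrightarrow> B \<subseteq> H \<Longrightarrow> N \<subseteq> H"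
    using fg by (rule M.fg_overE) blast
  let ?\<iota> = "\<lambda>t v s. if s = t then v else \<zero>\<^bsub>M\<^esub>"
  show ?thesis
  proof (rule F.fg_overI[of "(\<Union>t\<in>S j. ?\<iota> t ` T)"])
    show "finite (\<Union>t\<in>S j. ?\<iota> t ` T)" using T finite_basis by auto
    show "(\<Union>t\<in>S j. ?\<iota> t ` T) \<subseteq> cochains M j N"
      using T(2) ND(3) by (auto simp: cochains_def)
    fix H assume H: "submodule H R (fun_module M)" "(\<Union>t\<in>S j. ?\<iota> t ` T) \<subseteq> H" "cochains M j B \<subseteq> H"
    note HD = F.submoduleD[OF H(1)]
    have single: "?\<iota> t v \<in> H" if t: "t \<in> S j" and v: "v \<in> N" for t v
    proof -
      have "N \<subseteq> {v \<in> carrier M. ?\<iota> t v \<in> H}"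
      proof (rule T(3))
        show "submodule {v \<in> carrier M. ?\<iota> t v \<in> H} R M"
          by (rule submodule_vimage[OF M F.module_axioms M.carrier_is_submodule single_cochain H(1)])
        show "T \<subseteq> {v \<in> carrier M. ?\<iota> t v \<in> H}" using T(2) ND(2) H(2) t by blast
        show "B \<subseteq> {v \<in> carrier M. ?\<iota> t v \<in> H}"
        proof
          fix b assume "b \<in> B"
          then have "?\<iota> t b \<in> cochains M j B" using t BD(3) by (auto simp: cochains_def)
          then show "b \<in> {v \<in> carrier M. ?\<iota> t v \<in> H}" using H(3) BD(2) \<open>b \<in> B\<close> by blast
        qed
      qed
      then show ?thesis using v by blast
    qed
    have part: "(\<lambda>s. if s \<in> A then g s else \<zero>\<^bsub>M\<^esub>) \<in> H"
      if "finite A" "A \<subseteq> S j" and g: "g \<in> cochains M j N" for A g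
      using that(1,2)
    proof (induction A rule: finite_induct)
      case empty
      show ?case using HD(3) by (simp add: fun_module_simps)
    next
      case (insert t A)
      have gN: "g s \<in> carrier M" for s using cochains_val[OF N g] ND(2) by blast
      have "(\<lambda>s. if s \<in> insert t A then g s else \<zero>\<^bsub>M\<^esub>) =
          ?\<iota> t (g t) \<oplus>\<^bsub>fun_module M\<^esub> (\<lambda>s. if s \<in> A then g s else \<zero>\<^bsub>M\<^esub>)"
        using insert gN by (auto simp: fun_module_simps fun_eq_iff)
      then show ?case
        using insert HD(4)[OF single[of t "g t"]] cochains_val[OF N g] by simp
    qed
    show "cochains M j N \<subseteq> H"
    proof
      fix g assume g: "g \<in> cochains M j N"
      then have "(\<lambda>s. if s \<in> S j then g s else \<zero>\<^bsub>M\<^esub>) = g" by (auto simp: cochains_def)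
      then show "g \<in> H" using part[OF finite_basis order_refl g] by metis
    qed
  qed
qed

text \<open>As the basis in each degree is finite, cochains with values in \<open>N\<close> are finitely generated
  over those with values in \<open>B\<close>; hence so are the cocycles.\<close>

lemma fg_cohomology_extension:
  assumes noeth: "noetherian_ring R" and B: "submodule B R M" and N: "submodule N R M" and BN: "B \<subseteq> N"
    and fg: "fg_over R M B N" and coh: "fg_cohomology M B"
  shows "fg_cohomology M N"
  unfolding fg_cohomology_def
proof
  fix j
  have "{g \<in> cocycles M j N. g \<in> cochains M j B} = cocycles M j B"
    using cochains_mono[OF BN, of j] by (auto simp: cocycles_def)
  moreover have "fg_over R (fun_module M) (coboundaries M j N) (cocycles M j B)"
    using coh F.fg_over_mono coboundaries_mono[OF BN] unfolding fg_cohomology_def by blast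
  ultimately have ker: "fg_over R (fun_module M) (coboundaries M j N) {g \<in> cocycles M j N. g \<in> cochains M j B}"
    by simp
  show "fg_over R (fun_module M) (coboundaries M j N) (cocycles M j N)"
    by (rule fg_over_extension[OF noeth F.module_axioms F.module_axioms submodule_cocycles[OF N]
          F.linear_on_id submodule_cochains[OF N] submodule_cochains[OF B] cochains_mono[OF BN] _
          fg_over_cochains[OF B N BN fg] ker])
      (use F.submoduleD(1)[OF submodule_cocycles[OF N]] in \<open>auto simp: cocycles_def\<close>)
qed

lemma fg_cohomology_zero: "fg_cohomology M {\<zero>\<^bsub>M\<^esub>}"
  unfolding fg_cohomology_def
proof
  fix j
  have "cocycles M j {\<zero>\<^bsub>M\<^esub>} \<subseteq> {\<lambda>_. \<zero>\<^bsub>M\<^esub>}"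
    by (auto simp: cocycles_def cochains_def fun_eq_iff)
  then show "fg_over R (fun_module M) (coboundaries M j {\<zero>\<^bsub>M\<^esub>}) (cocycles M j {\<zero>\<^bsub>M\<^esub>})"
    using F.submoduleD(3)[OF submodule_coboundaries[OF M.submodule_zero, of j]]
    by (intro F.fg_over_self) (auto simp: fun_module_simps)
qed

text \<open>If \<open>B\<close> has finitely generated cohomology in degree 1 and \<open>Z\<close> has it in degree 0, the start of
  the long exact sequence of \<open>0 \<rightarrow> B \<rightarrow> Z \<rightarrow> Z / B \<rightarrow> 0\<close> bounds the degree 0 cohomology of \<open>Z / B\<close>,
  which is all of \<open>Z / B\<close> because the first differential vanishes on it.\<close>

lemma fg_over_if_fg_cohomology:
  assumes noeth: "noetherian_ring R" and S0: "S 0 = {e}"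
    and B: "submodule B R M" and Z: "submodule Z R M" and K: "submodule K R M"
    and BZ: "B \<subseteq> Z" and ZK: "Z \<subseteq> K"
    and act: "\<And>t z. t \<in> S 1 \<Longrightarrow> z \<in> Z \<Longrightarrow> bnd t e \<odot>\<^bsub>M\<^esub> z \<in> B"
    and cohB: "fg_cohomology M B" and cohK: "fg_cohomology M K"
  shows "fg_over R M B Z"
proof -
  note ZD = M.submoduleD[OF Z] and BD = M.submoduleD[OF B] and KD = M.submoduleD[OF K]
  let ?\<iota> = "\<lambda>v s. if s = e then v else \<zero>\<^bsub>M\<^esub>"
  define \<phi> where "\<phi> v = coboundary M 0 (?\<iota> v)" for v
  have \<iota>: "?\<iota> v \<in> cochains M 0 N" if "v \<in> N" for v N
    using that by (auto simp: cochains_def S0)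
  have \<phi>: "linear_on R M (carrier M) (fun_module M) \<phi>"
  proof (rule linear_onI)
    note L1 = linear_onD[OF single_cochain[of e]]
      and L2 = linear_onD[OF coboundary_linear[OF M.carrier_is_submodule, of 0]]
    show "\<phi> v \<in> carrier (fun_module M)" if "v \<in> carrier M" for v
      unfolding \<phi>_def using L2(1) \<iota>[OF that] by blast
    show "\<phi> (v \<oplus>\<^bsub>M\<^esub> w) = \<phi> v \<oplus>\<^bsub>fun_module M\<^esub> \<phi> w" if "v \<in> carrier M" "w \<in> carrier M" for v w
      unfolding \<phi>_def L1(2)[OF that] using L2(2) \<iota> that by blast
    show "\<phi> (r \<odot>\<^bsub>M\<^esub> v) = r \<odot>\<^bsub>fun_module M\<^esub> \<phi> v" if "r \<in> carrier R" "v \<in> carrier M" for r v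
      unfolding \<phi>_def L1(3)[OF that] using L2(3) \<iota> that by blast
  qed
  have cochain0: "g = ?\<iota> (g e)" if "g \<in> cochains M 0 N" for g N
    using that by (auto simp: cochains_def S0 fun_eq_iff)
  have \<phi>_val: "\<phi> v t = bnd t e \<odot>\<^bsub>M\<^esub> v" if "t \<in> S 1" "v \<in> carrier M" for t v
  proof -
    have b: "bnd t \<in> carrier (free_module R {e})" using bnd_closed[of t 0] that S0 by simp
    have "lin_ext R M (?\<iota> v) (bnd t) = (\<Oplus>\<^bsub>M\<^esub>s\<in>{e}. bnd t s \<odot>\<^bsub>M\<^esub> ?\<iota> v s)"
      using b that(2) by (intro lin_ext_superset[OF M]) (auto simp: free_module_simps)
    then show ?thesis using that b by (simp add: \<phi>_def coboundary_def free_module_simps image_subset_iff)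
  qed
  define U where "U = {v \<in> K. \<phi> v = \<zero>\<^bsub>fun_module M\<^esub>}"
  have ev: "linear_on R (fun_module M) (cocycles M 0 K) M (\<lambda>g. g e)"
    by (rule linear_onI)
      (use F.submoduleD(2)[OF submodule_cocycles[OF K, of 0]] in \<open>auto simp: fun_module_simps\<close>)
  have "(\<lambda>g. g e) ` cocycles M 0 K = U"
  proof safe
    fix g assume g: "g \<in> cocycles M 0 K"
    then have "g \<in> cochains M 0 K" "coboundary M 0 g = (\<lambda>_. \<zero>\<^bsub>M\<^esub>)" by (auto simp: cocycles_def)
    then show "g e \<in> U"
      using cochains_val[OF K] cochain0[of g K] unfolding U_def \<phi>_def by (auto simp: fun_module_simps)
  next
    fix v assume v: "v \<in> U"
    then have "?\<iota> v \<in> cocycles M 0 K"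
      using \<iota>[of v K] by (auto simp: U_def \<phi>_def cocycles_def fun_module_simps)
    then show "v \<in> (\<lambda>g. g e) ` cocycles M 0 K" by (intro image_eqI[of _ _ "?\<iota> v"]) auto
  qed
  moreover have "fg_over R (fun_module M) (coboundaries M 0 K) (cocycles M 0 K)"
    using cohK unfolding fg_cohomology_def by blast
  from fg_over_image[OF F.module_axioms M submodule_cocycles[OF K] ev coboundaries_sub_cocycles[OF K] this]
  have "fg_over R M {\<zero>\<^bsub>M\<^esub>} ((\<lambda>g. g e) ` cocycles M 0 K)" by simp
  ultimately have fgU: "fg_over R M {\<zero>\<^bsub>M\<^esub>} U" by simp
  have "submodule {v \<in> carrier M. \<phi> v \<in> {\<zero>\<^bsub>fun_module M\<^esub>}} R M"
    by (rule submodule_vimage[OF M F.module_axioms M.carrier_is_submodule \<phi> F.submodule_zero])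
  from M.submodule_Int[OF K this] have "submodule (K \<inter> {v \<in> carrier M. \<phi> v \<in> {\<zero>\<^bsub>fun_module M\<^esub>}}) R M" .
  moreover have "K \<inter> {v \<in> carrier M. \<phi> v \<in> {\<zero>\<^bsub>fun_module M\<^esub>}} = U"
    using KD(2) unfolding U_def by blast
  ultimately have U: "submodule U R M" by simp
  have UZ: "submodule (U \<inter> Z) R M" by (rule M.submodule_Int[OF U Z])
  have fgUZ: "fg_over R M {\<zero>\<^bsub>M\<^esub>} (U \<inter> Z)"
    by (rule M.fg_over_submodule[OF noeth fgU _ _ UZ]) (use M.submoduleD[OF U] M.submoduleD[OF UZ] in auto)
  have ker: "fg_over R M B {z \<in> Z. \<phi> z \<in> coboundaries M 1 B}"
  proof -
    obtain T where T: "finite T" "T \<subseteq> U \<inter> Z"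
      "\<And>H. submodule H R M \<Longrightarrow> T \<subseteq> H \<Longrightarrow> {\<zero>\<^bsub>M\<^esub>} \<subseteq> H \<Longrightarrow> U \<inter> Z \<subseteq> H"
      using fgUZ by (rule M.fg_overE) blast
    show ?thesis
    proof (rule M.fg_overI[OF T(1)])
      have "\<phi> z \<in> coboundaries M 1 B" if "z \<in> U" for z
        using that F.submoduleD(3)[OF submodule_coboundaries[OF B, of 1]] by (simp add: U_def)
      then show "T \<subseteq> {z \<in> Z. \<phi> z \<in> coboundaries M 1 B}" using T(2) by blast
      fix H assume H: "submodule H R M" "T \<subseteq> H" "B \<subseteq> H"
      note HD = M.submoduleD[OF H(1)]
      have UH: "U \<inter> Z \<subseteq> H" using T(3)[OF H(1,2)] HD(3) by simp
      show "{z \<in> Z. \<phi> z \<in> coboundaries M 1 B} \<subseteq> H"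
      proof safe
        fix z assume z: "z \<in> Z" "\<phi> z \<in> coboundaries M 1 B"
        then obtain g where g: "g \<in> cochains M 0 B" "\<phi> z = coboundary M 0 g" by auto
        define b where "b = g e"
        have b: "b \<in> B" "b \<in> Z" "\<phi> z = \<phi> b"
          using g cochains_val[OF B g(1)] BZ cochain0[OF g(1)] by (auto simp: b_def \<phi>_def)
        have "\<phi> (z \<ominus>\<^bsub>M\<^esub> b) = \<phi> z \<ominus>\<^bsub>fun_module M\<^esub> \<phi> b"
          using linear_on_basics(3)[OF M F.module_axioms M.carrier_is_submodule \<phi>] z b ZD(2) by blast
        also have "\<dots> = \<zero>\<^bsub>fun_module M\<^esub>"
          unfolding b(3) using linear_onD(1)[OF \<phi>] ZD(2)[OF b(2)] by (simp add: F.M.minus_eq F.M.r_neg)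
        finally have "z \<ominus>\<^bsub>M\<^esub> b \<in> U \<inter> Z" using ZD(7)[OF z(1) b(2)] ZK by (auto simp: U_def)
        then have "(z \<ominus>\<^bsub>M\<^esub> b) \<oplus>\<^bsub>M\<^esub> b \<in> H" using UH HD(4) H(3) b(1) by blast
        moreover have "(z \<ominus>\<^bsub>M\<^esub> b) \<oplus>\<^bsub>M\<^esub> b = z" using ZD(2)[OF z(1)] ZD(2)[OF b(2)] by algebra
        ultimately show "z \<in> H" by simp
      qed
    qed
  qed
  show ?thesis
  proof (rule fg_over_extension[OF noeth M F.module_axioms Z linear_on_subset[OF \<phi> ZD(1)]
        submodule_cocycles[OF B, of 1] submodule_coboundaries[OF B, of 1] coboundaries_sub_cocycles[OF B] _ _ ker])
    show "fg_over R (fun_module M) (coboundaries M 1 B) (cocycles M 1 B)"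
      using cohB unfolding fg_cohomology_def by blast
    fix z assume z: "z \<in> Z"
    have "\<phi> z t \<in> B" if "t \<in> S 1" for t using \<phi>_val[OF that ZD(2)[OF z]] act[OF that z] by simp
    then have "\<phi> z \<in> cochains M (Suc 0) B"
      by (auto simp: cochains_def) (simp add: \<phi>_def coboundary_def)
    moreover have "coboundary M (Suc 0) (\<phi> z) = (\<lambda>_. \<zero>\<^bsub>M\<^esub>)"
      unfolding \<phi>_def by (rule coboundary_coboundary[OF \<iota>[OF ZD(2)[OF z]]])
    ultimately show "\<phi> z \<in> cocycles M 1 B" by (simp add: cocycles_def)
  qed
qed

end

end

context free_complex
begin

lemma coboundary_natural:
  assumes M: "module R M" and N: "module R N" and K: "submodule K R M" and \<phi>: "linear_on R M K N \<phi>"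
    and g: "g \<in> cochains M j K"
  shows "coboundary N j (\<lambda>t. \<phi> (g t)) = (\<lambda>t. \<phi> (coboundary M j g t))"
proof
  fix t
  show "coboundary N j (\<lambda>t. \<phi> (g t)) t = \<phi> (coboundary M j g t)"
    using lin_ext_linear_map[OF M N K \<phi> bnd_closed[of t j], of g] cochains_val[OF M K g]
      linear_on_basics(1)[OF M N K \<phi>]
    by (simp add: coboundary_def)
qed

text \<open>The part of the long exact sequence that bounds the cohomology of a quotient: a cocycle with
  values in \<open>\<phi> K\<close> lifts to a cochain, whose coboundary has values in the kernel of \<open>\<phi>\<close>.\<close>

lemma fg_cohomology_image:
  assumes noeth: "noetherian_ring R" and M: "module R M" and N: "module R N"
    and K: "submodule K R M" and \<phi>: "linear_on R M K N \<phi>"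
    and cohK: "fg_cohomology M K" and cohZ: "fg_cohomology M {k \<in> K. \<phi> k = \<zero>\<^bsub>N\<^esub>}"
  shows "fg_cohomology N (\<phi> ` K)"
  unfolding fg_cohomology_def
proof
  fix j
  interpret M: module R M by (rule M)
  interpret N: module R N by (rule N)
  interpret F: module R "fun_module M :: ('a, 'i \<Rightarrow> _) module" by (rule module_fun_module[OF M])
  interpret G: module R "fun_module N :: ('a, 'i \<Rightarrow> _) module" by (rule module_fun_module[OF N])
  define Z where "Z = {k \<in> K. \<phi> k = \<zero>\<^bsub>N\<^esub>}"
  have Z: "submodule Z R M"
    using submodule_vimage[OF M N K \<phi> N.submodule_zero] by (simp add: Z_def)
  have ZK: "Z \<subseteq> K" by (auto simp: Z_def)
  have im: "submodule (\<phi> ` K) R N" by (rule submodule_image[OF M N K \<phi>])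
  have \<phi>0: "\<phi> \<zero>\<^bsub>M\<^esub> = \<zero>\<^bsub>N\<^esub>" by (rule linear_on_basics(1)[OF M N K \<phi>])
  note CK = submodule_cochains[OF M K, of j] and CZ = submodule_cochains[OF M Z]
    and BK = submodule_coboundaries[OF M K, of j]
  have \<delta>: "linear_on R (fun_module M) (cochains M j K) (fun_module M) (coboundary M j)"
    by (rule coboundary_linear[OF M K])
  define Y where "Y = {g \<in> cochains M j K. coboundary M j g \<in> cochains M (Suc j) Z}"
  have Y: "submodule Y R (fun_module M)"
    unfolding Y_def by (rule submodule_vimage[OF F.module_axioms F.module_axioms CK \<delta> CZ])
  define B where "B = F.plus_set (cochains M j Z) (coboundaries M j K)"
  note PL = F.submodule_plus[OF CZ[of j] BK, folded B_def]
  have ker: "fg_over R (fun_module M) B {g \<in> Y. coboundary M j g \<in> coboundaries M (Suc j) Z}"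
  proof -
    obtain T where T: "finite T" "T \<subseteq> cocycles M j K"
      "\<And>H. submodule H R (fun_module M) \<Longrightarrow> T \<subseteq> H \<Longrightarrow> coboundaries M j K \<subseteq> H \<Longrightarrow> cocycles M j K \<subseteq> H"
      using cohK[unfolded fg_cohomology_def, rule_format, of j] by (rule F.fg_overE) blast
    show ?thesis
    proof (rule F.fg_overI[OF T(1)])
      have "(\<lambda>_. \<zero>\<^bsub>M\<^esub>) \<in> coboundaries M (Suc j) Z" "(\<lambda>_. \<zero>\<^bsub>M\<^esub>) \<in> cochains M (Suc j) Z"
        using F.submoduleD(3)[OF submodule_coboundaries[OF M Z, of "Suc j"]]
          F.submoduleD(3)[OF CZ[of "Suc j"]] by (auto simp: fun_module_simps)
      then show "T \<subseteq> {g \<in> Y. coboundary M j g \<in> coboundaries M (Suc j) Z}"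
        using T(2) by (auto simp: Y_def cocycles_def subset_iff)
      fix H assume H: "submodule H R (fun_module M)" "T \<subseteq> H" "B \<subseteq> H"
      note HD = F.submoduleD[OF H(1)]
      have ZH: "cocycles M j K \<subseteq> H" using T(3)[OF H(1,2)] PL(3) H(3) by blast
      show "{g \<in> Y. coboundary M j g \<in> coboundaries M (Suc j) Z} \<subseteq> H"
      proof safe
        fix g assume g: "g \<in> Y" "coboundary M j g \<in> coboundaries M (Suc j) Z"
        then obtain c where c: "c \<in> cochains M j Z" "coboundary M j g = coboundary M j c" by auto
        have gK: "g \<in> cochains M j K" and cK: "c \<in> cochains M j K"
          using g c cochains_mono[OF M ZK, of j] by (auto simp: Y_def)
        have "coboundary M j (g \<ominus>\<^bsub>fun_module M\<^esub> c) = coboundary M j g \<ominus>\<^bsub>fun_module M\<^esub> coboundary M j c"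
          by (rule linear_on_basics(3)[OF F.module_axioms F.module_axioms CK \<delta> gK cK])
        also have "\<dots> = \<zero>\<^bsub>fun_module M\<^esub>"
          unfolding c(2) using linear_onD(1)[OF \<delta> cK] by (simp add: F.M.minus_eq F.M.r_neg)
        finally have "g \<ominus>\<^bsub>fun_module M\<^esub> c \<in> cocycles M j K"
          using F.submoduleD(7)[OF CK gK cK] by (simp add: cocycles_def fun_module_simps)
        then have "(g \<ominus>\<^bsub>fun_module M\<^esub> c) \<oplus>\<^bsub>fun_module M\<^esub> c \<in> H"
          using ZH HD(4) H(3) PL(2) c(1) by blast
        moreover have "(g \<ominus>\<^bsub>fun_module M\<^esub> c) \<oplus>\<^bsub>fun_module M\<^esub> c = g"
          using F.submoduleD(2)[OF CK gK] F.submoduleD(2)[OF CK cK] by algebra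
        ultimately show "g \<in> H" by simp
      qed
    qed
  qed
  have fgY: "fg_over R (fun_module M) B Y"
  proof (rule fg_over_extension[OF noeth F.module_axioms F.module_axioms Y _
        submodule_cocycles[OF M Z, of "Suc j"] submodule_coboundaries[OF M Z, of "Suc j"]
        coboundaries_sub_cocycles[OF M Z] _ _ ker])
    show "linear_on R (fun_module M) Y (fun_module M) (coboundary M j)"
      by (rule linear_on_subset[OF \<delta>]) (auto simp: Y_def)
    show "fg_over R (fun_module M) (coboundaries M (Suc j) Z) (cocycles M (Suc j) Z)"
      using cohZ unfolding fg_cohomology_def Z_def by blast
    show "coboundary M j g \<in> cocycles M (Suc j) Z" if "g \<in> Y" for g
      using that coboundary_coboundary[OF M, of g j] cochains_mono[OF M M.submoduleD(1)[OF K], of j]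
      by (auto simp: Y_def cocycles_def)
  qed
  define D where "D g = (\<lambda>t. \<phi> (g t))" for g :: "'i \<Rightarrow> _"
  have D: "linear_on R (fun_module M) (cochains M j K) (fun_module N) D" for j
    by (rule linear_onI)
      (use linear_onD[OF \<phi>] cochains_val[OF M K] in \<open>auto simp: D_def fun_module_simps\<close>)
  have BY: "B \<subseteq> Y"
  proof -
    have "cochains M j Z \<subseteq> Y"
      using cochains_mono[OF M ZK, of j] coboundary_closed[OF M Z] by (auto simp: Y_def)
    moreover have "coboundaries M j K \<subseteq> Y"
      using coboundaries_sub_cocycles[OF M K, of j] F.submoduleD(3)[OF CZ[of "Suc j"]]
      by (auto simp: Y_def cocycles_def fun_module_simps)
    ultimately show ?thesis
      unfolding B_def F.plus_set_def using F.submoduleD(4)[OF Y] by blast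
  qed
  have YK: "Y \<subseteq> cochains M j K" by (auto simp: Y_def)
  have "fg_over R (fun_module N) (D ` B) (D ` Y)"
    by (rule fg_over_image[OF F.module_axioms G.module_axioms Y linear_on_subset[OF D YK] BY fgY])
  moreover have "D ` B \<subseteq> coboundaries N j (\<phi> ` K)"
  proof safe
    fix b assume "b \<in> B"
    then obtain z c where zc: "z \<in> cochains M j Z" "c \<in> coboundaries M j K" "b = z \<oplus>\<^bsub>fun_module M\<^esub> c"
      unfolding B_def F.plus_set_def by blast
    have cK: "c \<in> cochains M j K" using zc(2) coboundaries_sub_cocycles[OF M K, of j] by (auto simp: cocycles_def)
    have zK: "z \<in> cochains M j K" using zc(1) cochains_mono[OF M ZK, of j] by blast
    have "D z = \<zero>\<^bsub>fun_module N\<^esub>"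
      using cochains_val[OF M Z zc(1)] by (simp add: D_def Z_def fun_module_simps)
    then have "D b = D c"
      using linear_onD(1)[OF D cK] linear_onD(2)[OF D zK cK] zc(3) by simp
    also have "D c \<in> coboundaries N j (\<phi> ` K)"
    proof (cases j)
      case 0
      then show ?thesis using zc(2) \<phi>0 by (simp add: D_def)
    next
      case (Suc i)
      then obtain h where h: "h \<in> cochains M i K" "c = coboundary M i h" using zc(2) by auto
      then have "D c = coboundary N i (D h)"
        using coboundary_natural[OF M N K \<phi> h(1)] by (simp add: D_def)
      moreover have "D h \<in> cochains N i (\<phi> ` K)"
        using h(1) \<phi>0 by (auto simp: D_def cochains_def)
      ultimately show ?thesis using Suc by simp
    qed
    finally show "D b \<in> coboundaries N j (\<phi> ` K)" .
  qed
  moreover have "D ` Y = cocycles N j (\<phi> ` K)"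
  proof safe
    fix g assume g: "g \<in> Y"
    then have gK: "g \<in> cochains M j K" "coboundary M j g \<in> cochains M (Suc j) Z" by (auto simp: Y_def)
    have "coboundary N j (D g) = (\<lambda>_. \<zero>\<^bsub>N\<^esub>)"
      unfolding D_def coboundary_natural[OF M N K \<phi> gK(1)]
      using cochains_val[OF M Z gK(2)] by (simp add: Z_def)
    moreover have "D g \<in> cochains N j (\<phi> ` K)"
      using gK(1) \<phi>0 by (auto simp: D_def cochains_def)
    ultimately show "D g \<in> cocycles N j (\<phi> ` K)" by (simp add: cocycles_def)
  next
    fix h assume "h \<in> cocycles N j (\<phi> ` K)"
    then have h: "h \<in> cochains N j (\<phi> ` K)" "coboundary N j h = (\<lambda>_. \<zero>\<^bsub>N\<^esub>)" by (auto simp: cocycles_def)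
    have "\<forall>t. \<exists>k. k \<in> K \<and> \<phi> k = h t" using cochains_val[OF N im h(1)] by (auto simp: image_iff) metis
    then obtain k where k: "\<And>t. k t \<in> K" "\<And>t. \<phi> (k t) = h t" by metis
    define g where "g t = (if t \<in> S j then k t else \<zero>\<^bsub>M\<^esub>)" for t
    have g: "g \<in> cochains M j K" using k by (auto simp: g_def cochains_def)
    have Dg: "D g = h" using k h(1) \<phi>0 by (auto simp: D_def g_def cochains_def)
    have "\<phi> (coboundary M j g t) = \<zero>\<^bsub>N\<^esub>" for t
      using coboundary_natural[OF M N K \<phi> g] h(2) Dg by (simp add: D_def fun_eq_iff)
    then have "coboundary M j g \<in> cochains M (Suc j) Z"
      using coboundary_closed[OF M K g] by (auto simp: cochains_def Z_def)
    then show "h \<in> D ` Y" using g Dg by (auto simp: Y_def)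
  qed
  ultimately show "fg_over R (fun_module N) (coboundaries N j (\<phi> ` K)) (cocycles N j (\<phi> ` K))"
    using G.fg_over_mono by simp
qed

text \<open>For a bounded below complex with terms \<open>K i\<close> all of whose cohomology is finitely generated, the
  boundaries, the homology and the cycles are handled alternately, from the bottom up.\<close>

theorem fg_homology_of_complex:
  assumes noeth: "noetherian_ring R" and M: "module R M" and S0: "S 0 = {e}"
    and K: "\<And>i. submodule (K i) R M" and d: "\<And>i. linear_on R M (K i) M d"
    and dK: "\<And>i k. k \<in> K i \<Longrightarrow> d k \<in> K (Suc i)" "\<And>i k. k \<in> K i \<Longrightarrow> d (d k) = \<zero>\<^bsub>M\<^esub>"
    and coh: "\<And>i. fg_cohomology M (K i)"
    and act: "\<And>i t z. t \<in> S 1 \<Longrightarrow> z \<in> K i \<Longrightarrow> d z = \<zero>\<^bsub>M\<^esub> \<Longrightarrow>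
      bnd t e \<odot>\<^bsub>M\<^esub> z \<in> (case i of 0 \<Rightarrow> {\<zero>\<^bsub>M\<^esub>} | Suc j \<Rightarrow> d ` K j)"
  shows "fg_over R M (case i of 0 \<Rightarrow> {\<zero>\<^bsub>M\<^esub>} | Suc j \<Rightarrow> d ` K j) {z \<in> K i. d z = \<zero>\<^bsub>M\<^esub>}"
proof -
  interpret M: module R M by (rule M)
  define B where "B i = (case i of 0 \<Rightarrow> {\<zero>\<^bsub>M\<^esub>} | Suc j \<Rightarrow> d ` K j)" for i
  define Z where "Z i = {z \<in> K i. d z = \<zero>\<^bsub>M\<^esub>}" for i
  have Z: "submodule (Z i) R M" for i
    using submodule_vimage[OF M M K d M.submodule_zero] by (simp add: Z_def)
  have B: "submodule (B i) R M" for i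
    using M.submodule_zero submodule_image[OF M M K d] by (cases i) (auto simp: B_def)
  have BZ: "B i \<subseteq> Z i" for i
    using M.submoduleD(3)[OF Z, of 0] dK by (cases i) (auto simp: B_def Z_def)
  have ZK: "Z i \<subseteq> K i" for i by (auto simp: Z_def)
  have act': "bnd t e \<odot>\<^bsub>M\<^esub> z \<in> B i" if "t \<in> S 1" "z \<in> Z i" for t z i
    using act[OF that(1), of z i] that(2) by (simp add: B_def Z_def)
  have step: "fg_over R M (B i) (Z i)" if "fg_cohomology M (B i)" for i
    by (rule fg_over_if_fg_cohomology[OF M noeth S0 B Z K BZ ZK act' that coh])
  have "fg_cohomology M (B i)" for i
  proof (induction i)
    case 0
    show ?case using fg_cohomology_zero[OF M] by (simp add: B_def)
  next
    case (Suc i)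
    have "fg_cohomology M (Z i)"
      by (rule fg_cohomology_extension[OF M noeth B Z BZ step[OF Suc] Suc])
    then show ?case
      unfolding B_def Z_def using fg_cohomology_image[OF noeth M M K d coh] by simp
  qed
  then show ?thesis using step[of i] by (simp add: B_def Z_def)
qed

end

section \<open>The Koszul complex of a module\<close>

context pairing_module
begin

definition pairs :: "'c set \<Rightarrow> 'c set \<Rightarrow> 'c set"
  where "pairs A B = {w \<in> carrier M. lo w \<in> A \<and> hi w \<in> B}"

lemma submodule_pairs:
  assumes "submodule A R M" "submodule B R M" shows "submodule (pairs A B) R M"
  by (rule submodule_intro)
    (use submoduleD[OF assms(1)] submoduleD[OF assms(2)] lo hi in \<open>auto simp: pairs_def\<close>)

lemma join_in_pairs:
  assumes "submodule A R M" "submodule B R M" "a \<in> A" "b \<in> B" shows "join a b \<in> pairs A B"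
  using assms submoduleD(2) by (auto simp: pairs_def intro!: join_closed)

lemma mem_koszul: "w \<in> koszul A \<longleftrightarrow> w \<in> carrier M \<and> lo w \<in> A \<and> hi w \<in> A"
  by (simp add: koszul_def)

text \<open>The part of degree \<open>i\<close> and the part of degree at least \<open>i\<close> of the \<open>n\<close>-fold Koszul
  construction on a module \<open>E\<close> with zero differential. The first component of a pair counts one degree
  higher than the second, so that the degrees run from \<open>0\<close> to \<open>n\<close> and the differential raises them
  by one. A lowest degree is needed to start the induction of \<open>fg_homology_of_complex\<close>.\<close>

primrec koszul_gr :: "'c set \<Rightarrow> nat \<Rightarrow> nat \<Rightarrow> 'c set"
  where
    "koszul_gr E 0 = (\<lambda>i. if i = 0 then E else {\<zero>\<^bsub>M\<^esub>})"
  | "koszul_gr E (Suc n) = (\<lambda>i. pairs (case i of 0 \<Rightarrow> {\<zero>\<^bsub>M\<^esub>} | Suc j \<Rightarrow> koszul_gr E n j) (koszul_gr E n i))"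

primrec koszul_tail :: "'c set \<Rightarrow> nat \<Rightarrow> nat \<Rightarrow> 'c set"
  where
    "koszul_tail E 0 = (\<lambda>i. if i = 0 then E else {\<zero>\<^bsub>M\<^esub>})"
  | "koszul_tail E (Suc n) =
      (\<lambda>i. pairs (case i of 0 \<Rightarrow> (koszul ^^ n) E | Suc j \<Rightarrow> koszul_tail E n j) (koszul_tail E n i))"

context
  fixes E assumes E: "submodule E R M"
begin

lemma submodule_koszul_power: "submodule ((koszul ^^ n) E) R M"
  by (induction n) (auto intro: E submodule_koszul)

lemma submodule_koszul_gr: "submodule (koszul_gr E n i) R M"
  by (induction n arbitrary: i)
    (auto intro!: E submodule_zero submodule_pairs split: nat.split)

lemma submodule_koszul_tail: "submodule (koszul_tail E n i) R M"
  by (induction n arbitrary: i)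
    (auto intro!: E submodule_zero submodule_pairs submodule_koszul_power split: nat.split)

lemma koszul_gr_subset: "koszul_gr E n i \<subseteq> (koszul ^^ n) E"
proof (induction n arbitrary: i)
  case 0
  show ?case using submoduleD(3)[OF E] by simp
next
  case (Suc n)
  have "(case i of 0 \<Rightarrow> {\<zero>\<^bsub>M\<^esub>} | Suc j \<Rightarrow> koszul_gr E n j) \<subseteq> (koszul ^^ n) E"
    using Suc submoduleD(3)[OF submodule_koszul_power] by (auto split: nat.split)
  then show ?case using Suc[of i] by (auto simp: pairs_def mem_koszul)
qed

lemma koszul_tail_0: "koszul_tail E n 0 = (koszul ^^ n) E"
proof (induction n)
  case (Suc n)
  then have "koszul_tail E (Suc n) 0 = pairs ((koszul ^^ n) E) ((koszul ^^ n) E)" by simp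
  also have "\<dots> = (koszul ^^ Suc n) E" by (simp add: pairs_def koszul_def[of "(koszul ^^ n) E"])
  finally show ?case .
qed simp

lemma koszul_tail_beyond: "n < i \<Longrightarrow> koszul_tail E n i = {\<zero>\<^bsub>M\<^esub>}"
proof (induction n arbitrary: i)
  case (Suc n)
  then obtain j where j: "i = Suc j" "n < j" by (cases i) auto
  have "w = \<zero>\<^bsub>M\<^esub>" if "lo w = \<zero>\<^bsub>M\<^esub>" "hi w = \<zero>\<^bsub>M\<^esub>" for w
    by (rule pair_eqI) (simp_all add: that)
  then show ?case using Suc.IH[of j] Suc.IH[of i] j by (auto simp: pairs_def)
qed simp

lemma koszul_tail_split:
  assumes "w \<in> koszul_tail E n i"
  shows "\<exists>a\<in>koszul_gr E n i. \<exists>b\<in>koszul_tail E n (Suc i). w = a \<oplus>\<^bsub>M\<^esub> b"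
  using assms
proof (induction n arbitrary: i w)
  case 0
  then have w: "w \<in> carrier M"
    using submoduleD(2)[OF E] by (auto split: if_splits)
  show ?case
    by (rule bexI[of _ w], rule bexI[of _ "\<zero>\<^bsub>M\<^esub>"]) (use 0 w in \<open>auto split: if_splits\<close>)
next
  case (Suc n)
  have w: "w \<in> carrier M" using Suc.prems by (simp add: pairs_def)
  have "\<exists>a\<in>(case i of 0 \<Rightarrow> {\<zero>\<^bsub>M\<^esub>} | Suc j \<Rightarrow> koszul_gr E n j). \<exists>b\<in>koszul_tail E n i. lo w = a \<oplus>\<^bsub>M\<^esub> b"
  proof (cases i)
    case 0
    then have "lo w \<in> (koszul ^^ n) E" using Suc.prems by (auto simp: pairs_def)
    then show ?thesis
      using 0 koszul_tail_0 lo(1)[OF w] by (intro bexI[of _ "\<zero>\<^bsub>M\<^esub>"] bexI[of _ "lo w"]) auto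
  next
    case (Suc j)
    then show ?thesis using Suc.prems Suc.IH[of "lo w" j] by (auto simp: pairs_def)
  qed
  then obtain a b where ab: "a \<in> (case i of 0 \<Rightarrow> {\<zero>\<^bsub>M\<^esub>} | Suc j \<Rightarrow> koszul_gr E n j)"
    "b \<in> koszul_tail E n i" "lo w = a \<oplus>\<^bsub>M\<^esub> b" by blast
  obtain a' b' where ab': "a' \<in> koszul_gr E n i" "b' \<in> koszul_tail E n (Suc i)" "hi w = a' \<oplus>\<^bsub>M\<^esub> b'"
    using Suc.IH[of "hi w" i] Suc.prems by (auto simp: pairs_def)
  have s: "submodule (case i of 0 \<Rightarrow> {\<zero>\<^bsub>M\<^esub>} | Suc j \<Rightarrow> koszul_gr E n j) R M"
    by (auto intro: submodule_zero submodule_koszul_gr split: nat.split)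
  have J: "join a a' \<in> koszul_gr E (Suc n) i" "join b b' \<in> koszul_tail E (Suc n) (Suc i)"
    using ab ab' join_in_pairs[OF s submodule_koszul_gr]
      join_in_pairs[OF submodule_koszul_tail submodule_koszul_tail] by simp_all
  have c: "join a a' \<in> carrier M" "join b b' \<in> carrier M"
    using submoduleD(2)[OF submodule_koszul_gr] submoduleD(2)[OF submodule_koszul_tail] J by blast+
  have "w = join a a' \<oplus>\<^bsub>M\<^esub> join b b'"
    by (rule pair_eqI) (simp_all add: lo(2) hi(2) c ab ab')
  then show ?case using J by blast
qed

lemma koszul_gr_Int_tail: "koszul_gr E n i \<inter> koszul_tail E n (Suc i) \<subseteq> {\<zero>\<^bsub>M\<^esub>}"
proof (induction n arbitrary: i)
  case (Suc n)
  show ?case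
  proof
    fix w assume w: "w \<in> koszul_gr E (Suc n) i \<inter> koszul_tail E (Suc n) (Suc i)"
    have "hi w = \<zero>\<^bsub>M\<^esub>" using w Suc[of i] by (auto simp: pairs_def)
    moreover have "lo w = \<zero>\<^bsub>M\<^esub>"
    proof (cases i)
      case (Suc j)
      then show ?thesis using w Suc.IH[of j] by (auto simp: pairs_def)
    qed (use w in \<open>simp add: pairs_def\<close>)
    ultimately have "w = \<zero>\<^bsub>M\<^esub>" by (intro pair_eqI[of w "\<zero>\<^bsub>M\<^esub>"]) simp_all
    then show "w \<in> {\<zero>\<^bsub>M\<^esub>}" by simp
  qed
qed auto

abbreviation "kd xs \<equiv> koszul_diffs xs (\<lambda>_. \<zero>\<^bsub>M\<^esub>)"

lemma dmod_zero: "dmod E (\<lambda>_. \<zero>\<^bsub>M\<^esub>)"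
  by (rule dmodI[OF E]) (use submoduleD(3)[OF E] in \<open>auto simp: linear_on_def\<close>)

lemma dmod_kd: "set xs \<subseteq> carrier R \<Longrightarrow> dmod ((koszul ^^ length xs) E) (kd xs)"
  by (rule dmod_koszul_diffs[OF dmod_zero])

lemma koszul_gr_diff:
  "set xs \<subseteq> carrier R \<Longrightarrow> w \<in> koszul_gr E (length xs) i \<Longrightarrow> kd xs w \<in> koszul_gr E (length xs) (Suc i)"
proof (induction xs arbitrary: w i)
  case (Cons x xs)
  let ?n = "length xs"
  note G = submoduleD[OF submodule_koszul_gr]
  have d0: "kd xs \<zero>\<^bsub>M\<^esub> = \<zero>\<^bsub>M\<^esub>" using dmodD(11)[OF dmod_kd] Cons.prems by simp
  have w: "hi w \<in> koszul_gr E ?n i" "lo w \<in> (case i of 0 \<Rightarrow> {\<zero>\<^bsub>M\<^esub>} | Suc j \<Rightarrow> koszul_gr E ?n j)"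
    using Cons.prems by (auto simp: pairs_def)
  have "kd xs (lo w) \<in> koszul_gr E ?n i"
    using Cons.IH[of "lo w"] w(2) Cons.prems d0 G(3) by (cases i) auto
  then have "kd xs (lo w) \<oplus>\<^bsub>M\<^esub> x \<odot>\<^bsub>M\<^esub> hi w \<in> koszul_gr E ?n i"
    using G(4,5) w(1) Cons.prems by simp
  moreover have "\<ominus>\<^bsub>M\<^esub> kd xs (hi w) \<in> koszul_gr E ?n (Suc i)"
    using G(6) Cons.IH w(1) Cons.prems by simp
  ultimately show ?case
    unfolding koszul_diffs_simps koszul_diff_def
    using join_in_pairs[OF submodule_koszul_gr submodule_koszul_gr] by simp
qed simp

lemma koszul_tail_diff:
  "set xs \<subseteq> carrier R \<Longrightarrow> w \<in> koszul_tail E (length xs) i \<Longrightarrow> kd xs w \<in> koszul_tail E (length xs) (Suc i)"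
proof (induction xs arbitrary: w i)
  case (Cons x xs)
  let ?n = "length xs"
  note G = submoduleD[OF submodule_koszul_tail]
  have w: "hi w \<in> koszul_tail E ?n i" "lo w \<in> (case i of 0 \<Rightarrow> (koszul ^^ ?n) E | Suc j \<Rightarrow> koszul_tail E ?n j)"
    using Cons.prems by (auto simp: pairs_def)
  have "kd xs (lo w) \<in> koszul_tail E ?n i"
  proof (cases i)
    case 0
    then show ?thesis using w(2) dmodD(4)[OF dmod_kd] Cons.prems by (simp add: koszul_tail_0)
  qed (use w(2) Cons.IH Cons.prems in auto)
  then have "kd xs (lo w) \<oplus>\<^bsub>M\<^esub> x \<odot>\<^bsub>M\<^esub> hi w \<in> koszul_tail E ?n i"
    using G(4,5) w(1) Cons.prems by simp
  moreover have "\<ominus>\<^bsub>M\<^esub> kd xs (hi w) \<in> koszul_tail E ?n (Suc i)"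
    using G(6) Cons.IH w(1) Cons.prems by simp
  ultimately show ?case
    unfolding koszul_diffs_simps koszul_diff_def
    using join_in_pairs[OF submodule_koszul_tail submodule_koszul_tail] by simp
qed simp

text \<open>Each of the elements acts null-homotopically: \<open>(a, b) \<mapsto> (0, a)\<close> is a homotopy for the
  outermost one, and a homotopy \<open>h\<close> for an inner one extends to \<open>(a, b) \<mapsto> (h a, - h b)\<close>.\<close>

lemma koszul_homotopy:
  assumes "set xs \<subseteq> carrier R" "x \<in> set xs"
  shows "\<exists>h. \<forall>i. linear_on R M (koszul_gr E (length xs) i) M h \<and>
    (\<forall>w\<in>koszul_gr E (length xs) i. h w \<in> (case i of 0 \<Rightarrow> {\<zero>\<^bsub>M\<^esub>} | Suc j \<Rightarrow> koszul_gr E (length xs) j) \<and>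
      kd xs (h w) \<oplus>\<^bsub>M\<^esub> h (kd xs w) = x \<odot>\<^bsub>M\<^esub> w)"
  using assms
proof (induction xs)
  case (Cons y ys)
  let ?n = "length ys"
  let ?G = "koszul_gr E ?n"
  let ?L = "\<lambda>i. case i of 0 \<Rightarrow> {\<zero>\<^bsub>M\<^esub>} | Suc j \<Rightarrow> ?G j"
  note G = submoduleD[OF submodule_koszul_gr]
  have y: "y \<in> carrier R" and ys: "set ys \<subseteq> carrier R" and x: "x \<in> carrier R" using Cons.prems by auto
  note D = dmodD[OF dmod_kd[OF ys]]
  have Lsub: "submodule (?L i) R M" for i
    by (auto intro: submodule_zero submodule_koszul_gr split: nat.split)
  have LK: "?L i \<subseteq> (koszul ^^ ?n) E" for i
    using koszul_gr_subset submoduleD(3)[OF submodule_koszul_power] by (auto split: nat.split)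
  have mem: "w \<in> carrier M" "lo w \<in> ?L i" "hi w \<in> ?G i" "lo w \<in> carrier M" "hi w \<in> carrier M"
    "kd ys (lo w) \<in> carrier M" "kd ys (hi w) \<in> carrier M"
    if "w \<in> koszul_gr E (length (y # ys)) i" for w i
  proof -
    show w: "w \<in> carrier M" "lo w \<in> ?L i" "hi w \<in> ?G i"
      using that by (auto simp: pairs_def simp del: nat.case)
    show "lo w \<in> carrier M" "hi w \<in> carrier M" using w(1) lo(1) hi(1) by auto
    show "kd ys (lo w) \<in> carrier M" "kd ys (hi w) \<in> carrier M"
      using D(6) LK w(2) koszul_gr_subset w(3) by blast+
  qed
  have dw: "koszul_diff y (kd ys) w \<in> carrier M" if "w \<in> koszul_gr E (length (y # ys)) i" for w i
    unfolding koszul_diff_def using mem[OF that] y by (auto intro: join_closed)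
  show ?case
  proof (cases "x = y")
    case True
    define h where "h w = join \<zero>\<^bsub>M\<^esub> (lo w)" for w
    have hc: "h w \<in> carrier M" if "w \<in> carrier M" for w
      unfolding h_def using that lo(1) by (intro join_closed) auto
    have "linear_on R M (carrier M) M h"
    proof (rule linear_onI)
      show "h (v \<oplus>\<^bsub>M\<^esub> w) = h v \<oplus>\<^bsub>M\<^esub> h w" if "v \<in> carrier M" "w \<in> carrier M" for v w
        using hc[OF that(1)] hc[OF that(2)] that
        by - (rule pair_eqI, simp_all add: lo(2) hi(2), simp_all add: h_def lo(2))
      show "h (r \<odot>\<^bsub>M\<^esub> v) = r \<odot>\<^bsub>M\<^esub> h v" if "r \<in> carrier R" "v \<in> carrier M" for r v
        using hc[OF that(2)] that
        by - (rule pair_eqI, simp_all add: lo(3) hi(3), simp_all add: h_def lo(3))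
    qed (rule hc)
    then have lin: "linear_on R M (koszul_gr E (length (y # ys)) i) M h" for i
      by (rule linear_on_subset) (rule submoduleD(1)[OF submodule_koszul_gr])
    have deg: "h w \<in> (case i of 0 \<Rightarrow> {\<zero>\<^bsub>M\<^esub>} | Suc j \<Rightarrow> koszul_gr E (length (y # ys)) j)"
      if w: "w \<in> koszul_gr E (length (y # ys)) i" for w i
    proof (cases i)
      case 0
      then show ?thesis using mem(2)[OF w] by (simp add: h_def)
    next
      case (Suc j)
      then have "lo w \<in> ?G j" using mem(2)[OF w] by simp
      then have "h w \<in> koszul_gr E (Suc ?n) j"
        unfolding h_def using join_in_pairs[OF Lsub submodule_koszul_gr submoduleD(3)[OF Lsub]] by simp
      then show ?thesis using Suc by simp
    qed
    have "koszul_diff y (kd ys) (h w) \<oplus>\<^bsub>M\<^esub> h (koszul_diff y (kd ys) w) = x \<odot>\<^bsub>M\<^esub> w"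
      if w: "w \<in> koszul_gr E (length (y # ys)) i" for w i
    proof -
      have c: "koszul_diff y (kd ys) (h w) \<in> carrier M" "h (koszul_diff y (kd ys) w) \<in> carrier M"
        unfolding koszul_diff_def[of _ _ "h w"] using mem[OF w] y D(11) hc[OF dw[OF w]]
        by (auto simp: h_def intro!: join_closed)
      show ?thesis
        by (rule pair_eqI; simp add: c lo(2,3) hi(2,3) mem[OF w] x y True;
            simp add: h_def D(11) M.r_neg1 mem[OF w] y)
    qed
    then show ?thesis
      by (intro exI[of _ h] allI conjI lin ballI deg) (simp_all only: koszul_diffs_simps)
  next
    case False
    then obtain k where k: "\<And>i. linear_on R M (?G i) M k"
      "\<And>i w. w \<in> ?G i \<Longrightarrow> k w \<in> ?L i"
      "\<And>i w. w \<in> ?G i \<Longrightarrow> kd ys (k w) \<oplus>\<^bsub>M\<^esub> k (kd ys w) = x \<odot>\<^bsub>M\<^esub> w"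
      using Cons by auto
    note kl = linear_onD[OF k(1)]
    have k0: "k \<zero>\<^bsub>M\<^esub> = \<zero>\<^bsub>M\<^esub>"
      by (rule linear_on_basics(1)[OF module_axioms module_axioms submodule_koszul_gr k(1)])
    have kL: "k v \<in> carrier M" if "v \<in> ?L i" for v i
      using that kl(1) k0 by (cases i) auto
    have kLa: "k (v \<oplus>\<^bsub>M\<^esub> w) = k v \<oplus>\<^bsub>M\<^esub> k w" if "v \<in> ?L i" "w \<in> ?L i" for v w i
      using that kl(2) k0 by (cases i) auto
    have kLs: "k (r \<odot>\<^bsub>M\<^esub> v) = r \<odot>\<^bsub>M\<^esub> k v" if "r \<in> carrier R" "v \<in> ?L i" for r v i
      using that kl(3) k0 by (cases i) auto
    define h where "h w = join (k (lo w)) (\<ominus>\<^bsub>M\<^esub> k (hi w))" for w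
    have hc: "h w \<in> carrier M" if "w \<in> koszul_gr E (length (y # ys)) i" for w i
      unfolding h_def using kL[OF mem(2)[OF that]] kl(1)[OF mem(3)[OF that]] by (intro join_closed) auto
    have lin: "linear_on R M (koszul_gr E (length (y # ys)) i) M h" for i
    proof (rule linear_onI)
      show "h (v \<oplus>\<^bsub>M\<^esub> w) = h v \<oplus>\<^bsub>M\<^esub> h w"
        if v: "v \<in> koszul_gr E (length (y # ys)) i" and w: "w \<in> koszul_gr E (length (y # ys)) i" for v w
        using hc[OF v] hc[OF w] mem[OF v] mem[OF w] kl(1)[OF mem(3)[OF v]] kl(1)[OF mem(3)[OF w]]
          kLa[OF mem(2)[OF v] mem(2)[OF w]] kl(2)[OF mem(3)[OF v] mem(3)[OF w]]
        by - (rule pair_eqI, simp_all add: lo(2) hi(2), simp_all add: h_def lo(2) hi(2) M.minus_add)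
      show "h (r \<odot>\<^bsub>M\<^esub> w) = r \<odot>\<^bsub>M\<^esub> h w"
        if r: "r \<in> carrier R" and w: "w \<in> koszul_gr E (length (y # ys)) i" for r w
        using hc[OF w] mem[OF w] kl(1)[OF mem(3)[OF w]] r
          kLs[OF r mem(2)[OF w]] kl(3)[OF r mem(3)[OF w]]
        by - (rule pair_eqI, simp_all add: lo(3) hi(3), simp_all add: h_def lo(3) hi(3) smult_r_minus)
    qed (rule hc)
    have deg: "h w \<in> (case i of 0 \<Rightarrow> {\<zero>\<^bsub>M\<^esub>} | Suc j \<Rightarrow> koszul_gr E (length (y # ys)) j)"
      if w: "w \<in> koszul_gr E (length (y # ys)) i" for w i
    proof (cases i)
      case 0
      then show ?thesis
        using mem(2)[OF w] k(2)[OF mem(3)[OF w]] k0 by (simp add: h_def minus_zero_module)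
    next
      case (Suc j)
      have "k (lo w) \<in> ?L j" using mem(2)[OF w] k(2) Suc by simp
      moreover have "\<ominus>\<^bsub>M\<^esub> k (hi w) \<in> ?G j" using k(2)[OF mem(3)[OF w]] G(6) Suc by simp
      ultimately have "h w \<in> koszul_gr E (Suc ?n) j"
        unfolding h_def using join_in_pairs[OF Lsub submodule_koszul_gr] by simp
      then show ?thesis using Suc by simp
    qed
    have "koszul_diff y (kd ys) (h w) \<oplus>\<^bsub>M\<^esub> h (koszul_diff y (kd ys) w) = x \<odot>\<^bsub>M\<^esub> w"
      if w: "w \<in> koszul_gr E (length (y # ys)) i" for w i
    proof -
      note m = mem[OF w]
      have dlo: "kd ys (lo w) \<in> ?G i"
        using m(2) koszul_gr_diff[OF ys] D(11) G(3) by (cases i) auto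
      have dhi: "kd ys (hi w) \<in> ?G (Suc i)" using koszul_gr_diff[OF ys m(3)] .
      have yh: "y \<odot>\<^bsub>M\<^esub> hi w \<in> ?G i" using G(5) y m(3) by blast
      have klo: "k (lo w) \<in> carrier M" by (rule kL[OF m(2)])
      have khi: "k (hi w) \<in> carrier M" "k (hi w) \<in> (koszul ^^ ?n) E"
        using kl(1)[OF m(3)] k(2)[OF m(3)] LK by blast+
      have kloE: "k (lo w) \<in> (koszul ^^ ?n) E"
      proof (cases i)
        case 0
        then show ?thesis using m(2) k0 submoduleD(3)[OF D(1)] by simp
      next
        case (Suc j)
        then show ?thesis using m(2) k(2)[of "lo w" j] LK[of j] by auto
      qed
      have eqlo: "kd ys (k (lo w)) \<oplus>\<^bsub>M\<^esub> k (kd ys (lo w)) = x \<odot>\<^bsub>M\<^esub> lo w"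
        using m(2) k(3) k0 D(11) x by (cases i) auto
      have eqhi: "kd ys (k (hi w)) \<oplus>\<^bsub>M\<^esub> k (kd ys (hi w)) = x \<odot>\<^bsub>M\<^esub> hi w" by (rule k(3)[OF m(3)])
      have e1: "k (kd ys (lo w) \<oplus>\<^bsub>M\<^esub> y \<odot>\<^bsub>M\<^esub> hi w) = k (kd ys (lo w)) \<oplus>\<^bsub>M\<^esub> y \<odot>\<^bsub>M\<^esub> k (hi w)"
        using kl(2)[OF dlo yh] kl(3)[OF y m(3)] by simp
      have e2: "k (\<ominus>\<^bsub>M\<^esub> kd ys (hi w)) = \<ominus>\<^bsub>M\<^esub> k (kd ys (hi w))"
        by (rule linear_on_basics(2)[OF module_axioms module_axioms submodule_koszul_gr k(1) dhi])
      have e3: "kd ys (\<ominus>\<^bsub>M\<^esub> k (hi w)) = \<ominus>\<^bsub>M\<^esub> kd ys (k (hi w))" by (rule D(9)[OF khi(2)])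
      have cs: "kd ys (k (lo w)) \<in> carrier M" "kd ys (k (hi w)) \<in> carrier M"
        "k (kd ys (lo w)) \<in> carrier M" "k (kd ys (hi w)) \<in> carrier M"
        using D(6)[OF kloE] D(6)[OF khi(2)] kl(1)[OF dlo] kl(1)[OF dhi] by auto
      have c: "koszul_diff y (kd ys) (h w) \<in> carrier M" "h (koszul_diff y (kd ys) w) \<in> carrier M"
        using cs klo khi(1) y by (auto simp: koszul_diff_def h_def e1 e2 e3 intro!: join_closed)
      have alg: "(p \<oplus>\<^bsub>M\<^esub> y \<odot>\<^bsub>M\<^esub> (\<ominus>\<^bsub>M\<^esub> q)) \<oplus>\<^bsub>M\<^esub> (r \<oplus>\<^bsub>M\<^esub> y \<odot>\<^bsub>M\<^esub> q) = p \<oplus>\<^bsub>M\<^esub> r"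
        if "p \<in> carrier M" "q \<in> carrier M" "r \<in> carrier M" for p q r
        using that y by algebra
      show ?thesis
      proof (rule pair_eqI)
        have "lo (koszul_diff y (kd ys) (h w) \<oplus>\<^bsub>M\<^esub> h (koszul_diff y (kd ys) w)) =
            kd ys (k (lo w)) \<oplus>\<^bsub>M\<^esub> k (kd ys (lo w))"
          unfolding lo(2)[OF c] using alg[OF cs(1) khi(1) cs(3)] by (simp add: h_def e1)
        then show "lo (koszul_diff y (kd ys) (h w) \<oplus>\<^bsub>M\<^esub> h (koszul_diff y (kd ys) w)) = lo (x \<odot>\<^bsub>M\<^esub> w)"
          using eqlo lo(3)[OF x m(1)] by simp
        have "hi (koszul_diff y (kd ys) (h w) \<oplus>\<^bsub>M\<^esub> h (koszul_diff y (kd ys) w)) =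
            kd ys (k (hi w)) \<oplus>\<^bsub>M\<^esub> k (kd ys (hi w))"
          unfolding hi(2)[OF c] using cs by (simp add: h_def e2 e3)
        then show "hi (koszul_diff y (kd ys) (h w) \<oplus>\<^bsub>M\<^esub> h (koszul_diff y (kd ys) w)) = hi (x \<odot>\<^bsub>M\<^esub> w)"
          using eqhi hi(3)[OF x m(1)] by simp
      qed
    qed
    then show ?thesis
      by (intro exI[of _ h] allI conjI lin ballI deg) (simp_all only: koszul_diffs_simps)
  qed
qed simp

lemma koszul_annihilated:
  assumes xs: "set xs \<subseteq> carrier R" "x \<in> set xs"
    and z: "z \<in> koszul_gr E (length xs) i" "kd xs z = \<zero>\<^bsub>M\<^esub>"
  shows "x \<odot>\<^bsub>M\<^esub> z \<in> (case i of 0 \<Rightarrow> {\<zero>\<^bsub>M\<^esub>} | Suc j \<Rightarrow> kd xs ` koszul_gr E (length xs) j)"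
proof -
  obtain h where h: "\<And>i. linear_on R M (koszul_gr E (length xs) i) M h"
    "\<And>i w. w \<in> koszul_gr E (length xs) i \<Longrightarrow>
      h w \<in> (case i of 0 \<Rightarrow> {\<zero>\<^bsub>M\<^esub>} | Suc j \<Rightarrow> koszul_gr E (length xs) j)"
    "\<And>i w. w \<in> koszul_gr E (length xs) i \<Longrightarrow> kd xs (h w) \<oplus>\<^bsub>M\<^esub> h (kd xs w) = x \<odot>\<^bsub>M\<^esub> w"
    using koszul_homotopy[OF xs] by blast
  have "h \<zero>\<^bsub>M\<^esub> = \<zero>\<^bsub>M\<^esub>"
    by (rule linear_on_basics(1)[OF module_axioms module_axioms submodule_koszul_gr h(1)])
  moreover have "h z \<in> (koszul ^^ length xs) E"
    using h(2)[OF z(1)] koszul_gr_subset submoduleD(3)[OF submodule_koszul_power]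
    by (cases i) auto
  ultimately have "x \<odot>\<^bsub>M\<^esub> z = kd xs (h z)"
    using h(3)[OF z(1)] z(2) dmodD(6)[OF dmod_kd[OF xs(1)]] by simp
  then show ?thesis
    using h(2)[OF z(1)] dmodD(11)[OF dmod_kd[OF xs(1)]] by (cases i) auto
qed

text \<open>The filtration by the parts of degree at least \<open>i\<close> is used instead of a sum of homogeneous
  components: splitting off the lowest component of a cycle leaves a cycle of higher degree.\<close>

lemma fg_homology_if_graded:
  assumes xs: "set xs \<subseteq> carrier R"
    and fg: "\<And>i. fg_over R M (case i of 0 \<Rightarrow> {\<zero>\<^bsub>M\<^esub>} | Suc j \<Rightarrow> kd xs ` koszul_gr E (length xs) j)
      {z \<in> koszul_gr E (length xs) i. kd xs z = \<zero>\<^bsub>M\<^esub>}"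
  shows "fg_homology ((koszul ^^ length xs) E) (kd xs)"
proof -
  let ?n = "length xs"
  let ?K = "(koszul ^^ ?n) E"
  let ?B = "kd xs ` ?K"
  note K = dmod_kd[OF xs] and D = dmodD[OF dmod_kd[OF xs]]
  have ex: "\<exists>S. finite S \<and> S \<subseteq> cycles ?K (kd xs) \<and> (\<forall>H. submodule H R M \<longrightarrow> S \<subseteq> H \<longrightarrow> ?B \<subseteq> H \<longrightarrow>
      cycles ?K (kd xs) \<inter> koszul_tail E ?n i \<subseteq> H)" if "i + k = Suc ?n" for i k
    using that
  proof (induction k arbitrary: i)
    case 0
    then show ?case
      using koszul_tail_beyond[of ?n i] submoduleD(3) by (intro exI[of _ "{}"]) auto
  next
    case (Suc k)
    let ?Z = "{z \<in> koszul_gr E ?n i. kd xs z = \<zero>\<^bsub>M\<^esub>}"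
    have "(case i of 0 \<Rightarrow> {\<zero>\<^bsub>M\<^esub>} | Suc j \<Rightarrow> kd xs ` koszul_gr E ?n j) \<subseteq> ?B"
      using koszul_gr_subset submoduleD(3)[OF submodule_boundaries[OF K]] by (cases i) auto
    from fg_over_mono[OF fg[of i] this]
    obtain S where S: "finite S" "S \<subseteq> ?Z" "\<And>H. submodule H R M \<Longrightarrow> S \<subseteq> H \<Longrightarrow> ?B \<subseteq> H \<Longrightarrow> ?Z \<subseteq> H"
      by (rule fg_overE) blast
    obtain T where T: "finite T" "T \<subseteq> cycles ?K (kd xs)"
      "\<And>H. submodule H R M \<Longrightarrow> T \<subseteq> H \<Longrightarrow> ?B \<subseteq> H \<Longrightarrow> cycles ?K (kd xs) \<inter> koszul_tail E ?n (Suc i) \<subseteq> H"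
      using Suc.IH[of "Suc i"] Suc.prems by auto
    have "cycles ?K (kd xs) \<inter> koszul_tail E ?n i \<subseteq> H"
      if H: "submodule H R M" "S \<union> T \<subseteq> H" "?B \<subseteq> H" for H
    proof
      have SH: "?Z \<subseteq> H" by (rule S(3)[OF H(1) _ H(3)]) (use H(2) in simp)
      have TH: "cycles ?K (kd xs) \<inter> koszul_tail E ?n (Suc i) \<subseteq> H"
        by (rule T(3)[OF H(1) _ H(3)]) (use H(2) in simp)
      fix z assume z: "z \<in> cycles ?K (kd xs) \<inter> koszul_tail E ?n i"
      then obtain a b where ab: "a \<in> koszul_gr E ?n i" "b \<in> koszul_tail E ?n (Suc i)" "z = a \<oplus>\<^bsub>M\<^esub> b"
        using koszul_tail_split by blast
      have zK: "z \<in> ?K" "kd xs z = \<zero>\<^bsub>M\<^esub>" using z by (auto simp: cycles_def)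
      have aK: "a \<in> ?K" using ab(1) koszul_gr_subset by blast
      have c: "a \<in> carrier M" "b \<in> carrier M"
        using D(3)[OF aK] submoduleD(2)[OF submodule_koszul_tail ab(2)] by auto
      have "b = z \<ominus>\<^bsub>M\<^esub> a" unfolding ab(3) using c by algebra
      then have bK: "b \<in> ?K" using submoduleD(7)[OF D(1) zK(1) aK] by simp
      have sum: "kd xs a \<oplus>\<^bsub>M\<^esub> kd xs b = \<zero>\<^bsub>M\<^esub>" using zK(2) D(7)[OF aK bK] ab(3) by simp
      have dc: "kd xs a \<in> carrier M" "kd xs b \<in> carrier M" using D(6) aK bK by auto
      have "kd xs a = \<ominus>\<^bsub>M\<^esub> kd xs b" using sum dc by (metis M.minus_equality)
      moreover have "\<ominus>\<^bsub>M\<^esub> kd xs b \<in> koszul_tail E ?n (Suc (Suc i))"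
        using submoduleD(6)[OF submodule_koszul_tail koszul_tail_diff[OF xs ab(2)]] .
      ultimately have da: "kd xs a = \<zero>\<^bsub>M\<^esub>"
        using koszul_gr_Int_tail[of ?n "Suc i"] koszul_gr_diff[OF xs ab(1)] by auto
      then have "kd xs b = \<zero>\<^bsub>M\<^esub>" using sum dc by simp
      then have "b \<in> H" using TH bK ab(2) by (auto simp: cycles_def)
      moreover have "a \<in> H" using SH ab(1) da by auto
      ultimately show "z \<in> H" using submoduleD(4)[OF H(1)] ab(3) by simp
    qed
    moreover have "S \<subseteq> cycles ?K (kd xs)" using S(2) koszul_gr_subset by (auto simp: cycles_def)
    ultimately show ?case using S(1) T(1,2) by (intro exI[of _ "S \<union> T"]) auto
  qed
  obtain S where S: "finite S" "S \<subseteq> cycles ?K (kd xs)"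
    "\<And>H. submodule H R M \<Longrightarrow> S \<subseteq> H \<Longrightarrow> ?B \<subseteq> H \<Longrightarrow> cycles ?K (kd xs) \<inter> koszul_tail E ?n 0 \<subseteq> H"
    using ex[of 0 "Suc ?n"] by auto
  show ?thesis
    unfolding fg_homology_def
  proof (rule fg_overI[OF S(1,2)])
    fix H assume "submodule H R M" "S \<subseteq> H" "?B \<subseteq> H"
    from S(3)[OF this] show "cycles ?K (kd xs) \<subseteq> H"
      by (auto simp: koszul_tail_0 cycles_def)
  qed
qed

end

end

text \<open>Cohomology commutes with the direct sum of \<open>A\<close> and \<open>B\<close>.\<close>

lemma (in pairing_module) fg_cohomology_pairs:
  assumes "free_complex R S bnd" and A: "submodule A R M" and B: "submodule B R M"
    and coh: "free_complex.fg_cohomology R S bnd M A" "free_complex.fg_cohomology R S bnd M B"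
  shows "free_complex.fg_cohomology R S bnd M (pairs A B)"
proof -
  interpret C: free_complex R S bnd by fact
  interpret F: module R "fun_module M :: ('a, _ \<Rightarrow> 'c) module" by (rule module_fun_module[OF module_axioms])
  note M = module_axioms
  note AD = submoduleD[OF A] and BD = submoduleD[OF B]
  define \<alpha> where "\<alpha> v = join v \<zero>\<^bsub>M\<^esub>" for v
  define \<beta> where "\<beta> v = join \<zero>\<^bsub>M\<^esub> v" for v
  have closed: "\<alpha> v \<in> carrier M" "\<beta> v \<in> carrier M" if "v \<in> carrier M" for v
    using that by (auto simp: \<alpha>_def \<beta>_def intro: join_closed)
  have lin: "linear_on R M (carrier M) M \<alpha>" "linear_on R M (carrier M) M \<beta>"
    by (rule linear_onI;
        (rule closed, assumption)?;
        rule pair_eqI; simp add: lo(2,3) hi(2,3) closed; simp add: \<alpha>_def \<beta>_def)+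
  have zero: "\<alpha> \<zero>\<^bsub>M\<^esub> = \<zero>\<^bsub>M\<^esub>" "\<beta> \<zero>\<^bsub>M\<^esub> = \<zero>\<^bsub>M\<^esub>" by (simp_all add: \<alpha>_def \<beta>_def)
  have into: "v \<in> A \<Longrightarrow> \<alpha> v \<in> pairs A B" "v \<in> B \<Longrightarrow> \<beta> v \<in> pairs A B" for v
    unfolding \<alpha>_def \<beta>_def using join_in_pairs[OF A B] AD(3) BD(3) by auto
  (* The two inclusions of A and B into the pairs are handled together as \<iota>. *)
  have part: "\<exists>T. finite T \<and> T \<subseteq> C.cocycles M j (pairs A B) \<and>
      (\<forall>H. submodule H R (fun_module M) \<longrightarrow> T \<subseteq> H \<longrightarrow> C.coboundaries M j (pairs A B) \<subseteq> H \<longrightarrow>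
        (\<forall>g\<in>C.cocycles M j X. (\<lambda>t. \<iota> (g t)) \<in> H))"
    if X: "submodule X R M" and cohX: "C.fg_cohomology M X" and \<iota>: "linear_on R M (carrier M) M \<iota>"
      and \<iota>0: "\<iota> \<zero>\<^bsub>M\<^esub> = \<zero>\<^bsub>M\<^esub>" and \<iota>X: "\<And>v. v \<in> X \<Longrightarrow> \<iota> v \<in> pairs A B" for X \<iota> j
  proof -
    let ?D = "\<lambda>g t. \<iota> (g t)"
    note \<iota>' = linear_on_subset[OF \<iota> submoduleD(1)[OF X]]
    have coch: "?D g \<in> C.cochains M i (pairs A B)" if "g \<in> C.cochains M i X" for g i
      using that \<iota>X \<iota>0 by (auto simp: C.cochains_def)
    have cocyc: "?D g \<in> C.cocycles M i (pairs A B)" if g: "g \<in> C.cocycles M i X" for g i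
      using coch C.coboundary_natural[OF M M X \<iota>', of g i] g \<iota>0
      by (simp add: C.cocycles_def)
    have cob: "?D g \<in> C.coboundaries M i (pairs A B)" if g: "g \<in> C.coboundaries M i X" for g i
    proof (cases i)
      case 0
      then show ?thesis using g \<iota>0 by auto
    next
      case (Suc k)
      then obtain h where h: "h \<in> C.cochains M k X" "g = C.coboundary M k h" using g by auto
      then have "?D g = C.coboundary M k (?D h)" using C.coboundary_natural[OF M M X \<iota>' h(1)] by simp
      then show ?thesis using Suc coch[OF h(1)] by simp
    qed
    obtain T where T: "finite T" "T \<subseteq> C.cocycles M j X"
      "\<And>H. submodule H R (fun_module M) \<Longrightarrow> T \<subseteq> H \<Longrightarrow> C.coboundaries M j X \<subseteq> H \<Longrightarrow> C.cocycles M j X \<subseteq> H"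
      using cohX[unfolded C.fg_cohomology_def, rule_format, of j] by (rule F.fg_overE) blast
    show ?thesis
    proof (intro exI[of _ "?D ` T"] conjI allI impI ballI)
      show "finite (?D ` T)" using T(1) by simp
      show "?D ` T \<subseteq> C.cocycles M j (pairs A B)" using T(2) cocyc by blast
      fix H g assume H: "submodule H R (fun_module M)" "?D ` T \<subseteq> H" "C.coboundaries M j (pairs A B) \<subseteq> H"
        and g: "g \<in> C.cocycles M j X"
      note Zs = C.submodule_cocycles[OF M X, of j]
      have D: "linear_on R (fun_module M) (C.cocycles M j X) (fun_module M) ?D"
        by (rule linear_onI)
          (use linear_onD[OF \<iota>] F.submoduleD(2)[OF Zs] in \<open>auto simp: fun_module_simps\<close>)
      have "C.cocycles M j X \<subseteq> {g \<in> C.cocycles M j X. ?D g \<in> H}"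
      proof (rule T(3)[OF submodule_vimage[OF F.module_axioms F.module_axioms Zs D H(1)]])
        show "T \<subseteq> {g \<in> C.cocycles M j X. ?D g \<in> H}" using T(2) H(2) by blast
        show "C.coboundaries M j X \<subseteq> {g \<in> C.cocycles M j X. ?D g \<in> H}"
          using C.coboundaries_sub_cocycles[OF M X, of j] cob H(3) by blast
      qed
      then show "?D g \<in> H" using g by blast
    qed
  qed
  show ?thesis
    unfolding C.fg_cohomology_def
  proof
    fix j
    obtain T1 where T1: "finite T1" "T1 \<subseteq> C.cocycles M j (pairs A B)"
      "\<And>H g. submodule H R (fun_module M) \<Longrightarrow> T1 \<subseteq> H \<Longrightarrow> C.coboundaries M j (pairs A B) \<subseteq> H \<Longrightarrow>
        g \<in> C.cocycles M j A \<Longrightarrow> (\<lambda>t. \<alpha> (g t)) \<in> H"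
      using part[OF A coh(1) lin(1) zero(1) into(1), of j] by auto
    obtain T2 where T2: "finite T2" "T2 \<subseteq> C.cocycles M j (pairs A B)"
      "\<And>H g. submodule H R (fun_module M) \<Longrightarrow> T2 \<subseteq> H \<Longrightarrow> C.coboundaries M j (pairs A B) \<subseteq> H \<Longrightarrow>
        g \<in> C.cocycles M j B \<Longrightarrow> (\<lambda>t. \<beta> (g t)) \<in> H"
      using part[OF B coh(2) lin(2) zero(2) into(2), of j] by auto
    show "fg_over R (fun_module M) (C.coboundaries M j (pairs A B)) (C.cocycles M j (pairs A B))"
    proof (rule F.fg_overI[of "T1 \<union> T2"])
      show "finite (T1 \<union> T2)" "T1 \<union> T2 \<subseteq> C.cocycles M j (pairs A B)" using T1 T2 by auto
      fix H assume H: "submodule H R (fun_module M)" "T1 \<union> T2 \<subseteq> H" "C.coboundaries M j (pairs A B) \<subseteq> H"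
      show "C.cocycles M j (pairs A B) \<subseteq> H"
      proof
        fix g assume g: "g \<in> C.cocycles M j (pairs A B)"
        then have gc: "g \<in> C.cochains M j (pairs A B)" "C.coboundary M j g = (\<lambda>_. \<zero>\<^bsub>M\<^esub>)"
          by (auto simp: C.cocycles_def)
        have P: "submodule (pairs A B) R M" by (rule submodule_pairs[OF A B])
        have lin': "linear_on R M (pairs A B) M lo" "linear_on R M (pairs A B) M hi"
          using linear_on_subset[OF lo_linear submoduleD(1)[OF P]]
            linear_on_subset[OF hi_linear submoduleD(1)[OF P]] by auto
        have "C.coboundary M j (\<lambda>t. lo (g t)) = (\<lambda>_. \<zero>\<^bsub>M\<^esub>)" "C.coboundary M j (\<lambda>t. hi (g t)) = (\<lambda>_. \<zero>\<^bsub>M\<^esub>)"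
          using C.coboundary_natural[OF M M P lin'(1) gc(1)] C.coboundary_natural[OF M M P lin'(2) gc(1)]
          unfolding gc(2) by simp_all
        moreover have "(\<lambda>t. lo (g t)) \<in> C.cochains M j A" "(\<lambda>t. hi (g t)) \<in> C.cochains M j B"
          using gc(1) by (auto simp: C.cochains_def pairs_def)
        ultimately have "(\<lambda>t. \<alpha> (lo (g t))) \<in> H" "(\<lambda>t. \<beta> (hi (g t))) \<in> H"
          using T1(3)[OF H(1), of "\<lambda>t. lo (g t)"] T2(3)[OF H(1), of "\<lambda>t. hi (g t)"] H
          by (auto simp: C.cocycles_def)
        then have "(\<lambda>t. \<alpha> (lo (g t))) \<oplus>\<^bsub>fun_module M\<^esub> (\<lambda>t. \<beta> (hi (g t))) \<in> H"
          by (rule F.submoduleD(4)[OF H(1)])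
        moreover have "\<alpha> (lo v) \<oplus>\<^bsub>M\<^esub> \<beta> (hi v) = v" if "v \<in> carrier M" for v
          by (rule pair_eqI; simp add: lo(1,2) hi(1,2) closed that; simp add: \<alpha>_def \<beta>_def lo(1) hi(1) that)
        then have "(\<lambda>t. \<alpha> (lo (g t))) \<oplus>\<^bsub>fun_module M\<^esub> (\<lambda>t. \<beta> (hi (g t))) = g"
          using C.cochains_val[OF M P gc(1)] by (auto simp: fun_module_simps pairs_def)
        ultimately show "g \<in> H" by simp
      qed
    qed
  qed
qed

lemma (in pairing_module) fg_cohomology_koszul_gr:
  assumes C: "free_complex R S bnd" and E: "submodule E R M"
    and coh: "free_complex.fg_cohomology R S bnd M E"
  shows "free_complex.fg_cohomology R S bnd M (koszul_gr E n i)"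
proof (induction n arbitrary: i)
  case 0
  then show ?case using coh free_complex.fg_cohomology_zero[OF C module_axioms] by simp
next
  case (Suc n)
  then show ?case
    using free_complex.fg_cohomology_zero[OF C module_axioms] submodule_zero submodule_koszul_gr[OF E]
    by (auto intro!: fg_cohomology_pairs[OF C] split: nat.split)
qed

text \<open>The elements \<open>bnd t e\<close> are the ones by which the first differential of the resolution
  multiplies. They occur in \<open>xs\<close>, so they act as zero on the Koszul homology, and therefore the
  cohomology of the latter in degree 0 is all of it.\<close>

theorem (in pairing_module) fg_homology_koszul:
  assumes noeth: "noetherian_ring R" and C: "free_complex R S bnd" and S0: "S 0 = {e}"
    and xs: "set xs \<subseteq> carrier R" "\<And>t. t \<in> S 1 \<Longrightarrow> bnd t e \<in> set xs"
    and E: "submodule E R M" and coh: "free_complex.fg_cohomology R S bnd M E"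
  shows "fg_homology ((koszul ^^ length xs) E) (koszul_diffs xs (\<lambda>_. \<zero>\<^bsub>M\<^esub>))"
proof (rule fg_homology_if_graded[OF E xs(1)])
  fix i
  let ?d = "koszul_diffs xs (\<lambda>_. \<zero>\<^bsub>M\<^esub>)"
  note D = dmodD[OF dmod_kd[OF E xs(1)]]
  show "fg_over R M (case i of 0 \<Rightarrow> {\<zero>\<^bsub>M\<^esub>} | Suc j \<Rightarrow> ?d ` koszul_gr E (length xs) j)
      {z \<in> koszul_gr E (length xs) i. ?d z = \<zero>\<^bsub>M\<^esub>}"
  proof (rule free_complex.fg_homology_of_complex[OF C noeth module_axioms S0])
    fix i
    show "submodule (koszul_gr E (length xs) i) R M" by (rule submodule_koszul_gr[OF E])
    show "linear_on R M (koszul_gr E (length xs) i) M ?d"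
      by (rule linear_on_subset[OF D(2) koszul_gr_subset[OF E]])
    show "free_complex.fg_cohomology R S bnd M (koszul_gr E (length xs) i)"
      by (rule fg_cohomology_koszul_gr[OF C E coh])
    fix k assume k: "k \<in> koszul_gr E (length xs) i"
    show "?d k \<in> koszul_gr E (length xs) (Suc i)" by (rule koszul_gr_diff[OF E xs(1) k])
    show "?d (?d k) = \<zero>\<^bsub>M\<^esub>" using D(5) k koszul_gr_subset[OF E] by blast
    fix t assume "t \<in> S 1" "?d k = \<zero>\<^bsub>M\<^esub>"
    then show "bnd t e \<odot>\<^bsub>M\<^esub> k \<in> (case i of 0 \<Rightarrow> {\<zero>\<^bsub>M\<^esub>} | Suc j \<Rightarrow> ?d ` koszul_gr E (length xs) j)"
      using koszul_annihilated[OF E xs(1) _ k] xs(2) by blast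
  qed
qed

section \<open>Quotient modules and modules of homomorphisms\<close>

context module
begin

context
  fixes H assumes H: "submodule H R M"
begin

interpretation H: abelian_subgroup H M
  by (rule abelian_subgroupI3[OF additive_subgroupI[OF submodule.axioms(1)[OF H]] M.abelian_group_axioms])

lemma quot_module_carrier: "carrier (quot_module M H) = {H +>\<^bsub>M\<^esub> x | x. x \<in> carrier M}"
  by (auto simp: quot_module_def A_RCOSETS_def')

lemma quot_module_zero: "\<zero>\<^bsub>quot_module M H\<^esub> = H" "H = H +>\<^bsub>M\<^esub> \<zero>\<^bsub>M\<^esub>"
  using submoduleD(1)[OF H] by (simp_all add: quot_module_def)

lemma quot_module_add:
  "x \<in> carrier M \<Longrightarrow> y \<in> carrier M \<Longrightarrow>
    (H +>\<^bsub>M\<^esub> x) \<oplus>\<^bsub>quot_module M H\<^esub> (H +>\<^bsub>M\<^esub> y) = H +>\<^bsub>M\<^esub> (x \<oplus>\<^bsub>M\<^esub> y)"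
  by (simp add: quot_module_def H.a_rcos_sum)

lemma coset_mem_iff: "x \<in> carrier M \<Longrightarrow> y \<in> H +>\<^bsub>M\<^esub> x \<longleftrightarrow> (\<exists>h\<in>H. y = h \<oplus>\<^bsub>M\<^esub> x)"
  by (auto simp: a_r_coset_def')

lemma coset_eq_iff:
  assumes "x \<in> carrier M" "y \<in> carrier M"
  shows "H +>\<^bsub>M\<^esub> x = H +>\<^bsub>M\<^esub> y \<longleftrightarrow> x \<ominus>\<^bsub>M\<^esub> y \<in> H"
proof
  assume "H +>\<^bsub>M\<^esub> x = H +>\<^bsub>M\<^esub> y"
  moreover have "x \<in> H +>\<^bsub>M\<^esub> x" by (rule H.a_rcos_self[OF assms(1)])
  ultimately obtain h where h: "h \<in> H" "x = h \<oplus>\<^bsub>M\<^esub> y" using coset_mem_iff[OF assms(2)] by blast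
  have "h \<in> carrier M" using submoduleD(2)[OF H h(1)] .
  then have "x \<ominus>\<^bsub>M\<^esub> y = h" unfolding h(2) using assms by algebra
  then show "x \<ominus>\<^bsub>M\<^esub> y \<in> H" using h by simp
next
  assume d: "x \<ominus>\<^bsub>M\<^esub> y \<in> H"
  have "x = (x \<ominus>\<^bsub>M\<^esub> y) \<oplus>\<^bsub>M\<^esub> y" using assms by algebra
  then have "x \<in> H +>\<^bsub>M\<^esub> y" using d coset_mem_iff[OF assms(2)] by blast
  then show "H +>\<^bsub>M\<^esub> x = H +>\<^bsub>M\<^esub> y" using H.a_repr_independence' assms by metis
qed

lemma quot_module_smult:
  assumes r: "r \<in> carrier R" and x: "x \<in> carrier M"
  shows "r \<odot>\<^bsub>quot_module M H\<^esub> (H +>\<^bsub>M\<^esub> x) = H +>\<^bsub>M\<^esub> (r \<odot>\<^bsub>M\<^esub> x)"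
proof -
  have const: "H +>\<^bsub>M\<^esub> (r \<odot>\<^bsub>M\<^esub> y) = H +>\<^bsub>M\<^esub> (r \<odot>\<^bsub>M\<^esub> x)" if "y \<in> H +>\<^bsub>M\<^esub> x" for y
  proof -
    obtain h where h: "h \<in> H" "y = h \<oplus>\<^bsub>M\<^esub> x" using \<open>y \<in> _\<close> coset_mem_iff[OF x] by blast
    have hc: "h \<in> carrier M" using submoduleD(2)[OF H h(1)] .
    have "r \<odot>\<^bsub>M\<^esub> y \<ominus>\<^bsub>M\<^esub> r \<odot>\<^bsub>M\<^esub> x = r \<odot>\<^bsub>M\<^esub> h" unfolding h(2) using hc r x by algebra
    then show ?thesis using coset_eq_iff[of "r \<odot>\<^bsub>M\<^esub> y" "r \<odot>\<^bsub>M\<^esub> x"] submoduleD(5)[OF H r h(1)] hc h(2) r x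
      by simp
  qed
  have "(\<Union>y\<in>H +>\<^bsub>M\<^esub> x. H +>\<^bsub>M\<^esub> (r \<odot>\<^bsub>M\<^esub> y)) = H +>\<^bsub>M\<^esub> (r \<odot>\<^bsub>M\<^esub> x)"
  proof (rule SUP_eq_const)
    show "H +>\<^bsub>M\<^esub> x \<noteq> {}" using H.a_rcos_self[OF x] by blast
  qed (rule const)
  then show ?thesis by (simp add: quot_module_def)
qed

lemma module_quot_module: "module R (quot_module M H)"
proof (rule moduleI[OF R.is_cring])
  note c = quot_module_carrier and S = quot_module_add quot_module_smult
  show "abelian_group (quot_module M H)"
  proof (rule abelian_groupI)
    fix X assume "X \<in> carrier (quot_module M H)"
    then obtain x where x: "x \<in> carrier M" "X = H +>\<^bsub>M\<^esub> x" unfolding c by blast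
    show "\<zero>\<^bsub>quot_module M H\<^esub> \<oplus>\<^bsub>quot_module M H\<^esub> X = X"
      unfolding quot_module_zero(1) x(2) using quot_module_zero(2) quot_module_add[of "\<zero>\<^bsub>M\<^esub>" x] x(1)
      by simp
    have "(H +>\<^bsub>M\<^esub> (\<ominus>\<^bsub>M\<^esub> x)) \<oplus>\<^bsub>quot_module M H\<^esub> X = \<zero>\<^bsub>quot_module M H\<^esub>"
      unfolding x(2) quot_module_zero(1)
      using quot_module_zero(2) quot_module_add[of "\<ominus>\<^bsub>M\<^esub> x" x] x(1) by (simp add: M.l_neg)
    then show "\<exists>Y\<in>carrier (quot_module M H). Y \<oplus>\<^bsub>quot_module M H\<^esub> X = \<zero>\<^bsub>quot_module M H\<^esub>"
      unfolding c using x(1) by blast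
  next
    show "\<zero>\<^bsub>quot_module M H\<^esub> \<in> carrier (quot_module M H)"
      unfolding c quot_module_zero(1) using quot_module_zero(2) by blast
  qed (unfold c, auto simp: S M.a_ac)
qed (unfold quot_module_carrier,
    auto simp: quot_module_add quot_module_smult smult_l_distr smult_r_distr smult_assoc1)

lemma fg_over_if_fin_gen_quot:
  assumes "fin_gen_module R (quot_module M H)" shows "fg_over R M H (carrier M)"
proof -
  note Q = module_quot_module
  interpret Q: module R "quot_module M H" by (rule Q)
  obtain T where T: "T \<subseteq> carrier (quot_module M H)" "finite T"
    "\<And>L. submodule L R (quot_module M H) \<Longrightarrow> T \<subseteq> L \<Longrightarrow> L = carrier (quot_module M H)"
    using assms unfolding fin_gen_module_def by blast
  have "\<forall>X\<in>T. \<exists>x. x \<in> carrier M \<and> X = H +>\<^bsub>M\<^esub> x" using T(1) unfolding quot_module_carrier by blast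
  then obtain \<rho> where \<rho>: "\<And>X. X \<in> T \<Longrightarrow> \<rho> X \<in> carrier M" "\<And>X. X \<in> T \<Longrightarrow> X = H +>\<^bsub>M\<^esub> \<rho> X" by metis
  have coset: "linear_on R M (carrier M) (quot_module M H) (\<lambda>x. H +>\<^bsub>M\<^esub> x)"
    by (rule linear_onI) (auto simp: quot_module_carrier quot_module_add quot_module_smult)
  show ?thesis
  proof (rule fg_overI[of "\<rho> ` T"])
    show "finite (\<rho> ` T)" "\<rho> ` T \<subseteq> carrier M" using T(2) \<rho>(1) by auto
    fix L assume L: "submodule L R M" "\<rho> ` T \<subseteq> L" "H \<subseteq> L"
    note LD = submoduleD[OF L(1)]
    have "submodule ((\<lambda>x. H +>\<^bsub>M\<^esub> x) ` L) R (quot_module M H)"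
      by (rule submodule_image[OF module_axioms Q L(1) linear_on_subset[OF coset LD(1)]])
    moreover have "T \<subseteq> (\<lambda>x. H +>\<^bsub>M\<^esub> x) ` L" using \<rho> L(2) by blast
    ultimately have eq: "(\<lambda>x. H +>\<^bsub>M\<^esub> x) ` L = carrier (quot_module M H)" by (rule T(3))
    show "carrier M \<subseteq> L"
    proof
      fix x assume x: "x \<in> carrier M"
      then have "H +>\<^bsub>M\<^esub> x \<in> (\<lambda>x. H +>\<^bsub>M\<^esub> x) ` L" unfolding eq quot_module_carrier by blast
      then obtain l where l: "l \<in> L" "H +>\<^bsub>M\<^esub> x = H +>\<^bsub>M\<^esub> l" by blast
      then have "x \<ominus>\<^bsub>M\<^esub> l \<in> L" using coset_eq_iff[OF x LD(2)[OF l(1)]] L(3) by blast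
      then have "(x \<ominus>\<^bsub>M\<^esub> l) \<oplus>\<^bsub>M\<^esub> l \<in> L" using LD(4) l(1) by blast
      moreover have "(x \<ominus>\<^bsub>M\<^esub> l) \<oplus>\<^bsub>M\<^esub> l = x" using x LD(2)[OF l(1)] by algebra
      ultimately show "x \<in> L" by simp
    qed
  qed
qed

end

end

lemma regular_module_simps:
  "carrier (regular_module R) = carrier R" "\<zero>\<^bsub>regular_module R\<^esub> = \<zero>\<^bsub>R\<^esub>"
  "x \<oplus>\<^bsub>regular_module R\<^esub> y = x \<oplus>\<^bsub>R\<^esub> y" "x \<odot>\<^bsub>regular_module R\<^esub> y = x \<otimes>\<^bsub>R\<^esub> y"
  by (simp_all add: regular_module_def)

lemma (in cring) module_regular_module: "module R (regular_module R)"
proof (rule moduleI[OF is_cring])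
  show "abelian_group (regular_module R)"
  proof (rule abelian_groupI)
    fix x assume "x \<in> carrier (regular_module R)"
    then show "\<exists>y\<in>carrier (regular_module R). y \<oplus>\<^bsub>regular_module R\<^esub> x = \<zero>\<^bsub>regular_module R\<^esub>"
      by (intro bexI[of _ "\<ominus> x"]) (auto simp: regular_module_simps l_neg)
  qed (auto simp: regular_module_simps a_ac)
qed (auto simp: regular_module_simps l_distr r_distr m_assoc)

lemma (in cring) submodule_regular_module:
  assumes "ideal I R" shows "submodule I R (regular_module R)"
proof -
  interpret ideal I R by fact
  show ?thesis
    by (rule module.submodule_intro[OF module_regular_module])
      (use a_subset I_l_closed in \<open>auto simp: regular_module_simps\<close>)
qed

lemma module_homD:
  assumes "f \<in> module_hom R N M"
  shows "\<And>x. x \<in> carrier N \<Longrightarrow> f x \<in> carrier M"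
    "\<And>x y. x \<in> carrier N \<Longrightarrow> y \<in> carrier N \<Longrightarrow> f (x \<oplus>\<^bsub>N\<^esub> y) = f x \<oplus>\<^bsub>M\<^esub> f y"
    "\<And>r x. r \<in> carrier R \<Longrightarrow> x \<in> carrier N \<Longrightarrow> f (r \<odot>\<^bsub>N\<^esub> x) = r \<odot>\<^bsub>M\<^esub> f x"
    "\<And>x. x \<notin> carrier N \<Longrightarrow> f x = undefined"
  using assms unfolding module_hom_def by (auto simp: PiE_def extensional_def)

lemma module_hom_linear: "f \<in> module_hom R N M \<Longrightarrow> linear_on R N (carrier N) M f"
  by (rule linear_onI) (auto dest: module_homD)

lemma linear_module_hom:
  "linear_on R N (carrier N) M f \<Longrightarrow> f \<in> extensional (carrier N) \<Longrightarrow> f \<in> module_hom R N M"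
  by (auto simp: module_hom_def linear_on_def PiE_def)

lemma hom_module_simps:
  "carrier (hom_module R N M) = module_hom R N M"
  "\<zero>\<^bsub>hom_module R N M\<^esub> = (\<lambda>x\<in>carrier N. \<zero>\<^bsub>M\<^esub>)"
  "f \<oplus>\<^bsub>hom_module R N M\<^esub> g = (\<lambda>x\<in>carrier N. f x \<oplus>\<^bsub>M\<^esub> g x)"
  "r \<odot>\<^bsub>hom_module R N M\<^esub> f = (\<lambda>x\<in>carrier N. r \<odot>\<^bsub>M\<^esub> f x)"
  by (simp_all add: hom_module_def)

lemma module_hom_module:
  assumes N: "module R N" and M: "module R M" shows "module R (hom_module R N M)"
proof -
  interpret N: module R N by fact
  interpret M: module R M by fact
  have mem: "(\<lambda>x\<in>carrier N. h x) \<in> module_hom R N M" if "linear_on R N (carrier N) M h" for h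
    by (rule linear_module_hom) (use linear_onD[OF that] in \<open>auto intro!: linear_onI\<close>)
  have add: "(\<lambda>x\<in>carrier N. f x \<oplus>\<^bsub>M\<^esub> g x) \<in> module_hom R N M"
    if "f \<in> module_hom R N M" "g \<in> module_hom R N M" for f g
    by (rule mem, rule linear_onI)
      (use module_homD(1-3)[OF that(1)] module_homD(1-3)[OF that(2)] in
        \<open>auto simp: M.smult_r_distr M.M.a_ac\<close>)
  have smult: "(\<lambda>x\<in>carrier N. r \<odot>\<^bsub>M\<^esub> f x) \<in> module_hom R N M"
    if "f \<in> module_hom R N M" "r \<in> carrier R" for f r
    by (rule mem, rule linear_onI)
      (use module_homD(1-3)[OF that(1)] that(2) in \<open>auto simp: M.smult_r_distr M.smult_lcomm\<close>)
  have neg: "(\<lambda>x\<in>carrier N. \<ominus>\<^bsub>M\<^esub> f x) \<in> module_hom R N M" if "f \<in> module_hom R N M" for f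
    by (rule mem, rule linear_onI)
      (use module_homD(1-3)[OF that(1)] in \<open>auto simp: M.smult_r_minus M.M.minus_add\<close>)
  have zero: "(\<lambda>x\<in>carrier N. \<zero>\<^bsub>M\<^esub>) \<in> module_hom R N M"
    by (rule mem, rule linear_onI) auto
  have ext: "f = g" if "f \<in> module_hom R N M" "g \<in> module_hom R N M"
      "\<And>x. x \<in> carrier N \<Longrightarrow> f x = g x" for f g
    using that(3) module_homD(4)[OF that(1)] module_homD(4)[OF that(2)] by (metis ext)
  have val: "f x \<in> carrier M" if "f \<in> module_hom R N M" "x \<in> carrier N" for f x
    by (rule module_homD(1)[OF that])
  show ?thesis
  proof (rule moduleI[OF N.R.is_cring])
    show "abelian_group (hom_module R N M)"
    proof (rule abelian_groupI; unfold hom_module_simps)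
      fix f assume f: "f \<in> module_hom R N M"
      show "\<exists>g\<in>module_hom R N M. (\<lambda>x\<in>carrier N. g x \<oplus>\<^bsub>M\<^esub> f x) = (\<lambda>x\<in>carrier N. \<zero>\<^bsub>M\<^esub>)"
        by (rule bexI[OF _ neg[OF f]]) (use val[OF f] in \<open>auto simp: fun_eq_iff M.M.l_neg\<close>)
      show "(\<lambda>x\<in>carrier N. (\<lambda>x\<in>carrier N. \<zero>\<^bsub>M\<^esub>) x \<oplus>\<^bsub>M\<^esub> f x) = f"
        by (rule ext[OF add[OF zero f] f]) (use val[OF f] in simp)
    qed (auto simp: fun_eq_iff M.M.a_ac val intro: add zero)
  next
    fix f assume "f \<in> carrier (hom_module R N M)"
    then have f: "f \<in> module_hom R N M" by (simp add: hom_module_simps)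
    show "\<one>\<^bsub>R\<^esub> \<odot>\<^bsub>hom_module R N M\<^esub> f = f"
      unfolding hom_module_simps by (rule ext[OF smult[OF f] f]) (use val[OF f] in auto)
  qed (unfold hom_module_simps, auto simp: fun_eq_iff M.smult_l_distr M.smult_r_distr M.smult_assoc1
      val intro: smult)
qed

section \<open>A finite part of the standard resolution\<close>

text \<open>Linear maps on a free module are determined by their values on the basis.\<close>

lemma free_linear_ext:
  assumes R: "cring R" and N: "module R N"
    and \<phi>: "linear_on R (free_module R X) (carrier (free_module R X)) N \<phi>"
    and \<psi>: "linear_on R (free_module R X) (carrier (free_module R X)) N \<psi>"
    and eq: "\<And>s. s \<in> X \<Longrightarrow> \<phi> (\<lambda>t. if t = s then \<one>\<^bsub>R\<^esub> else \<zero>\<^bsub>R\<^esub>) = \<psi> (\<lambda>t. if t = s then \<one>\<^bsub>R\<^esub> else \<zero>\<^bsub>R\<^esub>)"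
    and f: "f \<in> carrier (free_module R X)"
  shows "\<phi> f = \<psi> f"
proof -
  interpret cring R by fact
  interpret F: module R "free_module R X" by (rule module_free_module[OF R])
  have "\<phi> (lin_comb R xs) = \<psi> (lin_comb R xs)" if "set xs \<subseteq> X \<times> carrier R" for xs
    using that
  proof (induction xs)
    case Nil
    have "\<phi> \<zero>\<^bsub>free_module R X\<^esub> = \<psi> \<zero>\<^bsub>free_module R X\<^esub>"
      using linear_on_basics(1)[OF F.module_axioms N F.carrier_is_submodule] \<phi> \<psi> by metis
    then show ?case by (simp add: free_module_simps(2))
  next
    case (Cons p xs)
    obtain s r where p: "p = (s, r)" "s \<in> X" "r \<in> carrier R" using Cons.prems by auto
    let ?u = "\<lambda>t. if t = s then \<one>\<^bsub>R\<^esub> else \<zero>\<^bsub>R\<^esub>"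
    have u: "?u \<in> carrier (free_module R X)" by (rule unit_in_free_module[OF R p(2)])
    have xs: "lin_comb R xs \<in> carrier (free_module R X)" using lin_comb_closed[OF R] Cons.prems by auto
    have "lin_comb R (p # xs) = r \<odot>\<^bsub>free_module R X\<^esub> ?u \<oplus>\<^bsub>free_module R X\<^esub> lin_comb R xs"
      using p free_module_val[OF xs] by (auto simp: free_module_simps fun_eq_iff)
    then show ?case
      using linear_onD(2,3)[OF \<phi>] linear_onD(2,3)[OF \<psi>] p u xs eq[OF p(2)] Cons.IH Cons.prems
        F.smult_closed[OF p(3) u] by simp
  qed
  then show ?thesis using lin_comb_exists[OF R f] by blast
qed

lemma lin_ext_linear:
  assumes "module R N" "v \<in> X \<rightarrow> carrier N"
  shows "linear_on R (free_module R X) (carrier (free_module R X)) N (lin_ext R N v)"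
  using lin_ext_closed[OF assms] lin_ext_add[OF assms] lin_ext_smult[OF assms]
  by (auto intro!: linear_onI simp: free_module_simps(3,4))

lemma free_submodule:
  assumes "cring R" shows "submodule (carrier (free_module R X)) R (free_module R UNIV)"
proof -
  interpret U: module R "free_module R UNIV" by (rule module_free_module[OF assms])
  interpret X: module R "free_module R X" by (rule module_free_module[OF assms])
  show ?thesis
  proof (rule U.submodule_intro)
    show "carrier (free_module R X) \<subseteq> carrier (free_module R UNIV)" by (auto simp: free_module_simps)
    show "\<zero>\<^bsub>free_module R UNIV\<^esub> \<in> carrier (free_module R X)"
      using X.M.zero_closed by (simp only: free_module_simps(2))
    show "f \<oplus>\<^bsub>free_module R UNIV\<^esub> g \<in> carrier (free_module R X)"
      if "f \<in> carrier (free_module R X)" "g \<in> carrier (free_module R X)" for f g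
      using X.M.a_closed[OF that] by (simp only: free_module_simps(3))
    show "r \<odot>\<^bsub>free_module R UNIV\<^esub> g \<in> carrier (free_module R X)"
      if "r \<in> carrier R" "g \<in> carrier (free_module R X)" for r g
      using X.smult_closed[OF that] by (simp only: free_module_simps(4))
  qed
qed

lemma fg_over_free_module:
  assumes R: "cring R" and X: "finite X"
  shows "fg_over R (free_module R UNIV) {\<lambda>_. \<zero>\<^bsub>R\<^esub>} (carrier (free_module R X))"
proof -
  interpret cring R by fact
  interpret U: module R "free_module R UNIV" by (rule module_free_module[OF R])
  let ?u = "\<lambda>s t. if t = s then \<one>\<^bsub>R\<^esub> else \<zero>\<^bsub>R\<^esub>"
  show ?thesis
  proof (rule U.fg_overI[of "?u ` X"])
    show "finite (?u ` X)" using X by simp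
    show "?u ` X \<subseteq> carrier (free_module R X)"
      by (rule image_subsetI) (rule unit_in_free_module[OF R])
    fix H assume H: "submodule H R (free_module R UNIV)" "?u ` X \<subseteq> H"
    note HD = U.submoduleD[OF H(1)]
    have "lin_comb R xs \<in> H" if "set xs \<subseteq> X \<times> carrier R" for xs
      using that
    proof (induction xs)
      case Nil
      then show ?case using HD(3) by (simp add: free_module_simps(2))
    next
      case (Cons p xs)
      obtain s r where p: "p = (s, r)" "s \<in> X" "r \<in> carrier R" using Cons.prems by auto
      have xs: "lin_comb R xs \<in> carrier (free_module R X)" using lin_comb_closed[OF R] Cons.prems by auto
      have "lin_comb R (p # xs) = r \<odot>\<^bsub>free_module R UNIV\<^esub> ?u s \<oplus>\<^bsub>free_module R UNIV\<^esub> lin_comb R xs"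
        using p free_module_val[OF xs] by (auto simp: free_module_simps fun_eq_iff)
      then show ?case using HD(4,5) p H(2) Cons by auto
    qed
    then show "carrier (free_module R X) \<subseteq> H" using lin_comb_exists[OF R] by blast
  qed
qed

text \<open>The kernel of the differential, or of the augmentation in degree 0.\<close>

definition std_cycles ::
    "('a, 'r) ring_scheme \<Rightarrow> ('a, 'b, 'n) module_scheme \<Rightarrow> nat \<Rightarrow> (('a, 'b) syz \<Rightarrow> 'a) set"
  where "std_cycles R N j = {f \<in> carrier (std_free R N j).
    if j = 0 then std_aug R N f = \<zero>\<^bsub>N\<^esub> else std_diff R f = (\<lambda>_. \<zero>\<^bsub>R\<^esub>)}"

abbreviation (input) unit_vec :: "('a, 'r) ring_scheme \<Rightarrow> 's \<Rightarrow> 's \<Rightarrow> 'a"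
  where "unit_vec R s \<equiv> (\<lambda>t. if t = s then \<one>\<^bsub>R\<^esub> else \<zero>\<^bsub>R\<^esub>)"

abbreviation (input) std_bnd :: "('a, 'r) ring_scheme \<Rightarrow> ('a, 'b) syz \<Rightarrow> ('a, 'b) syz \<Rightarrow> 'a"
  where "std_bnd R \<equiv> (\<lambda>s. lin_comb R (rel_of s))"

lemma std_diff_image:
  assumes "module R N" shows "std_diff R ` carrier (std_free R N (Suc j)) = std_cycles R N j"
  using std_resolution(5,6)[OF assms] by (cases j) (auto simp: std_cycles_def std_free_def free_module_simps(2))

lemma std_basis_Suc:
  assumes R: "cring R"
  shows "std_basis R N (Suc j) =
    Syz ` {xs. set xs \<subseteq> std_basis R N j \<times> carrier R \<and> lin_comb R xs \<in> std_cycles R N j}"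
  using lin_comb_closed[OF R, of _ "std_basis R N j"]
  by (cases j) (auto simp: std_cycles_def std_free_def simp del: std_basis.simps(1) intro!: image_cong)

text \<open>Only \<open>N = R / I\<close> is needed; that it is generated by one element gives the finite part of its
  standard resolution a single basis element in degree 0.\<close>

locale cyclic_module = N: module R N for R :: "('a, 'r) ring_scheme" (structure)
  and N :: "('a, 'b, 'n) module_scheme" +
  fixes e :: 'b
  assumes gen: "e \<in> carrier N" "\<And>y. y \<in> carrier N \<Longrightarrow> \<exists>r\<in>carrier R. y = r \<odot>\<^bsub>N\<^esub> e"
begin

abbreviation U :: "('a, ('a, 'b) syz \<Rightarrow> 'a) module" where "U \<equiv> free_module R UNIV"
abbreviation free :: "('a, 'b) syz set \<Rightarrow> (('a, 'b) syz \<Rightarrow> 'a) set" where "free X \<equiv> carrier (free_module R X)"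

lemma module_U: "module R U" by (rule module_free_module[OF N.R.is_cring])

sublocale U: module R U by (rule module_U)

lemma free_mono: "X \<subseteq> Y \<Longrightarrow> free X \<subseteq> free Y"
  unfolding subset_iff free_module_simps(1) by blast

lemma sub_free: "submodule (free X) R U"
  by (rule free_submodule[OF N.R.is_cring])

lemma linear_U: "linear_on R (free_module R X) (free X) P f \<longleftrightarrow> linear_on R U (free X) P f"
  by (simp add: linear_on_def free_module_simps(3,4))

lemma aug_linear: "X \<subseteq> std_basis R N 0 \<Longrightarrow> linear_on R U (free X) N (std_aug R N)"
  unfolding std_aug_def linear_U[symmetric]
  by (rule lin_ext_linear[OF N.module_axioms]) auto

lemma bnd_closed:
  assumes "Y \<subseteq> Syz ` {xs. set xs \<subseteq> X \<times> carrier R}" "t \<in> Y"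
  shows "lin_comb R (rel_of t) \<in> free X"
  using rel_closed[OF N.R.is_cring assms(1)] assms(2) by auto

lemma basis_Suc_rel: "std_basis R N (Suc j) \<subseteq> Syz ` {xs. set xs \<subseteq> std_basis R N j \<times> carrier R}"
  unfolding std_basis_Suc[OF N.R.is_cring] by blast

lemma diff_linear:
  assumes "Y \<subseteq> Syz ` {xs. set xs \<subseteq> X \<times> carrier R}"
  shows "linear_on R U (free Y) U (std_diff R)" "f \<in> free Y \<Longrightarrow> std_diff R f \<in> free X"
proof -
  have b: "std_bnd R t \<in> free X" if "t \<in> Y" for t using bnd_closed[OF assms that] .
  have "std_bnd R \<in> Y \<rightarrow> carrier U" using b free_mono[of X UNIV] by auto
  from lin_ext_linear[OF module_U this] show "linear_on R U (free Y) U (std_diff R)"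
    by (simp only: std_diff_def linear_U)
  show "std_diff R f \<in> free X" if "f \<in> free Y"
    unfolding std_diff_def by (rule U.lin_ext_in_submodule[OF sub_free that b])
qed

lemma diff_unit:
  fixes X Y :: "('a, 'b) syz set"
  shows "t \<in> Y \<Longrightarrow> Y \<subseteq> Syz ` {xs. set xs \<subseteq> X \<times> carrier R} \<Longrightarrow> std_diff R (unit_vec R t) = std_bnd R t"
  unfolding std_diff_def
  by (rule lin_ext_unit[OF module_U, of _ Y]) (use bnd_closed[of Y X] free_mono[of X UNIV] in auto)

lemma submodule_std_cycles:
  assumes "X \<subseteq> std_basis R N j" shows "submodule (std_cycles R N j \<inter> free X) R U"
proof -
  have sub: "free X \<subseteq> carrier (std_free R N j)" using free_mono[OF assms] by (simp add: std_free_def)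
  show ?thesis
  proof (cases j)
    case 0
    have "submodule {f \<in> free X. std_aug R N f \<in> {\<zero>\<^bsub>N\<^esub>}} R U"
      by (rule submodule_vimage[OF module_U N.module_axioms sub_free aug_linear N.submodule_zero])
        (use assms 0 in simp)
    moreover have "{f \<in> free X. std_aug R N f \<in> {\<zero>\<^bsub>N\<^esub>}} = std_cycles R N j \<inter> free X"
      using sub 0 by (auto simp: std_cycles_def)
    ultimately show ?thesis by simp
  next
    case (Suc i)
    have "X \<subseteq> Syz ` {xs. set xs \<subseteq> std_basis R N i \<times> carrier R}"
      using assms basis_Suc_rel[of i] Suc by blast
    from diff_linear(1)[OF this] have "submodule {f \<in> free X. std_diff R f \<in> {\<zero>\<^bsub>U\<^esub>}} R U"
      by (rule submodule_vimage[OF module_U module_U sub_free _ U.submodule_zero])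
    moreover have "{f \<in> free X. std_diff R f \<in> {\<zero>\<^bsub>U\<^esub>}} = std_cycles R N j \<inter> free X"
      using sub Suc by (auto simp: std_cycles_def free_module_simps(2))
    ultimately show ?thesis by simp
  qed
qed

text \<open>The standard resolution has a basis element for every syzygy. Since \<open>R\<close> is Noetherian, those
  of finitely many syzygies suffice to make the next step exact.\<close>

lemma finite_syzygies:
  assumes noeth: "noetherian_ring R" and X: "finite X" "X \<subseteq> std_basis R N j"
  shows "\<exists>Y. finite Y \<and> Y \<subseteq> std_basis R N (Suc j) \<and> Y \<subseteq> Syz ` {xs. set xs \<subseteq> X \<times> carrier R} \<and>
    std_cycles R N j \<inter> free X \<subseteq> std_diff R ` free Y"
proof -
  note R = N.R.is_cring
  let ?K = "std_cycles R N j \<inter> free X"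
  note K = submodule_std_cycles[OF X(2)]
  have "fg_over R U {\<lambda>_. \<zero>} ?K"
    by (rule U.fg_over_submodule[OF noeth fg_over_free_module[OF R X(1)] _ _ K])
      (use U.submoduleD(1)[OF sub_free] U.submoduleD(3)[OF K] U.M.zero_closed in \<open>auto simp: free_module_simps(2)\<close>)
  then obtain T where T: "finite T" "T \<subseteq> ?K"
    "\<And>H. submodule H R U \<Longrightarrow> T \<subseteq> H \<Longrightarrow> {\<lambda>_. \<zero>} \<subseteq> H \<Longrightarrow> ?K \<subseteq> H"
    by (rule U.fg_overE) blast
  have "\<forall>f\<in>T. \<exists>xs. set xs \<subseteq> X \<times> carrier R \<and> lin_comb R xs = f"
    using lin_comb_exists[OF R] T(2) by blast
  then obtain xs where xs: "\<And>f. f \<in> T \<Longrightarrow> set (xs f) \<subseteq> X \<times> carrier R" "\<And>f. f \<in> T \<Longrightarrow> lin_comb R (xs f) = f"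
    by metis
  define Y where "Y = (\<lambda>f. Syz (xs f)) ` T"
  have Ysyz: "Y \<subseteq> Syz ` {xs. set xs \<subseteq> X \<times> carrier R}" using xs(1) by (auto simp: Y_def)
  have "set (xs f) \<subseteq> std_basis R N j \<times> carrier R \<and> lin_comb R (xs f) \<in> std_cycles R N j" if "f \<in> T" for f
    using xs[OF that] T(2) X(2) that by auto
  then have Ybas: "Y \<subseteq> std_basis R N (Suc j)"
    unfolding std_basis_Suc[OF R] Y_def by blast
  have "submodule (std_diff R ` free Y) R U"
    by (rule submodule_image[OF module_U module_U sub_free diff_linear(1)[OF Ysyz]])
  moreover have "T \<subseteq> std_diff R ` free Y"
  proof
    fix f assume f: "f \<in> T"
    then have s: "Syz (xs f) \<in> Y" by (simp add: Y_def)
    have "std_diff R (unit_vec R (Syz (xs f))) = f" using diff_unit[OF s Ysyz] xs(2)[OF f] by simp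
    then show "f \<in> std_diff R ` free Y" using unit_in_free_module[OF R s] by (metis image_eqI)
  qed
  ultimately have "?K \<subseteq> std_diff R ` free Y"
    using T(3) U.submoduleD(3) by (simp add: free_module_simps(2))
  then show ?thesis using T(1) Ysyz Ybas by (intro exI[of _ Y]) (simp add: Y_def)
qed

lemma finite_subresolution:
  assumes "noetherian_ring R"
  obtains S where "S 0 = {Gen e}" "\<And>j. finite (S j)" "\<And>j. S j \<subseteq> std_basis R N j"
    "\<And>j. S (Suc j) \<subseteq> Syz ` {xs. set xs \<subseteq> S j \<times> carrier R}"
    "\<And>j. std_cycles R N j \<inter> free (S j) \<subseteq> std_diff R ` free (S (Suc j))"
proof -
  define Q where "Q j X Y \<longleftrightarrow> finite Y \<and> Y \<subseteq> std_basis R N (Suc j) \<and>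
      Y \<subseteq> Syz ` {xs. set xs \<subseteq> X \<times> carrier R} \<and> std_cycles R N j \<inter> free X \<subseteq> std_diff R ` free Y" for j X Y
  define g where "g j X = (SOME Y. Q j X Y)" for j X
  have g: "Q j X (g j X)" if "finite X" "X \<subseteq> std_basis R N j" for j X
    unfolding g_def by (rule someI_ex) (use finite_syzygies[OF assms that] in \<open>simp only: Q_def\<close>)
  define S where "S = rec_nat {Gen e} g"
  have S0: "S 0 = {Gen e}" and SS: "S (Suc j) = g j (S j)" for j by (simp_all add: S_def)
  have fin: "finite (S j) \<and> S j \<subseteq> std_basis R N j" for j
  proof (induction j)
    case 0
    show ?case using gen(1) by (simp add: S0)
  next
    case (Suc j)
    then show ?case using g[of "S j" j] by (simp only: SS Q_def)
  qed
  have QS: "Q j (S j) (S (Suc j))" for j using g fin by (simp only: SS)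
  show ?thesis
    by (rule that[of S, OF S0]) (use fin QS in \<open>auto simp only: Q_def\<close>)
qed

text \<open>The standard resolution retracts onto its finite part. Only the single terms of the retraction
  are needed, with the property that cycles go to cycles, so no compatible choice of all of them has
  to be made.\<close>

lemma retraction:
  assumes S0: "S 0 = {Gen e}" and S: "\<And>j. S j \<subseteq> std_basis R N j"
    "\<And>j. S (Suc j) \<subseteq> Syz ` {xs. set xs \<subseteq> S j \<times> carrier R}"
    "\<And>j. std_cycles R N j \<inter> free (S j) \<subseteq> std_diff R ` free (S (Suc j))"
  shows "\<exists>\<beta>. (\<forall>t\<in>std_basis R N j. \<beta> t \<in> free (S j)) \<and> (\<forall>t\<in>S j. \<beta> t = unit_vec R t) \<and>
    (\<forall>f\<in>std_cycles R N j. lin_ext R U \<beta> f \<in> std_cycles R N j)"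
proof (induction j)
  note R = N.R.is_cring
  case 0
  have "\<forall>y. \<exists>c. y \<in> carrier N \<longrightarrow> c \<in> carrier R \<and> y = c \<odot>\<^bsub>N\<^esub> e \<and> (y = e \<longrightarrow> c = \<one>)"
  proof
    fix y show "\<exists>c. y \<in> carrier N \<longrightarrow> c \<in> carrier R \<and> y = c \<odot>\<^bsub>N\<^esub> e \<and> (y = e \<longrightarrow> c = \<one>)"
      using gen(1) gen(2)[of y] by (cases "y = e") auto
  qed
  then obtain c where c: "\<And>y. y \<in> carrier N \<Longrightarrow> c y \<in> carrier R"
    "\<And>y. y \<in> carrier N \<Longrightarrow> c y \<odot>\<^bsub>N\<^esub> e = y" "c e = \<one>"
    using gen(1) by metis
  have u: "unit_vec R (Gen e) \<in> free (S 0)" by (rule unit_in_free_module[OF R]) (simp add: S0)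
  define \<beta> where "\<beta> t = c (gen_of t) \<odot>\<^bsub>U\<^esub> unit_vec R (Gen e)" for t :: "('a, 'b) syz"
  have \<beta>: "\<beta> t \<in> free (S 0)" if "t \<in> std_basis R N 0" for t
    unfolding \<beta>_def using U.submoduleD(5)[OF sub_free _ u] c(1) that by auto
  have \<beta>1: "\<beta> t = unit_vec R t" if "t \<in> S 0" for t
    using that c(3) by (auto simp: \<beta>_def S0 free_module_simps(4) fun_eq_iff)
  have \<beta>U: "\<beta> \<in> std_basis R N 0 \<rightarrow> carrier U" using \<beta> free_mono[of "S 0" UNIV] by auto
  have le: "lin_ext R U \<beta> f \<in> free (S 0)" if "f \<in> free (std_basis R N 0)" for f
    by (rule U.lin_ext_in_submodule[OF sub_free that \<beta>])
  have S0b: "free (S 0) \<subseteq> free (std_basis R N 0)" by (rule free_mono[OF S(1)])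
  have aug: "std_aug R N (lin_ext R U \<beta> f) = std_aug R N f" if f: "f \<in> free (std_basis R N 0)" for f
  proof (rule free_linear_ext[OF R N.module_axioms _ _ _ f])
    note l = linear_onD[OF lin_ext_linear[OF module_U \<beta>U]] and a = linear_onD[OF aug_linear[OF S(1)[of 0]]]
    show "linear_on R (free_module R (std_basis R N 0)) (free (std_basis R N 0)) N (\<lambda>f. std_aug R N (lin_ext R U \<beta> f))"
      by (rule linear_onI) (use l a le in auto)
    show "linear_on R (free_module R (std_basis R N 0)) (free (std_basis R N 0)) N (std_aug R N)"
      unfolding linear_U by (rule aug_linear) simp
    fix s assume s: "s \<in> std_basis R N 0"
    then have y: "gen_of s \<in> carrier N" by auto
    have "lin_ext R U \<beta> (unit_vec R s) = \<beta> s" by (rule lin_ext_unit[OF module_U \<beta>U s])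
    moreover have "std_aug R N (\<beta> s) = c (gen_of s) \<odot>\<^bsub>N\<^esub> std_aug R N (unit_vec R (Gen e))"
      unfolding \<beta>_def using a(3)[OF c(1)[OF y] u] .
    moreover have "std_aug R N (unit_vec R (Gen e)) = e"
      unfolding std_aug_def using lin_ext_unit[OF N.module_axioms, of gen_of "{Gen e}" "Gen e"] gen(1) by simp
    moreover have "std_aug R N (unit_vec R s) = gen_of s"
      unfolding std_aug_def using lin_ext_unit[OF N.module_axioms, of gen_of "{s}" s] y by simp
    ultimately show "std_aug R N (lin_ext R U \<beta> (unit_vec R s)) = std_aug R N (unit_vec R s)"
      using c(2)[OF y] by simp
  qed
  have "lin_ext R U \<beta> f \<in> std_cycles R N 0" if "f \<in> std_cycles R N 0" for f
    using that aug[of f] le[of f] S0b by (auto simp: std_cycles_def std_free_def)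
  then show ?case using \<beta> \<beta>1 by (intro exI[of _ \<beta>]) blast
next
  note R = N.R.is_cring
  case (Suc j)
  then obtain \<beta> where \<beta>: "\<And>t. t \<in> std_basis R N j \<Longrightarrow> \<beta> t \<in> free (S j)"
    "\<And>t. t \<in> S j \<Longrightarrow> \<beta> t = unit_vec R t"
    "\<And>f. f \<in> std_cycles R N j \<Longrightarrow> lin_ext R U \<beta> f \<in> std_cycles R N j" by blast
  let ?B = "std_basis R N (Suc j)"
  have \<beta>U: "\<beta> \<in> std_basis R N j \<rightarrow> carrier U" using \<beta>(1) free_mono[of "S j" UNIV] by auto
  have le: "lin_ext R U \<beta> f \<in> free (S j)" if "f \<in> free (std_basis R N j)" for f
    by (rule U.lin_ext_in_submodule[OF sub_free that \<beta>(1)])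
  have id: "lin_ext R U \<beta> f = f" if f: "f \<in> free (S j)" for f
  proof (rule free_linear_ext[OF R module_U _ _ _ f])
    have \<beta>S: "\<beta> \<in> S j \<rightarrow> carrier U" using \<beta>U S(1) by auto
    show "linear_on R (free_module R (S j)) (free (S j)) U (lin_ext R U \<beta>)"
      by (rule lin_ext_linear[OF module_U \<beta>S])
    show "linear_on R (free_module R (S j)) (free (S j)) U (\<lambda>f. f)"
      unfolding linear_U by (rule U.linear_on_id) (rule free_mono, simp)
    show "lin_ext R U \<beta> (unit_vec R s) = unit_vec R s" if "s \<in> S j" for s
      using lin_ext_unit[OF module_U \<beta>S that] \<beta>(2)[OF that] by simp
  qed
  have ex: "\<exists>p. t \<in> ?B \<longrightarrow> p \<in> free (S (Suc j)) \<and> std_diff R p = lin_ext R U \<beta> (std_bnd R t) \<and>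
      (t \<in> S (Suc j) \<longrightarrow> p = unit_vec R t)" for t
  proof (cases "t \<in> S (Suc j)")
    case True
    have "std_diff R (unit_vec R t) = std_bnd R t" by (rule diff_unit[OF True S(2)])
    then show ?thesis
      using id[OF bnd_closed[OF S(2) True]] unit_in_free_module[OF R True]
      by (intro exI[of _ "unit_vec R t"]) simp
  next
    case False
    have "\<exists>p. p \<in> free (S (Suc j)) \<and> std_diff R p = lin_ext R U \<beta> (std_bnd R t)" if t: "t \<in> ?B"
    proof -
      have "std_bnd R t \<in> std_cycles R N j" using t unfolding std_basis_Suc[OF R] by auto
      then have "lin_ext R U \<beta> (std_bnd R t) \<in> std_cycles R N j" by (rule \<beta>(3))
      moreover have "lin_ext R U \<beta> (std_bnd R t) \<in> free (S j)"
        by (rule le[OF bnd_closed[OF basis_Suc_rel t]])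
      ultimately have "lin_ext R U \<beta> (std_bnd R t) \<in> std_diff R ` free (S (Suc j))" using S(3) by blast
      then show ?thesis by (metis imageE)
    qed
    then show ?thesis using False by blast
  qed
  have "\<exists>\<gamma>. \<forall>t. t \<in> ?B \<longrightarrow> \<gamma> t \<in> free (S (Suc j)) \<and> std_diff R (\<gamma> t) = lin_ext R U \<beta> (std_bnd R t) \<and>
      (t \<in> S (Suc j) \<longrightarrow> \<gamma> t = unit_vec R t)"
    by (rule choice) (rule allI, rule ex)
  then obtain \<gamma> where \<gamma>: "\<And>t. t \<in> ?B \<Longrightarrow> \<gamma> t \<in> free (S (Suc j))"
    "\<And>t. t \<in> ?B \<Longrightarrow> std_diff R (\<gamma> t) = lin_ext R U \<beta> (std_bnd R t)"
    "\<And>t. t \<in> ?B \<Longrightarrow> t \<in> S (Suc j) \<Longrightarrow> \<gamma> t = unit_vec R t" by blast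
  have \<gamma>U: "\<gamma> \<in> ?B \<rightarrow> carrier U" using \<gamma>(1) free_mono[of "S (Suc j)" UNIV] by auto
  have le': "lin_ext R U \<gamma> f \<in> free (S (Suc j))" if "f \<in> free ?B" for f
    by (rule U.lin_ext_in_submodule[OF sub_free that \<gamma>(1)])
  note dB = diff_linear[OF basis_Suc_rel[of j]] and dS = diff_linear[OF S(2)[of j]]
  have chain: "std_diff R (lin_ext R U \<gamma> f) = lin_ext R U \<beta> (std_diff R f)" if f: "f \<in> free ?B" for f
  proof (rule free_linear_ext[OF R module_U _ _ _ f])
    note l = linear_onD[OF lin_ext_linear[OF module_U \<gamma>U]] and l' = linear_onD[OF lin_ext_linear[OF module_U \<beta>U]]
      and a = linear_onD[OF dS(1)]
    note b = linear_onD[OF dB(1)[unfolded linear_U[symmetric]]]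
    show "linear_on R (free_module R ?B) (free ?B) U (\<lambda>f. std_diff R (lin_ext R U \<gamma> f))"
      by (rule linear_onI) (use l a le' in \<open>auto simp del: std_basis.simps\<close>)
    have b': "std_diff R (x \<oplus>\<^bsub>free_module R ?B\<^esub> y) = std_diff R x \<oplus>\<^bsub>free_module R (std_basis R N j)\<^esub> std_diff R y"
      if "x \<in> free ?B" "y \<in> free ?B" for x y using b(2)[OF that] by (simp add: free_module_simps(3))
    have b'': "std_diff R (r \<odot>\<^bsub>free_module R ?B\<^esub> x) = r \<odot>\<^bsub>free_module R (std_basis R N j)\<^esub> std_diff R x"
      if "r \<in> carrier R" "x \<in> free ?B" for r x using b(3)[OF that] by (simp add: free_module_simps(4))
    show "linear_on R (free_module R ?B) (free ?B) U (\<lambda>f. lin_ext R U \<beta> (std_diff R f))"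
      by (rule linear_onI) (use b' b'' l' dB(2) in \<open>auto simp del: std_basis.simps\<close>)
    fix s assume s: "s \<in> ?B"
    show "std_diff R (lin_ext R U \<gamma> (unit_vec R s)) = lin_ext R U \<beta> (std_diff R (unit_vec R s))"
      using lin_ext_unit[OF module_U \<gamma>U s] \<gamma>(2)[OF s] diff_unit[OF s basis_Suc_rel] by simp
  qed
  have zero: "lin_ext R U \<beta> (\<lambda>_. \<zero>) = (\<lambda>_. \<zero>)"
    using lin_ext_zero[OF module_U \<beta>U] by (simp add: free_module_simps(2))
  have "lin_ext R U \<gamma> f \<in> std_cycles R N (Suc j)" if "f \<in> std_cycles R N (Suc j)" for f
  proof -
    have f: "f \<in> free ?B" "std_diff R f = (\<lambda>_. \<zero>)"
      using that by (auto simp: std_cycles_def std_free_def simp del: std_basis.simps)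
    then have "std_diff R (lin_ext R U \<gamma> f) = (\<lambda>_. \<zero>)" using chain[OF f(1)] zero by simp
    then show ?thesis
      using le'[OF f(1)] free_mono[OF S(1)[of "Suc j"]]
      by (auto simp: std_cycles_def std_free_def simp del: std_basis.simps)
  qed
  then show ?case
    using \<gamma> S(1)[of "Suc j"] by (intro exI[of _ \<gamma>]) (auto simp del: std_basis.simps)
qed

end

context cyclic_module
begin

lemma free_complex_subresolution:
  assumes S: "\<And>j. finite (S j)" "\<And>j. S j \<subseteq> std_basis R N j"
    "\<And>j. S (Suc j) \<subseteq> Syz ` {xs. set xs \<subseteq> S j \<times> carrier R}"
  shows "free_complex R S (std_bnd R)"
proof (unfold_locales)
  show "std_bnd R t \<in> free (S j)" if "t \<in> S (Suc j)" for t j by (rule bnd_closed[OF S(3) that])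
  show "lin_ext R U (std_bnd R) (std_bnd R t) = (\<lambda>_. \<zero>)" if "t \<in> S (Suc (Suc j))" for t j
  proof -
    have "t \<in> std_basis R N (Suc (Suc j))" using S(2) that by blast
    then have "std_bnd R t \<in> std_cycles R N (Suc j)" unfolding std_basis_Suc[OF N.R.is_cring, of N "Suc j"] by auto
    then show ?thesis by (simp add: std_cycles_def std_diff_def)
  qed
qed (rule S(1))

context
  fixes M :: "('a, 'c, 'm) module_scheme"
  assumes M: "module R M"
begin

interpretation M: module R M by (rule M)

lemma std_diff_hom:
  "\<And>x. x \<in> carrier (std_free R N (Suc j)) \<Longrightarrow> std_diff R x \<in> carrier (std_free R N j)"
  "\<And>x y. x \<in> carrier (std_free R N (Suc j)) \<Longrightarrow> y \<in> carrier (std_free R N (Suc j)) \<Longrightarrow>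
    std_diff R (x \<oplus>\<^bsub>std_free R N (Suc j)\<^esub> y) = std_diff R x \<oplus>\<^bsub>std_free R N j\<^esub> std_diff R y"
  "\<And>r x. r \<in> carrier R \<Longrightarrow> x \<in> carrier (std_free R N (Suc j)) \<Longrightarrow>
    std_diff R (r \<odot>\<^bsub>std_free R N (Suc j)\<^esub> x) = r \<odot>\<^bsub>std_free R N j\<^esub> std_diff R x"
proof -
  note F = std_resolution(1)[OF N.module_axioms, of "Suc j"]
  interpret F: module R "std_free R N (Suc j)" by (rule F)
  note h = module_homD[OF std_resolution(3)[OF N.module_axioms, of j]]
  show "std_diff R x \<in> carrier (std_free R N j)" if "x \<in> carrier (std_free R N (Suc j))" for x
    using h(1)[OF that] that by simp
  show "std_diff R (x \<oplus>\<^bsub>std_free R N (Suc j)\<^esub> y) = std_diff R x \<oplus>\<^bsub>std_free R N j\<^esub> std_diff R y"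
    if "x \<in> carrier (std_free R N (Suc j))" "y \<in> carrier (std_free R N (Suc j))" for x y
    using h(2)[OF that] that by simp
  show "std_diff R (r \<odot>\<^bsub>std_free R N (Suc j)\<^esub> x) = r \<odot>\<^bsub>std_free R N j\<^esub> std_diff R x"
    if "r \<in> carrier R" "x \<in> carrier (std_free R N (Suc j))" for r x
    using h(3)[OF that] that by simp
qed

lemma ext_diff_eq: "ext_diff R N j f = (\<lambda>x\<in>carrier (std_free R N (Suc j)). f (std_diff R x))"
  by (simp add: ext_diff_def compose_def)

lemma ext_diff_closed:
  assumes f: "f \<in> module_hom R (std_free R N j) M"
  shows "ext_diff R N j f \<in> module_hom R (std_free R N (Suc j)) M"
proof -
  interpret F: module R "std_free R N (Suc j)" by (rule std_resolution(1)[OF N.module_axioms])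
  show ?thesis
    unfolding ext_diff_eq
    by (rule linear_module_hom, rule linear_onI)
      (use module_homD(1-3)[OF f] std_diff_hom in auto)
qed

lemma ext_diff_linear:
  "linear_on R (hom_module R (std_free R N j) M) (module_hom R (std_free R N j) M)
    (hom_module R (std_free R N (Suc j)) M) (ext_diff R N j)"
  by (rule linear_onI)
    (use std_diff_hom in \<open>auto simp: hom_module_simps ext_diff_closed, auto simp: ext_diff_eq fun_eq_iff\<close>)

lemma submodule_ext_cocycles: "submodule (ext_cocycles R N M j) R (hom_module R (std_free R N j) M)"
proof -
  note F = std_resolution(1)[OF N.module_axioms]
  interpret H: module R "hom_module R (std_free R N j) M" by (rule module_hom_module[OF F M])
  interpret H': module R "hom_module R (std_free R N (Suc j)) M" by (rule module_hom_module[OF F M])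
  have c: "submodule (module_hom R (std_free R N j) M) R (hom_module R (std_free R N j) M)"
    using H.carrier_is_submodule by (simp add: hom_module_simps)
  have "submodule {f \<in> module_hom R (std_free R N j) M.
      ext_diff R N j f \<in> {\<zero>\<^bsub>hom_module R (std_free R N (Suc j)) M\<^esub>}} R (hom_module R (std_free R N j) M)"
    by (rule submodule_vimage[OF H.module_axioms H'.module_axioms c ext_diff_linear H'.submodule_zero])
  then show ?thesis by (simp add: ext_cocycles_def)
qed

lemma submodule_ext_coboundaries:
  "submodule (ext_coboundaries R N M j) R (hom_module R (std_free R N j) M)"
  "ext_coboundaries R N M j \<subseteq> ext_cocycles R N M j"
proof -
  note F = std_resolution(1)[OF N.module_axioms]
  interpret H: module R "hom_module R (std_free R N j) M" by (rule module_hom_module[OF F M])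
  show "submodule (ext_coboundaries R N M j) R (hom_module R (std_free R N j) M)"
  proof (cases j)
    case 0
    then show ?thesis using H.submodule_zero by simp
  next
    case (Suc i)
    interpret H': module R "hom_module R (std_free R N i) M" by (rule module_hom_module[OF F M])
    have c: "submodule (module_hom R (std_free R N i) M) R (hom_module R (std_free R N i) M)"
      using H'.carrier_is_submodule by (simp add: hom_module_simps)
    show ?thesis
      using submodule_image[OF H'.module_axioms _ c ext_diff_linear] H.module_axioms Suc by simp
  qed
  show "ext_coboundaries R N M j \<subseteq> ext_cocycles R N M j"
  proof (cases j)
    case 0
    then show ?thesis using H.submoduleD(3)[OF submodule_ext_cocycles] by simp
  next
    case (Suc i)
    have "ext_diff R N (Suc i) (ext_diff R N i f) = \<zero>\<^bsub>hom_module R (std_free R N (Suc (Suc i))) M\<^esub>"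
      if f: "f \<in> module_hom R (std_free R N i) M" for f
    proof -
      interpret F: module R "std_free R N i" by (rule F)
      have "std_diff R (std_diff R x) = (\<lambda>_. \<zero>)" if x: "x \<in> carrier (std_free R N (Suc (Suc i)))" for x
      proof -
        have "std_diff R x \<in> std_cycles R N (Suc i)" using std_diff_image[OF N.module_axioms, of "Suc i"] x by blast
        then show ?thesis by (simp add: std_cycles_def)
      qed
      moreover have "f (\<lambda>_. \<zero>) = \<zero>\<^bsub>M\<^esub>"
        using linear_on_basics(1)[OF F.module_axioms M F.carrier_is_submodule module_hom_linear[OF f]]
        by (simp add: std_free_def free_module_simps(2))
      ultimately show ?thesis
        using std_diff_hom(1)[of _ "Suc i"] by (auto simp: ext_diff_eq hom_module_simps intro!: restrict_ext)
    qed
    then show ?thesis using Suc ext_diff_closed by (auto simp: ext_cocycles_def)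
  qed
qed

text \<open>Restriction to the finite part maps cocycles onto cocycles, because a cocycle on the finite
  part can be composed with the retraction.\<close>

theorem fg_cohomology_if_Ext:
  assumes S0: "S 0 = {Gen e}" and S: "\<And>j. finite (S j)" "\<And>j. S j \<subseteq> std_basis R N j"
    "\<And>j. S (Suc j) \<subseteq> Syz ` {xs. set xs \<subseteq> S j \<times> carrier R}"
    "\<And>j. std_cycles R N j \<inter> free (S j) \<subseteq> std_diff R ` free (S (Suc j))"
    and fg: "\<And>j. fin_gen_module R (Ext R j N M)"
  shows "free_complex.fg_cohomology R S (std_bnd R) M (carrier M)"
proof -
  note R = N.R.is_cring and F = std_resolution(1)[OF N.module_axioms]
  interpret C: free_complex R S "std_bnd R" by (rule free_complex_subresolution[OF S(1-3)])
  show ?thesis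
    unfolding C.fg_cohomology_def
  proof
    fix j
    interpret H: module R "hom_module R (std_free R N j) M" by (rule module_hom_module[OF F M])
    interpret FM: module R "fun_module M :: ('a, ('a, 'b) syz \<Rightarrow> 'c) module" by (rule module_fun_module[OF M])
    define Z where "Z = ext_cocycles R N M j"
    define B where "B = ext_coboundaries R N M j"
    define H1 where "H1 = (hom_module R (std_free R N j) M)\<lparr>carrier := Z\<rparr>"
    note ZD = H.submoduleD[OF submodule_ext_cocycles[of j], folded Z_def]
      and BD = H.submoduleD[OF submodule_ext_coboundaries(1)[of j], folded B_def]
    have BZ: "B \<subseteq> Z" unfolding B_def Z_def by (rule submodule_ext_coboundaries(2))
    have H1: "module R H1"
      unfolding H1_def Z_def
      using submodule.submodule_is_module[OF submodule_ext_cocycles H.module_axioms] .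
    interpret H1: module R H1 by (rule H1)
    have H1s: "carrier H1 = Z" "\<zero>\<^bsub>H1\<^esub> = \<zero>\<^bsub>hom_module R (std_free R N j) M\<^esub>"
      "\<And>f g. f \<oplus>\<^bsub>H1\<^esub> g = f \<oplus>\<^bsub>hom_module R (std_free R N j) M\<^esub> g"
      "\<And>r g. r \<odot>\<^bsub>H1\<^esub> g = r \<odot>\<^bsub>hom_module R (std_free R N j) M\<^esub> g"
      by (simp_all add: H1_def)
    have BH1: "submodule B R H1"
      by (rule H1.submodule_intro) (use BZ BD in \<open>auto simp: H1s\<close>)
    have "fin_gen_module R (quot_module H1 B)"
      using fg[of j] by (simp add: Ext_def H1_def Z_def B_def)
    from H1.fg_over_if_fin_gen_quot[OF BH1 this] have fg1: "fg_over R H1 B Z" by (simp add: H1s)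
    define \<rho> where "\<rho> j f = (\<lambda>t. if t \<in> S j then f (unit_vec R t) else \<zero>\<^bsub>M\<^esub>)" for j and f :: "_ \<Rightarrow> 'c"
    have unit: "unit_vec R t \<in> carrier (std_free R N j)" if "t \<in> S j" for t j
      unfolding std_free_def by (rule unit_in_free_module[OF R]) (use S(2) that in blast)
    have \<rho>_cochain: "\<rho> j f \<in> C.cochains M j (carrier M)" if "f \<in> module_hom R (std_free R N j) M" for f j
      using module_homD(1)[OF that unit] by (auto simp: \<rho>_def C.cochains_def)
    have eval: "lin_ext R M (\<rho> j f) h = f h"
      if f: "f \<in> module_hom R (std_free R N j) M" and h: "h \<in> free (S j)" for f h j
    proof (rule free_linear_ext[OF R M _ _ _ h])
      have v: "\<rho> j f \<in> S j \<rightarrow> carrier M"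
        using C.cochains_val[OF M M.carrier_is_submodule \<rho>_cochain[OF f]] by auto
      show "linear_on R (free_module R (S j)) (free (S j)) M (lin_ext R M (\<rho> j f))"
        by (rule lin_ext_linear[OF M v])
      show "linear_on R (free_module R (S j)) (free (S j)) M f"
        using linear_on_subset[OF module_hom_linear[OF f], of "free (S j)"] free_mono[OF S(2)[of j]]
        by (simp add: linear_on_def free_module_simps(3,4) std_free_def)
      show "lin_ext R M (\<rho> j f) (unit_vec R s) = f (unit_vec R s)" if "s \<in> S j" for s
        using lin_ext_unit[OF M v that] that by (simp add: \<rho>_def)
    qed
    have natural: "\<rho> (Suc j) (ext_diff R N j f) = C.coboundary M j (\<rho> j f)"
      if f: "f \<in> module_hom R (std_free R N j) M" for f j
    proof
      fix t
      show "\<rho> (Suc j) (ext_diff R N j f) t = C.coboundary M j (\<rho> j f) t"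
      proof (cases "t \<in> S (Suc j)")
        case True
        then show ?thesis
          using unit[OF True] diff_unit[OF True S(3)] eval[OF f C.bnd_closed[OF True]]
          by (simp add: \<rho>_def[of "Suc j"] C.coboundary_def ext_diff_eq)
      qed (simp add: \<rho>_def C.coboundary_def)
    qed
    have \<rho>: "linear_on R H1 Z (fun_module M) (\<rho> j)"
    proof (rule linear_onI)
      have Zh: "f \<in> module_hom R (std_free R N j) M" if "f \<in> Z" for f
        using that by (simp add: Z_def ext_cocycles_def)
      show "\<rho> j f \<in> carrier (fun_module M)" if "f \<in> Z" for f
        using module_homD(1)[OF Zh[OF that] unit] by (auto simp: \<rho>_def fun_module_simps)
      show "\<rho> j (f \<oplus>\<^bsub>H1\<^esub> g) = \<rho> j f \<oplus>\<^bsub>fun_module M\<^esub> \<rho> j g" if "f \<in> Z" "g \<in> Z" for f g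
        using unit[of _ j] by (auto simp: \<rho>_def H1s hom_module_simps fun_module_simps fun_eq_iff)
      show "\<rho> j (r \<odot>\<^bsub>H1\<^esub> f) = r \<odot>\<^bsub>fun_module M\<^esub> \<rho> j f" if "r \<in> carrier R" "f \<in> Z" for r f
        using unit[of _ j] that(1) by (auto simp: \<rho>_def H1s hom_module_simps fun_module_simps fun_eq_iff)
    qed
    have "fg_over R (fun_module M) (\<rho> j ` B) (\<rho> j ` Z)"
      using fg_over_image[OF H1 FM.module_axioms H1.carrier_is_submodule] \<rho> BZ fg1 by (simp add: H1s)
    moreover have "\<rho> j ` B \<subseteq> C.coboundaries M j (carrier M)"
    proof (cases j)
      case 0
      then show ?thesis using unit[of _ 0] by (auto simp: B_def \<rho>_def hom_module_simps)
    next
      case (Suc i)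
      then show ?thesis using natural[of _ i] \<rho>_cochain[of _ i] by (auto simp: B_def)
    qed
    moreover have "\<rho> j ` Z = C.cocycles M j (carrier M)"
    proof (intro equalityI subsetI)
      fix g assume "g \<in> \<rho> j ` Z"
      then obtain f where f: "f \<in> module_hom R (std_free R N j) M"
        "ext_diff R N j f = \<zero>\<^bsub>hom_module R (std_free R N (Suc j)) M\<^esub>" "g = \<rho> j f"
        by (auto simp: Z_def ext_cocycles_def)
      have "\<rho> (Suc j) (\<zero>\<^bsub>hom_module R (std_free R N (Suc j)) M\<^esub>) = (\<lambda>_. \<zero>\<^bsub>M\<^esub>)"
        using unit[of _ "Suc j"] by (auto simp: \<rho>_def hom_module_simps fun_eq_iff)
      then have "C.coboundary M j g = (\<lambda>_. \<zero>\<^bsub>M\<^esub>)"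
        using natural[OF f(1)] f(2,3) by metis
      then show "g \<in> C.cocycles M j (carrier M)" using \<rho>_cochain[OF f(1)] f(3) by (simp add: C.cocycles_def)
    next
      fix g assume "g \<in> C.cocycles M j (carrier M)"
      then have g: "g \<in> C.cochains M j (carrier M)" "C.coboundary M j g = (\<lambda>_. \<zero>\<^bsub>M\<^esub>)"
        by (auto simp: C.cocycles_def)
      have gc: "g t \<in> carrier M" for t by (rule C.cochains_val[OF M M.carrier_is_submodule g(1)])
      have "\<exists>\<beta>. (\<forall>t\<in>std_basis R N j. \<beta> t \<in> free (S j)) \<and> (\<forall>t\<in>S j. \<beta> t = unit_vec R t) \<and>
          (\<forall>f\<in>std_cycles R N j. lin_ext R U \<beta> f \<in> std_cycles R N j)"
        by (rule retraction[OF S0 S(2-4)])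
      then obtain \<beta> where \<beta>: "\<And>t. t \<in> std_basis R N j \<Longrightarrow> \<beta> t \<in> free (S j)"
        "\<And>t. t \<in> S j \<Longrightarrow> \<beta> t = unit_vec R t"
        "\<And>f. f \<in> std_cycles R N j \<Longrightarrow> lin_ext R U \<beta> f \<in> std_cycles R N j" by blast
      have \<beta>U: "\<beta> \<in> std_basis R N j \<rightarrow> carrier U" using \<beta>(1) free_mono[of "S j" UNIV] by auto
      have le: "lin_ext R U \<beta> h \<in> free (S j)" if "h \<in> free (std_basis R N j)" for h
        by (rule U.lin_ext_in_submodule[OF sub_free that \<beta>(1)])
      have gl: "linear_on R U (free X) M (lin_ext R M g)" for X
        unfolding linear_U[symmetric] by (rule lin_ext_linear[OF M]) (use gc in auto)
      define f where "f = (\<lambda>h\<in>carrier (std_free R N j). lin_ext R M g (lin_ext R U \<beta> h))"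
      have f: "f \<in> module_hom R (std_free R N j) M"
      proof (rule linear_module_hom)
        note l = linear_onD[OF lin_ext_linear[OF module_U \<beta>U]] and l' = linear_onD[OF gl[of UNIV]]
        have "linear_on R (free_module R (std_basis R N j)) (free (std_basis R N j)) M
            (\<lambda>h. lin_ext R M g (lin_ext R U \<beta> h))"
          by (rule linear_onI) (use l l' in auto)
        then show "linear_on R (std_free R N j) (carrier (std_free R N j)) M f"
          using module.smult_closed[OF F, of _ _ j] abelian_monoid.a_closed[OF abelian_group.axioms(1)[OF module.axioms(2)[OF F[of j]]]]
          unfolding linear_on_def f_def std_free_def by simp
      qed (simp add: f_def)
      have "f (std_diff R h) = \<zero>\<^bsub>M\<^esub>" if h: "h \<in> carrier (std_free R N (Suc j))" for h
      proof -
        have k: "std_diff R h \<in> std_cycles R N j" using std_diff_image[OF N.module_axioms] h by blast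
        then have kF: "std_diff R h \<in> carrier (std_free R N j)" by (simp add: std_cycles_def)
        have "lin_ext R U \<beta> (std_diff R h) \<in> std_cycles R N j \<inter> free (S j)"
          using \<beta>(3)[OF k] le kF by (simp add: std_free_def)
        then obtain p where p: "p \<in> free (S (Suc j))" "lin_ext R U \<beta> (std_diff R h) = std_diff R p"
          using S(4) by blast
        have "lin_ext R M g (std_diff R p) = lin_ext R M (\<lambda>s. lin_ext R M g (std_bnd R s)) p"
          unfolding std_diff_def
          by (rule lin_ext_linear_map[OF module_U M U.carrier_is_submodule gl p(1)])
            (use C.bnd_closed free_mono[of "S j" UNIV] in blast)
        also have "\<dots> = lin_ext R M (\<lambda>_. \<zero>\<^bsub>M\<^esub>) p"
        proof (rule M.lin_ext_cong[OF p(1)])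
          fix s assume "s \<in> S (Suc j)"
          then show "lin_ext R M g (std_bnd R s) = \<zero>\<^bsub>M\<^esub>"
            using fun_cong[OF g(2), of s] by (simp add: C.coboundary_def)
        qed simp
        also have "\<dots> = \<zero>\<^bsub>M\<^esub>"
          using M.lin_ext_in_submodule[OF M.submodule_zero p(1), of "\<lambda>_. \<zero>\<^bsub>M\<^esub>"] by simp
        finally show ?thesis using kF p(2) by (simp add: f_def)
      qed
      then have "f \<in> Z"
        using f by (auto simp: Z_def ext_cocycles_def ext_diff_eq hom_module_simps fun_eq_iff)
      moreover have "\<rho> j f = g"
      proof
        fix t
        show "\<rho> j f t = g t"
        proof (cases "t \<in> S j")
          case True
          then have "lin_ext R U \<beta> (unit_vec R t) = unit_vec R t"
            using lin_ext_unit[OF module_U \<beta>U, of t] \<beta>(2) S(2) by auto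
          moreover have "lin_ext R M g (unit_vec R t) = g t"
            by (rule lin_ext_unit[OF M, of g "S j"]) (use True gc in auto)
          ultimately show ?thesis using True unit[OF True] by (simp add: \<rho>_def f_def)
        qed (use g(1) in \<open>auto simp: \<rho>_def C.cochains_def\<close>)
      qed
      ultimately show "g \<in> \<rho> j ` Z" by blast
    qed
    ultimately show "fg_over R (fun_module M) (C.coboundaries M j (carrier M)) (C.cocycles M j (carrier M))"
      using FM.fg_over_mono by metis
  qed
qed

end

end

section \<open>Annihilators\<close>

text \<open>Finitely many annihilators, one for each generator, are multiplied.\<close>

lemma (in module) uniform_annihilator:
  assumes fg: "fg_over R M B Z" and B: "submodule B R M" and Z: "Z \<subseteq> carrier M"
    and T: "T \<subseteq> carrier R" "\<one> \<in> T" "\<And>s t. s \<in> T \<Longrightarrow> t \<in> T \<Longrightarrow> s \<otimes> t \<in> T"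
    and kill: "\<And>z. z \<in> Z \<Longrightarrow> \<exists>t\<in>T. t \<odot>\<^bsub>M\<^esub> z \<in> B"
  shows "\<exists>t\<in>T. \<forall>z\<in>Z. t \<odot>\<^bsub>M\<^esub> z \<in> B"
proof -
  note BD = submoduleD[OF B]
  obtain S where S: "finite S" "S \<subseteq> Z" "\<And>H. submodule H R M \<Longrightarrow> S \<subseteq> H \<Longrightarrow> B \<subseteq> H \<Longrightarrow> Z \<subseteq> H"
    using fg by (rule fg_overE) blast
  have "\<exists>t\<in>T. \<forall>z\<in>A. t \<odot>\<^bsub>M\<^esub> z \<in> B" if "finite A" "A \<subseteq> Z" for A
    using that
  proof (induction A rule: finite_induct)
    case empty
    then show ?case using T by auto
  next
    case (insert a A)
    then obtain t where t: "t \<in> T" "\<And>z. z \<in> A \<Longrightarrow> t \<odot>\<^bsub>M\<^esub> z \<in> B" by auto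
    obtain s where s: "s \<in> T" "s \<odot>\<^bsub>M\<^esub> a \<in> B" using kill[of a] insert.prems by auto
    have c: "s \<in> carrier R" "t \<in> carrier R" using s t T(1) by auto
    have "(s \<otimes> t) \<odot>\<^bsub>M\<^esub> z \<in> B" if z: "z \<in> insert a A" for z
    proof -
      have zc: "z \<in> carrier M" using z insert.prems Z by auto
      show ?thesis
      proof (cases "z = a")
        case True
        then show ?thesis
          using BD(5)[OF c(2) s(2)] zc c smult_lcomm[OF c zc] by (simp add: smult_assoc1)
      next
        case False
        then show ?thesis using z BD(5)[OF c(1) t(2)] zc c by (simp add: smult_assoc1)
      qed
    qed
    then show ?case using T(3)[OF s(1) t(1)] by blast
  qed
  from this[OF S(1,2)] obtain t where t: "t \<in> T" "\<And>z. z \<in> S \<Longrightarrow> t \<odot>\<^bsub>M\<^esub> z \<in> B" by blast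
  have tc: "t \<in> carrier R" using t T by blast
  have "submodule {z \<in> carrier M. t \<odot>\<^bsub>M\<^esub> z \<in> B} R M"
  proof (rule submodule_vimage[OF module_axioms module_axioms carrier_is_submodule _ B])
    show "linear_on R M (carrier M) M (\<lambda>z. t \<odot>\<^bsub>M\<^esub> z)"
      by (rule linear_onI) (use tc in \<open>auto simp: smult_r_distr smult_lcomm\<close>)
  qed
  moreover have "S \<subseteq> {z \<in> carrier M. t \<odot>\<^bsub>M\<^esub> z \<in> B}" using S(2) Z t(2) by blast
  moreover have "B \<subseteq> {z \<in> carrier M. t \<odot>\<^bsub>M\<^esub> z \<in> B}" using BD tc by blast
  ultimately have "Z \<subseteq> {z \<in> carrier M. t \<odot>\<^bsub>M\<^esub> z \<in> B}" by (rule S(3))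
  then show ?thesis using t(1) by blast
qed

context pairing_module
begin

lemma koszul_power_annihilated:
  assumes T: "T \<subseteq> carrier R" "\<And>s t. s \<in> T \<Longrightarrow> t \<in> T \<Longrightarrow> s \<otimes> t \<in> T"
    and kill: "\<And>v. v \<in> E \<Longrightarrow> \<exists>t\<in>T. t \<odot>\<^bsub>M\<^esub> v = \<zero>\<^bsub>M\<^esub>"
  shows "w \<in> (koszul ^^ n) E \<Longrightarrow> \<exists>t\<in>T. t \<odot>\<^bsub>M\<^esub> w = \<zero>\<^bsub>M\<^esub>"
proof (induction n arbitrary: w)
  case 0
  then show ?case using kill by simp
next
  case (Suc n)
  then have w: "w \<in> carrier M" "lo w \<in> (koszul ^^ n) E" "hi w \<in> (koszul ^^ n) E" by (auto simp: mem_koszul)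
  obtain s t where st: "s \<in> T" "s \<odot>\<^bsub>M\<^esub> lo w = \<zero>\<^bsub>M\<^esub>" "t \<in> T" "t \<odot>\<^bsub>M\<^esub> hi w = \<zero>\<^bsub>M\<^esub>"
    using Suc.IH w by metis
  have c: "s \<in> carrier R" "t \<in> carrier R" using st T by auto
  have cw: "lo w \<in> carrier M" "hi w \<in> carrier M" using lo(1) hi(1) w by auto
  have "(s \<otimes> t) \<odot>\<^bsub>M\<^esub> lo w = t \<odot>\<^bsub>M\<^esub> (s \<odot>\<^bsub>M\<^esub> lo w)"
    using c cw by (metis smult_assoc1 smult_lcomm)
  moreover have "(s \<otimes> t) \<odot>\<^bsub>M\<^esub> hi w = s \<odot>\<^bsub>M\<^esub> (t \<odot>\<^bsub>M\<^esub> hi w)"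
    using c cw by (simp add: smult_assoc1)
  ultimately have "(s \<otimes> t) \<odot>\<^bsub>M\<^esub> w = \<zero>\<^bsub>M\<^esub>"
    using c w st by (intro pair_eqI[of _ "\<zero>\<^bsub>M\<^esub>"]) (simp_all add: lo(3) hi(3))
  then show ?case using T(2) st by blast
qed

text \<open>The lowest degree of the Koszul complex is a copy of \<open>E\<close> that contains no boundaries, and its
  cycles are the elements killed by all of \<open>xs\<close>.\<close>

lemma annihilates_if_kills_homology:
  assumes E: "submodule E R M" and xs: "set xs \<subseteq> carrier R"
    and m: "m \<in> E" "\<And>x. x \<in> set xs \<Longrightarrow> x \<odot>\<^bsub>M\<^esub> m = \<zero>\<^bsub>M\<^esub>"
    and f: "f \<in> carrier R" "kills_homology f ((koszul ^^ length xs) E) (koszul_diffs xs (\<lambda>_. \<zero>\<^bsub>M\<^esub>))"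
  shows "f \<odot>\<^bsub>M\<^esub> m = \<zero>\<^bsub>M\<^esub>"
proof -
  define top where "top n = (join \<zero>\<^bsub>M\<^esub> ^^ n) m" for n
  have mc: "m \<in> carrier M" using submoduleD(2)[OF E] m by blast
  have topc: "top n \<in> carrier M" for n
    by (induction n) (auto simp: top_def mc join_closed)
  have topE: "top n \<in> (koszul ^^ n) E" for n
  proof (induction n)
    case (Suc n)
    then show ?case
      using topc[of "Suc n"] submoduleD(3)[OF submodule_koszul_power[OF E]] by (simp add: top_def mem_koszul)
  qed (simp add: top_def m)
  have kill: "x \<odot>\<^bsub>M\<^esub> top n = \<zero>\<^bsub>M\<^esub>" if x: "x \<in> set xs" for x n
  proof (induction n)
    case (Suc n)
    have "top (Suc n) = join \<zero>\<^bsub>M\<^esub> (top n)" by (simp add: top_def)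
    then show ?case
      using Suc x xs topc[of "Suc n"] by (intro pair_eqI[of _ "\<zero>\<^bsub>M\<^esub>"]) (auto simp: lo(3) hi(3))
  qed (simp add: top_def m(2)[OF x])
  have "koszul_diffs ys (\<lambda>_. \<zero>\<^bsub>M\<^esub>) (top (length ys)) = \<zero>\<^bsub>M\<^esub>" if "set ys \<subseteq> set xs" for ys
    using that
  proof (induction ys)
    case (Cons y ys)
    have D: "koszul_diffs ys (\<lambda>_. \<zero>\<^bsub>M\<^esub>) \<zero>\<^bsub>M\<^esub> = \<zero>\<^bsub>M\<^esub>"
      using dmodD(11)[OF dmod_kd[OF E, of ys]] Cons.prems xs by auto
    have "top (length (y # ys)) = join \<zero>\<^bsub>M\<^esub> (top (length ys))" by (simp add: top_def)
    then show ?case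
      using Cons D kill[of y] by (intro pair_eqI[of _ "\<zero>\<^bsub>M\<^esub>"]) (simp_all add: minus_zero_module)
  qed simp
  then have "top (length xs) \<in> cycles ((koszul ^^ length xs) E) (koszul_diffs xs (\<lambda>_. \<zero>\<^bsub>M\<^esub>))"
    using topE by (simp add: cycles_def)
  then obtain v where v: "v \<in> (koszul ^^ length xs) E"
    "f \<odot>\<^bsub>M\<^esub> top (length xs) = koszul_diffs xs (\<lambda>_. \<zero>\<^bsub>M\<^esub>) v"
    using f(2) by (auto simp: kills_homology_def)
  have "(hi ^^ length ys) (koszul_diffs ys (\<lambda>_. \<zero>\<^bsub>M\<^esub>) v) = \<zero>\<^bsub>M\<^esub>"
    if "v \<in> (koszul ^^ length ys) E" "set ys \<subseteq> carrier R" for ys v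
    using that
  proof (induction ys arbitrary: v)
    case (Cons y ys)
    have hv: "hi v \<in> (koszul ^^ length ys) E" using Cons.prems by (simp add: mem_koszul)
    have hin: "(hi ^^ n) (\<ominus>\<^bsub>M\<^esub> w) = \<ominus>\<^bsub>M\<^esub> (hi ^^ n) w \<and> (hi ^^ n) w \<in> carrier M" if "w \<in> carrier M" for w n
      using that by (induction n) (simp_all add: lo_hi_minus hi(1))
    have "koszul_diffs ys (\<lambda>_. \<zero>\<^bsub>M\<^esub>) (hi v) \<in> carrier M"
      using dmodD(6)[OF dmod_kd[OF E, of ys] hv] Cons.prems by simp
    then show ?case
      using Cons.IH[OF hv] Cons.prems hin by (simp add: funpow_swap1 funpow_Suc_right minus_zero_module del: funpow.simps)
  qed simp
  from this[OF v(1) xs] have "(hi ^^ length xs) (f \<odot>\<^bsub>M\<^esub> top (length xs)) = \<zero>\<^bsub>M\<^esub>" using v(2) by simp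
  moreover have "(hi ^^ n) (f \<odot>\<^bsub>M\<^esub> top n) = f \<odot>\<^bsub>M\<^esub> m" for n
  proof (induction n)
    case (Suc n)
    have "top (Suc n) = join \<zero>\<^bsub>M\<^esub> (top n)" by (simp add: top_def)
    then have "hi (f \<odot>\<^bsub>M\<^esub> top (Suc n)) = f \<odot>\<^bsub>M\<^esub> top n" using hi(3)[OF f(1) topc[of "Suc n"]] by simp
    then show ?case using Suc by (simp add: funpow_Suc_right del: funpow.simps)
  qed (simp add: top_def)
  ultimately show ?thesis by simp
qed

end

section \<open>Primes, support and completeness\<close>

text \<open>Krull's argument: if neither \<open>a\<close> nor \<open>b\<close> lies in \<open>P\<close>, then some powers of \<open>x\<close> lie in
  \<open>P + R a\<close> and in \<open>P + R b\<close>, so their product lies in \<open>P + R a b\<close>. For \<open>x = 1\<close> the ideal \<open>P\<close> is maximal.\<close>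

lemma ideal_maximal_avoiding_powers:
  fixes R (structure)
  assumes noeth: "noetherian_ring R" and "cring R" and J: "ideal J R" and x: "x \<in> carrier R"
    and av: "\<And>k::nat. x [^]\<^bsub>R\<^esub> k \<notin> J"
  obtains P where "primeideal P R" "J \<subseteq> P" "\<And>k::nat. x [^]\<^bsub>R\<^esub> k \<notin> P"
    "\<And>Q. ideal Q R \<Longrightarrow> P \<subseteq> Q \<Longrightarrow> (\<And>k::nat. x [^]\<^bsub>R\<^esub> k \<notin> Q) \<Longrightarrow> Q = P"
proof -
  interpret noetherian_ring R by fact
  interpret cring R by fact
  define A where "A = {Q. ideal Q R \<and> J \<subseteq> Q \<and> (\<forall>k::nat. x [^] k \<notin> Q)}"
  have "\<exists>P\<in>A. \<forall>Q\<in>A. P \<subseteq> Q \<longrightarrow> Q = P"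
  proof (rule subset_Zorn)
    fix C assume C: "subset.chain A C"
    show "\<exists>U\<in>A. \<forall>X\<in>C. X \<subseteq> U"
    proof (cases "C = {}")
      case True
      then show ?thesis using J av by (intro bexI[of _ J]) (auto simp: A_def)
    next
      case False
      have "subset.chain {I. ideal I R} C" using C unfolding subset_chain_def A_def by blast
      then have "\<Union>C \<in> C" using ideal_chain_is_trivial[OF False] by blast
      then show ?thesis using C by (intro bexI[of _ "\<Union>C"]) (auto simp: subset_chain_def)
    qed
  qed
  then obtain P where P: "P \<in> A" "\<And>Q. Q \<in> A \<Longrightarrow> P \<subseteq> Q \<Longrightarrow> Q = P" by blast
  have Pi: "ideal P R" "J \<subseteq> P" "\<And>k::nat. x [^] k \<notin> P" using P(1) by (auto simp: A_def)
  interpret P: ideal P R by (rule Pi(1))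
  have ex: "\<exists>k::nat. \<exists>p\<in>P. \<exists>r\<in>carrier R. x [^] k = p \<oplus> r \<otimes> a" if a: "a \<in> carrier R" "a \<notin> P" for a
  proof -
    let ?Q = "P <+>\<^bsub>R\<^esub> (PIdl\<^bsub>R\<^esub> a)"
    have Q: "ideal ?Q R" by (rule add_ideals[OF Pi(1) cgenideal_ideal[OF a(1)]])
    have z: "\<zero> \<in> PIdl a" "\<zero> \<in> P"
      using additive_subgroup.zero_closed[OF ideal.axioms(1)[OF cgenideal_ideal[OF a(1)]]] P.zero_closed by auto
    have sub: "P \<subseteq> ?Q"
    proof
      fix p assume p: "p \<in> P"
      then have "p = p \<oplus> \<zero>" using P.a_subset by auto
      then show "p \<in> ?Q" unfolding set_add_def' using p z by blast
    qed
    have aQ: "a \<in> ?Q"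
    proof -
      have "a = \<zero> \<oplus> a" using a(1) by simp
      then show ?thesis unfolding set_add_def' using z cgenideal_self[OF a(1)] by blast
    qed
    have "\<not> (\<forall>k::nat. x [^] k \<notin> ?Q)"
    proof
      assume "\<forall>k::nat. x [^] k \<notin> ?Q"
      then have "?Q \<in> A" using Q sub Pi(2) by (auto simp: A_def)
      then show False using P(2) sub aQ a(2) by blast
    qed
    then show ?thesis by (auto simp: set_add_def' cgenideal_def)
  qed
  have prime: "primeideal P R"
  proof (rule primeidealI[OF Pi(1) is_cring])
    show "carrier R \<noteq> P" using Pi(3)[of 0] by auto
    fix a b assume ab: "a \<in> carrier R" "b \<in> carrier R" "a \<otimes> b \<in> P"
    show "a \<in> P \<or> b \<in> P"
    proof (rule ccontr)
      assume n: "\<not> (a \<in> P \<or> b \<in> P)"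
      obtain i :: nat and p r where i: "p \<in> P" "r \<in> carrier R" "x [^] i = p \<oplus> r \<otimes> a" using ex[OF ab(1)] n by blast
      obtain j :: nat and q s where j: "q \<in> P" "s \<in> carrier R" "x [^] j = q \<oplus> s \<otimes> b" using ex[OF ab(2)] n by blast
      have c: "p \<in> carrier R" "q \<in> carrier R" using i j P.a_subset by auto
      have "x [^] (i + j) = (p \<oplus> r \<otimes> a) \<otimes> (q \<oplus> s \<otimes> b)" using x i(3) j(3) by (simp add: nat_pow_mult[symmetric])
      also have "\<dots> = p \<otimes> (q \<oplus> s \<otimes> b) \<oplus> ((r \<otimes> a) \<otimes> q \<oplus> (r \<otimes> s) \<otimes> (a \<otimes> b))"
        using c i(2) j(2) ab by algebra
      also have "\<dots> \<in> P"
      proof -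
        have "p \<otimes> (q \<oplus> s \<otimes> b) \<in> P" by (rule P.I_r_closed[OF i(1)]) (use c j ab in auto)
        moreover have "(r \<otimes> a) \<otimes> q \<in> P" by (rule P.I_l_closed[OF j(1)]) (use i ab in auto)
        moreover have "(r \<otimes> s) \<otimes> (a \<otimes> b) \<in> P" by (rule P.I_l_closed[OF ab(3)]) (use i j in auto)
        ultimately show ?thesis by (intro additive_subgroup.a_closed[OF P.is_additive_subgroup])
      qed
      finally show False using Pi(3) by blast
    qed
  qed
  show ?thesis
    by (rule that[OF prime Pi(2,3)]) (use P(2) Pi(2) in \<open>auto simp: A_def\<close>)
qed

lemma proper_ideal_subset_local:
  fixes R (structure)
  assumes noeth: "noetherian_ring R" and loc: "local_ring R \<mm>" and I: "ideal I R" "\<one>\<^bsub>R\<^esub> \<notin> I"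
  shows "I \<subseteq> \<mm>"
proof -
  interpret cring R using loc by (simp add: local_ring_def)
  have one: "\<one> [^] (k::nat) = \<one>" for k by simp
  obtain P where P: "primeideal P R" "I \<subseteq> P" "\<And>k::nat. \<one> [^] k \<notin> P"
    "\<And>Q. ideal Q R \<Longrightarrow> P \<subseteq> Q \<Longrightarrow> (\<And>k::nat. \<one> [^] k \<notin> Q) \<Longrightarrow> Q = P"
    using ideal_maximal_avoiding_powers[OF noeth is_cring I(1), of "\<one>"] I(2) by auto
  have Pid: "ideal P R" using P(1) by (simp add: primeideal_def)
  have "maximalideal P R"
  proof (rule maximalidealI[OF Pid])
    show "carrier R \<noteq> P" using P(3)[of 0] by auto
    fix Q assume Q: "ideal Q R" "P \<subseteq> Q" "Q \<subseteq> carrier R"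
    show "Q = P \<or> Q = carrier R"
      using P(4)[OF Q(1,2)] ideal.one_imp_carrier[OF Q(1)] by auto
  qed
  then have "P = \<mm>" using loc by (auto simp: local_ring_def)
  then show ?thesis using P(2) by simp
qed

lemma in_Supp_iff:
  assumes M: "module R M" and P: "primeideal \<pp> R"
  shows "\<pp> \<in> Supp R M \<longleftrightarrow> (\<exists>x\<in>carrier M. \<forall>s\<in>carrier R - \<pp>. s \<odot>\<^bsub>M\<^esub> x \<noteq> \<zero>\<^bsub>M\<^esub>)"
proof -
  interpret M: module R M by fact
  interpret P: primeideal \<pp> R by fact
  have one: "\<one>\<^bsub>R\<^esub> \<in> carrier R - \<pp>" using P.one_imp_carrier P.I_notcarr by auto
  have mult: "s \<otimes>\<^bsub>R\<^esub> t \<in> carrier R - \<pp>" if "s \<in> carrier R - \<pp>" "t \<in> carrier R - \<pp>" for s t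
    using P.I_prime that by auto
  let ?rel = "loc_rel R M \<pp>"
  let ?Q = "carrier M \<times> (carrier R - \<pp>)"
  show ?thesis
  proof
    assume "\<pp> \<in> Supp R M"
    then have ne: "localization R M \<pp> \<noteq> {?rel `` {(\<zero>\<^bsub>M\<^esub>, \<one>\<^bsub>R\<^esub>)}}" by (simp add: Supp_def)
    show "\<exists>x\<in>carrier M. \<forall>s\<in>carrier R - \<pp>. s \<odot>\<^bsub>M\<^esub> x \<noteq> \<zero>\<^bsub>M\<^esub>"
    proof (rule ccontr)
      assume "\<not> ?thesis"
      then have kill: "\<And>x. x \<in> carrier M \<Longrightarrow> \<exists>s\<in>carrier R - \<pp>. s \<odot>\<^bsub>M\<^esub> x = \<zero>\<^bsub>M\<^esub>" by blast
      have all: "?rel `` {q} = ?Q" if q: "q \<in> ?Q" for q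
      proof
        show "?rel `` {q} \<subseteq> ?Q" by (auto simp: loc_rel_def)
        show "?Q \<subseteq> ?rel `` {q}"
        proof
          fix q' assume q': "q' \<in> ?Q"
          obtain x s y t where xs: "q = (x, s)" "q' = (y, t)" by (cases q; cases q')
          have c: "x \<in> carrier M" "y \<in> carrier M" "s \<in> carrier R - \<pp>" "t \<in> carrier R - \<pp>"
            using q q' xs by auto
          obtain u v where u: "u \<in> carrier R - \<pp>" "u \<odot>\<^bsub>M\<^esub> x = \<zero>\<^bsub>M\<^esub>"
            and v: "v \<in> carrier R - \<pp>" "v \<odot>\<^bsub>M\<^esub> y = \<zero>\<^bsub>M\<^esub>" using kill c by meson
          have R: "u \<in> carrier R" "v \<in> carrier R" "s \<in> carrier R" "t \<in> carrier R" using u v c by auto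
          have "(u \<otimes>\<^bsub>R\<^esub> v) \<odot>\<^bsub>M\<^esub> (t \<odot>\<^bsub>M\<^esub> x) = v \<odot>\<^bsub>M\<^esub> (t \<odot>\<^bsub>M\<^esub> (u \<odot>\<^bsub>M\<^esub> x))"
            using R c by (simp add: M.smult_assoc1 M.smult_lcomm[of u])
          moreover have "(u \<otimes>\<^bsub>R\<^esub> v) \<odot>\<^bsub>M\<^esub> (s \<odot>\<^bsub>M\<^esub> y) = u \<odot>\<^bsub>M\<^esub> (s \<odot>\<^bsub>M\<^esub> (v \<odot>\<^bsub>M\<^esub> y))"
            using R c by (simp add: M.smult_assoc1 M.smult_lcomm[of v])
          ultimately have "(u \<otimes>\<^bsub>R\<^esub> v) \<odot>\<^bsub>M\<^esub> (t \<odot>\<^bsub>M\<^esub> x) = (u \<otimes>\<^bsub>R\<^esub> v) \<odot>\<^bsub>M\<^esub> (s \<odot>\<^bsub>M\<^esub> y)"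
            using u v R by simp
          then show "q' \<in> ?rel `` {q}" using c mult[OF u(1) v(1)] xs by (auto simp: loc_rel_def)
        qed
      qed
      have "localization R M \<pp> = {?rel `` {(\<zero>\<^bsub>M\<^esub>, \<one>\<^bsub>R\<^esub>)}}"
        using all one unfolding localization_def quotient_def by auto
      then show False using ne by simp
    qed
  next
    assume "\<exists>x\<in>carrier M. \<forall>s\<in>carrier R - \<pp>. s \<odot>\<^bsub>M\<^esub> x \<noteq> \<zero>\<^bsub>M\<^esub>"
    then obtain x where x: "x \<in> carrier M" "\<And>s. s \<in> carrier R - \<pp> \<Longrightarrow> s \<odot>\<^bsub>M\<^esub> x \<noteq> \<zero>\<^bsub>M\<^esub>" by blast
    have "localization R M \<pp> \<noteq> {?rel `` {(\<zero>\<^bsub>M\<^esub>, \<one>\<^bsub>R\<^esub>)}}"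
    proof
      assume eq: "localization R M \<pp> = {?rel `` {(\<zero>\<^bsub>M\<^esub>, \<one>\<^bsub>R\<^esub>)}}"
      have "?rel `` {(x, \<one>\<^bsub>R\<^esub>)} \<in> localization R M \<pp>"
        unfolding localization_def using x one by (intro quotientI) auto
      then have "?rel `` {(x, \<one>\<^bsub>R\<^esub>)} = ?rel `` {(\<zero>\<^bsub>M\<^esub>, \<one>\<^bsub>R\<^esub>)}" using eq by simp
      moreover have "(x, \<one>\<^bsub>R\<^esub>) \<in> ?rel `` {(x, \<one>\<^bsub>R\<^esub>)}" using x one by (auto simp: loc_rel_def)
      ultimately have "((\<zero>\<^bsub>M\<^esub>, \<one>\<^bsub>R\<^esub>), (x, \<one>\<^bsub>R\<^esub>)) \<in> ?rel" by blast
      then obtain u where "u \<in> carrier R - \<pp>"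
        "u \<odot>\<^bsub>M\<^esub> (\<one>\<^bsub>R\<^esub> \<odot>\<^bsub>M\<^esub> \<zero>\<^bsub>M\<^esub>) = u \<odot>\<^bsub>M\<^esub> (\<one>\<^bsub>R\<^esub> \<odot>\<^bsub>M\<^esub> x)"
        by (auto simp: loc_rel_def)
      then show False using x by auto
    qed
    then show "\<pp> \<in> Supp R M" using P by (simp add: Supp_def)
  qed
qed

text \<open>Otherwise some prime ideal contains the annihilator of \<open>m\<close> but not \<open>x\<close>, and it belongs to the
  support.\<close>

lemma torsion_if_Supp_subset:
  assumes noeth: "noetherian_ring R" and M: "module R M" and Supp: "Supp R M \<subseteq> zero_locus R I"
    and I: "ideal I R" and x: "x \<in> I" and m: "m \<in> carrier M"
  shows "\<exists>k::nat. x [^]\<^bsub>R\<^esub> k \<odot>\<^bsub>M\<^esub> m = \<zero>\<^bsub>M\<^esub>"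
proof (rule ccontr)
  assume "\<not> ?thesis"
  then have n: "\<And>k::nat. x [^]\<^bsub>R\<^esub> k \<odot>\<^bsub>M\<^esub> m \<noteq> \<zero>\<^bsub>M\<^esub>" by blast
  interpret M: module R M by fact
  interpret I: ideal I R by fact
  have xR: "x \<in> carrier R" using x I.a_subset by blast
  define J where "J = {r \<in> carrier R. r \<odot>\<^bsub>M\<^esub> m = \<zero>\<^bsub>M\<^esub>}"
  have J: "ideal J R"
  proof (rule idealI[OF M.R.ring_axioms])
    show "subgroup J (add_monoid R)"
    proof (rule group.subgroupI)
      show "group (add_monoid R)" using M.R.add.is_group .
      show "J \<noteq> {}" using m by (auto simp: J_def intro!: exI[of _ "\<zero>\<^bsub>R\<^esub>"])
    qed (use m in \<open>auto simp: J_def M.smult_l_distr M.smult_l_minus M.minus_zero_module a_inv_def[symmetric]\<close>)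
    show "r \<otimes>\<^bsub>R\<^esub> a \<in> J" "a \<otimes>\<^bsub>R\<^esub> r \<in> J" if "a \<in> J" "r \<in> carrier R" for a r
    proof -
      have "r \<otimes>\<^bsub>R\<^esub> a \<in> J" using that m by (auto simp: J_def M.smult_assoc1)
      then show "r \<otimes>\<^bsub>R\<^esub> a \<in> J" "a \<otimes>\<^bsub>R\<^esub> r \<in> J" using that by (auto simp: J_def M.R.m_comm)
    qed
  qed
  have "x [^]\<^bsub>R\<^esub> k \<notin> J" for k :: nat using n by (simp add: J_def)
  then obtain P where P: "primeideal P R" "J \<subseteq> P" "\<And>k::nat. x [^]\<^bsub>R\<^esub> k \<notin> P"
    by (rule ideal_maximal_avoiding_powers[OF noeth M.R.is_cring J xR]) blast
  have "P \<in> Supp R M"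
    unfolding in_Supp_iff[OF M P(1)] using m P(2) by (auto simp: J_def)
  then have "x \<in> P" using Supp x by (auto simp: zero_locus_def)
  then show False using P(3)[of 1] xR by simp
qed

text \<open>The sums \<open>t k = \<Sum>j. r (k + j) x\<^sup>j\<close> are limits of partial sums; the relation between \<open>t k\<close>
  and \<open>t (k + 1)\<close> holds because limits are unique.\<close>

lemma power_series_summable_if_adic_complete:
  fixes R (structure)
  assumes "cring R" and \<mm>: "ideal \<mm> R" and complete: "adic_complete R \<mm>" and x: "x \<in> \<mm>"
  shows "power_series_summable R x"
  unfolding power_series_summable_def
proof (intro allI impI)
  interpret cring R by fact
  interpret m: ideal \<mm> R by fact
  fix r :: "nat \<Rightarrow> 'a" assume "range r \<subseteq> carrier R"
  then have r: "r k \<in> carrier R" for k by blast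
  have xR: "x \<in> carrier R" using x m.a_subset by blast
  have pow: "ideal (ideal_power R \<mm> n) R" for n
    by (induction n) (auto intro: oneideal ideal_prod_is_ideal \<mm>)
  have xpow: "x [^] n \<in> ideal_power R \<mm> n" for n
  proof (induction n)
    case (Suc n)
    then have "x \<otimes> x [^] n \<in> ideal_prod R \<mm> (ideal_power R \<mm> n)" by (intro ideal_prod.prod x)
    then show ?case using xR by (simp add: nat_pow_Suc2[symmetric] del: nat_pow_Suc)
  qed simp
  define s where "s = rec_nat (\<lambda>_. \<zero>) (\<lambda>N f k. r k \<oplus> x \<otimes> f (Suc k))"
  have s0: "s 0 k = \<zero>" and sS: "s (Suc N) k = r k \<oplus> x \<otimes> s N (Suc k)" for N k by (simp_all add: s_def)
  have sR: "s N k \<in> carrier R" for N k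
    by (induction N arbitrary: k) (auto simp: s0 sS r xR)
  have tail: "s (N + n) k = s N k \<oplus> x [^] N \<otimes> s n (k + N)" for N n k
  proof (induction N arbitrary: k)
    case 0
    then show ?case by (simp add: s0 sR)
  next
    case (Suc N)
    have "s (Suc N + n) k = r k \<oplus> x \<otimes> (s N (Suc k) \<oplus> x [^] N \<otimes> s n (Suc k + N))" using Suc by (simp add: sS)
    also have "\<dots> = (r k \<oplus> x \<otimes> s N (Suc k)) \<oplus> (x [^] N \<otimes> x) \<otimes> s n (Suc k + N)"
    proof -
      have "x [^] N \<in> carrier R" using xR by simp
      then show ?thesis using xR r[of k] sR[of N "Suc k"] sR[of n "Suc k + N"] by algebra
    qed
    finally show ?case by (simp add: sS)
  qed
  have diff: "s i k \<ominus> s N k \<in> ideal_power R \<mm> N" if "N \<le> i" for i N k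
  proof -
    obtain n where n: "i = N + n" using \<open>N \<le> i\<close> le_Suc_ex by blast
    have "x [^] N \<in> carrier R" using xR by simp
    then have "s i k \<ominus> s N k = x [^] N \<otimes> s n (k + N)"
      unfolding n tail using sR[of N k] sR[of n "k + N"] by algebra
    then show ?thesis using ideal.I_r_closed[OF pow xpow sR] by simp
  qed
  have cauchy: "adic_Cauchy R \<mm> (\<lambda>i. s i k)" for k
    unfolding adic_Cauchy_def
  proof (intro allI, rule exI, intro allI impI)
    fix N i j :: nat assume ij: "N \<le> i" "N \<le> j"
    have "s i k \<ominus> s j k = (s i k \<ominus> s N k) \<oplus> \<ominus> (s j k \<ominus> s N k)"
      using sR[of i k] sR[of j k] sR[of N k] by algebra
    then show "s i k \<ominus> s j k \<in> ideal_power R \<mm> N"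
      using diff[OF ij(1)] diff[OF ij(2)] additive_subgroup.a_closed[OF ideal.axioms(1)[OF pow]]
        additive_subgroup.a_inv_closed[OF ideal.axioms(1)[OF pow]] by simp
  qed
  have lim: "\<exists>!l. l \<in> carrier R \<and> adic_limit R \<mm> (\<lambda>i. s i k) l" for k
    using complete cauchy[of k] sR unfolding adic_complete_def by (simp add: image_subset_iff)
  define t where "t k = (THE l. l \<in> carrier R \<and> adic_limit R \<mm> (\<lambda>i. s i k) l)" for k
  have t: "t k \<in> carrier R" "adic_limit R \<mm> (\<lambda>i. s i k) (t k)" for k
    using theI'[OF lim[of k]] unfolding t_def by blast+
  have t_eq: "t k = r k \<oplus> x \<otimes> t (Suc k)" for k
  proof -
    have "adic_limit R \<mm> (\<lambda>i. s i k) (r k \<oplus> x \<otimes> t (Suc k))"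
      unfolding adic_limit_def
    proof
      fix n
      obtain N where N: "\<And>i. N \<le> i \<Longrightarrow> s i (Suc k) \<ominus> t (Suc k) \<in> ideal_power R \<mm> n"
        using t(2)[of "Suc k"] unfolding adic_limit_def by blast
      show "\<exists>N. \<forall>i\<ge>N. s i k \<ominus> (r k \<oplus> x \<otimes> t (Suc k)) \<in> ideal_power R \<mm> n"
      proof (intro exI allI impI)
        fix i assume "Suc N \<le> i"
        then obtain j where j: "i = Suc j" "N \<le> j" by (metis Suc_le_D Suc_le_mono)
        have "s i k \<ominus> (r k \<oplus> x \<otimes> t (Suc k)) = x \<otimes> (s j (Suc k) \<ominus> t (Suc k))"
          unfolding j(1) sS using r[of k] xR sR[of j "Suc k"] t(1)[of "Suc k"] by algebra
        then show "s i k \<ominus> (r k \<oplus> x \<otimes> t (Suc k)) \<in> ideal_power R \<mm> n"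
          using ideal.I_l_closed[OF pow N[OF j(2)] xR] by simp
      qed
    qed
    then show ?thesis
      using t(1)[of "Suc k"] r[of k] xR unfolding t_def[of k] by (intro the1_equality[OF lim]) simp
  qed
  have "range t \<subseteq> carrier R" using t(1) by blast
  with t_eq show "\<exists>t. range t \<subseteq> carrier R \<and> (\<forall>k. t k = r k \<oplus> x \<otimes> t (Suc k))" by blast
qed

section \<open>Dimension of quotient rings\<close>

context cring
begin

lemma carrier_quotient: "carrier (R Quot J) = (\<lambda>x. J +> x) ` carrier R"
  unfolding FactRing_def A_RCOSETS_def' by auto

lemma prime_vimage_quotient:
  assumes J: "ideal J R" and Q: "primeideal Q (R Quot J)"
  shows "primeideal {x \<in> carrier R. J +> x \<in> Q} R" "J \<subseteq> {x \<in> carrier R. J +> x \<in> Q}"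
    "Q = (\<lambda>x. J +> x) ` {x \<in> carrier R. J +> x \<in> Q}"
proof -
  interpret J: ideal J R by fact
  interpret h: ring_hom_ring R "R Quot J" "(+>) J" by (rule J.rcos_ring_hom_ring)
  interpret Q: primeideal Q "R Quot J" by fact
  note carr = carrier_quotient[of J]
  show Qeq: "Q = (\<lambda>x. J +> x) ` {x \<in> carrier R. J +> x \<in> Q}"
    using Q.a_subset unfolding carr by auto
  have "ideal {x \<in> carrier R. J +> x \<in> Q} R"
    using h.ideal_vimage[OF Q.is_ideal] by simp
  then show "primeideal {x \<in> carrier R. J +> x \<in> Q} R"
  proof (rule primeidealI[OF _ is_cring])
    show "carrier R \<noteq> {x \<in> carrier R. J +> x \<in> Q}"
    proof
      assume "carrier R = {x \<in> carrier R. J +> x \<in> Q}"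
      then have "\<one> \<in> {x \<in> carrier R. J +> x \<in> Q}" using one_closed by metis
      then have "\<one>\<^bsub>R Quot J\<^esub> \<in> Q" using h.hom_one by simp
      then show False using Q.one_imp_carrier Q.I_notcarr by simp
    qed
    fix a b assume "a \<in> carrier R" "b \<in> carrier R" "a \<otimes> b \<in> {x \<in> carrier R. J +> x \<in> Q}"
    then show "a \<in> {x \<in> carrier R. J +> x \<in> Q} \<or> b \<in> {x \<in> carrier R. J +> x \<in> Q}"
      using Q.I_prime[of "J +> a" "J +> b"] h.hom_mult[of a b] h.hom_closed by auto
  qed
  show "J \<subseteq> {x \<in> carrier R. J +> x \<in> Q}"
  proof
    fix x assume x: "x \<in> J"
    then have xc: "x \<in> carrier R" using J.a_subset by blast
    have "J +> x = \<zero>\<^bsub>R Quot J\<^esub>" using J.a_rcos_const[OF x] unfolding FactRing_def by simp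
    then show "x \<in> {x \<in> carrier R. J +> x \<in> Q}"
      using xc additive_subgroup.zero_closed[OF Q.is_additive_subgroup] by simp
  qed
qed

lemma coset_in_image_iff:
  assumes J: "ideal J R" and P: "ideal P R" and JP: "J \<subseteq> P" and x: "x \<in> carrier R"
  shows "J +> x \<in> (\<lambda>x. J +> x) ` P \<longleftrightarrow> x \<in> P"
proof
  interpret J: ideal J R by fact
  interpret P: ideal P R by fact
  assume "J +> x \<in> (\<lambda>x. J +> x) ` P"
  then obtain p where p: "p \<in> P" "J +> x = J +> p" by blast
  then have "x \<ominus> p \<in> J" using quotient_eq_iff_same_a_r_cos[OF J x, of p] P.a_subset by auto
  then have "x \<ominus> p \<in> P" using JP by blast
  then have "(x \<ominus> p) \<oplus> p \<in> P" using p additive_subgroup.a_closed[OF P.is_additive_subgroup] by blast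
  moreover have "p \<in> carrier R" using p P.a_subset by blast
  then have "(x \<ominus> p) \<oplus> p = x" using x by algebra
  ultimately show "x \<in> P" by simp
qed simp

lemma prime_image_quotient:
  assumes J: "ideal J R" and P: "primeideal P R" and JP: "J \<subseteq> P"
  shows "primeideal ((\<lambda>x. J +> x) ` P) (R Quot J)"
proof -
  interpret J: ideal J R by fact
  interpret h: ring_hom_ring R "R Quot J" "(+>) J" by (rule J.rcos_ring_hom_ring)
  interpret P: primeideal P R by fact
  note iff = coset_in_image_iff[OF J P.is_ideal JP]
  note carr = carrier_quotient[of J]
  show ?thesis
  proof (rule primeidealI)
    show "ideal ((\<lambda>x. J +> x) ` P) (R Quot J)"
      by (rule ring_ideal_imp_quot_ideal[OF J P.is_ideal])
    show "cring (R Quot J)" by (rule J.quotient_is_cring[OF is_cring])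
    show "carrier (R Quot J) \<noteq> (\<lambda>x. J +> x) ` P"
    proof
      assume "carrier (R Quot J) = (\<lambda>x. J +> x) ` P"
      then have "J +> \<one> \<in> (\<lambda>x. J +> x) ` P" unfolding carr using one_closed by blast
      then show False using iff[OF one_closed] P.one_imp_carrier P.I_notcarr by simp
    qed
    fix X Y assume "X \<in> carrier (R Quot J)" "Y \<in> carrier (R Quot J)" "X \<otimes>\<^bsub>R Quot J\<^esub> Y \<in> (\<lambda>x. J +> x) ` P"
    then obtain a b where ab: "a \<in> carrier R" "b \<in> carrier R" "X = J +> a" "Y = J +> b"
      "J +> (a \<otimes> b) \<in> (\<lambda>x. J +> x) ` P"
      unfolding carr using h.hom_mult by auto
    then have "a \<otimes> b \<in> P" using iff[of "a \<otimes> b"] by simp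
    then show "X \<in> (\<lambda>x. J +> x) ` P \<or> Y \<in> (\<lambda>x. J +> x) ` P"
      using P.I_prime[OF ab(1,2)] unfolding ab(3,4) by blast
  qed
qed

lemma krull_dim_quotient:
  assumes J: "ideal J R"
  shows "krull_dim (R Quot J) = Sup {ereal (real n) | n. \<exists>P :: nat \<Rightarrow> 'a set.
    (\<forall>i\<le>n. primeideal (P i) R \<and> J \<subseteq> P i) \<and> (\<forall>i<n. P i \<subset> P (Suc i))}"
proof -
  have "(\<exists>Q :: nat \<Rightarrow> 'a set set. (\<forall>i\<le>n. primeideal (Q i) (R Quot J)) \<and> (\<forall>i<n. Q i \<subset> Q (Suc i))) \<longleftrightarrow>
      (\<exists>P :: nat \<Rightarrow> 'a set. (\<forall>i\<le>n. primeideal (P i) R \<and> J \<subseteq> P i) \<and> (\<forall>i<n. P i \<subset> P (Suc i)))" for n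
  proof
    assume "\<exists>Q :: nat \<Rightarrow> 'a set set. (\<forall>i\<le>n. primeideal (Q i) (R Quot J)) \<and> (\<forall>i<n. Q i \<subset> Q (Suc i))"
    then obtain Q :: "nat \<Rightarrow> 'a set set" where Q: "\<And>i. i \<le> n \<Longrightarrow> primeideal (Q i) (R Quot J)"
      "\<And>i. i < n \<Longrightarrow> Q i \<subset> Q (Suc i)" by blast
    define P where "P i = {x \<in> carrier R. J +> x \<in> Q i}" for i
    have P: "primeideal (P i) R" "J \<subseteq> P i" "Q i = (\<lambda>x. J +> x) ` P i" if "i \<le> n" for i
      using prime_vimage_quotient[OF J Q(1)[OF that]] unfolding P_def by auto
    have "P i \<subset> P (Suc i)" if "i < n" for i
    proof
      show "P i \<subseteq> P (Suc i)" using Q(2)[OF that] by (auto simp: P_def)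
      show "P i \<noteq> P (Suc i)" using Q(2)[OF that] P(3)[of i] P(3)[of "Suc i"] that by auto
    qed
    then show "\<exists>P :: nat \<Rightarrow> 'a set. (\<forall>i\<le>n. primeideal (P i) R \<and> J \<subseteq> P i) \<and> (\<forall>i<n. P i \<subset> P (Suc i))"
      using P by (intro exI[of _ P]) auto
  next
    assume "\<exists>P :: nat \<Rightarrow> 'a set. (\<forall>i\<le>n. primeideal (P i) R \<and> J \<subseteq> P i) \<and> (\<forall>i<n. P i \<subset> P (Suc i))"
    then obtain P :: "nat \<Rightarrow> 'a set" where P: "\<And>i. i \<le> n \<Longrightarrow> primeideal (P i) R" "\<And>i. i \<le> n \<Longrightarrow> J \<subseteq> P i"
      "\<And>i. i < n \<Longrightarrow> P i \<subset> P (Suc i)" by blast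
    have Pid: "ideal (P i) R" if "i \<le> n" for i using P(1)[OF that] by (simp add: primeideal_def)
    define Q where "Q i = (\<lambda>x. J +> x) ` P i" for i
    have "Q i \<subset> Q (Suc i)" if i: "i < n" for i
    proof -
      obtain x where x: "x \<in> P (Suc i)" "x \<notin> P i" using P(3)[OF i] by blast
      then have "x \<in> carrier R"
        using additive_subgroup.a_subset[OF ideal.axioms(1)[OF Pid[of "Suc i"]]] i by auto
      then have "J +> x \<notin> Q i"
        using x coset_in_image_iff[OF J Pid[of i] P(2)[of i]] i by (simp add: Q_def)
      then show ?thesis using P(3)[OF i] x by (auto simp: Q_def)
    qed
    then show "\<exists>Q :: nat \<Rightarrow> 'a set set. (\<forall>i\<le>n. primeideal (Q i) (R Quot J)) \<and> (\<forall>i<n. Q i \<subset> Q (Suc i))"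
      using prime_image_quotient[OF J P(1,2)] by (intro exI[of _ Q]) (auto simp: Q_def)
  qed
  then show ?thesis unfolding krull_dim_def by simp
qed

text \<open>A chain of primes containing \<open>J\<close> is a chain of primes containing its first member.\<close>

lemma krull_dim_quotient_eq_SUP:
  assumes J: "ideal J R"
  shows "krull_dim (R Quot J) = (SUP \<pp>\<in>zero_locus R J. krull_dim (R Quot \<pp>))"
proof (rule antisym)
  define D where "D J n \<longleftrightarrow> (\<exists>P :: nat \<Rightarrow> 'a set. (\<forall>i\<le>n. primeideal (P i) R \<and> J \<subseteq> P i) \<and> (\<forall>i<n. P i \<subset> P (Suc i)))"
    for J and n :: nat
  have kd: "krull_dim (R Quot J) = Sup {ereal (real n) | n. D J n}" if "ideal J R" for J
    unfolding D_def by (rule krull_dim_quotient[OF that])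
  have prime: "ideal \<pp> R" if "\<pp> \<in> zero_locus R J" for \<pp>
    using that by (auto simp: zero_locus_def primeideal_def)
  show "krull_dim (R Quot J) \<le> (SUP \<pp>\<in>zero_locus R J. krull_dim (R Quot \<pp>))"
    unfolding kd[OF J]
  proof (rule Sup_least, safe)
    fix n assume "D J n"
    then obtain P :: "nat \<Rightarrow> 'a set" where P: "\<And>i. i \<le> n \<Longrightarrow> primeideal (P i) R" "\<And>i. i \<le> n \<Longrightarrow> J \<subseteq> P i"
      "\<And>i. i < n \<Longrightarrow> P i \<subset> P (Suc i)" unfolding D_def by blast
    have P0: "P 0 \<in> zero_locus R J" using P(1,2)[of 0] by (simp add: zero_locus_def)
    have "P 0 \<subseteq> P i" if "i \<le> n" for i
      using that
    proof (induction i)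
      case (Suc i)
      then show ?case using P(3)[of i] by auto
    qed simp
    then have "D (P 0) n" unfolding D_def using P by (intro exI[of _ P]) auto
    then have "ereal (real n) \<le> krull_dim (R Quot (P 0))"
      unfolding kd[OF prime[OF P0]] by (intro Sup_upper) blast
    also have "\<dots> \<le> (SUP \<pp>\<in>zero_locus R J. krull_dim (R Quot \<pp>))" by (rule SUP_upper[OF P0])
    finally show "ereal (real n) \<le> (SUP \<pp>\<in>zero_locus R J. krull_dim (R Quot \<pp>))" .
  qed
  show "(SUP \<pp>\<in>zero_locus R J. krull_dim (R Quot \<pp>)) \<le> krull_dim (R Quot J)"
  proof (rule SUP_least)
    fix \<pp> assume p: "\<pp> \<in> zero_locus R J"
    then have "J \<subseteq> \<pp>" by (simp add: zero_locus_def)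
    then have "D J n" if "D \<pp> n" for n using that unfolding D_def by (meson subset_trans)
    then show "krull_dim (R Quot \<pp>) \<le> krull_dim (R Quot J)"
      unfolding kd[OF prime[OF p]] kd[OF J] by (intro Sup_subset_mono) blast
  qed
qed

end

section \<open>The support of a cofinite module\<close>

lemma ideal_annihilator:
  assumes "module R M" shows "ideal (annihilator R M) R"
proof -
  interpret module R M by fact
  have mult: "r \<otimes>\<^bsub>R\<^esub> a \<in> annihilator R M" if "a \<in> annihilator R M" "r \<in> carrier R" for a r
    using that by (auto simp: annihilator_def smult_assoc1)
  show ?thesis
  proof (rule idealI[OF R.ring_axioms])
    show "subgroup (annihilator R M) (add_monoid R)"
    proof (rule group.subgroupI)
      show "Group.group (add_monoid R)" using R.add.is_group .
      show "annihilator R M \<noteq> {}" by (auto simp: annihilator_def intro!: exI[of _ "\<zero>\<^bsub>R\<^esub>"])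
    qed (auto simp: annihilator_def smult_l_distr smult_l_minus minus_zero_module a_inv_def[symmetric])
    show "r \<otimes>\<^bsub>R\<^esub> a \<in> annihilator R M" "a \<otimes>\<^bsub>R\<^esub> r \<in> annihilator R M"
      if "a \<in> annihilator R M" "r \<in> carrier R" for a r
      using mult[OF that] that by (auto simp: annihilator_def R.m_comm)
  qed
qed

lemma fg_cohomology_if_cofinite:
  assumes noeth: "noetherian_ring R" and I: "ideal I R" and M: "module R M" and cof: "cofinite_module R I M"
  obtains S and bnd :: "('a, 'a set) syz \<Rightarrow> ('a, 'a set) syz \<Rightarrow> 'a" and e
  where "free_complex R S bnd" "S 0 = {e}" "\<And>t. t \<in> S 1 \<Longrightarrow> bnd t e \<in> I"
    "free_complex.fg_cohomology R S bnd M (carrier M)"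
proof -
  interpret M: module R M by fact
  have R: "cring R" by (rule M.R.is_cring)
  interpret A: module R "regular_module R" by (rule M.R.module_regular_module)
  note IA = M.R.submodule_regular_module[OF I]
  define N where "N = quot_module (regular_module R) I"
  have N: "module R N" unfolding N_def by (rule A.module_quot_module[OF IA])
  interpret N: module R N by (rule N)
  define e where "e = I +>\<^bsub>regular_module R\<^esub> \<one>\<^bsub>R\<^esub>"
  have re: "r \<odot>\<^bsub>N\<^esub> e = I +>\<^bsub>regular_module R\<^esub> r" if "r \<in> carrier R" for r
    using A.quot_module_smult[OF IA that, of "\<one>\<^bsub>R\<^esub>"] that by (simp add: N_def e_def regular_module_simps)
  interpret C: cyclic_module R N e
  proof
    show "e \<in> carrier N" unfolding N_def A.quot_module_carrier[OF IA] e_def by (auto simp: regular_module_simps)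
    show "\<exists>r\<in>carrier R. y = r \<odot>\<^bsub>N\<^esub> e" if "y \<in> carrier N" for y
      using that re unfolding N_def A.quot_module_carrier[OF IA] by (auto simp: regular_module_simps)
  qed
  obtain S where S: "S 0 = {Gen e}" "\<And>j. finite (S j)" "\<And>j. S j \<subseteq> std_basis R N j"
    "\<And>j. S (Suc j) \<subseteq> Syz ` {xs. set xs \<subseteq> S j \<times> carrier R}"
    "\<And>j. std_cycles R N j \<inter> C.free (S j) \<subseteq> std_diff R ` C.free (S (Suc j))"
    using C.finite_subresolution[OF noeth] by blast
  show ?thesis
  proof (rule that)
    show "free_complex R S (\<lambda>s. lin_comb R (rel_of s))" by (rule C.free_complex_subresolution[of S, OF S(2-4)])
    show "S 0 = {Gen e}" by (rule S(1))
    show "free_complex.fg_cohomology R S (\<lambda>s. lin_comb R (rel_of s)) M (carrier M)"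
    proof (rule C.fg_cohomology_if_Ext[OF M])
      show "fin_gen_module R (Ext R j N M)" for j
        using cof by (simp add: cofinite_module_def N_def)
    qed (rule S)+
    fix t assume t: "t \<in> S 1"
    define b where "b = lin_comb R (rel_of t)"
    have b: "b \<in> C.free {Gen e}" using C.bnd_closed[OF S(4)[of 0]] t S(1) by (simp add: b_def)
    then have bR: "b (Gen e) \<in> carrier R" by (rule free_module_val)
    have "t \<in> std_basis R N (Suc 0)" using S(3)[of 1] t by auto
    then have "b \<in> std_cycles R N 0" unfolding std_basis_Suc[OF R, of N 0] b_def by auto
    then have "std_aug R N b = \<zero>\<^bsub>N\<^esub>" by (simp add: std_cycles_def)
    moreover have "std_aug R N b = (\<Oplus>\<^bsub>N\<^esub>s\<in>{Gen e}. b s \<odot>\<^bsub>N\<^esub> gen_of s)"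
      unfolding std_aug_def using b C.gen(1)
      by (intro lin_ext_superset[OF N]) (auto simp: free_module_simps)
    ultimately have "b (Gen e) \<odot>\<^bsub>N\<^esub> e = \<zero>\<^bsub>N\<^esub>" using bR C.gen(1) by simp
    then have "I +>\<^bsub>regular_module R\<^esub> b (Gen e) = I +>\<^bsub>regular_module R\<^esub> \<zero>\<^bsub>regular_module R\<^esub>"
      using re[OF bR] A.quot_module_zero[OF IA] unfolding N_def by simp
    then have "b (Gen e) \<ominus>\<^bsub>regular_module R\<^esub> \<zero>\<^bsub>regular_module R\<^esub> \<in> I"
      using A.coset_eq_iff[OF IA, of "b (Gen e)" "\<zero>\<^bsub>regular_module R\<^esub>"] bR by (simp add: regular_module_simps)
    moreover have "b (Gen e) \<ominus>\<^bsub>regular_module R\<^esub> \<zero>\<^bsub>regular_module R\<^esub> = b (Gen e)"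
      using bR A.minus_zero_module A.M.r_zero[of "b (Gen e)"] by (simp add: A.M.minus_eq regular_module_simps(1))
    ultimately show "lin_comb R (rel_of t) (Gen e) \<in> I" by (simp add: b_def)
  qed
qed

text \<open>The finitely generated Koszul homology of \<open>M\<close> is killed by some \<open>s\<close> outside a given prime
  \<open>P\<close> that contains \<open>I + Ann M\<close> but is not in the support. The element \<open>f = s\<^sup>n + a\<close> obtained from it
  kills all of \<open>M\<close>, as every element of \<open>M\<close> is killed by powers of the elements of \<open>I\<close>; hence
  \<open>f \<in> P\<close>, which contradicts \<open>s \<notin> P\<close>.\<close>

theorem Supp_cofinite:
  fixes R :: "('a, 'r) ring_scheme" and M :: "('a, 'b, 'm) module_scheme"
  assumes noeth: "noetherian_ring R" and loc: "local_ring R \<mm>" and complete: "adic_complete R \<mm>"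
    and I: "ideal I R" and M: "module R M" and ne: "carrier M \<noteq> {\<zero>\<^bsub>M\<^esub>}" and cof: "cofinite_module R I M"
  shows "Supp R M = zero_locus R (I <+>\<^bsub>R\<^esub> annihilator R M)"
proof -
  interpret M: module R M by fact
  interpret I: ideal I R by fact
  have R: "cring R" by (rule M.R.is_cring)
  note Ann = ideal_annihilator[OF M]
  have Supp: "Supp R M \<subseteq> zero_locus R I" using cof by (simp add: cofinite_module_def)
  note torsion = torsion_if_Supp_subset[OF noeth M Supp I]
  (* 1 \<in> I would make M torsion for the element 1, hence zero. *)
  have "\<one>\<^bsub>R\<^esub> \<notin> I"
  proof
    assume "\<one>\<^bsub>R\<^esub> \<in> I"
    from torsion[OF this] have "m = \<zero>\<^bsub>M\<^esub>" if "m \<in> carrier M" for m using that by auto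
    then show False using ne M.M.zero_closed by blast
  qed
  then have Im: "I \<subseteq> \<mm>" by (rule proper_ideal_subset_local[OF noeth loc I])
  have \<mm>: "ideal \<mm> R" using loc by (simp add: local_ring_def maximalideal_def)
  have sum_subset: "I <+>\<^bsub>R\<^esub> annihilator R M \<subseteq> P \<longleftrightarrow> I \<subseteq> P \<and> annihilator R M \<subseteq> P" if P: "ideal P R" for P
  proof -
    interpret P: ideal P R by fact
    have z: "\<zero>\<^bsub>R\<^esub> \<in> I" "\<zero>\<^bsub>R\<^esub> \<in> annihilator R M"
      using I.zero_closed additive_subgroup.zero_closed[OF ideal.axioms(1)[OF Ann]] by auto
    have Ac: "annihilator R M \<subseteq> carrier R" by (auto simp: annihilator_def)
    have "I \<subseteq> I <+>\<^bsub>R\<^esub> annihilator R M"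
    proof
      fix x assume "x \<in> I"
      then have "x = x \<oplus>\<^bsub>R\<^esub> \<zero>\<^bsub>R\<^esub>" using I.a_subset by auto
      then show "x \<in> I <+>\<^bsub>R\<^esub> annihilator R M" unfolding set_add_def' using \<open>x \<in> I\<close> z by blast
    qed
    moreover have "annihilator R M \<subseteq> I <+>\<^bsub>R\<^esub> annihilator R M"
    proof
      fix x assume "x \<in> annihilator R M"
      then have "x = \<zero>\<^bsub>R\<^esub> \<oplus>\<^bsub>R\<^esub> x" using Ac by auto
      then show "x \<in> I <+>\<^bsub>R\<^esub> annihilator R M" unfolding set_add_def' using \<open>x \<in> annihilator R M\<close> z by blast
    qed
    moreover have "I <+>\<^bsub>R\<^esub> annihilator R M \<subseteq> P" if "I \<subseteq> P" "annihilator R M \<subseteq> P"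
      using that additive_subgroup.a_closed[OF P.is_additive_subgroup] unfolding set_add_def' by blast
    ultimately show ?thesis by blast
  qed
  show ?thesis
  proof (intro equalityI subsetI)
    fix P assume P: "P \<in> Supp R M"
    then have prime: "primeideal P R" by (simp add: Supp_def)
    then have Pid: "ideal P R" by (simp add: primeideal_def)
    obtain x where x: "x \<in> carrier M" "\<And>s. s \<in> carrier R - P \<Longrightarrow> s \<odot>\<^bsub>M\<^esub> x \<noteq> \<zero>\<^bsub>M\<^esub>"
      using P unfolding in_Supp_iff[OF M prime] by blast
    then have "annihilator R M \<subseteq> P" by (auto simp: annihilator_def)
    then show "P \<in> zero_locus R (I <+>\<^bsub>R\<^esub> annihilator R M)"
      using prime sum_subset[OF Pid] P Supp by (auto simp: zero_locus_def)
  next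
    fix P assume "P \<in> zero_locus R (I <+>\<^bsub>R\<^esub> annihilator R M)"
    then have prime: "primeideal P R" and "I <+>\<^bsub>R\<^esub> annihilator R M \<subseteq> P" by (auto simp: zero_locus_def)
    moreover from this have Pid: "ideal P R" by (simp add: primeideal_def)
    ultimately have IP: "I \<subseteq> P" and AP: "annihilator R M \<subseteq> P" using sum_subset by auto
    interpret P: primeideal P R by (rule prime)
    show "P \<in> Supp R M"
    proof (rule ccontr)
      assume "P \<notin> Supp R M"
      then have kill: "\<exists>s\<in>carrier R - P. s \<odot>\<^bsub>M\<^esub> m = \<zero>\<^bsub>M\<^esub>" if "m \<in> carrier M" for m
        using that unfolding in_Supp_iff[OF M prime] by blast
      obtain S and bnd :: "('a, 'a set) syz \<Rightarrow> ('a, 'a set) syz \<Rightarrow> 'a" and e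
        where C: "free_complex R S bnd" and S0: "S 0 = {e}" and bI: "\<And>t. t \<in> S 1 \<Longrightarrow> bnd t e \<in> I"
          and coh: "free_complex.fg_cohomology R S bnd M (carrier M)"
        using fg_cohomology_if_cofinite[OF noeth I M cof] by metis
      interpret C: free_complex R S bnd by (rule C)
      let ?V = "fun_module M :: ('a, nat \<Rightarrow> 'b) module"
      interpret V: sequence_module R ?V interleave even_part odd_part uncurry_seq curry_seq
        by (rule sequence_module_fun_module[OF M])
      obtain xs where xs: "set xs = (\<lambda>t. bnd t e) ` S 1"
        using finite_list[OF finite_imageI[OF C.finite_basis[of 1], of "\<lambda>t. bnd t e"]] by blast
      have xsI: "set xs \<subseteq> I" using xs bI by auto
      have xsR: "set xs \<subseteq> carrier R" using xsI I.a_subset by blast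
      have sums: "power_series_summable R x" if "x \<in> set xs" for x
        by (rule power_series_summable_if_adic_complete[OF R \<mm> complete]) (use that xsI Im in blast)
      (* M embedded into the module of sequences, in which all Koszul constructions take place *)
      define \<iota> where "\<iota> m = (\<lambda>i::nat. if i = 0 then m else \<zero>\<^bsub>M\<^esub>)" for m
      have \<iota>: "linear_on R M (carrier M) ?V \<iota>"
        by (rule linear_onI) (auto simp: \<iota>_def fun_module_simps fun_eq_iff)
      define E where "E = \<iota> ` carrier M"
      have E: "submodule E R ?V"
        unfolding E_def by (rule submodule_image[OF M V.module_axioms M.carrier_is_submodule \<iota>])
      have "{m \<in> carrier M. \<iota> m = \<zero>\<^bsub>?V\<^esub>} = {\<zero>\<^bsub>M\<^esub>}"
        by (auto simp: \<iota>_def fun_module_simps fun_eq_iff)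
      then have cohE: "C.fg_cohomology ?V E"
        unfolding E_def
        using C.fg_cohomology_image[OF noeth M V.module_axioms M.carrier_is_submodule \<iota> coh]
          C.fg_cohomology_zero[OF M] by simp
      let ?K = "(V.koszul ^^ length xs) E"
      let ?d = "\<lambda>xs. V.koszul_diffs xs (\<lambda>_. \<zero>\<^bsub>?V\<^esub>)"
      have fg: "V.fg_homology ?K (?d xs)"
        by (rule V.fg_homology_koszul[OF noeth C S0 xsR _ E cohE]) (use xs in auto)
      note dm = V.dmod_kd[OF E xsR]
      have "\<exists>s\<in>carrier R - P. \<forall>z\<in>V.cycles ?K (?d xs). s \<odot>\<^bsub>?V\<^esub> z \<in> ?d xs ` ?K"
      proof (rule V.uniform_annihilator)
        show "fg_over R ?V (?d xs ` ?K) (V.cycles ?K (?d xs))" using fg by (simp add: V.fg_homology_def)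
        show B: "submodule (?d xs ` ?K) R ?V" by (rule V.submodule_boundaries[OF dm])
        show "V.cycles ?K (?d xs) \<subseteq> carrier ?V"
          by (rule V.submoduleD(1)[OF V.submodule_cycles[OF dm]])
        show "carrier R - P \<subseteq> carrier R" by blast
        show "\<one>\<^bsub>R\<^esub> \<in> carrier R - P" using P.one_imp_carrier P.I_notcarr by auto
        show mult: "s \<otimes>\<^bsub>R\<^esub> t \<in> carrier R - P" if "s \<in> carrier R - P" "t \<in> carrier R - P" for s t
          using P.I_prime that by auto
        fix z assume "z \<in> V.cycles ?K (?d xs)"
        then have "z \<in> ?K" by (simp add: V.cycles_def)
        moreover have "\<exists>s\<in>carrier R - P. s \<odot>\<^bsub>?V\<^esub> v = \<zero>\<^bsub>?V\<^esub>" if v: "v \<in> E" for v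
        proof -
          obtain m where m: "m \<in> carrier M" "v = \<iota> m" using v by (auto simp: E_def)
          obtain s where s: "s \<in> carrier R - P" "s \<odot>\<^bsub>M\<^esub> m = \<zero>\<^bsub>M\<^esub>" using kill[OF m(1)] by blast
          then have "s \<odot>\<^bsub>?V\<^esub> v = \<zero>\<^bsub>?V\<^esub>" by (auto simp: m(2) \<iota>_def fun_module_simps fun_eq_iff)
          then show ?thesis using s(1) by blast
        qed
        ultimately have "\<exists>s\<in>carrier R - P. s \<odot>\<^bsub>?V\<^esub> z = \<zero>\<^bsub>?V\<^esub>"
          using V.koszul_power_annihilated[of "carrier R - P" E z "length xs"] mult by blast
        then show "\<exists>s\<in>carrier R - P. s \<odot>\<^bsub>?V\<^esub> z \<in> ?d xs ` ?K" using V.submoduleD(3)[OF B] by metis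
      qed
      then obtain s where s: "s \<in> carrier R" "s \<notin> P" and ks: "V.kills_homology s ?K (?d xs)"
        by (auto simp: V.kills_homology_def)
      obtain n :: nat and a where a: "a \<in> I"
        and kills: "\<And>k. V.kills_homology (s [^]\<^bsub>R\<^esub> n \<oplus>\<^bsub>R\<^esub> a) ?K (?d (map (\<lambda>x. x [^]\<^bsub>R\<^esub> Suc k) xs))"
        using V.kills_koszul_powers[OF noeth I xsI sums V.dmod_zero[OF E] fg s(1) ks] by blast
      define f where "f = s [^]\<^bsub>R\<^esub> n \<oplus>\<^bsub>R\<^esub> a"
      have aR: "a \<in> carrier R" using a I.a_subset by blast
      have f: "f \<in> carrier R" using s(1) aR by (simp add: f_def)
      have "f \<odot>\<^bsub>M\<^esub> m = \<zero>\<^bsub>M\<^esub>" if m: "m \<in> carrier M" for m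
      proof -
        have "\<forall>x\<in>set xs. \<exists>k::nat. x [^]\<^bsub>R\<^esub> k \<odot>\<^bsub>M\<^esub> m = \<zero>\<^bsub>M\<^esub>" using torsion[OF _ m] xsI by blast
        then obtain h where h: "\<And>x. x \<in> set xs \<Longrightarrow> x [^]\<^bsub>R\<^esub> (h x :: nat) \<odot>\<^bsub>M\<^esub> m = \<zero>\<^bsub>M\<^esub>" by metis
        (* any upper bound of the exponents h x serves *)
        define k where "k = (\<Sum>x\<in>set xs. h x)"
        have xk: "x [^]\<^bsub>R\<^esub> Suc k \<odot>\<^bsub>M\<^esub> m = \<zero>\<^bsub>M\<^esub>" if x: "x \<in> set xs" for x
        proof -
          have "h x \<le> Suc k" unfolding k_def using member_le_sum[OF x, of h] by simp
          then have "x [^]\<^bsub>R\<^esub> Suc k = x [^]\<^bsub>R\<^esub> (Suc k - h x) \<otimes>\<^bsub>R\<^esub> x [^]\<^bsub>R\<^esub> h x"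
            using x xsR by (subst M.R.nat_pow_mult) auto
          then show ?thesis using x xsR h[OF x] m by (auto simp: M.smult_assoc1 simp del: M.R.nat_pow_Suc)
        qed
        have "f \<odot>\<^bsub>?V\<^esub> \<iota> m = \<zero>\<^bsub>?V\<^esub>"
        proof (rule V.annihilates_if_kills_homology[OF E])
          show "set (map (\<lambda>x. x [^]\<^bsub>R\<^esub> Suc k) xs) \<subseteq> carrier R" using xsR by auto
          show "\<iota> m \<in> E" using m by (simp add: E_def)
          show "x \<odot>\<^bsub>?V\<^esub> \<iota> m = \<zero>\<^bsub>?V\<^esub>" if "x \<in> set (map (\<lambda>x. x [^]\<^bsub>R\<^esub> Suc k) xs)" for x
            using that xk xsR
            by (auto simp: \<iota>_def fun_module_simps fun_eq_iff subset_iff simp del: M.R.nat_pow_Suc)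
          show "V.kills_homology f ((V.koszul ^^ length (map (\<lambda>x. x [^]\<^bsub>R\<^esub> Suc k) xs)) E)
              (?d (map (\<lambda>x. x [^]\<^bsub>R\<^esub> Suc k) xs))"
            using kills[of k] by (simp add: f_def)
        qed (rule f)
        then have "(f \<odot>\<^bsub>?V\<^esub> \<iota> m) 0 = \<zero>\<^bsub>?V\<^esub> 0" by simp
        then show ?thesis by (simp add: \<iota>_def fun_module_simps)
      qed
      then have "f \<in> P" using f AP by (auto simp: annihilator_def)
      moreover have "s [^]\<^bsub>R\<^esub> n = f \<oplus>\<^bsub>R\<^esub> \<ominus>\<^bsub>R\<^esub> a"
        unfolding f_def using s(1) aR by (simp add: M.R.a_assoc M.R.r_neg)
      moreover have "\<ominus>\<^bsub>R\<^esub> a \<in> P" using a IP additive_subgroup.a_inv_closed[OF P.is_additive_subgroup] by blast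
      ultimately have "s [^]\<^bsub>R\<^esub> n \<in> P" using additive_subgroup.a_closed[OF P.is_additive_subgroup] by simp
      moreover have "s [^]\<^bsub>R\<^esub> n \<notin> P" for n :: nat
      proof (induction n)
        case 0
        show ?case using P.one_imp_carrier P.I_notcarr by auto
      next
        case (Suc n)
        then show ?case using P.I_prime[of "s [^]\<^bsub>R\<^esub> n" s] s by auto
      qed
      ultimately show False by blast
    qed
  qed
qed

theorem theorem1p2:
  fixes R :: "('a, 'r) ring_scheme" and \<mm> I :: "'a set" and M :: "('a, 'b, 'm) module_scheme"
  assumes "noetherian_ring R" and "local_ring R \<mm>" and "adic_complete R \<mm>"
    and "ideal I R"
    and "module R M" and "carrier M \<noteq> {\<zero>\<^bsub>M\<^esub>}" and "cofinite_module R I M"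
  shows "krull_dim (R Quot (I <+>\<^bsub>R\<^esub> annihilator R M)) = module_dim R M"
proof -
  interpret module R M by fact
  have "ideal (I <+>\<^bsub>R\<^esub> annihilator R M) R"
    using R.add_ideals[OF assms(4) ideal_annihilator[OF assms(5)]] .
  then show ?thesis
    unfolding module_dim_def Supp_cofinite[OF assms] by (rule R.krull_dim_quotient_eq_SUP)
qed

end
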